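(* Let $d\ge1$, $R>0$, $\Omega=(-R,R)^d$, points written ${\bf x}=(x_1,\dots,x_{d-1},z)$, and $\Gamma^+=\{{\bf x}\in\partial\Omega: z=R\}$. Let $F=F({\bf x},s,{\bf p}):\overline\Omega\times\mathbb{R}\times\mathbb{R}^d\to\mathbb{R}$ be of class $C^2$, let $f$ be given boundary data on $\partial\Omega$ and $g$ given data on $\Gamma^+$. Let $p>\lceil d/2\rceil+2$ be an integer (so that $H^p(\Omega)\hookrightarrow C^2(\overline\Omega)$), and set \[H=\{u\in H^p(\Omega): u|_{\partial\Omega}=f,\ u_z|_{\Gamma^+}=g\},\quad H_0=\{u\in H^p(\Omega): u|_{\partial\Omega}=0,\ u_z|_{\Gamma^+}=0\},\] and for $M>0$, $B(M)=\{u\in H^p(\Omega):\|u\|_{H^p(\Omega)}<M\}$; assume $H\cap\overline{B(M)}\neq\emptyset$. Fix $\epsilon_0>0$, $r>R+1$, $b>R+r$, and for $\lambda>1,\beta>1,\eta>0$ define \[J_{\lambda,\beta,\eta}(u)=\int_\Omega e^{2\lambda(\frac{z+r}{b})^\beta}\big|-\epsilon_0\Delta u+F({\bf x},u,\nabla u)\big|^2\,d{\bf x}+\eta\|u\|^2_{H^p(\Omega)}.\] Then: 1. For all $\lambda,\beta>1$, $\eta>0$ and all $u\in H^p(\Omega)$, \[\lim_{H_0\ni h\to0}\frac{|J_{\lambda,\beta,\eta}(u+h)-J_{\lambda,\beta,\eta}(u)-DJ_{\lambda,\beta,\eta}(u)h|}{\|h\|_{H^p(\Omega)}}=0,\] where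 for $h\in H_0$ \[DJ_{\lambda,\beta,\eta}(u)h=2\int_\Omega e^{2\lambda(\frac{z+r}{b})^\beta}\big[-\epsilon_0\Delta u+F({\bf x},u,\nabla u)\big]\big[-\epsilon_0\Delta h+\partial_sF({\bf x},u,\nabla u)h+\nabla_{\bf p}F({\bf x},u,\nabla u)\cdot\nabla h\big]d{\bf x}+2\eta\langle u,h\rangle_{H^p(\Omega)}.\] 2. Let $M$ be an arbitrarily large number. For each $\beta>1$ there is $\lambda_0=\lambda_0(\epsilon_0,M,b,d,r,F,\beta)>1$ such that for all $\lambda>\lambda_0$, $\eta>0$ and all $u,v\in H\cap\overline{B(M)}$, \[J_{\lambda,\beta,\eta}(v)-J_{\lambda,\beta,\eta}(u)-DJ_{\lambda,\beta,\eta}(u)(v-u)\ge C\|v-u\|^2_{H^1(\Omega)}+\eta\|v-u\|^2_{H^p(\Omega)}\] and \[\big(DJ_{\lambda,\beta,\eta}(v)-DJ_{\lambda,\beta,\eta}(u)\big)(v-u)\ge C\|v-u\|^2_{H^1(\Omega)}+\eta\|v-u\|^2_{H^p(\Omega)},\] where $C>0$ depends only on $\lambda,\beta,R,r,b,d,M,F,\epsilon_0$. As a result, $J_{\lambda,\beta,\eta}$ has a unique minimizer in $H\cap\overline{B(M)}$.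
   Context: $\partial_sF$ and $\nabla_{\bf p}F$ denote the derivative of $F$ in its second variable and the gradient in its third variable; $u_z$ is the partial derivative in the last coordinate; $H^p(\Omega)$ is the Sobolev space with inner product $\langle\cdot,\cdot\rangle_{H^p(\Omega)}$. *)

theory Defs
  imports "HOL-Analysis.Analysis"
begin

definition cube :: "real \<Rightarrow> (real^'n::finite) set" where
  "cube R = box (- (R *\<^sub>R One)) (R *\<^sub>R One)"

definition ccube :: "real \<Rightarrow> (real^'n::finite) set" where
  "ccube R = cbox (- (R *\<^sub>R One)) (R *\<^sub>R One)"

definition bdry :: "real \<Rightarrow> (real^'n::finite) set" where
  "bdry R = ccube R - cube R"

text \<open>Top face Gamma^+ : the distinguished coordinate k plays the role of z.\<close>
definition gamma_plus :: "'n::finite \<Rightarrow> real \<Rightarrow> (real^'n) set" where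
  "gamma_plus k R = {x \<in> bdry R. x $ k = R}"

definition pd :: "'n::finite \<Rightarrow> (real^'n \<Rightarrow> real) \<Rightarrow> real^'n \<Rightarrow> real" where
  "pd i u x = deriv (\<lambda>t. u (x + t *\<^sub>R axis i 1)) 0"

fun pdl :: "'n::finite list \<Rightarrow> (real^'n \<Rightarrow> real) \<Rightarrow> real^'n \<Rightarrow> real" where
  "pdl [] f = f"
| "pdl (i # is) f = pd i (pdl is f)"

definition grad :: "(real^'n::finite \<Rightarrow> real) \<Rightarrow> real^'n \<Rightarrow> real^'n" where
  "grad u x = (\<chi> i. pd i u x)"

definition lap :: "(real^'n::finite \<Rightarrow> real) \<Rightarrow> real^'n \<Rightarrow> real" where
  "lap u x = (\<Sum>i\<in>UNIV. pd i (pd i u) x)"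

definition test_fun :: "(real^'n::finite) set \<Rightarrow> (real^'n \<Rightarrow> real) \<Rightarrow> bool" where
  "test_fun U \<phi> \<longleftrightarrow>
     compact (closure {x. \<phi> x \<noteq> 0}) \<and> closure {x. \<phi> x \<noteq> 0} \<subseteq> U \<and>
     (\<forall>is. continuous_on UNIV (pdl is \<phi>) \<and>
        (\<forall>i x. (\<lambda>t. pdl is \<phi> (x + t *\<^sub>R axis i 1)) differentiable (at 0)))"

definition L2 :: "(real^'n::finite) set \<Rightarrow> (real^'n \<Rightarrow> real) \<Rightarrow> bool" where
  "L2 U v \<longleftrightarrow> set_borel_measurable lebesgue U v \<and>
              set_integrable lebesgue U (\<lambda>x. (v x)^2)"

definition mi_list :: "('n::finite \<Rightarrow> nat) \<Rightarrow> 'n list" where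
  "mi_list \<alpha> = (SOME is. \<forall>i. count_list is i = \<alpha> i)"

definition is_wderiv :: "(real^'n::finite) set \<Rightarrow> ('n \<Rightarrow> nat) \<Rightarrow> (real^'n \<Rightarrow> real)
    \<Rightarrow> (real^'n \<Rightarrow> real) \<Rightarrow> bool" where
  "is_wderiv U \<alpha> u v \<longleftrightarrow> L2 U v \<and>
     (\<forall>\<phi>. test_fun U \<phi> \<longrightarrow>
        set_lebesgue_integral lebesgue U (\<lambda>x. u x * pdl (mi_list \<alpha>) \<phi> x)
        = (-1) ^ (sum \<alpha> UNIV) * set_lebesgue_integral lebesgue U (\<lambda>x. v x * \<phi> x))"

definition wd :: "(real^'n::finite) set \<Rightarrow> ('n \<Rightarrow> nat) \<Rightarrow> (real^'n \<Rightarrow> real) \<Rightarrow> real^'n \<Rightarrow> real" where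
  "wd U \<alpha> u = (SOME v. is_wderiv U \<alpha> u v)"

definition multi_idx :: "nat \<Rightarrow> ('n::finite \<Rightarrow> nat) set" where
  "multi_idx p = {\<alpha>. sum \<alpha> UNIV \<le> p}"

definition sobolev :: "(real^'n::finite) set \<Rightarrow> nat \<Rightarrow> (real^'n \<Rightarrow> real) set" where
  "sobolev U p = {u. L2 U u \<and> (\<forall>\<alpha>\<in>multi_idx p. \<exists>v. is_wderiv U \<alpha> u v)}"

definition sob_inner :: "(real^'n::finite) set \<Rightarrow> nat \<Rightarrow> (real^'n \<Rightarrow> real) \<Rightarrow> (real^'n \<Rightarrow> real) \<Rightarrow> real" where
  "sob_inner U p u v =
     (\<Sum>\<alpha>\<in>multi_idx p. set_lebesgue_integral lebesgue U (\<lambda>x. wd U \<alpha> u x * wd U \<alpha> v x))"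

definition sob_norm :: "(real^'n::finite) set \<Rightarrow> nat \<Rightarrow> (real^'n \<Rightarrow> real) \<Rightarrow> real" where
  "sob_norm U p u = sqrt (sob_inner U p u u)"

section \<open>Elements of H^p(Omega), represented by their C^2(closure) representative\<close>

definition C2_cl :: "real \<Rightarrow> (real^'n::finite \<Rightarrow> real) \<Rightarrow> bool" where
  "C2_cl R u \<longleftrightarrow> continuous_on (ccube R) u \<and>
     (\<forall>x\<in>cube R. \<forall>i. (\<lambda>t. u (x + t *\<^sub>R axis i 1)) differentiable (at 0) \<and>
        (\<forall>j. (\<lambda>t. pd i u (x + t *\<^sub>R axis j 1)) differentiable (at 0))) \<and>
     (\<forall>i. continuous_on (cube R) (pd i u) \<and> (\<forall>j. continuous_on (cube R) (pd j (pd i u)))) \<and>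
     (\<forall>x\<in>ccube R. \<forall>i. (\<exists>l. (pd i u \<longlongrightarrow> l) (at x within cube R)) \<and>
        (\<forall>j. \<exists>l. (pd j (pd i u) \<longlongrightarrow> l) (at x within cube R)))"

definition Hp :: "real \<Rightarrow> nat \<Rightarrow> (real^'n::finite \<Rightarrow> real) set" where
  "Hp R p = {u. u \<in> sobolev (cube R) p \<and> C2_cl R u \<and> (\<forall>x. x \<notin> ccube R \<longrightarrow> u x = 0)}"

definition Hset :: "real \<Rightarrow> nat \<Rightarrow> 'n::finite \<Rightarrow> (real^'n \<Rightarrow> real) \<Rightarrow> (real^'n \<Rightarrow> real)
     \<Rightarrow> (real^'n \<Rightarrow> real) set" where
  "Hset R p k f g = {u \<in> Hp R p. (\<forall>x\<in>bdry R. u x = f x) \<and>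
       (\<forall>x\<in>gamma_plus k R. (pd k u \<longlongrightarrow> g x) (at x within cube R))}"

definition H0set :: "real \<Rightarrow> nat \<Rightarrow> 'n::finite \<Rightarrow> (real^'n \<Rightarrow> real) set" where
  "H0set R p k = Hset R p k (\<lambda>_. 0) (\<lambda>_. 0)"

definition Bbar :: "real \<Rightarrow> nat \<Rightarrow> real \<Rightarrow> (real^'n::finite \<Rightarrow> real) set" where
  "Bbar R p M = {u \<in> Hp R p. sob_norm (cube R) p u \<le> M}"

definition C2_F :: "real \<Rightarrow> (real^'n::finite \<Rightarrow> real \<Rightarrow> real^'n \<Rightarrow> real) \<Rightarrow> bool" where
  "C2_F R F \<longleftrightarrow> (\<exists>G1 G2.
     (\<forall>y\<in>ccube R \<times> UNIV \<times> UNIV.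
        ((\<lambda>(x,s,q). F x s q) has_derivative blinfun_apply (G1 y)) (at y within ccube R \<times> UNIV \<times> UNIV)) \<and>
     (\<forall>y\<in>ccube R \<times> UNIV \<times> UNIV.
        (G1 has_derivative blinfun_apply (G2 y)) (at y within ccube R \<times> UNIV \<times> UNIV)) \<and>
     continuous_on (ccube R \<times> UNIV \<times> UNIV) G2)"

definition dsF :: "(real^'n::finite \<Rightarrow> real \<Rightarrow> real^'n \<Rightarrow> real) \<Rightarrow> real^'n \<Rightarrow> real \<Rightarrow> real^'n \<Rightarrow> real" where
  "dsF F x s q = deriv (\<lambda>t. F x t q) s"

definition dpF :: "(real^'n::finite \<Rightarrow> real \<Rightarrow> real^'n \<Rightarrow> real) \<Rightarrow> real^'n \<Rightarrow> real \<Rightarrow> real^'n \<Rightarrow> real^'n" where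
  "dpF F x s q = (\<chi> i. deriv (\<lambda>t. F x s (q + t *\<^sub>R axis i 1)) 0)"

definition weight :: "'n::finite \<Rightarrow> real \<Rightarrow> real \<Rightarrow> real \<Rightarrow> real \<Rightarrow> real^'n \<Rightarrow> real" where
  "weight k r b lam \<beta> x = exp (2 * lam * ((x $ k + r) / b) powr \<beta>)"

definition Jfun :: "real \<Rightarrow> nat \<Rightarrow> 'n::finite \<Rightarrow> real \<Rightarrow> real \<Rightarrow> real
    \<Rightarrow> (real^'n \<Rightarrow> real \<Rightarrow> real^'n \<Rightarrow> real) \<Rightarrow> real \<Rightarrow> real \<Rightarrow> real
    \<Rightarrow> (real^'n \<Rightarrow> real) \<Rightarrow> real" where
  "Jfun R p k \<epsilon>0 r b F lam \<beta> \<eta> u =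
     set_lebesgue_integral lebesgue (cube R)
       (\<lambda>x. weight k r b lam \<beta> x * (- \<epsilon>0 * lap u x + F x (u x) (grad u x))^2)
     + \<eta> * (sob_norm (cube R) p u)^2"

definition DJfun :: "real \<Rightarrow> nat \<Rightarrow> 'n::finite \<Rightarrow> real \<Rightarrow> real \<Rightarrow> real
    \<Rightarrow> (real^'n \<Rightarrow> real \<Rightarrow> real^'n \<Rightarrow> real) \<Rightarrow> real \<Rightarrow> real \<Rightarrow> real
    \<Rightarrow> (real^'n \<Rightarrow> real) \<Rightarrow> (real^'n \<Rightarrow> real) \<Rightarrow> real" where
  "DJfun R p k \<epsilon>0 r b F lam \<beta> \<eta> u h =
     2 * set_lebesgue_integral lebesgue (cube R)
       (\<lambda>x. weight k r b lam \<beta> x * (- \<epsilon>0 * lap u x + F x (u x) (grad u x))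
            * (- \<epsilon>0 * lap h x + dsF F x (u x) (grad u x) * h x
               + dpF F x (u x) (grad u x) \<bullet> grad h x))
     + 2 * \<eta> * sob_inner (cube R) p u h"

end

theory Submission
  imports Defs "HOL-Real_Asymp.Real_Asymp"
begin

text \<open>The integrand of \<open>J (u + h) - J u - DJ u h\<close> is, up to the weight, at least
  \<open>\<epsilon>\<^sup>2 / 2 * (\<Delta> h)\<^sup>2 - K * (h\<^sup>2 + \<bar>\<nabla>h\<bar>\<^sup>2)\<close>, because \<open>F\<close> has bounded first and second
  derivatives on the range of \<open>(x, u, \<nabla>u)\<close>, which is bounded by the Sobolev embedding. The Carleman
  estimate for functions with zero Dirichlet data and zero Neumann data on the top face makes the
  first term dominate for large \<open>\<lambda>\<close>, and this is strong convexity. The estimate itself follows from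
  the substitution \<open>w = e^(\<lambda> \<mu>) h\<close> with \<open>\<mu> = ((z + r) / b) powr \<beta>\<close> and integration by parts.

  For the embedding, the mean of \<open>w\<close> against a test function scaled about \<open>x\<close> by the factor
  \<open>1 / \<sigma>\<close> tends to \<open>w x\<close> as \<open>\<sigma> \<rightarrow> \<infinity>\<close>. Its \<open>\<sigma>\<close>-derivative is \<open>\<sigma>\<^sup>-\<^sup>2\<close> times means of
  the first derivatives of \<open>w\<close>, so that each derivative gains one power of \<open>\<sigma>\<close> over the
  Cauchy-Schwarz bound \<open>\<sigma> powr (d / 2)\<close>.

  A minimizing sequence is Cauchy in \<open>H\<^sup>p\<close> by strong convexity at midpoints; its limit is again an
  admissible function of class \<open>C\<^sup>2\<close>, the embedding giving uniform convergence of all derivatives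
  up to order two.\<close>

section \<open>Smooth functions and iterated partial derivatives\<close>

text \<open>The bottom face shapes the Carleman estimate. No Neumann data are given there, so a
  boundary term with the square of the normal derivative remains; it has the favourable sign because
  the weight increases in z, and the divergence theorem is therefore needed in a one-sided form.
  Differentiability holds only inside the cube, with limits of the derivatives at its boundary,
  which is why that theorem is derived from difference quotients. The equation is linear in the
  Laplacian. Hence the second-order Taylor remainder of the nonlinearity contains only h and its
  gradient, exactly the quantities that the Carleman estimate controls with an extra factor
  \<lambda>. Once \<lambda> exceeds a threshold the surplus is at least 1, so \<open>C = 1\<close>
  serves for every larger \<lambda> and for all boundary data at once. Elements of H^p are concrete
  functions here, continuous on the closed cube and zero outside. A vanishing norm therefore gives
  equality everywhere, and the minimizer is unique as a function.\<close>

lemma pd_eq: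
  fixes f :: "real^'n::finite \<Rightarrow> real"
  assumes "(f has_derivative f') (at x)"
  shows "pd i f x = f' (axis i 1)"
proof -
  have "((\<lambda>t. f (x + t *\<^sub>R axis i 1)) has_derivative (\<lambda>t. f' (t *\<^sub>R axis i 1))) (at 0)"
    by (rule has_derivative_compose[where g=f and f="\<lambda>t. x + t *\<^sub>R axis i 1"])
       (use assms in \<open>auto intro!: derivative_eq_intros\<close>)
  moreover have "(\<lambda>t. f' (t *\<^sub>R axis i 1)) = (*) (f' (axis i 1))"
    using linear_scale[OF has_derivative_linear[OF assms]] by (auto simp: fun_eq_iff mult.commute)
  ultimately have "DERIV (\<lambda>t. f (x + t *\<^sub>R axis i 1)) 0 :> f' (axis i 1)"
    by (simp add: has_field_derivative_def)
  thus ?thesis unfolding pd_def by (rule DERIV_imp_deriv)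
qed

lemma has_derivative_pd:
  fixes f :: "real^'n::finite \<Rightarrow> real"
  assumes "f differentiable (at x)"
  shows "(f has_derivative (\<lambda>v. \<Sum>i\<in>UNIV. v $ i * pd i f x)) (at x)"
proof -
  obtain f' where f': "(f has_derivative f') (at x)" using assms differentiable_def by blast
  have "f' v = (\<Sum>i\<in>UNIV. v $ i * pd i f x)" for v
  proof -
    have "f' v = f' (\<Sum>i\<in>UNIV. v $ i *\<^sub>R axis i 1)"
      by (simp add: basis_expansion flip: scalar_mult_eq_scaleR)
    also have "\<dots> = (\<Sum>i\<in>UNIV. v $ i * f' (axis i 1))"
      by (simp add: linear_sum[OF has_derivative_linear[OF f']] linear_scale[OF has_derivative_linear[OF f']])
    finally show ?thesis by (simp add: pd_eq[OF f'])
  qed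
  thus ?thesis using f' by presburger
qed

lemma pd_line_deriv:
  assumes "(\<lambda>t. u (x + t *\<^sub>R axis i 1)) differentiable (at 0)"
  shows "((\<lambda>t. u (x + t *\<^sub>R axis i 1)) has_real_derivative pd i u x) (at 0)"
  using assms unfolding pd_def by (metis DERIV_deriv_iff_real_differentiable)

lemma pd_line_deriv_at:
  assumes "(\<lambda>t. u ((x + s *\<^sub>R axis i 1) + t *\<^sub>R axis i 1)) differentiable (at 0)"
  shows "((\<lambda>t. u (x + t *\<^sub>R axis i 1)) has_real_derivative pd i u (x + s *\<^sub>R axis i 1)) (at s)"
proof -
  have "((\<lambda>t. u (x + (s + t) *\<^sub>R axis i 1)) has_real_derivative pd i u (x + s *\<^sub>R axis i 1)) (at 0)"
    using pd_line_deriv[OF assms] by (simp add: scaleR_add_left add.assoc)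
  from DERIV_shift[THEN iffD1, OF DERIV_cmult_Id[of 1, THEN DERIV_cong], of 0] this
  show ?thesis by (simp add: DERIV_at_within_shift add.commute field_differentiable_def
       DERIV_shift[of "\<lambda>t. u (x + t *\<^sub>R axis i 1)" _ 0 s, simplified])
qed

lemma pd_cong:
  assumes "open S" "x \<in> S" "\<And>y. y \<in> S \<Longrightarrow> f y = g y"
  shows "pd i f x = pd i g x"
proof -
  have "eventually (\<lambda>t. x + t *\<^sub>R axis i 1 \<in> S) (at (0::real))"
  proof -
    have "((\<lambda>t. x + t *\<^sub>R axis i 1) \<longlongrightarrow> x + 0 *\<^sub>R axis i 1) (at (0::real))" by (intro tendsto_intros)
    thus ?thesis using assms(1,2) topological_tendstoD by fastforce
  qed
  hence "eventually (\<lambda>t. x + t *\<^sub>R axis i 1 \<in> S) (nhds (0::real))"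
    using assms(2) by (simp add: eventually_nhds_conv_at)
  hence "eventually (\<lambda>t. f (x + t *\<^sub>R axis i 1) = g (x + t *\<^sub>R axis i 1)) (nhds (0::real))"
    by eventually_elim (use assms(3) in auto)
  thus ?thesis unfolding pd_def by (intro deriv_cong_ev) auto
qed

lemma differentiable_cong_open:
  fixes x :: "real^'n::finite"
  assumes "open S" "x \<in> S" "\<And>y. y \<in> S \<Longrightarrow> f y = g y"
    "(\<lambda>t::real. f (x + t *\<^sub>R axis i 1)) differentiable (at 0)"
  shows "(\<lambda>t::real. g (x + t *\<^sub>R axis i 1) :: real) differentiable (at 0)"
proof -
  have "((\<lambda>t. x + t *\<^sub>R axis i 1) \<longlongrightarrow> x + 0 *\<^sub>R axis i 1) (at (0::real))" by (intro tendsto_intros)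
  hence "eventually (\<lambda>t. x + t *\<^sub>R axis i 1 \<in> S) (at (0::real))"
    using assms(1,2) topological_tendstoD by fastforce
  hence "eventually (\<lambda>t. x + t *\<^sub>R axis i 1 \<in> S) (nhds (0::real))"
    using assms(2) by (simp add: eventually_nhds_conv_at)
  then obtain T where T: "open T" "0 \<in> T" "\<And>t. t \<in> T \<Longrightarrow> x + t *\<^sub>R axis i 1 \<in> S"
    unfolding eventually_nhds by blast
  obtain D where "((\<lambda>t::real. f (x + t *\<^sub>R axis i 1)) has_derivative D) (at 0)"
    using assms(4) unfolding differentiable_def by blast
  hence "((\<lambda>t::real. g (x + t *\<^sub>R axis i 1)) has_derivative D) (at 0)"
    by (rule has_derivative_transform_within_open[OF _ T(1,2)]) (use T(3) assms(3) in auto)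
  thus ?thesis unfolding differentiable_def by blast
qed

text \<open>Each level asks for total differentiability and not merely for partial derivatives,
  since the chain rule along a curve, as in \<open>kern_deriv\<close>, requires it. The base case
  makes every iterated derivative of a smooth function continuous.\<close>

primrec cdiff :: "nat \<Rightarrow> (real^'n::finite \<Rightarrow> real) \<Rightarrow> bool" where
  "cdiff 0 f = continuous_on UNIV f"
| "cdiff (Suc n) f = ((\<forall>x. f differentiable (at x)) \<and> (\<forall>i. cdiff n (pd i f)))"

definition smooth :: "(real^'n::finite \<Rightarrow> real) \<Rightarrow> bool" where
  "smooth f \<longleftrightarrow> (\<forall>n. cdiff n f)"

lemma cdiff_mono: "cdiff (Suc n) f \<Longrightarrow> cdiff n f"
proof (induction n arbitrary: f)
  case 0
  thus ?case by (auto intro!: continuous_at_imp_continuous_on differentiable_imp_continuous_within)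
next
  case (Suc n)
  from Suc.prems have "\<forall>x. f differentiable (at x)" "\<And>i. cdiff (Suc n) (pd i f)" by simp_all
  with Suc.IH show ?case by simp
qed

lemma smooth_D:
  assumes "smooth f"
  shows "f differentiable (at x)" "smooth (pd i f)" "continuous_on UNIV f"
proof -
  show "f differentiable (at x)" using assms cdiff.simps(2)[of 0 f] unfolding smooth_def by blast
  show "smooth (pd i f)" using assms unfolding smooth_def by (metis cdiff.simps(2))
  show "continuous_on UNIV f" using assms unfolding smooth_def by (metis cdiff.simps(1))
qed

lemma smooth_pdl: "smooth f \<Longrightarrow> smooth (pdl is f)"
  by (induction "is") (auto intro: smooth_D(2))

lemma differentiable_line:
  fixes f :: "real^'n::finite \<Rightarrow> real"
  assumes "f differentiable (at x)"
  shows "(\<lambda>t. f (x + t *\<^sub>R axis i 1)) differentiable (at 0)"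
proof -
  have "f differentiable (at (x + 0 *\<^sub>R axis i 1))" using assms by simp
  show ?thesis
    by (rule differentiable_compose[where f=f and g="\<lambda>t. x + t *\<^sub>R axis i 1"]) (use assms in \<open>auto intro!: derivative_intros\<close>)
qed

lemma pd_add: "f differentiable (at x) \<Longrightarrow> g differentiable (at x)
   \<Longrightarrow> pd i (\<lambda>x. f x + g x) x = pd i f x + pd i g x"
  by (subst pd_eq[OF has_derivative_add[OF has_derivative_pd has_derivative_pd]])
     (auto simp: axis_def if_distrib[of "\<lambda>x. x * _"] cong: if_cong)

lemma pd_mult: "f differentiable (at x) \<Longrightarrow> g differentiable (at x)
   \<Longrightarrow> pd i (\<lambda>x. f x * g x) x = pd i f x * g x + f x * pd i g x"
  by (subst pd_eq[OF has_derivative_mult[OF has_derivative_pd has_derivative_pd]])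
     (auto simp: axis_def if_distrib[of "\<lambda>x. x * _"] cong: if_cong)

lemma pd_const [simp]: "pd i (\<lambda>x. c) = (\<lambda>x. 0)"
  by (auto simp: fun_eq_iff pd_def)

lemma cdiff_const [simp]: "cdiff n (\<lambda>x. c)"
  by (induction n arbitrary: c) auto

lemma cdiff_add: "cdiff n f \<Longrightarrow> cdiff n g \<Longrightarrow> cdiff n (\<lambda>x. f x + g x)"
proof (induction n arbitrary: f g)
  case (Suc n)
  then have "pd i (\<lambda>x. f x + g x) = (\<lambda>x. pd i f x + pd i g x)" for i
    by (auto simp: pd_add)
  with Suc show ?case by auto
qed (auto intro: continuous_intros)

lemma cdiff_mult: "cdiff n f \<Longrightarrow> cdiff n g \<Longrightarrow> cdiff n (\<lambda>x. f x * g x)"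
proof (induction n arbitrary: f g)
  case (Suc n)
  then have "pd i (\<lambda>x. f x * g x) = (\<lambda>x. pd i f x * g x + f x * pd i g x)" for i
    by (auto simp: pd_mult)
  with Suc show ?case
    using cdiff_mono[of n f] cdiff_mono[of n g] by (auto intro!: cdiff_add derivative_intros)
qed (auto intro: continuous_intros)

lemma has_derivative_coord: "((\<lambda>x::real^'n::finite. x $ j) has_derivative (\<lambda>v. v $ j)) (at x within S)"
  using bounded_linear_imp_has_derivative[OF bounded_linear_vec_nth] .

lemma pd_coord: "pd i (\<lambda>x::real^'n::finite. x $ j) = (\<lambda>x. if i = j then 1 else 0)"
  by (auto simp: fun_eq_iff pd_eq[OF has_derivative_coord] axis_def)

lemma cdiff_coord: "cdiff n (\<lambda>x::real^'n::finite. x $ j)"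
proof (cases n)
  case (Suc m)
  thus ?thesis using has_derivative_coord[of j] unfolding differentiable_def
    by (auto simp: pd_coord differentiable_def)
qed (auto intro: continuous_intros)

lemma smooth_const [simp]: "smooth (\<lambda>x. c)"
  and smooth_add: "smooth f \<Longrightarrow> smooth g \<Longrightarrow> smooth (\<lambda>x. f x + g x)"
  and smooth_mult: "smooth f \<Longrightarrow> smooth g \<Longrightarrow> smooth (\<lambda>x. f x * g x)"
  and smooth_coord: "smooth (\<lambda>x. x $ j)"
  unfolding smooth_def by (auto intro: cdiff_add cdiff_mult cdiff_coord)

lemma smooth_prod: "finite S \<Longrightarrow> (\<And>i. i \<in> S \<Longrightarrow> smooth (f i)) \<Longrightarrow> smooth (\<lambda>x. \<Prod>i\<in>S. f i x)"
  by (induction S rule: finite_induct) (auto intro: smooth_mult)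

lemma has_derivative_affine_comp:
  fixes f :: "real^'n::finite \<Rightarrow> real"
  assumes "f differentiable (at (a + c *\<^sub>R x))"
  shows "((\<lambda>x. f (a + c *\<^sub>R x)) has_derivative (\<lambda>v. \<Sum>i\<in>UNIV. c * v $ i * pd i f (a + c *\<^sub>R x))) (at x)"
  by (rule has_derivative_compose[where f="\<lambda>x. a + c *\<^sub>R x" and f'="\<lambda>v. c *\<^sub>R v", OF _ has_derivative_pd[OF assms], simplified])
     (auto intro!: derivative_eq_intros)

lemma pd_affine_comp:
  assumes "f differentiable (at (a + c *\<^sub>R x))"
  shows "pd i (\<lambda>x. f (a + c *\<^sub>R x)) x = c * pd i f (a + c *\<^sub>R x)"
  by (subst pd_eq[OF has_derivative_affine_comp[OF assms]])
     (auto simp: axis_def if_distrib[of "\<lambda>x. x * _"] if_distrib[of "\<lambda>x. _ * x"] cong: if_cong)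

lemma cdiff_affine_comp: "cdiff n f \<Longrightarrow> cdiff n (\<lambda>x. f (a + c *\<^sub>R x))"
proof (induction n arbitrary: f)
  case 0
  thus ?case by (auto intro!: continuous_on_compose2[of UNIV f UNIV] continuous_intros)
next
  case (Suc n)
  then have "pd i (\<lambda>x. f (a + c *\<^sub>R x)) = (\<lambda>x. c * pd i f (a + c *\<^sub>R x))" for i
    by (auto simp: pd_affine_comp)
  moreover have "(\<lambda>x. f (a + c *\<^sub>R x)) differentiable at x" for x
    using has_derivative_affine_comp[of f a c x] Suc unfolding differentiable_def[of "\<lambda>x. f (a + c *\<^sub>R x)"] by auto
  ultimately show ?case using Suc by (auto intro!: cdiff_mult)
qed

lemma smooth_affine_comp: "smooth f \<Longrightarrow> smooth (\<lambda>x. f (a + c *\<^sub>R x))"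
  unfolding smooth_def using cdiff_affine_comp by blast

text \<open>The second difference of \<open>f\<close> over a square of side \<open>s\<close> is
  symmetric in the two directions, and two applications of the mean value theorem write it as
  \<open>s * s\<close> times either mixed derivative at a nearby point; continuity at
  \<open>x\<close> then identifies the two. Differentiability is assumed along axes only, which is
  what \<open>C2_cl\<close> supplies inside the cube.\<close>

lemma pd_commute_open:
  fixes f :: "real^'n::finite \<Rightarrow> real"
  assumes S: "open S" "x \<in> S"
    and df: "\<And>y k. y \<in> S \<Longrightarrow> (\<lambda>t. f (y + t *\<^sub>R axis k 1)) differentiable (at 0)"
    and dpf: "\<And>y k l. y \<in> S \<Longrightarrow> (\<lambda>t. pd k f (y + t *\<^sub>R axis l 1)) differentiable (at 0)"
    and cont: "\<And>k l. continuous_on S (pd k (pd l f))"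
  shows "pd i (pd j f) x = pd j (pd i f) x"
proof -
  obtain e0 where e0: "e0 > 0" "\<And>y. dist y x < e0 \<Longrightarrow> y \<in> S"
    using S unfolding open_dist by blast
  have dd: "dist (x + s *\<^sub>R axis i 1 + t *\<^sub>R axis j 1) x < e"
    if "0 \<le> s" "0 \<le> t" "s + t < e" for s t e :: real and i j
  proof -
    have "dist (x + s *\<^sub>R axis i 1 + t *\<^sub>R axis j 1) x \<le> norm (s *\<^sub>R axis i 1 :: real^'n) + norm (t *\<^sub>R axis j 1 :: real^'n)"
      unfolding dist_norm by (metis (no_types, lifting) add.assoc add_diff_cancel_left' norm_triangle_ineq)
    also have "\<dots> < e" using that by simp
    finally show ?thesis .
  qed
  have key: "\<exists>y. dist y x < e \<and> f (x + s *\<^sub>R axis i 1 + s *\<^sub>R axis j 1) - f (x + s *\<^sub>R axis i 1) - f (x + s *\<^sub>R axis j 1) + f x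
      = s * s * pd i (pd j f) y" if "0 < s" "2 * s < e" "2 * s < e0" for s e i j
  proof -
    have S1: "x + s *\<^sub>R axis i 1 + t *\<^sub>R axis j 1 \<in> S" if "0 \<le> t" "t \<le> s" for t
      by (rule e0(2)[OF dd]) (use that \<open>0 < s\<close> \<open>2 * s < e0\<close> in auto)
    have S2: "x + t *\<^sub>R axis j 1 + q *\<^sub>R axis i 1 \<in> S" if "0 \<le> t" "t \<le> s" "0 \<le> q" "q \<le> s" for t q
      by (rule e0(2)[OF dd]) (use that \<open>0 < s\<close> \<open>2 * s < e0\<close> in auto)
    have S3: "x + t *\<^sub>R axis j 1 \<in> S" if "0 \<le> t" "t \<le> s" for t
      using S2[OF that, of 0] \<open>0 < s\<close> by simp
    let ?G = "\<lambda>t. f (x + s *\<^sub>R axis i 1 + t *\<^sub>R axis j 1) - f (x + t *\<^sub>R axis j 1)"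
    have "\<exists>t>0. t < s \<and> ?G s - ?G 0 = (s - 0) * (pd j f (x + s *\<^sub>R axis i 1 + t *\<^sub>R axis j 1) - pd j f (x + t *\<^sub>R axis j 1))"
      by (rule MVT2[OF that(1)]) (intro DERIV_diff pd_line_deriv_at df S1 S3; assumption)
    then obtain t where t: "t > 0" "t < s" "?G s - ?G 0 = s * (pd j f (x + s *\<^sub>R axis i 1 + t *\<^sub>R axis j 1) - pd j f (x + t *\<^sub>R axis j 1))"
      by auto
    have "\<exists>q>0. q < s \<and> pd j f ((x + t *\<^sub>R axis j 1) + s *\<^sub>R axis i 1) - pd j f ((x + t *\<^sub>R axis j 1) + 0 *\<^sub>R axis i 1)
        = (s - 0) * pd i (pd j f) ((x + t *\<^sub>R axis j 1) + q *\<^sub>R axis i 1)"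
      by (rule MVT2[OF that(1)]) (intro pd_line_deriv_at dpf S2; use t in simp)
    then obtain q where q: "q > 0" "q < s" "pd j f ((x + t *\<^sub>R axis j 1) + s *\<^sub>R axis i 1) - pd j f (x + t *\<^sub>R axis j 1)
        = s * pd i (pd j f) ((x + t *\<^sub>R axis j 1) + q *\<^sub>R axis i 1)" by auto
    have "dist ((x + t *\<^sub>R axis j 1) + q *\<^sub>R axis i 1) x < e" by (rule dd) (use t q that in auto)
    moreover have "pd j f (x + s *\<^sub>R axis i 1 + t *\<^sub>R axis j 1) = pd j f ((x + t *\<^sub>R axis j 1) + s *\<^sub>R axis i 1)"
      by (simp add: algebra_simps)
    ultimately show ?thesis using t(3) q(3)
      by (intro exI[of _ "(x + t *\<^sub>R axis j 1) + q *\<^sub>R axis i 1"]) (auto simp: algebra_simps)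
  qed
  show ?thesis
  proof (rule ccontr)
    let ?a = "pd i (pd j f)" and ?b = "pd j (pd i f)"
    \<comment> \<open>If both mixed derivatives vary by less than half the gap between them, they
      cannot take a common value nearby.\<close>
    define e where "e = \<bar>?a x - ?b x\<bar> / 2"
    assume "?a x \<noteq> ?b x"
    hence e: "e > 0" by (auto simp: e_def)
    have "isCont ?a x" "isCont ?b x"
      using cont S by (auto simp: continuous_on_eq_continuous_at)
    then obtain d1 d2 where d: "d1 > 0" "d2 > 0" "\<And>y. dist y x < d1 \<Longrightarrow> \<bar>?a y - ?a x\<bar> < e"
        "\<And>y. dist y x < d2 \<Longrightarrow> \<bar>?b y - ?b x\<bar> < e"
      using e unfolding continuous_at_eps_delta dist_real_def by metis
    define s where "s = min (min d1 d2) e0 / 4"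
    have s: "s > 0" "2 * s < d1" "2 * s < d2" "2 * s < e0" using d e0(1) unfolding s_def by auto
    obtain y where y: "dist y x < d1" "f (x + s *\<^sub>R axis i 1 + s *\<^sub>R axis j 1) - f (x + s *\<^sub>R axis i 1) - f (x + s *\<^sub>R axis j 1) + f x
      = s * s * ?a y" using key[OF s(1,2,4)] by blast
    obtain z where z: "dist z x < d2" "f (x + s *\<^sub>R axis j 1 + s *\<^sub>R axis i 1) - f (x + s *\<^sub>R axis j 1) - f (x + s *\<^sub>R axis i 1) + f x
      = s * s * ?b z" using key[OF s(1,3,4)] by blast
    have "s * s * ?a y = s * s * ?b z" using y(2) z(2) by (simp add: algebra_simps)
    hence "?a y = ?b z" using s by simp
    moreover note d(3)[OF y(1)] d(4)[OF z(1)]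
    ultimately show False unfolding e_def by (auto simp: abs_if field_simps split: if_splits)
  qed
qed

lemma pd_commute:
  fixes f :: "real^'n::finite \<Rightarrow> real"
  assumes "smooth f"
  shows "pd i (pd j f) x = pd j (pd i f) x"
  by (rule pd_commute_open[OF open_UNIV])
     (auto intro!: differentiable_line smooth_D assms)

section \<open>Iterated derivatives and the order of differentiation\<close>

lemma pdl_append: "pdl (xs @ ys) f = pdl xs (pdl ys f)"
  by (induction xs) auto

lemma pdl_move: "smooth f \<Longrightarrow> pdl (xs @ [i]) f = pdl (i # xs) f"
proof (induction xs)
  case (Cons a xs)
  have "pdl ((a # xs) @ [i]) f = pd a (pd i (pdl xs f))" using Cons by simp
  also have "\<dots> = pd i (pd a (pdl xs f))" using pd_commute[OF smooth_pdl[OF Cons.prems]] by blast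
  finally show ?case by simp
qed auto

text \<open>\<open>mi_list\<close> is some list with prescribed multiplicities, so a derivative
  indexed by a multi-index is usable only if the order of differentiation is immaterial. The head of
  one list occurs in the other and is moved to its front by commuting it past the entries before
  it.\<close>

lemma pdl_perm: "smooth f \<Longrightarrow> (\<And>i. count_list xs i = count_list ys i) \<Longrightarrow> pdl xs f = pdl ys f"
proof (induction xs arbitrary: ys)
  case Nil
  hence "ys = []" by (cases ys) (auto, metis add_is_0 n_not_Suc_n  One_nat_def)
  thus ?case by simp
next
  case (Cons a xs)
  have "count_list ys a \<noteq> 0" using Cons.prems(2)[of a] by simp
  hence "a \<in> set ys" by (meson count_notin)
  then obtain y1 y2 where ys: "ys = y1 @ a # y2" by (meson split_list)
  have "count_list xs i = count_list (y1 @ y2) i" for i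
    using Cons.prems(2)[of i] ys by (auto split: if_splits)
  hence "pdl xs f = pdl (y1 @ y2) f" using Cons by blast
  moreover have "pdl ys f = pdl (y1 @ [a]) (pdl y2 f)" using ys pdl_append[of "y1 @ [a]" y2] by simp
  ultimately show ?case
    using pdl_move[OF smooth_pdl[OF Cons.prems(1)], of y1 a y2] by (simp add: pdl_append)
qed

lemma mi_list_count: "count_list (mi_list \<alpha>) i = \<alpha> i"
proof -
  have "\<exists>xs. \<forall>i. count_list xs i = (if i \<in> S then \<alpha> i else 0)" if "finite S" for S
    using that
  proof (induction S rule: finite_induct)
    case empty thus ?case by (intro exI[of _ "[]"]) auto
  next
    case (insert a S)
    then obtain xs where "\<forall>i. count_list xs i = (if i \<in> S then \<alpha> i else 0)" by blast
    moreover have "count_list (replicate n a) i = (if i = a then n else 0)" for n i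
      by (induction n) auto
    ultimately show ?case using insert by (intro exI[of _ "replicate (\<alpha> a) a @ xs"]) auto
  qed
  from this[OF finite_class.finite_UNIV] have "\<exists>xs. \<forall>i. count_list xs i = \<alpha> i" by simp
  from someI_ex[OF this] show ?thesis unfolding mi_list_def by blast
qed

lemma mi_list_length: "length (mi_list \<alpha>) = sum \<alpha> UNIV"
proof -
  have "length xs = (\<Sum>i\<in>UNIV. count_list xs i)" for xs :: "'a list"
  proof (induction xs)
    case (Cons a xs)
    have "(\<Sum>i\<in>UNIV. count_list (a # xs) i) = (\<Sum>i\<in>UNIV. count_list xs i + (if a = i then 1 else 0))"
      by (intro sum.cong) auto
    thus ?case using Cons by (simp add: sum.distrib)
  qed auto
  thus ?thesis by (simp add: mi_list_count)
qed

text \<open>The test functions constructed in the proof. The class is contained in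
  \<open>test_fun\<close>, is stable under differentiation and under multiplication by smooth
  functions, and offers total differentiability.\<close>

definition stest :: "(real^'n::finite) set \<Rightarrow> (real^'n \<Rightarrow> real) \<Rightarrow> bool" where
  "stest U \<phi> \<longleftrightarrow> smooth \<phi> \<and> (\<exists>K. compact K \<and> K \<subseteq> U \<and> (\<forall>x. x \<notin> K \<longrightarrow> \<phi> x = 0))"

lemma stest_imp_test_fun: "stest U \<phi> \<Longrightarrow> test_fun U \<phi>"
proof -
  assume "stest U \<phi>"
  then obtain K where K: "smooth \<phi>" "compact K" "K \<subseteq> U" "\<And>x. x \<notin> K \<Longrightarrow> \<phi> x = 0"
    unfolding stest_def by blast
  have "closure {x. \<phi> x \<noteq> 0} \<subseteq> K"
    by (rule closure_minimal) (use K compact_imp_closed in auto)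
  moreover from this have "compact (closure {x. \<phi> x \<noteq> 0})"
    using K(2) compact_Int_closed by (metis closed_closure inf.absorb_iff2)
  moreover have "continuous_on UNIV (pdl is \<phi>)"
      "(\<lambda>t. pdl is \<phi> (x + t *\<^sub>R axis i 1)) differentiable (at 0)" for "is" i x
    using smooth_D[OF smooth_pdl[OF K(1)]] differentiable_line by blast+
  ultimately show "test_fun U \<phi>" unfolding test_fun_def using K(3) by auto
qed

lemma stest_pd: "stest U \<phi> \<Longrightarrow> stest U (pd i \<phi>)"
proof -
  assume "stest U \<phi>"
  then obtain K where K: "smooth \<phi>" "compact K" "K \<subseteq> U" "\<And>x. x \<notin> K \<Longrightarrow> \<phi> x = 0"
    unfolding stest_def by blast
  have "pd i \<phi> x = 0" if "x \<notin> K" for x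
    using pd_cong[of "-K" x \<phi> "\<lambda>_. 0"] K that by (auto simp: compact_imp_closed open_Compl)
  thus ?thesis unfolding stest_def using K smooth_D(2) by blast
qed

lemma stest_mult: "stest U \<phi> \<Longrightarrow> smooth f \<Longrightarrow> stest U (\<lambda>x. \<phi> x * f x)"
  unfolding stest_def by (metis mult_zero_left smooth_mult)

section \<open>Bump functions and the fundamental lemma of the calculus of variations\<close>

lemma sum_Basis_nth [simp]: "(\<Sum>b\<in>Basis. (b :: real^'n::finite) $ i) = 1"
proof -
  have "(\<Sum>b\<in>Basis. (b :: real^'n) $ i) = (One :: real^'n) \<bullet> axis i 1"
    by (simp only: inner_axis sum_component) simp
  also have "\<dots> = (\<Sum>b\<in>Basis. b \<bullet> (axis i 1 :: real^'n))" by (rule inner_sum_left)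
  also have "\<dots> = (\<Sum>b\<in>Basis. if b = (axis i 1 :: real^'n) then 1 else 0)"
    by (intro sum.cong) (auto simp: inner_Basis axis_in_Basis_iff)
  also have "\<dots> = 1" by (simp add: axis_in_Basis_iff)
  finally show ?thesis .
qed

section \<open>The open and the closed cube\<close>

lemma mem_cube: "x \<in> cube R \<longleftrightarrow> (\<forall>i. - R < x $ i \<and> x $ i < R)"
  by (simp add: cube_def mem_box_cart)

lemma mem_ccube: "x \<in> ccube R \<longleftrightarrow> (\<forall>i. - R \<le> x $ i \<and> x $ i \<le> R)"
  by (simp add: ccube_def mem_box_cart)

lemma cube_subset_ccube: "cube R \<subseteq> ccube R"
  by (auto simp: mem_cube mem_ccube less_imp_le)

lemma open_cube [simp]: "open (cube R)"
  unfolding cube_def by (rule open_box)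

lemma compact_ccube [simp]: "compact (ccube R)"
  by (simp add: ccube_def)

lemma cube_lmeasurable [simp]: "cube R \<in> lmeasurable"
  unfolding cube_def by (rule lmeasurable_box)

lemma cube_sets [simp, measurable]: "cube R \<in> sets lebesgue"
  by (simp add: fmeasurableD)

text \<open>The functions \<open>e^(-1/t) / t^n\<close>, extended by zero to \<open>t \<le> 0\<close>; their span is closed under
  differentiation.\<close>

definition hbump :: "nat \<Rightarrow> real \<Rightarrow> real" where
  "hbump n t = (if t > 0 then exp (- (1 / t)) / t ^ n else 0)"

lemma hbump_0_bounds: "0 \<le> hbump 0 t" "hbump 0 t \<le> 1"
  by (auto simp: hbump_def)

text \<open>The exponential dominates \<open>(1 + x / N) ^ N\<close> with \<open>x = 1 / t\<close>
  and \<open>N = n + 2\<close>. Of the powers of \<open>t\<close> obtained, \<open>n\<close> pay for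
  the denominator and the other two make the difference quotient at 0 tend to 0, so these functions
  are differentiable there.\<close>

lemma hbump_bound: "\<bar>hbump n t\<bar> \<le> real (n + 2) ^ (n + 2) * t\<^sup>2"
proof (cases "t > 0")
  case True
  have "(1 + (1 / t) / real (n + 2)) ^ (n + 2) \<le> exp (1 / t)"
    by (rule exp_ge_one_plus_x_over_n_power_n) (use True in \<open>auto intro: order_trans[of _ 0]\<close>)
  moreover have "((1 / t) / real (n + 2)) ^ (n + 2) \<le> (1 + (1 / t) / real (n + 2)) ^ (n + 2)"
    by (rule power_mono) (use True in auto)
  ultimately have "((1 / t) / real (n + 2)) ^ (n + 2) \<le> exp (1 / t)" by linarith
  hence "1 / (t ^ (n + 2) * real (n + 2) ^ (n + 2)) \<le> exp (1 / t)"
    by (simp add: power_divide power_mult_distrib del: power_Suc of_nat_add)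
  hence "exp (- (1 / t)) \<le> t ^ (n + 2) * real (n + 2) ^ (n + 2)"
    using True by (simp add: exp_minus divide_simps mult_ac del: power_Suc of_nat_add)
  hence "exp (- (1 / t)) / t ^ n \<le> t ^ (n + 2) * real (n + 2) ^ (n + 2) / t ^ n"
    using True by (intro divide_right_mono) auto
  also have "\<dots> = real (n + 2) ^ (n + 2) * t\<^sup>2" using True by (simp add: power_add power2_eq_square)
  finally show ?thesis using True by (simp add: hbump_def)
qed (simp add: hbump_def)

lemma hbump_deriv:
  "(hbump n has_real_derivative (- real n * hbump (n + 1) t + hbump (n + 2) t)) (at t)"
proof -
  consider "t > 0" | "t < 0" | "t = 0" by linarith
  thus ?thesis
  proof cases
    case 1
    have "((\<lambda>t. exp (- (1 / t)) / t ^ n) has_real_derivative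
       ((exp (- (1 / t)) * (1 / t\<^sup>2)) * t ^ n - exp (- (1 / t)) * (real n * t ^ (n - 1))) / (t ^ n * t ^ n)) (at t)"
      using 1 by (auto intro!: derivative_eq_intros simp: power2_eq_square field_simps)
    moreover have "((exp (- (1 / t)) * (1 / t\<^sup>2)) * t ^ n - exp (- (1 / t)) * (real n * t ^ (n - 1))) / (t ^ n * t ^ n)
       = - real n * hbump (n + 1) t + hbump (n + 2) t"
      using 1 by (cases n) (auto simp: hbump_def field_simps power2_eq_square)
    ultimately have "((\<lambda>t. exp (- (1 / t)) / t ^ n) has_real_derivative (- real n * hbump (n + 1) t + hbump (n + 2) t)) (at t)"
      by simp
    thus ?thesis
      by (rule DERIV_cong_ev[THEN iffD1, OF refl _ refl, rotated])
         (use 1 in \<open>auto simp: hbump_def intro!: eventually_mono[OF eventually_nhds_in_open[of "{0<..}"]]\<close>)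
  next
    case 2
    have "((\<lambda>t. 0) has_real_derivative (- real n * hbump (n + 1) t + hbump (n + 2) t)) (at t)"
      using 2 by (simp add: hbump_def)
    thus ?thesis
      by (rule DERIV_cong_ev[THEN iffD1, OF refl _ refl, rotated])
         (use 2 in \<open>auto simp: hbump_def intro!: eventually_mono[OF eventually_nhds_in_open[of "{..<0}"]]\<close>)
  next
    case 3
    have "((\<lambda>h. hbump n h / h) \<longlongrightarrow> 0) (at 0)"
    proof (rule Lim_null_comparison)
      show "\<forall>\<^sub>F h in at 0. norm (hbump n h / h) \<le> real (n + 2) ^ (n + 2) * \<bar>h\<bar>"
      proof (rule eventually_mono[OF eventually_neq_at_within[of 0]])
        fix h :: real assume "h \<noteq> 0"
        thus "norm (hbump n h / h) \<le> real (n + 2) ^ (n + 2) * \<bar>h\<bar>"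
          using hbump_bound[of n h] by (simp add: field_simps power2_eq_square abs_mult_self del: of_nat_add power_Suc)
      qed
      show "((\<lambda>h. real (n + 2) ^ (n + 2) * \<bar>h\<bar>) \<longlongrightarrow> 0) (at (0::real))"
        by (auto intro!: tendsto_eq_intros)
    qed
    thus ?thesis using 3 by (simp add: hbump_def has_field_derivative_iff)
  qed
qed

lemma has_derivative_hbump_coord:
  "((\<lambda>x::real^'n::finite. hbump n (c * x $ i + a)) has_derivative
     (\<lambda>v. (c * v $ i) * (- real n * hbump (n + 1) (c * x $ i + a) + hbump (n + 2) (c * x $ i + a)))) (at x)"
proof -
  have "((\<lambda>x. c * x $ i + a) has_derivative (\<lambda>v. c * v $ i)) (at x)"
    by (auto intro!: derivative_eq_intros has_derivative_coord)
  from has_derivative_compose[OF this hbump_deriv[unfolded has_field_derivative_def]]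
  show ?thesis by (simp add: mult.commute)
qed

lemma cdiff_diff: "cdiff n f \<Longrightarrow> cdiff n g \<Longrightarrow> cdiff n (\<lambda>x. f x - g x)"
  using cdiff_add[of n f "\<lambda>x. - 1 * g x"] cdiff_mult[of n "\<lambda>x. - 1" g] by simp

lemma cdiff_hbump_coord: "cdiff k (\<lambda>x::real^'n::finite. hbump n (c * x $ i + a))"
proof (induction k arbitrary: n)
  case 0
  have "continuous_on UNIV (hbump n)"
    using hbump_deriv by (meson DERIV_isCont continuous_at_imp_continuous_on)
  thus ?case by (auto intro!: continuous_on_compose2[of UNIV "hbump n"] continuous_intros)
next
  case (Suc k)
  have "pd j (\<lambda>x::real^'n. hbump n (c * x $ i + a)) = (\<lambda>x. (if j = i then c else 0) *
      (- real n * hbump (n + 1) (c * x $ i + a) + hbump (n + 2) (c * x $ i + a)))" for j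
    by (auto simp: fun_eq_iff pd_eq[OF has_derivative_hbump_coord] axis_def)
  moreover have "(\<lambda>x::real^'n. hbump n (c * x $ i + a)) differentiable (at x)" for x
    using has_derivative_hbump_coord differentiable_def by blast
  ultimately show ?case using Suc by (auto intro!: cdiff_mult cdiff_diff)
qed

lemma smooth_hbump_coord: "smooth (\<lambda>x::real^'n::finite. hbump n (c * x $ i + a))"
  unfolding smooth_def using cdiff_hbump_coord by blast

text \<open>The shift by 1 after scaling by \<open>n\<close> serves two ends: each factor vanishes
  within distance \<open>1 / n\<close> of its face, which keeps the support compact in the open box,
  while its argument tends to infinity at every interior point, where the product therefore tends to
  1.\<close>

definition boxbump :: "nat \<Rightarrow> real^'n::finite \<Rightarrow> real^'n \<Rightarrow> real^'n \<Rightarrow> real" where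
  "boxbump n a b x = (\<Prod>i\<in>UNIV. hbump 0 (real n * x $ i + (- real n * a $ i - 1))
      * hbump 0 (- real n * x $ i + (real n * b $ i - 1)))"

lemma smooth_boxbump: "smooth (boxbump n a b)"
  unfolding boxbump_def[abs_def] by (intro smooth_prod smooth_mult smooth_hbump_coord) auto

lemma boxbump_bounds: "0 \<le> boxbump n a b x" "boxbump n a b x \<le> 1"
  unfolding boxbump_def
  by (auto intro!: prod_nonneg prod_le_1 mult_le_one mult_nonneg_nonneg hbump_0_bounds)

lemma boxbump_pos:
  assumes "n > 0"
  shows "boxbump n a b x \<noteq> 0 \<longleftrightarrow> (\<forall>i. a $ i + 1 / n < x $ i \<and> x $ i < b $ i - 1 / n)"
proof -
  have "real n * x $ i + (- real n * a $ i - 1) > 0 \<longleftrightarrow> a $ i + 1 / n < x $ i"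
    "- real n * x $ i + (real n * b $ i - 1) > 0 \<longleftrightarrow> x $ i < b $ i - 1 / n" for i
    using assms by (auto simp: field_simps)
  thus ?thesis unfolding boxbump_def hbump_def by (auto simp del: minus_mult_left)
qed

lemma stest_boxbump:
  assumes "n > 0" "box a b \<subseteq> U"
  shows "stest U (boxbump n a b)"
proof -
  let ?K = "cbox (a + (\<chi> i. 1 / real n)) (b - (\<chi> i. 1 / real n)) :: (real^'a) set"
  have p: "1 / real n > 0" using assms by simp
  have "?K \<subseteq> box a b"
  proof
    fix x assume "x \<in> ?K"
    hence "a $ i + 1 / real n \<le> x $ i \<and> x $ i \<le> b $ i - 1 / real n" for i by (simp add: mem_box_cart)
    thus "x \<in> box a b" using p unfolding mem_box_cart by (smt (verit))
  qed
  moreover have "boxbump n a b x = 0" if "x \<notin> ?K" for x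
    using boxbump_pos[OF assms(1), of a b x] that by (auto simp: mem_box_cart less_imp_le)
  ultimately show ?thesis unfolding stest_def
    using assms smooth_boxbump compact_cbox by (meson order_trans)
qed

lemma boxbump_tendsto: "(\<lambda>n. boxbump n a b x) \<longlonglongrightarrow> indicator (box a b) x"
proof (cases "x \<in> box a b")
  case True
  have *: "(\<lambda>n. hbump 0 (real n * e - 1)) \<longlonglongrightarrow> 1" if "e > 0" for e
  proof -
    have lim: "filterlim (\<lambda>n. real n * e - 1) at_top sequentially"
      using that by real_asymp
    have "(\<lambda>n. exp (- (1 / (real n * e - 1)))) \<longlonglongrightarrow> exp (- 0)"
      by (intro tendsto_intros tendsto_divide_0[OF tendsto_const] filterlim_at_top_imp_at_infinity lim)
    moreover have "eventually (\<lambda>n. real n * e - 1 > 0) sequentially"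
      using lim by (rule filterlim_at_top_dense[THEN iffD1, rule_format])
    hence "eventually (\<lambda>n. exp (- (1 / (real n * e - 1))) = hbump 0 (real n * e - 1)) sequentially"
      by eventually_elim (simp add: hbump_def)
    ultimately show ?thesis using Lim_transform_eventually by fastforce
  qed
  have "(\<lambda>n. boxbump n a b x) \<longlonglongrightarrow> (\<Prod>i\<in>(UNIV::'a set). 1 * 1)"
    unfolding boxbump_def
  proof (intro tendsto_prod tendsto_mult)
    fix i :: 'a
    have "x $ i - a $ i > 0" "b $ i - x $ i > 0" using True by (auto simp: mem_box_cart)
    from *[OF this(1)] *[OF this(2)]
    show "(\<lambda>n. hbump 0 (real n * x $ i + (- real n * a $ i - 1))) \<longlonglongrightarrow> 1"
      "(\<lambda>n. hbump 0 (- real n * x $ i + (real n * b $ i - 1))) \<longlonglongrightarrow> 1"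
      by (simp_all add: algebra_simps)
  qed
  thus ?thesis using True by simp
next
  case False
  then obtain i where i: "x $ i \<le> a $ i \<or> b $ i \<le> x $ i" by (auto simp: mem_box_cart not_less)
  have "boxbump n a b x = 0" if "n > 0" for n
    using boxbump_pos[OF that, of a b x] i that by (smt (verit) zero_less_divide_iff of_nat_0_less_iff)
  hence "eventually (\<lambda>n. boxbump n a b x = 0) sequentially"
    unfolding eventually_sequentially by (intro exI[of _ 1]) auto
  thus ?thesis using False by (simp add: tendsto_eventually)
qed

text \<open>Bumps converge boundedly to indicators of boxes, so \<open>v\<close> has integral zero
  over every box inside the cube. Boxes form an intersection-stable generator of the Borel sets;
  hence the integrals over all Borel sets vanish, and with them the function.\<close>

lemma fundamental_lemma:
  fixes v :: "real^'n::finite \<Rightarrow> real"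
  assumes v: "integrable (lebesgue_on (cube R)) v"
    and z: "\<And>\<phi>. stest (cube R) \<phi> \<Longrightarrow> integral\<^sup>L (lebesgue_on (cube R)) (\<lambda>x. v x * \<phi> x) = 0"
  shows "AE x in lebesgue_on (cube R). v x = 0"
proof -
  define w where "w x = indicator (cube R) x * v x" for x
  have w: "integrable lebesgue w"
    using v by (simp add: integrable_restrict_space w_def[abs_def])
  have zw: "integral\<^sup>L lebesgue (\<lambda>x. w x * \<phi> x) = 0" if "stest (cube R) \<phi>" for \<phi>
    using z[OF that] by (simp add: integral_restrict_space w_def[abs_def] mult.assoc)
  have bx: "integral\<^sup>L lebesgue (\<lambda>x. w x * indicator (box a b) x) = 0" for a b
  proof -
    \<comment> \<open>Clipping the box to the cube makes the bumps admissible test functions;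
      outside the cube \<open>w\<close> is zero, so the integral does not change.\<close>
    define a' b' where "a' = (\<chi> i. max (a $ i) (- R))" and "b' = (\<chi> i. min (b $ i) R)"
    have eq: "box a' b' = box a b \<inter> cube R"
      by (auto simp: a'_def b'_def mem_box_cart mem_cube)
    have e: "(\<lambda>x. w x * indicator (box a b) x) = (\<lambda>x. w x * indicator (box a' b') x)"
      by (auto simp: w_def eq indicator_def)
    have "(\<lambda>n. integral\<^sup>L lebesgue (\<lambda>x. w x * boxbump (Suc n) a' b' x))
        \<longlonglongrightarrow> integral\<^sup>L lebesgue (\<lambda>x. w x * indicator (box a' b') x)"
    proof (rule integral_dominated_convergence[where w="\<lambda>x. \<bar>w x\<bar>"])
      have "continuous_on UNIV (boxbump n a' b')" for n using smooth_boxbump smooth_D(3) by blast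
      hence "boxbump n a' b' \<in> borel_measurable lebesgue" for n
        by (intro measurable_completion) (simp add: borel_measurable_continuous_onI)
      thus "(\<lambda>x. w x * boxbump (Suc n) a' b' x) \<in> borel_measurable lebesgue" for n
        using w by (intro borel_measurable_times) auto
      show "AE x in lebesgue. (\<lambda>n. w x * boxbump (Suc n) a' b' x) \<longlonglongrightarrow> w x * indicator (box a' b') x"
        by (intro AE_I2 tendsto_mult tendsto_const LIMSEQ_Suc boxbump_tendsto)
      show "AE x in lebesgue. norm (w x * boxbump (Suc n) a' b' x) \<le> \<bar>w x\<bar>" for n
        by (intro AE_I2) (simp add: abs_mult abs_of_nonneg boxbump_bounds mult_left_le)
      show "(\<lambda>x. w x * indicator (box a' b') x) \<in> borel_measurable lebesgue"
        using w by (intro borel_measurable_times borel_measurable_indicator) (auto simp: fmeasurableD lmeasurable_box)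
    qed (use w in auto)
    moreover have "integral\<^sup>L lebesgue (\<lambda>x. w x * boxbump (Suc n) a' b' x) = 0" for n
      by (intro zw stest_boxbump) (auto simp: eq)
    ultimately show ?thesis unfolding e by (simp add: LIMSEQ_const_iff)
  qed
  \<comment> \<open>The generator argument reaches Borel sets, hence the passage from the Lebesgue
    measurable \<open>w\<close> to a Borel function equal to it almost everywhere.\<close>
  obtain w' where w': "w' \<in> borel_measurable lborel" "AE x in lborel. w x = w' x"
    using completion_ex_borel_measurable_real w by blast
  have iw': "integrable lborel w'"
  proof -
    have "integrable lebesgue w'"
      by (rule integrable_cong_AE_imp[OF w]) (use w' in \<open>auto simp: AE_completion measurable_completion\<close>)
    thus ?thesis using w'(1) by (simp add: integrable_completion)
  qed
  have tr: "set_lebesgue_integral lborel A w' = integral\<^sup>L lebesgue (\<lambda>x. w x * indicator A x)" if "A \<in> sets borel" for A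
  proof -
    have "set_lebesgue_integral lborel A w' = integral\<^sup>L lebesgue (\<lambda>x. w' x * indicator A x)"
      unfolding set_lebesgue_integral_def using w'(1) that
      by (subst integral_completion) (auto simp: mult.commute)
    also have "\<dots> = integral\<^sup>L lebesgue (\<lambda>x. w x * indicator A x)"
    proof (rule integral_cong_AE)
      show "(\<lambda>x. w' x * indicator A x) \<in> borel_measurable lebesgue"
        using w'(1) that by (intro measurable_completion) auto
      show "(\<lambda>x. w x * indicator A x) \<in> borel_measurable lebesgue"
        using w that by (intro borel_measurable_times borel_measurable_indicator) auto
      show "AE x in lebesgue. w' x * indicator A x = w x * indicator A x"
        using AE_completion[OF w'(2)] by eventually_elim simp
    qed
    finally show ?thesis .
  qed
  have tot: "set_lebesgue_integral lborel UNIV w' = 0"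
  proof -
    have "(\<lambda>x. w x * indicator (box (- (R *\<^sub>R One)) (R *\<^sub>R One)) x) = w"
      by (auto simp: w_def cube_def indicator_def)
    with bx[of "- (R *\<^sub>R One)" "R *\<^sub>R One"] show ?thesis using tr[of UNIV] by simp
  qed
  have si: "set_integrable lborel A w'" if "A \<in> sets borel" for A
    using iw' that unfolding set_integrable_def by (intro integrable_mult_indicator) auto
  have "set_lebesgue_integral lborel A w' = 0" if "A \<in> sets borel" for A
  proof -
    have "Int_stable (range (\<lambda>(a, b). box a b :: (real^'n) set))"
      by (auto simp: Int_stable_def box_Int_box)
    moreover have "range (\<lambda>(a, b). box a b :: (real^'n) set) \<subseteq> Pow UNIV" by auto
    moreover have "A \<in> sigma_sets UNIV (range (\<lambda>(a, b). box a b :: (real^'n) set))"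
      using that unfolding borel_eq_box by simp
    ultimately show ?thesis
    proof (induction rule: sigma_sets_induct_disjoint)
      case (basic A)
      thus ?case using tr bx by auto
    next
      case (compl A)
      hence A: "A \<in> sets borel" by (simp add: borel_eq_box)
      hence "set_lebesgue_integral lborel (A \<union> (UNIV - A)) w' =
          set_lebesgue_integral lborel A w' + set_lebesgue_integral lborel (UNIV - A) w'"
        by (intro set_integral_Un si) auto
      thus ?case using compl tot by (simp add: Un_commute)
    next
      case (union F)
      hence F: "F i \<in> sets borel" for i by (simp add: borel_eq_box subset_eq)
      have "set_lebesgue_integral lborel (\<Union>i. F i) w' = (\<Sum>i. set_lebesgue_integral lborel (F i) w')"
        by (rule lebesgue_integral_countable_add)
           (use F union(1) si in \<open>auto simp: disjoint_family_on_def\<close>)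
      thus ?case using union by simp
    qed (auto simp: Int_stable_def set_lebesgue_integral_def)
  qed
  hence "AE x in lborel. w' x = 0" by (intro density_unique_real iw') auto
  hence "AE x in lborel. w x = 0" using w'(2) by eventually_elim auto
  hence "AE x in lebesgue. w x = 0" by (rule AE_completion)
  thus ?thesis by (subst AE_restrict_space_iff) (auto simp: w_def indicator_def elim!: eventually_mono)
qed

section \<open>Square-integrable functions\<close>

definition sqint :: "'a measure \<Rightarrow> ('a \<Rightarrow> real) \<Rightarrow> bool" where
  "sqint M f \<longleftrightarrow> f \<in> borel_measurable M \<and> integrable M (\<lambda>x. (f x)\<^sup>2)"

lemma sqint_measurable: "sqint M f \<Longrightarrow> f \<in> borel_measurable M"
  by (simp add: sqint_def)

lemma sqint_square: "sqint M f \<Longrightarrow> integrable M (\<lambda>x. (f x)\<^sup>2)"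
  by (simp add: sqint_def)

lemma abs_mult_le_squares: "\<bar>a * b\<bar> \<le> a\<^sup>2 + (b::real)\<^sup>2"
proof -
  have "2 * \<bar>a\<bar> * \<bar>b\<bar> \<le> \<bar>a\<bar>\<^sup>2 + \<bar>b\<bar>\<^sup>2" by (rule sum_squares_bound)
  moreover have "0 \<le> \<bar>a\<bar> * \<bar>b\<bar>" by simp
  ultimately have "\<bar>a\<bar> * \<bar>b\<bar> \<le> \<bar>a\<bar>\<^sup>2 + \<bar>b\<bar>\<^sup>2" by linarith
  thus ?thesis by (simp add: abs_mult)
qed

lemma sqint_mult:
  assumes "sqint M f" "sqint M g"
  shows "integrable M (\<lambda>x. f x * g x)"
proof (rule Bochner_Integration.integrable_bound[of M "\<lambda>x. (f x)\<^sup>2 + (g x)\<^sup>2"])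
  show "integrable M (\<lambda>x. (f x)\<^sup>2 + (g x)\<^sup>2)" using assms by (simp add: sqint_def)
  show "(\<lambda>x. f x * g x) \<in> borel_measurable M" using assms by (auto simp: sqint_def)
  show "AE x in M. norm (f x * g x) \<le> norm ((f x)\<^sup>2 + (g x)\<^sup>2)"
    using abs_mult_le_squares by (intro AE_I2) simp
qed

lemma sqint_cmult: "sqint M f \<Longrightarrow> sqint M (\<lambda>x. c * f x)"
  by (auto simp: sqint_def power_mult_distrib)

lemma sqint_add:
  assumes "sqint M f" "sqint M g"
  shows "sqint M (\<lambda>x. f x + g x)"
proof -
  have "integrable M (\<lambda>x. (f x)\<^sup>2 + (g x)\<^sup>2 + 2 * (f x * g x))"
    using assms sqint_mult[OF assms] by (simp add: sqint_def)
  moreover have "(\<lambda>x. (f x)\<^sup>2 + (g x)\<^sup>2 + 2 * (f x * g x)) = (\<lambda>x. (f x + g x)\<^sup>2)"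
    by (simp add: power2_eq_square algebra_simps fun_eq_iff)
  ultimately show ?thesis using assms by (auto simp: sqint_def)
qed

lemma sqint_diff:
  assumes "sqint M f" "sqint M g"
  shows "sqint M (\<lambda>x. f x - g x)"
  using sqint_add[OF assms(1) sqint_cmult[OF assms(2), of "-1"]] by simp

lemma (in finite_measure) sqint_bounded:
  assumes "f \<in> borel_measurable M" "\<And>x. x \<in> space M \<Longrightarrow> \<bar>f x\<bar> \<le> B"
  shows "sqint M f"
proof -
  have "integrable M (\<lambda>x. (f x)\<^sup>2)"
  proof (rule integrable_const_bound[where B="B\<^sup>2"])
    show "AE x in M. norm ((f x)\<^sup>2) \<le> B\<^sup>2"
    proof (rule AE_I2)
      fix x assume "x \<in> space M"
      from power_mono[OF assms(2)[OF this], of 2] show "norm ((f x)\<^sup>2) \<le> B\<^sup>2" by simp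
    qed
  qed (use assms in auto)
  thus ?thesis using assms by (simp add: sqint_def)
qed

lemma (in finite_measure) sqint_integrable:
  assumes "sqint M f" shows "integrable M f"
  using sqint_mult[OF assms sqint_bounded[of "\<lambda>_. 1" 1]] by simp

text \<open>The minimum over \<open>t\<close> is attained at \<open>- B / C\<close>. Both
  Cauchy-Schwarz inequalities, in L^2 and in H^p, are instances.\<close>

lemma discriminant_le:
  fixes A B C :: real
  assumes "\<And>t. 0 \<le> A + 2 * t * B + t\<^sup>2 * C" "C \<ge> 0"
  shows "B\<^sup>2 \<le> A * C"
proof (cases "C = 0")
  case True
  have "B = 0"
  proof (rule ccontr)
    assume "B \<noteq> 0"
    \<comment> \<open>For \<open>C = 0\<close> this \<open>t\<close> gives the expression the value
      -1.\<close>
    thus False using assms(1)[of "- (A + 1) / (2 * B)"] True by (simp add: field_simps)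
  qed
  thus ?thesis using True by simp
next
  case False
  hence "C > 0" using assms by simp
  moreover have "0 \<le> A + 2 * (- B / C) * B + (- B / C)\<^sup>2 * C" by (rule assms)
  ultimately show ?thesis by (simp add: power2_eq_square field_simps)
qed

lemma sqint_Cauchy_Schwarz:
  assumes "sqint M f" "sqint M g"
  shows "(integral\<^sup>L M (\<lambda>x. f x * g x))\<^sup>2 \<le> integral\<^sup>L M (\<lambda>x. (f x)\<^sup>2) * integral\<^sup>L M (\<lambda>x. (g x)\<^sup>2)"
proof (rule discriminant_le)
  fix t
  have "0 \<le> integral\<^sup>L M (\<lambda>x. (f x + t * g x)\<^sup>2)" by simp
  also have "(\<lambda>x. (f x + t * g x)\<^sup>2) = (\<lambda>x. (f x)\<^sup>2 + 2 * t * (f x * g x) + t\<^sup>2 * (g x)\<^sup>2)"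
    by (simp add: power2_eq_square algebra_simps fun_eq_iff)
  also have "integral\<^sup>L M \<dots> = integral\<^sup>L M (\<lambda>x. (f x)\<^sup>2) + 2 * t * integral\<^sup>L M (\<lambda>x. f x * g x)
       + t\<^sup>2 * integral\<^sup>L M (\<lambda>x. (g x)\<^sup>2)"
    using assms sqint_mult[OF assms] by (simp add: sqint_def)
  finally show "0 \<le> integral\<^sup>L M (\<lambda>x. (f x)\<^sup>2) + 2 * t * integral\<^sup>L M (\<lambda>x. f x * g x)
       + t\<^sup>2 * integral\<^sup>L M (\<lambda>x. (g x)\<^sup>2)" .
qed simp

lemma (in finite_measure) sqint_tendsto_integral:
  assumes "\<And>n. sqint M (f n)" "sqint M g" "(\<lambda>n. integral\<^sup>L M (\<lambda>x. (f n x - g x)\<^sup>2)) \<longlonglongrightarrow> 0" "sqint M \<phi>"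
  shows "(\<lambda>n. integral\<^sup>L M (\<lambda>x. f n x * \<phi> x)) \<longlonglongrightarrow> integral\<^sup>L M (\<lambda>x. g x * \<phi> x)"
proof -
  have eq: "integral\<^sup>L M (\<lambda>x. f n x * \<phi> x) - integral\<^sup>L M (\<lambda>x. g x * \<phi> x) = integral\<^sup>L M (\<lambda>x. (f n x - g x) * \<phi> x)" for n
    using sqint_mult[OF assms(1) assms(4)] sqint_mult[OF assms(2) assms(4)] by (simp add: left_diff_distrib)
  have "(\<lambda>n. sqrt (integral\<^sup>L M (\<lambda>x. (f n x - g x)\<^sup>2) * integral\<^sup>L M (\<lambda>x. (\<phi> x)\<^sup>2))) \<longlonglongrightarrow> sqrt (0 * integral\<^sup>L M (\<lambda>x. (\<phi> x)\<^sup>2))"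
    by (intro tendsto_intros assms)
  hence lim: "(\<lambda>n. sqrt (integral\<^sup>L M (\<lambda>x. (f n x - g x)\<^sup>2) * integral\<^sup>L M (\<lambda>x. (\<phi> x)\<^sup>2))) \<longlonglongrightarrow> 0"
    by simp
  have "norm (integral\<^sup>L M (\<lambda>x. f n x * \<phi> x) - integral\<^sup>L M (\<lambda>x. g x * \<phi> x))
       \<le> sqrt (integral\<^sup>L M (\<lambda>x. (f n x - g x)\<^sup>2) * integral\<^sup>L M (\<lambda>x. (\<phi> x)\<^sup>2))" for n
    using real_sqrt_le_mono[OF sqint_Cauchy_Schwarz[OF sqint_diff[OF assms(1,2)] assms(4)], of n]
    by (simp only: eq real_sqrt_abs real_norm_def)
  hence "(\<lambda>n. integral\<^sup>L M (\<lambda>x. f n x * \<phi> x) - integral\<^sup>L M (\<lambda>x. g x * \<phi> x)) \<longlonglongrightarrow> 0"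
    by (intro Lim_null_comparison[OF always_eventually lim]) blast
  thus ?thesis by (simp add: LIM_zero_iff)
qed

text \<open>The Riesz-Fischer theorem with an explicit limit function: a rapidly converging
  subsequence has absolutely summable increments almost everywhere, its pointwise limit is the
  candidate, and Fatou's lemma transfers the Cauchy bound to it.\<close>

lemma (in finite_measure) sqint_complete:
  assumes f: "\<And>n. sqint M (f n)"
    and cau: "\<And>e. e > 0 \<Longrightarrow> \<exists>N. \<forall>m\<ge>N. \<forall>n\<ge>N. integral\<^sup>L M (\<lambda>x. (f m x - f n x)\<^sup>2) < e"
  obtains g where "sqint M g" "(\<lambda>n. integral\<^sup>L M (\<lambda>x. (f n x - g x)\<^sup>2)) \<longlonglongrightarrow> 0"
proof -
  define I where "I m n = integral\<^sup>L M (\<lambda>x. (f m x - f n x)\<^sup>2)" for m n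
  have "\<exists>r. \<forall>n. (\<forall>m\<ge>r n. \<forall>k\<ge>r n. I m k < (1/4) ^ n) \<and> r n < r (Suc n)"
  proof (rule dependent_nat_choice)
    show "\<exists>N. \<forall>m\<ge>N. \<forall>k\<ge>N. I m k < (1/4) ^ 0" using cau[of 1] by (auto simp: I_def)
  next
    fix x n
    obtain N where "\<forall>m\<ge>N. \<forall>k\<ge>N. I m k < (1/4) ^ Suc n" using cau[of "(1/4) ^ Suc n"] by (auto simp: I_def)
    thus "\<exists>y. (\<forall>m\<ge>y. \<forall>k\<ge>y. I m k < (1/4) ^ Suc n) \<and> x < y"
      by (intro exI[of _ "max N (Suc x)"]) auto
  qed
  then obtain r where r: "\<And>n m k. m \<ge> r n \<Longrightarrow> k \<ge> r n \<Longrightarrow> I m k < (1/4) ^ n" "\<And>n. r n < r (Suc n)" by blast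
  have sm: "strict_mono r" using r(2) by (simp add: strict_mono_Suc_iff)
  define d where "d k x = f (r (Suc k)) x - f (r k) x" for k x
  have d: "sqint M (d k)" for k unfolding d_def[abs_def] by (intro sqint_diff f)
  define m where "m = measure M (space M)"
  have id: "integral\<^sup>L M (\<lambda>x. \<bar>d k x\<bar>) \<le> sqrt m * (1/2) ^ k" for k
  proof -
    have "sqint M (\<lambda>x. \<bar>d k x\<bar>)" "sqint M (\<lambda>_. 1)" using d[of k] by (auto simp: sqint_def)
    from sqint_Cauchy_Schwarz[OF this]
    have "(integral\<^sup>L M (\<lambda>x. \<bar>d k x\<bar>))\<^sup>2 \<le> I (r (Suc k)) (r k) * m"
      by (simp add: I_def d_def m_def)
    also have "\<dots> \<le> (1/4) ^ k * m"
      using r(1)[of k "r (Suc k)" "r k"] r(2)[of k] by (intro mult_right_mono) (auto simp: m_def)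
    also have "\<dots> = (sqrt m * (1/2) ^ k)\<^sup>2"
    proof -
      have "((1/2::real) ^ k)\<^sup>2 = (1/4) ^ k"
        by (simp add: power2_eq_square flip: power_mult_distrib)
      thus ?thesis by (simp add: power_mult_distrib m_def)
    qed
    finally show ?thesis by (rule power2_le_imp_le) (simp add: m_def)
  qed
  have "(\<integral>\<^sup>+x. (\<Sum>k. ennreal \<bar>d k x\<bar>) \<partial>M) = (\<Sum>k. \<integral>\<^sup>+x. ennreal \<bar>d k x\<bar> \<partial>M)"
    by (intro nn_integral_suminf) (use sqint_measurable[OF d] in measurable)
  also have "\<dots> = (\<Sum>k. ennreal (integral\<^sup>L M (\<lambda>x. \<bar>d k x\<bar>)))"
    by (intro suminf_cong nn_integral_eq_integral) (use sqint_integrable[OF d] in auto)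
  also have "\<dots> \<le> (\<Sum>k. ennreal (sqrt m * (1/2) ^ k))"
    by (intro suminf_le ennreal_leI id) auto
  also have "\<dots> = ennreal (\<Sum>k. sqrt m * (1/2) ^ k)"
    by (intro suminf_ennreal2) (auto simp: m_def intro!: summable_mult summable_geometric)
  also have "\<dots> < \<infinity>" by simp
  finally have "(\<integral>\<^sup>+x. (\<Sum>k. ennreal \<bar>d k x\<bar>) \<partial>M) \<noteq> \<infinity>" by simp
  hence "AE x in M. (\<Sum>k. ennreal \<bar>d k x\<bar>) \<noteq> \<infinity>"
    by (intro nn_integral_PInf_AE) (use sqint_measurable[OF d] in measurable)
  hence conv: "AE x in M. convergent (\<lambda>k. f (r k) x)"
  proof eventually_elim
    fix x assume "(\<Sum>k. ennreal \<bar>d k x\<bar>) \<noteq> \<infinity>"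
    hence "summable (\<lambda>k. \<bar>d k x\<bar>)" by (intro summable_suminf_not_top) (auto simp: infinity_ennreal_def)
    hence "summable (\<lambda>k. d k x)" by (rule summable_rabs_cancel)
    hence "convergent (\<lambda>n. \<Sum>k<n. d k x)" by (simp add: summable_iff_convergent)
    hence "convergent (\<lambda>n. f (r 0) x + (\<Sum>k<n. d k x))" by (rule convergent_add[OF convergent_const])
    moreover have "f (r 0) x + (\<Sum>k<n. d k x) = f (r n) x" for n
      by (induction n) (auto simp: d_def)
    ultimately show "convergent (\<lambda>k. f (r k) x)" by simp
  qed
  \<comment> \<open>On the null set without convergence \<open>lim\<close> is an unspecified value;
    measurability holds all the same.\<close>
  define g where "g x = lim (\<lambda>k. f (r k) x)" for x
  have gm: "g \<in> borel_measurable M"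
    unfolding g_def[abs_def] by (intro borel_measurable_lim_metric sqint_measurable f)
  have bd: "(\<integral>\<^sup>+x. ennreal ((f n x - g x)\<^sup>2) \<partial>M) \<le> ennreal e" if "e > 0" "\<forall>k. \<forall>m\<ge>N. I m n < e" "n \<ge> N" for n N e
  proof -
    have "(\<integral>\<^sup>+x. ennreal ((f n x - g x)\<^sup>2) \<partial>M) = (\<integral>\<^sup>+x. liminf (\<lambda>k. ennreal ((f n x - f (r k) x)\<^sup>2)) \<partial>M)"
    proof (rule nn_integral_cong_AE)
      show "AE x in M. ennreal ((f n x - g x)\<^sup>2) = liminf (\<lambda>k. ennreal ((f n x - f (r k) x)\<^sup>2))"
        using conv
      proof eventually_elim
        fix x assume "convergent (\<lambda>k. f (r k) x)"
        hence "(\<lambda>k. f (r k) x) \<longlonglongrightarrow> g x" by (simp add: convergent_LIMSEQ_iff g_def)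
        hence "(\<lambda>k. ennreal ((f n x - f (r k) x)\<^sup>2)) \<longlonglongrightarrow> ennreal ((f n x - g x)\<^sup>2)"
          by (intro tendsto_ennrealI tendsto_intros)
        thus "ennreal ((f n x - g x)\<^sup>2) = liminf (\<lambda>k. ennreal ((f n x - f (r k) x)\<^sup>2))"
          by (intro lim_imp_Liminf[symmetric]) auto
      qed
    qed
    also have "\<dots> \<le> liminf (\<lambda>k. \<integral>\<^sup>+x. ennreal ((f n x - f (r k) x)\<^sup>2) \<partial>M)"
      by (rule nn_integral_liminf) (use sqint_measurable[OF f] in measurable)
    also have "\<dots> = liminf (\<lambda>k. ennreal (I (r k) n))"
      by (subst nn_integral_eq_integral)
         (use sqint_square[OF sqint_diff[OF f f]] in \<open>auto simp: I_def power2_commute\<close>)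
    also have "\<dots> \<le> ennreal e"
    proof (rule Liminf_le)
      show "\<forall>\<^sub>F k in sequentially. ennreal (I (r k) n) \<le> ennreal e"
        unfolding eventually_sequentially
      proof (intro exI[of _ N] allI impI)
        fix k assume "N \<le> k"
        hence "N \<le> r k" using seq_suble[OF sm, of k] by simp
        thus "ennreal (I (r k) n) \<le> ennreal e" using that by (intro ennreal_leI) (simp add: less_imp_le)
      qed
    qed simp
    finally show ?thesis .
  qed
  have bd2: "sqint M (\<lambda>x. f n x - g x) \<and> integral\<^sup>L M (\<lambda>x. (f n x - g x)\<^sup>2) \<le> e"
    if "e > 0" "\<forall>k. \<forall>m\<ge>N. I m n < e" "n \<ge> N" for n N e
  proof -
    have ms: "(\<lambda>x. f n x - g x) \<in> borel_measurable M" using gm sqint_measurable[OF f] by simp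
    have fin: "(\<integral>\<^sup>+x. ennreal ((f n x - g x)\<^sup>2) \<partial>M) < \<infinity>"
      using bd[OF that] by (metis ennreal_less_top infinity_ennreal_def order_le_less_trans)
    have int: "integrable M (\<lambda>x. (f n x - g x)\<^sup>2)"
      by (rule integrableI_nonneg) (use ms fin in auto)
    have "ennreal (integral\<^sup>L M (\<lambda>x. (f n x - g x)\<^sup>2)) \<le> ennreal e"
      using bd[OF that] nn_integral_eq_integral[OF int] by simp
    thus ?thesis using ms int that(1) by (simp add: sqint_def ennreal_le_iff)
  qed
  show ?thesis
  proof (rule that)
    obtain N where N: "\<forall>m\<ge>N. \<forall>n\<ge>N. I m n < 1" using cau[of 1] by (auto simp: I_def)
    \<comment> \<open>Square integrability of \<open>g\<close> comes from one member of the sequence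
      and its difference to \<open>g\<close>.\<close>
    have "sqint M (\<lambda>x. f N x - (f N x - g x))"
      by (rule sqint_diff[OF f conjunct1[OF bd2[of 1 N N]]]) (use N in auto)
    thus "sqint M g" by simp
    show "(\<lambda>n. integral\<^sup>L M (\<lambda>x. (f n x - g x)\<^sup>2)) \<longlonglongrightarrow> 0"
    proof (rule LIMSEQ_I)
      fix e :: real assume e: "e > 0"
      obtain N where N: "\<forall>m\<ge>N. \<forall>n\<ge>N. I m n < e/2" using cau[of "e/2"] e by (auto simp: I_def)
      have "norm (integral\<^sup>L M (\<lambda>x. (f n x - g x)\<^sup>2) - 0) < e" if "n \<ge> N" for n
      proof -
        have "integral\<^sup>L M (\<lambda>x. (f n x - g x)\<^sup>2) \<le> e/2" using bd2[of "e/2" N n] N e that by auto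
        thus ?thesis using e by simp
      qed
      thus "\<exists>N. \<forall>n\<ge>N. norm (integral\<^sup>L M (\<lambda>x. (f n x - g x)\<^sup>2) - 0) < e" by blast
    qed
  qed
qed

section \<open>Set integrals as integrals over the restricted measure\<close>

lemma finite_measure_lebesgue_on: "U \<in> lmeasurable \<Longrightarrow> finite_measure (lebesgue_on U)"
  by (intro finite_measureI) (auto simp: emeasure_restrict_space fmeasurable_def)

lemma L2_iff:
  assumes "U \<in> sets lebesgue" shows "L2 U v \<longleftrightarrow> sqint (lebesgue_on U) v"
proof -
  have "set_integrable lebesgue U (\<lambda>x. (v x)\<^sup>2) \<longleftrightarrow> integrable (lebesgue_on U) (\<lambda>x. (v x)\<^sup>2)"
    unfolding set_integrable_def using assms by (subst integrable_restrict_space) auto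
  moreover have "set_borel_measurable lebesgue U v \<longleftrightarrow> v \<in> borel_measurable (lebesgue_on U)"
    unfolding set_borel_measurable_def using assms by (subst borel_measurable_restrict_space_iff) auto
  ultimately show ?thesis unfolding L2_def sqint_def by simp
qed

lemma set_integral_eq:
  fixes f :: "real^'n::finite \<Rightarrow> real"
  assumes "U \<in> sets lebesgue" shows "set_lebesgue_integral lebesgue U f = integral\<^sup>L (lebesgue_on U) f"
  unfolding set_lebesgue_integral_def using assms by (subst integral_restrict_space) auto

section \<open>Bounded continuous functions on the cube and the divergence theorem\<close>

text \<open>A class closed under sums and products whose members are automatically measurable and
  integrable. Boundedness is required on the open cube, where derivatives of \<open>C2_cl\<close>
  functions are meaningful; at the boundary these have limits, but no values of their own.\<close>

definition nice :: "real \<Rightarrow> (real^'n::finite \<Rightarrow> real) \<Rightarrow> bool" where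
  "nice R f \<longleftrightarrow> continuous_on (cube R) f \<and> (\<exists>B. \<forall>x\<in>cube R. \<bar>f x\<bar> \<le> B)"

lemma nice_const: "nice R (\<lambda>_. c)"
  by (auto simp: nice_def)

lemma nice_add:
  assumes "nice R f" "nice R g" shows "nice R (\<lambda>x. f x + g x)"
proof -
  obtain A B where "\<forall>x\<in>cube R. \<bar>f x\<bar> \<le> A" "\<forall>x\<in>cube R. \<bar>g x\<bar> \<le> B"
    using assms by (auto simp: nice_def)
  hence "\<forall>x\<in>cube R. \<bar>f x + g x\<bar> \<le> A + B" by (meson abs_triangle_ineq add_mono order_trans)
  thus ?thesis using assms by (auto simp: nice_def intro!: continuous_intros)
qed

lemma nice_mult:
  assumes "nice R f" "nice R g" shows "nice R (\<lambda>x. f x * g x)"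
proof -
  obtain A B where AB: "\<forall>x\<in>cube R. \<bar>f x\<bar> \<le> A" "\<forall>x\<in>cube R. \<bar>g x\<bar> \<le> B"
    using assms by (auto simp: nice_def)
  have "\<forall>x\<in>cube R. \<bar>f x * g x\<bar> \<le> A * B"
    unfolding abs_mult using AB by (meson abs_ge_zero mult_mono order_trans)
  thus ?thesis using assms by (auto simp: nice_def intro!: continuous_intros)
qed

lemma nice_minus: "nice R f \<Longrightarrow> nice R (\<lambda>x. - f x)"
  by (auto simp: nice_def intro!: continuous_intros)

lemma nice_diff: "nice R f \<Longrightarrow> nice R g \<Longrightarrow> nice R (\<lambda>x. f x - g x)"
  using nice_add[OF _ nice_minus] by fastforce

lemma nice_power: "nice R f \<Longrightarrow> nice R (\<lambda>x. f x ^ n)"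
  by (induction n) (auto intro: nice_const nice_mult)

lemma nice_sum: "(\<And>i. i \<in> S \<Longrightarrow> nice R (f i)) \<Longrightarrow> nice R (\<lambda>x. \<Sum>i\<in>S. f i x)"
  by (induction S rule: infinite_finite_induct) (auto intro: nice_const nice_add)

lemma nice_continuous_ccube:
  assumes "continuous_on (ccube R) f" shows "nice R f"
proof -
  have "bounded (f ` ccube R)" by (intro compact_imp_bounded compact_continuous_image assms compact_ccube)
  then obtain B where "\<forall>x\<in>ccube R. \<bar>f x\<bar> \<le> B" by (auto simp: bounded_iff)
  thus ?thesis using assms cube_subset_ccube unfolding nice_def
    by (meson continuous_on_subset subsetD)
qed

lemmas nice_intros = nice_const nice_add nice_mult nice_minus nice_diff nice_power nice_sum

lemma finite_measure_cube: "finite_measure (lebesgue_on (cube R))"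
  by (rule finite_measure_lebesgue_on) simp

lemma nice_measurable: "nice R f \<Longrightarrow> f \<in> borel_measurable (lebesgue_on (cube R))"
  unfolding nice_def by (intro continuous_imp_measurable_on_sets_lebesgue) auto

lemma nice_sqint: "nice R f \<Longrightarrow> sqint (lebesgue_on (cube R)) f"
  using finite_measure.sqint_bounded[OF finite_measure_cube nice_measurable] unfolding nice_def by force

lemma nice_integrable: "nice R f \<Longrightarrow> integrable (lebesgue_on (cube R)) f"
  by (rule finite_measure.sqint_integrable[OF finite_measure_cube nice_sqint])

lemma integral_mono_cube:
  assumes "nice R f" "nice R g" "\<And>x. x \<in> cube R \<Longrightarrow> f x \<le> g x"
  shows "integral\<^sup>L (lebesgue_on (cube R)) f \<le> integral\<^sup>L (lebesgue_on (cube R)) g"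
  by (rule integral_mono[OF nice_integrable nice_integrable]) (use assms in auto)

text \<open>A limit at \<open>x\<close> bounds \<open>f\<close> near \<open>x\<close>, and finitely
  many such neighbourhoods cover the compact closed cube.\<close>

lemma nice_of_limits:
  assumes "continuous_on (cube R) f" "\<And>x. x \<in> ccube R \<Longrightarrow> \<exists>l. (f \<longlongrightarrow> l) (at x within cube R)"
  shows "nice R f"
proof -
  have "\<exists>U B. open U \<and> x \<in> U \<and> (\<forall>y\<in>U \<inter> cube R. \<bar>f y\<bar> \<le> B)" if x: "x \<in> ccube R" for x
  proof -
    obtain l where "(f \<longlongrightarrow> l) (at x within cube R)" using assms(2)[OF x] by blast
    hence "\<forall>\<^sub>F y in at x within cube R. dist (f y) l < 1" by (rule tendstoD) simp
    then obtain U where U: "open U" "x \<in> U" "\<forall>y\<in>U. y \<noteq> x \<longrightarrow> y \<in> cube R \<longrightarrow> dist (f y) l < 1"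
      unfolding eventually_at_topological by blast
    \<comment> \<open>The filter \<open>at x\<close> excludes \<open>x\<close> itself, so the value
      \<open>f x\<close> has to be bounded separately.\<close>
    have "\<bar>f y\<bar> \<le> max (\<bar>l\<bar> + 1) \<bar>f x\<bar>" if "y \<in> U \<inter> cube R" for y
      using U(3) that by (cases "y = x") (auto simp: dist_real_def)
    thus ?thesis using U by blast
  qed
  then obtain U B where UB: "\<And>x. x \<in> ccube R \<Longrightarrow> open (U x) \<and> x \<in> U x \<and> (\<forall>y\<in>U x \<inter> cube R. \<bar>f y\<bar> \<le> B x)"
    by metis
  have "ccube R \<subseteq> (\<Union>x\<in>ccube R. U x)" using UB by blast
  then obtain C where C: "C \<subseteq> ccube R" "finite C" "ccube R \<subseteq> (\<Union>x\<in>C. U x)"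
    using compactE_image[OF compact_ccube, of "ccube R" U R] UB by metis
  have "\<bar>f y\<bar> \<le> (\<Sum>x\<in>C. \<bar>B x\<bar>)" if "y \<in> cube R" for y
  proof -
    have "y \<in> (\<Union>x\<in>C. U x)" using C(3) that cube_subset_ccube by blast
    then obtain x where x: "x \<in> C" "y \<in> U x" by blast
    hence "\<bar>f y\<bar> \<le> \<bar>B x\<bar>" using UB[of x] C(1) that by force
    also have "\<dots> \<le> (\<Sum>x\<in>C. \<bar>B x\<bar>)" by (rule member_le_sum) (use x C in auto)
    finally show ?thesis .
  qed
  thus ?thesis using assms(1) unfolding nice_def by blast
qed

lemma C2_cl_nice:
  assumes "C2_cl R u"
  shows "nice R u" "nice R (pd i u)" "nice R (pd j (pd i u))"
proof -
  show "nice R u" by (rule nice_continuous_ccube) (use assms in \<open>simp add: C2_cl_def\<close>)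
  show "nice R (pd i u)" "nice R (pd j (pd i u))"
    by (rule nice_of_limits; use assms in \<open>simp add: C2_cl_def\<close>)+
qed

section \<open>Differentiability along one axis and the divergence theorem\<close>

definition ldiff :: "real \<Rightarrow> 'n \<Rightarrow> (real^'n::finite \<Rightarrow> real) \<Rightarrow> bool" where
  "ldiff R i g \<longleftrightarrow> (\<forall>x\<in>cube R. (\<lambda>t. g (x + t *\<^sub>R axis i 1)) differentiable (at 0))"

lemma C2_cl_ldiff:
  assumes "C2_cl R u" shows "ldiff R i u" "ldiff R j (pd i u)"
  using assms by (auto simp: C2_cl_def ldiff_def)

lemma axis_line_cube:
  assumes "x \<in> cube R" "- R < x $ i + s" "x $ i + s < R"
  shows "x + s *\<^sub>R axis i 1 \<in> cube R"
  using assms by (auto simp: mem_cube axis_def)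

lemma ldiff_MVT:
  assumes "ldiff R i g" "x \<in> cube R" "x + t *\<^sub>R axis i 1 \<in> cube R" "t > 0"
  obtains s where "0 < s" "s < t" "x + s *\<^sub>R axis i 1 \<in> cube R"
    "g (x + t *\<^sub>R axis i 1) - g x = t * pd i g (x + s *\<^sub>R axis i 1)"
proof -
  have mem: "x + s *\<^sub>R axis i 1 \<in> cube R" if "0 \<le> s" "s \<le> t" for s
  proof (rule axis_line_cube[OF assms(2)])
    have "- R < x $ i" "x $ i + t < R" using assms(2,3) by (auto simp: mem_cube dest: spec[of _ i])
    thus "- R < x $ i + s" "x $ i + s < R" using that by linarith+
  qed
  have "\<exists>s>0. s < t \<and> g (x + t *\<^sub>R axis i 1) - g (x + 0 *\<^sub>R axis i 1) = (t - 0) * pd i g (x + s *\<^sub>R axis i 1)"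
  proof (rule MVT2[OF assms(4)])
    fix s assume "0 \<le> s" "s \<le> t"
    from mem[OF this] show "((\<lambda>t. g (x + t *\<^sub>R axis i 1)) has_real_derivative pd i g (x + s *\<^sub>R axis i 1)) (at s)"
      by (intro pd_line_deriv_at) (use assms(1) in \<open>auto simp: ldiff_def\<close>)
  qed
  then obtain s where "s>0" "s < t" "g (x + t *\<^sub>R axis i 1) - g (x + 0 *\<^sub>R axis i 1) = (t - 0) * pd i g (x + s *\<^sub>R axis i 1)"
    by blast
  thus ?thesis using that mem[of s] by simp
qed

lemma tendsto_within_seq:
  assumes "(g \<longlongrightarrow> l) (at a within S)" "\<And>n. y n \<in> S" "\<And>n. y n \<noteq> a" "y \<longlonglongrightarrow> a"
  shows "(\<lambda>n. g (y n)) \<longlonglongrightarrow> l"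
proof -
  have "filterlim y (at a within S) sequentially"
    unfolding filterlim_at using assms by (auto intro: always_eventually)
  thus ?thesis by (rule filterlim_compose[OF assms(1)])
qed

text \<open>Factors for approaching a boundary point through the open cube; the summand 2 keeps them
  positive from the index 0 on.\<close>

lemma seq_shrink: "(\<lambda>n. (1::real) - 1 / real (n + 2)) \<longlonglongrightarrow> 1"
  by real_asymp

lemma seq_shrink_bounds: "0 < (1::real) - 1 / real (n + 2)" "(1::real) - 1 / real (n + 2) < 1"
  by auto

text \<open>Relatively open: lines in direction \<open>i\<close> through points of the open cube
  leave it in these sets, and small shifts along the other axes stay inside them.\<close>

definition face :: "real \<Rightarrow> 'n \<Rightarrow> real \<Rightarrow> (real^'n::finite) set" where
  "face R i c = {x. x $ i = c \<and> (\<forall>j. j \<noteq> i \<longrightarrow> - R < x $ j \<and> x $ j < R)}"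

text \<open>The extension of \<open>g\<close> by zero has difference quotients in direction \<open>i\<close> with integral zero. They
  are dominated, and those on the cube converge to \<open>pd i g\<close>; only the layer at the bottom face contributes
  an error, and it has a sign.\<close>

lemma integral_pd_nonpos:
  fixes g :: "real^'n::finite \<Rightarrow> real"
  assumes g: "nice R g" "ldiff R i g" "nice R (pd i g)"
    and top: "\<And>x. x \<in> face R i R \<Longrightarrow> (g \<longlongrightarrow> 0) (at x within cube R)"
    and bot: "\<And>x. x \<in> face R i (- R) \<Longrightarrow> \<exists>l\<ge>0. (g \<longlongrightarrow> l) (at x within cube R)"
  shows "integral\<^sup>L (lebesgue_on (cube R)) (pd i g) \<le> 0"
proof -
  obtain B where B: "\<And>x. x \<in> cube R \<Longrightarrow> \<bar>pd i g x\<bar> \<le> B" using g(3) by (auto simp: nice_def)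
  have lip: "\<bar>g (x + t *\<^sub>R axis i 1) - g x\<bar> \<le> B * t"
    if t: "x \<in> cube R" "x + t *\<^sub>R axis i 1 \<in> cube R" "t > 0" for x t
  proof -
    from ldiff_MVT[OF g(2) that] obtain s where s: "x + s *\<^sub>R axis i 1 \<in> cube R"
      "g (x + t *\<^sub>R axis i 1) - g x = t * pd i g (x + s *\<^sub>R axis i 1)" by metis
    have "t * \<bar>pd i g (x + s *\<^sub>R axis i 1)\<bar> \<le> t * B" using B[OF s(1)] t by (intro mult_left_mono) auto
    thus ?thesis unfolding s(2) using t by (simp add: abs_mult mult.commute)
  qed
  \<comment> \<open>The derivative is bounded by \<open>B\<close> along the line up to the top face,
    where the limit is 0. The resulting linear decay bounds the difference quotients of the
    extension by zero across that face.\<close>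
  have upper: "\<bar>g x\<bar> \<le> B * (R - x $ i)" if x: "x \<in> cube R" for x
  proof -
    define s where "s n = (R - x $ i) * (1 - 1 / real (n + 2))" for n
    define z where "z = x + (R - x $ i) *\<^sub>R axis i 1"
    have xi: "- R < x $ i" "x $ i < R" using x by (auto simp: mem_cube)
    have s: "0 < s n" "s n < R - x $ i" for n
      using seq_shrink_bounds[of n] xi mult_strict_left_mono[of "1 - 1 / real (n + 2)" 1 "R - x $ i"]
      unfolding s_def by auto
    have y: "x + s n *\<^sub>R axis i 1 \<in> cube R" for n
      by (rule axis_line_cube[OF x]) (use s[of n] xi in linarith)+
    have sl: "s \<longlonglongrightarrow> (R - x $ i) * 1" unfolding s_def[abs_def] by (intro tendsto_intros seq_shrink)
    have "(\<lambda>n. g (x + s n *\<^sub>R axis i 1)) \<longlonglongrightarrow> 0"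
    proof (rule tendsto_within_seq[OF top y])
      show "z \<in> face R i R" using x by (auto simp: face_def z_def mem_cube axis_def)
      show "x + s n *\<^sub>R axis i 1 \<noteq> z" for n
      proof
        assume "x + s n *\<^sub>R axis i 1 = z"
        hence "(x + s n *\<^sub>R axis i 1) $ i = z $ i" by simp
        thus False using s(2)[of n] by (simp add: z_def)
      qed
      show "(\<lambda>n. x + s n *\<^sub>R axis i 1) \<longlonglongrightarrow> z"
        unfolding z_def using sl by (intro tendsto_intros) simp
    qed
    hence "(\<lambda>n. \<bar>g (x + s n *\<^sub>R axis i 1)\<bar> + B * s n) \<longlonglongrightarrow> \<bar>0\<bar> + B * ((R - x $ i) * 1)"
      by (intro tendsto_intros sl)
    moreover have "\<bar>g x\<bar> \<le> \<bar>g (x + s n *\<^sub>R axis i 1)\<bar> + B * s n" for n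
      using lip[OF x y s(1), of n] by linarith
    ultimately show ?thesis using LIMSEQ_le_const by fastforce
  qed
  \<comment> \<open>At the bottom face only the sign of the limit is known, which yields the bound
    from one side.\<close>
  have lower: "g x \<ge> - (B * (x $ i + R))" if x: "x \<in> cube R" for x
  proof -
    define s where "s n = (x $ i + R) * (1 - 1 / real (n + 2))" for n
    define z where "z = x + (- (x $ i + R)) *\<^sub>R axis i 1"
    have xi: "- R < x $ i" "x $ i < R" using x by (auto simp: mem_cube)
    have s: "0 < s n" "s n < x $ i + R" for n
      using seq_shrink_bounds[of n] xi mult_strict_left_mono[of "1 - 1 / real (n + 2)" 1 "x $ i + R"]
      unfolding s_def by auto
    have y: "x + (- s n) *\<^sub>R axis i 1 \<in> cube R" for n
      by (rule axis_line_cube[OF x]) (use s[of n] xi in linarith)+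
    have sl: "s \<longlonglongrightarrow> (x $ i + R) * 1" unfolding s_def[abs_def] by (intro tendsto_intros seq_shrink)
    have "z \<in> face R i (- R)" using x by (auto simp: face_def z_def mem_cube axis_def)
    from bot[OF this] obtain l where l: "l \<ge> 0" "(g \<longlongrightarrow> l) (at z within cube R)" by blast
    have "(\<lambda>n. g (x + (- s n) *\<^sub>R axis i 1)) \<longlonglongrightarrow> l"
    proof (rule tendsto_within_seq[OF l(2) y])
      show "x + (- s n) *\<^sub>R axis i 1 \<noteq> z" for n
      proof
        assume "x + (- s n) *\<^sub>R axis i 1 = z"
        hence "(x + (- s n) *\<^sub>R axis i 1) $ i = z $ i" by (rule arg_cong)
        thus False using s(2)[of n] by (simp add: z_def)
      qed
      have "(\<lambda>n. x + (- s n) *\<^sub>R axis i 1) \<longlonglongrightarrow> x + (- ((x $ i + R) * 1)) *\<^sub>R axis i 1"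
        using sl by (intro tendsto_intros)
      thus "(\<lambda>n. x + (- s n) *\<^sub>R axis i 1) \<longlonglongrightarrow> z" unfolding z_def by simp
    qed
    hence "(\<lambda>n. g (x + (- s n) *\<^sub>R axis i 1) - B * s n) \<longlonglongrightarrow> l - B * ((x $ i + R) * 1)"
      by (intro tendsto_intros sl)
    moreover have "g x \<ge> g (x + (- s n) *\<^sub>R axis i 1) - B * s n" for n
    proof -
      have "x + (- s n) *\<^sub>R axis i 1 + s n *\<^sub>R axis i 1 = x" by (simp add: algebra_simps)
      thus ?thesis using lip[OF y[of n] _ s(1), of n] x by simp
    qed
    ultimately have "l - B * ((x $ i + R) * 1) \<le> g x" by (intro LIMSEQ_le_const2) auto
    thus ?thesis using l(1) by simp
  qed
  define G where "G x = indicator (cube R) x * g x" for x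
  have cb: "(cube R :: (real^'n) set) \<in> sets borel" by (simp add: borel_open)
  have gb: "(\<lambda>x. indicator (cube R) x * f x) \<in> borel_measurable borel" if "nice R f" for f :: "real^'n \<Rightarrow> real"
    using borel_measurable_continuous_on_indicator[OF cb, of f] that by (simp add: nice_def)
  have fin: "emeasure lborel (cube R :: (real^'n) set) < \<infinity>" unfolding cube_def by (intro emeasure_bounded_finite bounded_box)
  have ind: "integrable lborel (\<lambda>x::real^'n. C * indicator (cube R) x)" for C :: real
    by (intro integrable_mult_right integrable_real_indicator) (use fin cb in simp_all)
  obtain C where C: "\<And>x. x \<in> cube R \<Longrightarrow> \<bar>g x\<bar> \<le> C" using g(1) by (auto simp: nice_def)
  have dom: "integrable lborel f" if "f \<in> borel_measurable borel" "\<And>x. \<bar>f x\<bar> \<le> D * indicator (cube R) x" for f :: "real^'n \<Rightarrow> real" and D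
    by (rule Bochner_Integration.integrable_bound[OF ind[of D]])
       (use that in \<open>auto intro!: AE_I2 order_trans[OF that(2) abs_ge_self]\<close>)
  have Gm: "G \<in> borel_measurable borel" using gb[OF g(1)] unfolding G_def .
  define tt where "tt n = 1 / real (n + 1)" for n
  have tt: "tt n > 0" for n by (simp add: tt_def)
  have ttl: "tt \<longlonglongrightarrow> 0" unfolding tt_def[abs_def] by real_asymp
  define e where "e = (axis i 1 :: real^'n)"
  have tr: "integral\<^sup>L lborel (\<lambda>x. f (x + t *\<^sub>R e)) = integral\<^sup>L lborel f"
    if "f \<in> borel_measurable borel" for f :: "real^'n \<Rightarrow> real" and t
  proof -
    have "integral\<^sup>L lborel f = integral\<^sup>L (distr lborel borel ((+) (t *\<^sub>R e))) f"
      by (simp add: lborel_distr_plus)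
    also have "\<dots> = integral\<^sup>L lborel (\<lambda>x. f (x + t *\<^sub>R e))"
      using that by (subst integral_distr) (auto simp: add.commute)
    finally show ?thesis ..
  qed
  define q where "q n x = indicator (cube R) x * ((G (x + tt n *\<^sub>R e) - G x) / tt n)" for n x
  define E where "E n = {x \<in> cube R. x $ i \<le> - R + tt n}" for n
  have shm: "(\<lambda>x. f (x + t *\<^sub>R e)) \<in> borel_measurable borel" if "f \<in> borel_measurable borel" for f :: "real^'n \<Rightarrow> real" and t
    using measurable_compose[OF _ that, of "\<lambda>x. x + t *\<^sub>R e" borel] by simp
  have qm: "q n \<in> borel_measurable borel" for n
    unfolding q_def[abs_def] using Gm shm[OF Gm] cb by (intro borel_measurable_times borel_measurable_divide borel_measurable_diff) auto
  \<comment> \<open>\<open>R\<close> may be nonpositive here, and for an empty cube nothing forces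
    \<open>B\<close> to be nonnegative.\<close>
  have B0: "B \<ge> 0" if "x \<in> cube R" for x :: "real^'n" using B[OF that] by linarith
  have qB: "\<bar>q n x\<bar> \<le> B * indicator (cube R) x" for n x
  proof (cases "x \<in> cube R")
    case True
    show ?thesis
    proof (cases "x + tt n *\<^sub>R e \<in> cube R")
      case t: True
      have "\<bar>G (x + tt n *\<^sub>R e) - G x\<bar> \<le> B * tt n" using lip[OF True _ tt] t True by (simp add: G_def e_def)
      thus ?thesis using True tt[of n] by (simp add: q_def field_simps)
    next
      case False
      have "R \<le> x $ i + tt n" using False True tt[of n] axis_line_cube[OF True, of i "tt n"]
        unfolding e_def mem_cube by (smt (verit))
      hence "B * (R - x $ i) \<le> B * tt n" using B0[OF True] by (intro mult_left_mono) auto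
      hence "\<bar>g x\<bar> \<le> B * tt n" using upper[OF True] by linarith
      thus ?thesis using False True tt[of n] by (simp add: q_def G_def field_simps)
    qed
  qed (simp add: q_def)
  have Em: "E n \<in> sets borel" for n
  proof -
    have "E n = cube R \<inter> {x. x $ i \<le> - R + tt n}" by (auto simp: E_def)
    thus ?thesis using cb by (auto intro!: borel_closed closed_Collect_le continuous_intros)
  qed
  \<comment> \<open>Translation invariance moves the shift from \<open>G\<close> to the indicator of
    the cube. What remains differs from 0 only at points \<open>x\<close> of the cube for which
    \<open>x - tt n *\<^sub>R e\<close> has left it, that is in the bottom layer \<open>E n\<close>;
    there it equals \<open>- g x / tt n\<close>, which \<open>lower\<close> bounds by
    \<open>B\<close>.\<close>
  have main: "integral\<^sup>L lborel (q n) \<le> integral\<^sup>L lborel (\<lambda>x. B * indicator (E n) x)" for n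
  proof -
    let ?f = "\<lambda>x. indicator (cube R) (x - tt n *\<^sub>R e) * G x"
    have fm: "?f \<in> borel_measurable borel"
      using Gm cb shm[of "indicator (cube R)" "- tt n"] by (intro borel_measurable_times) auto
    have cb': "\<bar>G x\<bar> \<le> \<bar>C\<bar> * indicator (cube R) x" for x
      using C[of x] by (cases "x \<in> cube R") (auto simp: G_def)
    have fi: "integrable lborel ?f"
    proof (rule dom[OF fm])
      have "\<bar>?f x\<bar> \<le> \<bar>G x\<bar>" for x by (auto simp: indicator_def)
      thus "\<bar>?f x\<bar> \<le> \<bar>C\<bar> * indicator (cube R) x" for x using cb' order_trans by blast
    qed
    have Gi: "integrable lborel G" by (rule dom[OF Gm cb'])
    have f'm: "(\<lambda>x. indicator (cube R) x * G (x + tt n *\<^sub>R e)) \<in> borel_measurable borel"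
      using shm[OF Gm] cb by (intro borel_measurable_times) auto
    have f'i: "integrable lborel (\<lambda>x. indicator (cube R) x * G (x + tt n *\<^sub>R e))"
      by (rule dom[OF f'm, of "\<bar>C\<bar>"]) (use cb' in \<open>auto simp: indicator_def split: if_splits intro: order_trans[OF cb']\<close>)
    have "integral\<^sup>L lborel (\<lambda>x. indicator (cube R) x * G (x + tt n *\<^sub>R e)) = integral\<^sup>L lborel ?f"
      using tr[OF fm, of "tt n"] by simp
    moreover have "q n x = (indicator (cube R) x * G (x + tt n *\<^sub>R e) - G x) / tt n" for x
      by (auto simp: q_def G_def indicator_def)
    hence "q n = (\<lambda>x. (indicator (cube R) x * G (x + tt n *\<^sub>R e) - G x) / tt n)" by blast
    ultimately have "integral\<^sup>L lborel (q n) = (integral\<^sup>L lborel ?f - integral\<^sup>L lborel G) / tt n"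
      using f'i Gi by simp
    also have "\<dots> = integral\<^sup>L lborel (\<lambda>x. (?f x - G x) / tt n)"
      using fi Gi by simp
    also have "\<dots> \<le> integral\<^sup>L lborel (\<lambda>x. B * indicator (E n) x)"
    proof (rule integral_mono)
      show "integrable lborel (\<lambda>x. (?f x - G x) / tt n)" using fi Gi by simp
      show "integrable lborel (\<lambda>x. B * indicator (E n) x)"
      proof (rule dom)
        show "(\<lambda>x. B * indicator (E n) x) \<in> borel_measurable borel" using Em by simp
        show "\<bar>B * indicator (E n) x\<bar> \<le> \<bar>B\<bar> * indicator (cube R) x" for x
          by (auto simp: E_def indicator_def)
      qed
      show "(?f x - G x) / tt n \<le> B * indicator (E n) x" for x
      proof (cases "x \<in> cube R \<and> x - tt n *\<^sub>R e \<notin> cube R")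
        case True
        hence xc: "x \<in> cube R" by simp
        have xi: "x $ i \<le> - R + tt n"
          using True tt[of n] axis_line_cube[OF xc, of i "- tt n"] unfolding e_def mem_cube by (smt (verit) scaleR_minus_left diff_conv_add_uminus)
        hence "B * (x $ i + R) \<le> B * tt n" using B0[OF xc] by (intro mult_left_mono) auto
        hence "- g x \<le> B * tt n" using lower[OF xc] by linarith
        thus ?thesis using True xi tt[of n] by (auto simp: E_def G_def field_simps)
      next
        case False
        have "0 \<le> B * indicator (E n) x" using B0 by (auto simp: E_def indicator_def)
        moreover have "(?f x - G x) / tt n = 0" using False by (auto simp: G_def indicator_def)
        ultimately show ?thesis by (simp only:)
      qed
    qed
    finally show ?thesis .
  qed
  have lim1: "(\<lambda>n. integral\<^sup>L lborel (q n)) \<longlonglongrightarrow> integral\<^sup>L lborel (\<lambda>x. indicator (cube R) x * pd i g x)"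
  proof (rule integral_dominated_convergence[OF _ _ ind[of B]])
    show "(\<lambda>x. indicator (cube R) x * pd i g x) \<in> borel_measurable lborel" using gb[OF g(3)] by simp
    show "q n \<in> borel_measurable lborel" for n using qm by simp
    show "AE x in lborel. norm (q n x) \<le> B * indicator (cube R) x" for n using qB by (intro AE_I2) simp
    show "AE x in lborel. (\<lambda>n. q n x) \<longlonglongrightarrow> indicator (cube R) x * pd i g x"
    proof (intro AE_I2)
      fix x
      show "(\<lambda>n. q n x) \<longlonglongrightarrow> indicator (cube R) x * pd i g x"
      proof (cases "x \<in> cube R")
        case True
        have "((\<lambda>t. (g (x + t *\<^sub>R axis i 1) - g x) / t) \<longlongrightarrow> pd i g x) (at 0)"
          using pd_line_deriv[of g x i] g(2) True by (simp add: ldiff_def has_field_derivative_iff)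
        hence 1: "(\<lambda>n. (g (x + tt n *\<^sub>R axis i 1) - g x) / tt n) \<longlonglongrightarrow> pd i g x"
          by (rule tendsto_within_seq[where y=tt]) (use tt ttl in \<open>auto simp: less_imp_neq[symmetric]\<close>)
        have "(\<lambda>n. x + tt n *\<^sub>R e) \<longlonglongrightarrow> x + 0 *\<^sub>R e" by (intro tendsto_intros ttl)
        hence "eventually (\<lambda>n. x + tt n *\<^sub>R e \<in> cube R) sequentially"
          using True topological_tendstoD[OF _ open_cube] by fastforce
        hence "eventually (\<lambda>n. (g (x + tt n *\<^sub>R axis i 1) - g x) / tt n = q n x) sequentially"
          by eventually_elim (use True in \<open>simp add: q_def G_def e_def\<close>)
        from Lim_transform_eventually[OF 1 this] True show ?thesis by simp
      qed (simp add: q_def)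
    qed
  qed
  \<comment> \<open>The layers shrink to the empty set: each point of the cube leaves them
    eventually.\<close>
  have lim2: "(\<lambda>n. integral\<^sup>L lborel (\<lambda>x. B * indicator (E n) x)) \<longlonglongrightarrow> integral\<^sup>L lborel (\<lambda>x::real^'n. 0)"
  proof (rule integral_dominated_convergence[OF _ _ ind[of "\<bar>B\<bar>"]])
    show "(\<lambda>x. B * indicator (E n) x) \<in> borel_measurable lborel" for n using Em by simp
    show "AE x in lborel. norm (B * indicator (E n) x) \<le> \<bar>B\<bar> * indicator (cube R) x" for n
      by (intro AE_I2) (auto simp: E_def indicator_def)
    show "AE x in lborel. (\<lambda>n. B * indicator (E n) x) \<longlonglongrightarrow> 0"
    proof (intro AE_I2)
      fix x
      show "(\<lambda>n. B * indicator (E n) x) \<longlonglongrightarrow> 0"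
      proof (cases "x \<in> cube R")
        case True
        hence "x $ i + R > 0" unfolding mem_cube by (smt (verit))
        hence "eventually (\<lambda>n. tt n < x $ i + R) sequentially" using ttl by (rule order_tendstoD(2)[rotated])
        hence "eventually (\<lambda>n. B * indicator (E n) x = 0) sequentially"
          by eventually_elim (auto simp: E_def)
        thus ?thesis by (rule tendsto_eventually)
      qed (simp add: E_def)
    qed
  qed simp
  have "integral\<^sup>L lborel (\<lambda>x. indicator (cube R) x * pd i g x) \<le> integral\<^sup>L lborel (\<lambda>x::real^'n. 0)"
    by (rule LIMSEQ_le[OF lim1 lim2]) (use main in blast)
  moreover have "integral\<^sup>L (lebesgue_on (cube R)) (pd i g) = integral\<^sup>L lborel (\<lambda>x. indicator (cube R) x * pd i g x)"
    using gb[OF g(3)] by (simp add: integral_restrict_space integral_completion)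
  ultimately show ?thesis by simp
qed

text \<open>The one-sided statement, applied to both \<open>g\<close> and
  \<open>- g\<close>.\<close>

lemma integral_pd_zero:
  fixes g :: "real^'n::finite \<Rightarrow> real"
  assumes g: "nice R g" "ldiff R i g" "nice R (pd i g)"
    and top: "\<And>x. x \<in> face R i R \<Longrightarrow> (g \<longlongrightarrow> 0) (at x within cube R)"
    and bot: "\<And>x. x \<in> face R i (- R) \<Longrightarrow> (g \<longlongrightarrow> 0) (at x within cube R)"
  shows "integral\<^sup>L (lebesgue_on (cube R)) (pd i g) = 0"
proof (rule antisym)
  show "integral\<^sup>L (lebesgue_on (cube R)) (pd i g) \<le> 0"
    by (rule integral_pd_nonpos[OF g top]) (use bot in auto)
  have pdm: "pd i (\<lambda>x. - g x) x = - pd i g x" if "x \<in> cube R" for x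
    using pd_line_deriv[of g x i] g(2) that DERIV_minus[of "\<lambda>t. g (x + t *\<^sub>R axis i 1)" "pd i g x" 0 UNIV]
    unfolding ldiff_def pd_def[of i "\<lambda>x. - g x"] by (intro DERIV_imp_deriv) auto
  have "integral\<^sup>L (lebesgue_on (cube R)) (pd i (\<lambda>x. - g x)) \<le> 0"
  proof (rule integral_pd_nonpos)
    show "ldiff R i (\<lambda>x. - g x)" using g(2) by (auto simp: ldiff_def)
    show "nice R (\<lambda>x. - g x)" using g by (intro nice_intros)
    have "nice R (\<lambda>x. - pd i g x)" using g by (intro nice_intros)
    thus "nice R (pd i (\<lambda>x. - g x))" using pdm by (simp add: nice_def cong: continuous_on_cong)
    show "((\<lambda>x. - g x) \<longlongrightarrow> 0) (at x within cube R)" if "x \<in> face R i R" for x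
      using tendsto_minus[OF top[OF that]] by simp
    show "\<exists>l\<ge>0. ((\<lambda>x. - g x) \<longlongrightarrow> l) (at x within cube R)" if "x \<in> face R i (- R)" for x
      using tendsto_minus[OF bot[OF that]] by auto
  qed
  moreover have "integral\<^sup>L (lebesgue_on (cube R)) (pd i (\<lambda>x. - g x)) = - integral\<^sup>L (lebesgue_on (cube R)) (pd i g)"
    unfolding integral_minus[symmetric] by (intro Bochner_Integration.integral_cong) (use pdm in auto)
  ultimately show "0 \<le> integral\<^sup>L (lebesgue_on (cube R)) (pd i g)" by simp
qed

section \<open>Boundary limits of functions with zero Dirichlet data\<close>

lemma C2_cl_tendsto_bdry:
  assumes "C2_cl R u" "\<And>x. x \<in> bdry R \<Longrightarrow> u x = 0" "x \<in> bdry R"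
  shows "(u \<longlongrightarrow> 0) (at x within cube R)"
proof -
  have "x \<in> ccube R" using assms(3) by (simp add: bdry_def)
  hence "(u \<longlongrightarrow> u x) (at x within ccube R)" using assms(1) by (simp add: C2_cl_def continuous_on_def)
  hence "(u \<longlongrightarrow> u x) (at x within cube R)" by (rule tendsto_within_subset[OF _ cube_subset_ccube])
  thus ?thesis using assms(2,3) by simp
qed

lemma face_bdry:
  assumes "R > 0" "c = R \<or> c = - R" "x \<in> face R i c" shows "x \<in> bdry R"
proof -
  have "- R \<le> x $ j \<and> x $ j \<le> R" for j
    using assms by (cases "j = i") (auto simp: face_def less_imp_le)
  moreover have "\<not> (- R < x $ i \<and> x $ i < R)" using assms by (auto simp: face_def)
  ultimately show ?thesis by (auto simp: bdry_def mem_ccube mem_cube)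
qed

text \<open>A nonzero limit of the tangential derivative would force \<open>u\<close> to change by a
  fixed amount along short segments parallel to the face and close to it; in the limit such a
  segment lies in the boundary, where \<open>u\<close> is constantly 0.\<close>

lemma C2_cl_tangential:
  fixes u :: "real^'n::finite \<Rightarrow> real"
  assumes u: "C2_cl R u" "\<And>x. x \<in> bdry R \<Longrightarrow> u x = 0" and R: "R > 0"
    and c: "c = R \<or> c = - R" and x: "x \<in> face R j c" and ij: "i \<noteq> j"
  shows "(pd i u \<longlongrightarrow> 0) (at x within cube R)"
proof -
  have xc: "x \<in> ccube R" using face_bdry[OF R c x] by (simp add: bdry_def)
  then obtain l where l: "(pd i u \<longlongrightarrow> l) (at x within cube R)" using u(1) unfolding C2_cl_def by blast
  have "l = 0"
  proof (rule ccontr)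
    assume l0: "l \<noteq> 0"
    have "\<forall>\<^sub>F y in at x within cube R. dist (pd i u y) l < \<bar>l\<bar> / 2" using l by (rule tendstoD) (use l0 in simp)
    then obtain d where d: "d > 0" "\<And>y. y \<in> cube R \<Longrightarrow> y \<noteq> x \<Longrightarrow> dist y x < d \<Longrightarrow> dist (pd i u y) l < \<bar>l\<bar> / 2"
      unfolding eventually_at by blast
    have xi: "\<bar>x $ i\<bar> < R" using x ij by (auto simp: face_def abs_less_iff dest!: spec[of _ i])
    \<comment> \<open>Half of each bound: the segment starts within \<open>s\<close> of
      \<open>x\<close> and has length \<open>s\<close>, so it stays in the ball of radius
      \<open>d\<close>, and its endpoint keeps clear of the edges of the face.\<close>
    define s where "s = min d (R - \<bar>x $ i\<bar>) / 2"
    have s: "s > 0" "s < d" "\<bar>x $ i\<bar> + s < R" "2 * s \<le> d" using d(1) xi by (auto simp: s_def min_def field_simps)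
    \<comment> \<open>Contraction towards the centre enters the open cube and does not increase the
      absolute value of coordinate \<open>i\<close>, so the shift by \<open>s\<close> remains in the
      cube.\<close>
    define y where "y n = (1 - 1 / real (n + 2)) *\<^sub>R x" for n
    have yc: "y n \<in> cube R" for n
      unfolding mem_cube
    proof
      fix m
      have "\<bar>x $ m\<bar> \<le> R" using xc by (auto simp: mem_ccube abs_le_iff minus_le_iff)
      hence "(1 - 1 / real (n + 2)) * \<bar>x $ m\<bar> \<le> (1 - 1 / real (n + 2)) * R" using seq_shrink_bounds[of n] by (intro mult_left_mono) auto
      also have "\<dots> < 1 * R" using seq_shrink_bounds[of n] R by (intro mult_strict_right_mono) auto
      finally have "\<bar>y n $ m\<bar> < R" using seq_shrink_bounds[of n] by (simp add: y_def abs_mult)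
      thus "- R < y n $ m \<and> y n $ m < R" by auto
    qed
    have ylim: "y \<longlonglongrightarrow> x"
      using tendsto_scaleR[OF seq_shrink tendsto_const, of x] unfolding y_def[abs_def] by simp
    have yi: "\<bar>y n $ i\<bar> \<le> \<bar>x $ i\<bar>" for n
      using seq_shrink_bounds[of n] by (simp add: y_def abs_mult mult_left_le_one_le del: of_nat_add)
    have ys: "y n + s *\<^sub>R axis i 1 \<in> cube R" for n
      by (rule axis_line_cube[OF yc]) (use yi[of n] s R in linarith)+
    have "\<forall>\<^sub>F n in sequentially. dist (y n) x < s" using ylim s(1) by (rule tendstoD)
    hence ev: "\<forall>\<^sub>F n in sequentially. \<bar>u (y n + s *\<^sub>R axis i 1) - u (y n)\<bar> \<ge> s * (\<bar>l\<bar> / 2)"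
    proof eventually_elim
      fix n assume n: "dist (y n) x < s"
      from ldiff_MVT[OF C2_cl_ldiff(1)[OF u(1)] yc ys s(1)] obtain t where t: "0 < t" "t < s" "y n + t *\<^sub>R axis i 1 \<in> cube R"
        "u (y n + s *\<^sub>R axis i 1) - u (y n) = s * pd i u (y n + t *\<^sub>R axis i 1)" by metis
      have "dist (y n + t *\<^sub>R axis i 1) x \<le> dist (y n) x + norm (t *\<^sub>R axis i 1 :: real^'n)"
        unfolding dist_norm by (metis add_diff_eq add.commute norm_triangle_ineq)
      also have "\<dots> < d" using n t s by simp
      finally have "dist (y n + t *\<^sub>R axis i 1) x < d" .
      moreover have "y n + t *\<^sub>R axis i 1 \<noteq> x" using t(3) face_bdry[OF R c x] by (auto simp: bdry_def)
      ultimately have "dist (pd i u (y n + t *\<^sub>R axis i 1)) l < \<bar>l\<bar> / 2" using d(2) t(3) by blast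
      hence "\<bar>pd i u (y n + t *\<^sub>R axis i 1)\<bar> \<ge> \<bar>l\<bar> / 2" unfolding dist_real_def by linarith
      thus "\<bar>u (y n + s *\<^sub>R axis i 1) - u (y n)\<bar> \<ge> s * (\<bar>l\<bar> / 2)"
        unfolding t(4) using s(1) by (simp add: abs_mult)
    qed
    have xs: "x + s *\<^sub>R axis i 1 \<in> bdry R"
    proof -
      have "- R \<le> (x + s *\<^sub>R axis i 1) $ m \<and> (x + s *\<^sub>R axis i 1) $ m \<le> R" for m
        using xc s xi by (cases "m = i") (auto simp: mem_ccube axis_def)
      moreover have "(x + s *\<^sub>R axis i 1) $ j = c" using x ij by (simp add: face_def axis_def)
      hence "x + s *\<^sub>R axis i 1 \<notin> cube R" using c by (auto simp: mem_cube intro!: exI[of _ j])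
      ultimately show ?thesis by (auto simp: bdry_def mem_ccube)
    qed
    have cc: "continuous_on (ccube R) u" using u(1) by (simp add: C2_cl_def)
    have l1: "(\<lambda>n. u (y n)) \<longlonglongrightarrow> u x"
      by (rule continuous_on_tendsto_compose[OF cc ylim xc]) (intro always_eventually allI subsetD[OF cube_subset_ccube] yc)
    have l2: "(\<lambda>n. u (y n + s *\<^sub>R axis i 1)) \<longlonglongrightarrow> u (x + s *\<^sub>R axis i 1)"
    proof (rule continuous_on_tendsto_compose[OF cc])
      show "(\<lambda>n. y n + s *\<^sub>R axis i 1) \<longlonglongrightarrow> x + s *\<^sub>R axis i 1" by (intro tendsto_intros ylim)
      show "x + s *\<^sub>R axis i 1 \<in> ccube R" using xs by (simp add: bdry_def)
    qed (intro always_eventually allI subsetD[OF cube_subset_ccube] ys)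
    have "(\<lambda>n. \<bar>u (y n + s *\<^sub>R axis i 1) - u (y n)\<bar>) \<longlonglongrightarrow> \<bar>u (x + s *\<^sub>R axis i 1) - u x\<bar>"
      by (intro tendsto_intros l1 l2)
    hence "s * (\<bar>l\<bar> / 2) \<le> \<bar>u (x + s *\<^sub>R axis i 1) - u x\<bar>"
      by (rule tendsto_lowerbound[OF _ ev]) simp
    thus False using u(2)[OF xs] u(2)[OF face_bdry[OF R c x]] s l0 by (simp add: mult_le_0_iff)
  qed
  thus ?thesis using l by simp
qed

section \<open>Weak derivatives\<close>

abbreviation cubeM :: "real \<Rightarrow> (real^'n::finite) measure" where
  "cubeM R \<equiv> lebesgue_on (cube R)"

lemma test_fun_nice:
  assumes "test_fun U \<phi>" shows "nice R (pdl is \<phi>)"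
proof -
  have "continuous_on UNIV (pdl is \<phi>)" using assms unfolding test_fun_def by blast
  thus ?thesis by (intro nice_continuous_ccube) (rule continuous_on_subset, auto)
qed

lemma smooth_nice: "smooth f \<Longrightarrow> nice R f"
  by (intro nice_continuous_ccube continuous_on_subset[OF smooth_D(3)]) auto

lemma stest_smooth: "stest U \<phi> \<Longrightarrow> smooth \<phi>"
  by (simp add: stest_def)

lemma is_wderiv_iff:
  "is_wderiv (cube R) \<alpha> u v \<longleftrightarrow> sqint (cubeM R) v \<and>
     (\<forall>\<phi>. test_fun (cube R) \<phi> \<longrightarrow> integral\<^sup>L (cubeM R) (\<lambda>x. u x * pdl (mi_list \<alpha>) \<phi> x)
        = (-1) ^ (sum \<alpha> UNIV) * integral\<^sup>L (cubeM R) (\<lambda>x. v x * \<phi> x))"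
  unfolding is_wderiv_def by (simp add: L2_iff set_integral_eq)

lemma sobolev_sqint: "u \<in> sobolev (cube R) p \<Longrightarrow> sqint (cubeM R) u"
  by (simp add: sobolev_def L2_iff)

lemma wd_is_wderiv:
  assumes "u \<in> sobolev (cube R) p" "\<alpha> \<in> multi_idx p"
  shows "is_wderiv (cube R) \<alpha> u (wd (cube R) \<alpha> u)"
  using assms unfolding sobolev_def wd_def by (metis (mono_tags, lifting) mem_Collect_eq someI_ex)

lemma wd_sqint:
  "u \<in> sobolev (cube R) p \<Longrightarrow> \<alpha> \<in> multi_idx p \<Longrightarrow> sqint (cubeM R) (wd (cube R) \<alpha> u)"
  using wd_is_wderiv is_wderiv_iff by blast

lemma sqint_eq_AE:
  assumes "sqint (cubeM R) v" "sqint (cubeM R) w"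
    "\<And>\<phi>. stest (cube R) \<phi> \<Longrightarrow> integral\<^sup>L (cubeM R) (\<lambda>x. v x * \<phi> x) = integral\<^sup>L (cubeM R) (\<lambda>x. w x * \<phi> x)"
  shows "AE x in cubeM R. v x = w x"
proof -
  have "AE x in cubeM R. v x - w x = 0"
  proof (rule fundamental_lemma)
    show "integrable (cubeM R) (\<lambda>x. v x - w x)"
      by (intro finite_measure.sqint_integrable[OF finite_measure_cube] sqint_diff assms)
    fix \<phi> :: "real^'a \<Rightarrow> real" assume p: "stest (cube R) \<phi>"
    have "sqint (cubeM R) \<phi>" by (intro nice_sqint smooth_nice stest_smooth[OF p])
    thus "integral\<^sup>L (cubeM R) (\<lambda>x. (v x - w x) * \<phi> x) = 0"
      using assms(3)[OF p] sqint_mult[OF assms(1)] sqint_mult[OF assms(2)] by (simp add: left_diff_distrib)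
  qed
  thus ?thesis by eventually_elim simp
qed

lemma is_wderiv_unique:
  assumes "is_wderiv (cube R) \<alpha> u v" "is_wderiv (cube R) \<alpha> u w"
  shows "AE x in cubeM R. v x = w x"
proof (rule sqint_eq_AE)
  show "sqint (cubeM R) v" "sqint (cubeM R) w" using assms by (auto simp: is_wderiv_iff)
  fix \<phi> :: "real^'a \<Rightarrow> real" assume "stest (cube R) \<phi>"
  hence "test_fun (cube R) \<phi>" by (rule stest_imp_test_fun)
  hence "(-1) ^ (sum \<alpha> UNIV) * integral\<^sup>L (cubeM R) (\<lambda>x. v x * \<phi> x) =
      (-1) ^ (sum \<alpha> UNIV) * integral\<^sup>L (cubeM R) (\<lambda>x. w x * \<phi> x)"
    using assms unfolding is_wderiv_iff by (auto dest!: spec[of _ \<phi>])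
  thus "integral\<^sup>L (cubeM R) (\<lambda>x. v x * \<phi> x) = integral\<^sup>L (cubeM R) (\<lambda>x. w x * \<phi> x)" by simp
qed

lemma is_wderiv_lincomb:
  assumes "is_wderiv (cube R) \<alpha> u v" "is_wderiv (cube R) \<alpha> u' v'" "sqint (cubeM R) u" "sqint (cubeM R) u'"
  shows "is_wderiv (cube R) \<alpha> (\<lambda>x. a * u x + b * u' x) (\<lambda>x. a * v x + b * v' x)"
  unfolding is_wderiv_iff
proof (intro conjI allI impI)
  have v: "sqint (cubeM R) v" "sqint (cubeM R) v'" using assms by (auto simp: is_wderiv_iff)
  thus "sqint (cubeM R) (\<lambda>x. a * v x + b * v' x)" by (intro sqint_add sqint_cmult)
  fix \<phi> :: "real^'a \<Rightarrow> real" assume t: "test_fun (cube R) \<phi>"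
  have p: "sqint (cubeM R) (pdl is \<phi>)" for "is" by (intro nice_sqint test_fun_nice[OF t])
  have i: "integrable (cubeM R) (\<lambda>x. u x * pdl (mi_list \<alpha>) \<phi> x)" "integrable (cubeM R) (\<lambda>x. u' x * pdl (mi_list \<alpha>) \<phi> x)"
    "integrable (cubeM R) (\<lambda>x. v x * \<phi> x)" "integrable (cubeM R) (\<lambda>x. v' x * \<phi> x)"
    using p[of "[]"] by (auto intro!: sqint_mult p assms v)
  have lin: "integral\<^sup>L (cubeM R) (\<lambda>x. (a * f x + b * g x) * q x)
      = a * integral\<^sup>L (cubeM R) (\<lambda>x. f x * q x) + b * integral\<^sup>L (cubeM R) (\<lambda>x. g x * q x)"
    if "integrable (cubeM R) (\<lambda>x. f x * q x)" "integrable (cubeM R) (\<lambda>x. g x * q x)" for f g q :: "real^'a \<Rightarrow> real"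
    using that by (simp add: distrib_right mult.assoc)
  show "integral\<^sup>L (cubeM R) (\<lambda>x. (a * u x + b * u' x) * pdl (mi_list \<alpha>) \<phi> x)
        = (-1) ^ (sum \<alpha> UNIV) * integral\<^sup>L (cubeM R) (\<lambda>x. (a * v x + b * v' x) * \<phi> x)"
    unfolding lin[OF i(1,2)] lin[OF i(3,4)] using assms(1,2) t by (simp add: is_wderiv_iff distrib_left mult.left_commute)
qed

lemma sobolev_lincomb:
  assumes "u \<in> sobolev (cube R) p" "v \<in> sobolev (cube R) p"
  shows "(\<lambda>x. a * u x + b * v x) \<in> sobolev (cube R) p"
proof -
  have "sqint (cubeM R) (\<lambda>x. a * u x + b * v x)"
    using assms by (intro sqint_add sqint_cmult sobolev_sqint)
  moreover have "\<exists>w. is_wderiv (cube R) \<alpha> (\<lambda>x. a * u x + b * v x) w" if "\<alpha> \<in> multi_idx p" for \<alpha>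
    using is_wderiv_lincomb[OF wd_is_wderiv[OF assms(1) that] wd_is_wderiv[OF assms(2) that]
       sobolev_sqint[OF assms(1)] sobolev_sqint[OF assms(2)]] by blast
  ultimately show ?thesis unfolding sobolev_def by (simp add: L2_iff)
qed

lemma wd_lincomb:
  assumes "u \<in> sobolev (cube R) p" "v \<in> sobolev (cube R) p" "\<alpha> \<in> multi_idx p"
  shows "AE x in cubeM R. wd (cube R) \<alpha> (\<lambda>x. a * u x + b * v x) x = a * wd (cube R) \<alpha> u x + b * wd (cube R) \<alpha> v x"
  by (rule is_wderiv_unique[OF wd_is_wderiv[OF sobolev_lincomb[OF assms(1,2)] assms(3)]
       is_wderiv_lincomb[OF wd_is_wderiv[OF assms(1,3)] wd_is_wderiv[OF assms(2,3)]
       sobolev_sqint[OF assms(1)] sobolev_sqint[OF assms(2)]]])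

lemma finite_multi_idx [simp]: "finite (multi_idx p :: ('n::finite \<Rightarrow> nat) set)"
proof (rule finite_subset)
  show "multi_idx p \<subseteq> {\<alpha> :: 'n \<Rightarrow> nat. (\<forall>x. (x \<in> UNIV \<longrightarrow> \<alpha> x \<in> {..p}) \<and> (x \<notin> UNIV \<longrightarrow> \<alpha> x = 0))}"
  proof -
    have "\<alpha> x \<le> sum \<alpha> UNIV" for \<alpha> :: "'n \<Rightarrow> nat" and x by (rule member_le_sum) auto
    thus ?thesis unfolding multi_idx_def by (auto intro: order_trans)
  qed
  show "finite {\<alpha> :: 'n \<Rightarrow> nat. (\<forall>x. (x \<in> UNIV \<longrightarrow> \<alpha> x \<in> {..p}) \<and> (x \<notin> UNIV \<longrightarrow> \<alpha> x = 0))}"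
    by (rule finite_set_of_finite_funs) auto
qed

section \<open>The inner product of H^p\<close>

lemma sob_inner_eq: "sob_inner (cube R) p u v = (\<Sum>\<alpha>\<in>multi_idx p. integral\<^sup>L (cubeM R) (\<lambda>x. wd (cube R) \<alpha> u x * wd (cube R) \<alpha> v x))"
  unfolding sob_inner_def by (simp add: set_integral_eq)

lemma sob_inner_commute: "sob_inner U p u v = sob_inner U p v u"
  unfolding sob_inner_def by (simp add: mult.commute)

text \<open>\<open>wd\<close> picks some representative of each weak derivative and is therefore
  linear only almost everywhere; integrals do not see the difference.\<close>

lemma sob_inner_lincomb:
  assumes "u \<in> sobolev (cube R) p" "v \<in> sobolev (cube R) p" "w \<in> sobolev (cube R) p"
  shows "sob_inner (cube R) p (\<lambda>x. a * u x + b * v x) w = a * sob_inner (cube R) p u w + b * sob_inner (cube R) p v w"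
proof -
  have "integral\<^sup>L (cubeM R) (\<lambda>x. wd (cube R) \<alpha> (\<lambda>x. a * u x + b * v x) x * wd (cube R) \<alpha> w x)
    = a * integral\<^sup>L (cubeM R) (\<lambda>x. wd (cube R) \<alpha> u x * wd (cube R) \<alpha> w x)
    + b * integral\<^sup>L (cubeM R) (\<lambda>x. wd (cube R) \<alpha> v x * wd (cube R) \<alpha> w x)" if al: "\<alpha> \<in> multi_idx p" for \<alpha>
  proof -
    have s: "sqint (cubeM R) (wd (cube R) \<alpha> u)" "sqint (cubeM R) (wd (cube R) \<alpha> v)" "sqint (cubeM R) (wd (cube R) \<alpha> w)"
      "sqint (cubeM R) (wd (cube R) \<alpha> (\<lambda>x. a * u x + b * v x))"
      by (intro wd_sqint[OF _ al] assms sobolev_lincomb)+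
    have "integral\<^sup>L (cubeM R) (\<lambda>x. wd (cube R) \<alpha> (\<lambda>x. a * u x + b * v x) x * wd (cube R) \<alpha> w x)
      = integral\<^sup>L (cubeM R) (\<lambda>x. a * (wd (cube R) \<alpha> u x * wd (cube R) \<alpha> w x) + b * (wd (cube R) \<alpha> v x * wd (cube R) \<alpha> w x))"
    proof (rule integral_cong_AE)
      show "AE x in cubeM R. wd (cube R) \<alpha> (\<lambda>x. a * u x + b * v x) x * wd (cube R) \<alpha> w x =
          a * (wd (cube R) \<alpha> u x * wd (cube R) \<alpha> w x) + b * (wd (cube R) \<alpha> v x * wd (cube R) \<alpha> w x)"
        using wd_lincomb[OF assms(1,2) al, of a b] by eventually_elim (simp add: algebra_simps)
    qed (use s[THEN sqint_measurable] in \<open>auto\<close>)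
    also have "\<dots> = a * integral\<^sup>L (cubeM R) (\<lambda>x. wd (cube R) \<alpha> u x * wd (cube R) \<alpha> w x)
    + b * integral\<^sup>L (cubeM R) (\<lambda>x. wd (cube R) \<alpha> v x * wd (cube R) \<alpha> w x)"
      using sqint_mult[OF s(1,3)] sqint_mult[OF s(2,3)] by simp
    finally show ?thesis .
  qed
  thus ?thesis by (simp add: sob_inner_eq sum.distrib sum_distrib_left)
qed

lemma sob_inner_self_nonneg: "0 \<le> sob_inner (cube R) p u u"
  unfolding sob_inner_eq by (intro sum_nonneg integral_nonneg_AE AE_I2) simp

lemma sob_norm_sq: "(sob_norm (cube R) p u)\<^sup>2 = sob_inner (cube R) p u u"
  unfolding sob_norm_def by (simp add: sob_inner_self_nonneg)

lemma sob_norm_nonneg: "0 \<le> sob_norm (cube R) p u"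
  unfolding sob_norm_def by (simp add: sob_inner_self_nonneg)

lemma sob_norm_lincomb_sq:
  assumes "u \<in> sobolev (cube R) p" "v \<in> sobolev (cube R) p"
  shows "(sob_norm (cube R) p (\<lambda>x. a * u x + b * v x))\<^sup>2 = a\<^sup>2 * (sob_norm (cube R) p u)\<^sup>2
     + 2 * a * b * sob_inner (cube R) p u v + b\<^sup>2 * (sob_norm (cube R) p v)\<^sup>2"
proof -
  note l = sob_inner_lincomb[OF assms]
  have "sob_inner (cube R) p (\<lambda>x. a * u x + b * v x) (\<lambda>x. a * u x + b * v x)
     = a * sob_inner (cube R) p (\<lambda>x. a * u x + b * v x) u + b * sob_inner (cube R) p (\<lambda>x. a * u x + b * v x) v"
    using l[OF sobolev_lincomb[OF assms], of a b a b] by (simp add: sob_inner_commute)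
  also have "\<dots> = a * (a * sob_inner (cube R) p u u + b * sob_inner (cube R) p v u)
       + b * (a * sob_inner (cube R) p u v + b * sob_inner (cube R) p v v)"
    by (simp only: l[OF assms(1)] l[OF assms(2)])
  finally show ?thesis
    unfolding sob_norm_sq by (simp add: algebra_simps power2_eq_square sob_inner_commute[of _ p v u])
qed

lemma sob_Cauchy_Schwarz:
  assumes "u \<in> sobolev (cube R) p" "v \<in> sobolev (cube R) p"
  shows "\<bar>sob_inner (cube R) p u v\<bar> \<le> sob_norm (cube R) p u * sob_norm (cube R) p v"
proof -
  have "(sob_inner (cube R) p u v)\<^sup>2 \<le> (sob_norm (cube R) p u)\<^sup>2 * (sob_norm (cube R) p v)\<^sup>2"
  proof (rule discriminant_le)
    fix t
    show "0 \<le> (sob_norm (cube R) p u)\<^sup>2 + 2 * t * sob_inner (cube R) p u v + t\<^sup>2 * (sob_norm (cube R) p v)\<^sup>2"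
      using sob_norm_lincomb_sq[OF assms, of 1 t] zero_le_power2[of "sob_norm (cube R) p (\<lambda>x. 1 * u x + t * v x)"]
      by (simp only: power_one mult_1 mult_1_right)
  qed simp
  hence "sqrt ((sob_inner (cube R) p u v)\<^sup>2) \<le> sqrt ((sob_norm (cube R) p u * sob_norm (cube R) p v)\<^sup>2)"
    by (simp add: power_mult_distrib del: real_sqrt_abs)
  thus ?thesis using sob_norm_nonneg[of R p u] sob_norm_nonneg[of R p v] by simp
qed

definition mi_inc :: "'n \<Rightarrow> ('n \<Rightarrow> nat) \<Rightarrow> 'n \<Rightarrow> nat" where
  "mi_inc i \<alpha> = \<alpha>(i := Suc (\<alpha> i))"

lemma sum_mi_inc: "sum (mi_inc i \<alpha>) UNIV = Suc (sum \<alpha> (UNIV :: 'n::finite set))"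
proof -
  have "sum (mi_inc i \<alpha>) UNIV = (\<Sum>j\<in>UNIV. \<alpha> j + (if j = i then 1 else 0))"
    by (intro sum.cong) (auto simp: mi_inc_def)
  thus ?thesis by (simp add: sum.distrib)
qed

text \<open>A family of functions indexed by multi-indices behaves like the derivatives of a single
  function as soon as consecutive members are linked by integration by parts.\<close>

definition wchain :: "real \<Rightarrow> nat \<Rightarrow> (('n::finite \<Rightarrow> nat) \<Rightarrow> real^'n \<Rightarrow> real) \<Rightarrow> bool" where
  "wchain R p V \<longleftrightarrow> (\<forall>\<alpha>\<in>multi_idx p. sqint (cubeM R) (V \<alpha>)) \<and>
     (\<forall>\<alpha> i \<phi>. sum \<alpha> UNIV < p \<longrightarrow> stest (cube R) \<phi> \<longrightarrow>
        integral\<^sup>L (cubeM R) (\<lambda>x. V \<alpha> x * pd i \<phi> x) = - integral\<^sup>L (cubeM R) (\<lambda>x. V (mi_inc i \<alpha>) x * \<phi> x))"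

text \<open>Testing the derivative of index \<open>\<alpha>\<close> with \<open>pd i \<phi>\<close>
  and that of index \<open>mi_inc i \<alpha>\<close> with \<open>\<phi>\<close> puts the same
  iterated derivative of \<open>\<phi>\<close> on \<open>u\<close>, up to the order of
  differentiation; the signs differ by one factor -1.\<close>

lemma wchain_wd:
  assumes u: "u \<in> sobolev (cube R) p"
  shows "wchain R p (\<lambda>\<alpha>. wd (cube R) \<alpha> u)"
  unfolding wchain_def
proof (intro conjI ballI allI impI wd_sqint[OF u])
  fix \<alpha> :: "'a \<Rightarrow> nat" and i and \<phi> :: "real^'a \<Rightarrow> real"
  assume al: "sum \<alpha> UNIV < p" and p: "stest (cube R) \<phi>"
  have t: "test_fun (cube R) \<phi>" "test_fun (cube R) (pd i \<phi>)"
    using p by (auto intro: stest_imp_test_fun stest_pd)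
  have m: "\<alpha> \<in> multi_idx p" "mi_inc i \<alpha> \<in> multi_idx p" using al by (auto simp: multi_idx_def sum_mi_inc)
  have "pdl (mi_list (mi_inc i \<alpha>)) \<phi> = pdl (mi_list \<alpha> @ [i]) \<phi>"
    by (rule pdl_perm[OF stest_smooth[OF p]]) (simp add: mi_list_count mi_inc_def)
  hence eq: "pdl (mi_list (mi_inc i \<alpha>)) \<phi> = pdl (mi_list \<alpha>) (pd i \<phi>)" by (simp add: pdl_append)
  have "(-1) ^ (sum \<alpha> UNIV) * integral\<^sup>L (cubeM R) (\<lambda>x. wd (cube R) \<alpha> u x * pd i \<phi> x)
     = integral\<^sup>L (cubeM R) (\<lambda>x. u x * pdl (mi_list (mi_inc i \<alpha>)) \<phi> x)"
    using wd_is_wderiv[OF u m(1)] t(2) by (simp add: is_wderiv_iff eq)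
  also have "\<dots> = - ((-1) ^ (sum \<alpha> UNIV) * integral\<^sup>L (cubeM R) (\<lambda>x. wd (cube R) (mi_inc i \<alpha>) u x * \<phi> x))"
    using wd_is_wderiv[OF u m(2)] t(1) by (simp add: is_wderiv_iff sum_mi_inc)
  finally have "(-1) ^ (sum \<alpha> UNIV) * integral\<^sup>L (cubeM R) (\<lambda>x. wd (cube R) \<alpha> u x * pd i \<phi> x)
     = (-1) ^ (sum \<alpha> UNIV) * (- integral\<^sup>L (cubeM R) (\<lambda>x. wd (cube R) (mi_inc i \<alpha>) u x * \<phi> x))" by simp
  thus "integral\<^sup>L (cubeM R) (\<lambda>x. wd (cube R) \<alpha> u x * pd i \<phi> x)
     = - integral\<^sup>L (cubeM R) (\<lambda>x. wd (cube R) (mi_inc i \<alpha>) u x * \<phi> x)"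
    by (subst (asm) mult_cancel_left) simp
qed

section \<open>Weak and classical derivatives agree\<close>

lemma pd_mult_line:
  assumes "(\<lambda>t. f (x + t *\<^sub>R axis i 1)) differentiable (at 0)" "(\<lambda>t. g (x + t *\<^sub>R axis i 1)) differentiable (at 0)"
  shows "pd i (\<lambda>x. f x * g x) x = pd i f x * g x + f x * pd i g x"
  unfolding pd_def[of i "\<lambda>x. f x * g x"]
  using DERIV_mult[OF pd_line_deriv[OF assms(1)] pd_line_deriv[OF assms(2)]]
  by (intro DERIV_imp_deriv) (simp add: mult.commute add.commute)

lemma ldiff_mult: "ldiff R i f \<Longrightarrow> ldiff R i g \<Longrightarrow> ldiff R i (\<lambda>x. f x * g x)"
  by (simp add: ldiff_def)

lemma smooth_ldiff: "smooth f \<Longrightarrow> ldiff R i f"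
  unfolding ldiff_def using differentiable_line smooth_D(1) by blast

lemma nice_cong: "(\<And>x. x \<in> cube R \<Longrightarrow> f x = g x) \<Longrightarrow> nice R f \<longleftrightarrow> nice R g"
  by (simp add: nice_def cong: continuous_on_cong)

text \<open>The product with a compactly supported function vanishes near the boundary, which meets
  the boundary conditions of \<open>integral_pd_zero\<close> whatever \<open>f\<close> does
  there.\<close>

lemma integration_by_parts_stest:
  assumes f: "nice R f" "ldiff R i f" "nice R (pd i f)" and p: "stest (cube R) \<phi>"
  shows "integral\<^sup>L (cubeM R) (\<lambda>x. f x * pd i \<phi> x) = - integral\<^sup>L (cubeM R) (\<lambda>x. pd i f x * \<phi> x)"
proof -
  have s: "smooth \<phi>" "smooth (pd i \<phi>)" using p stest_smooth smooth_D(2) by blast+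
  note n = smooth_nice[OF s(1), of R] smooth_nice[OF s(2), of R]
  have eq: "pd i (\<lambda>x. f x * \<phi> x) x = pd i f x * \<phi> x + f x * pd i \<phi> x" if "x \<in> cube R" for x
    using f(2) smooth_ldiff[OF s(1), of R i] that by (intro pd_mult_line) (auto simp: ldiff_def)
  have n': "nice R (\<lambda>x. pd i f x * \<phi> x)" "nice R (\<lambda>x. f x * pd i \<phi> x)" by (intro nice_intros f n)+
  obtain K where K: "compact K" "K \<subseteq> cube R" "\<And>x. x \<notin> K \<Longrightarrow> \<phi> x = 0" using p by (auto simp: stest_def)
  have lim: "((\<lambda>x. f x * \<phi> x) \<longlongrightarrow> 0) (at x within cube R)" if "x \<notin> cube R" for x
  proof (rule tendsto_eventually)
    have "open (- K)" "x \<in> - K" using K that by (auto simp: compact_imp_closed open_Compl)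
    hence "eventually (\<lambda>y. y \<in> - K) (at x within cube R)"
      using eventually_at_topological by blast
    thus "\<forall>\<^sub>F x in at x within cube R. f x * \<phi> x = 0" by eventually_elim (simp add: K(3))
  qed
  have "integral\<^sup>L (cubeM R) (pd i (\<lambda>x. f x * \<phi> x)) = 0"
  proof (rule integral_pd_zero)
    show "nice R (\<lambda>x. f x * \<phi> x)" by (intro nice_intros f n)
    show "ldiff R i (\<lambda>x. f x * \<phi> x)" by (intro ldiff_mult f smooth_ldiff s)
    show "nice R (pd i (\<lambda>x. f x * \<phi> x))"
      using nice_add[OF n'] eq by (subst nice_cong) auto
    fix x :: "real^'a" assume "x \<in> face R i R"
    thus "((\<lambda>x. f x * \<phi> x) \<longlongrightarrow> 0) (at x within cube R)" by (intro lim) (auto simp: face_def mem_cube)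
  next
    fix x :: "real^'a" assume "x \<in> face R i (- R)"
    hence "\<not> - R < x $ i" by (simp add: face_def)
    thus "((\<lambda>x. f x * \<phi> x) \<longlongrightarrow> 0) (at x within cube R)" by (intro lim) (auto simp: mem_cube)
  qed
  also have "integral\<^sup>L (cubeM R) (pd i (\<lambda>x. f x * \<phi> x)) = integral\<^sup>L (cubeM R) (\<lambda>x. pd i f x * \<phi> x + f x * pd i \<phi> x)"
    by (intro Bochner_Integration.integral_cong) (use eq in auto)
  also have "\<dots> = integral\<^sup>L (cubeM R) (\<lambda>x. pd i f x * \<phi> x) + integral\<^sup>L (cubeM R) (\<lambda>x. f x * pd i \<phi> x)"
    by (intro Bochner_Integration.integral_add nice_integrable n')
  finally show ?thesis by simp
qed

text \<open>One step of identifying weak with classical derivatives. Starting from order 0 it is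
  applied twice, so a \<open>C2_cl\<close> function in the Sobolev space has its classical first and
  second derivatives as weak ones.\<close>

lemma wchain_pd_AE:
  assumes V: "wchain R p V" and f: "nice R f" "ldiff R i f" "nice R (pd i f)"
    and al: "sum \<alpha> UNIV < p" and ae: "AE x in cubeM R. V \<alpha> x = f x"
  shows "AE x in cubeM R. V (mi_inc i \<alpha>) x = pd i f x"
proof (rule sqint_eq_AE)
  have m: "\<alpha> \<in> multi_idx p" "mi_inc i \<alpha> \<in> multi_idx p" using al by (auto simp: multi_idx_def sum_mi_inc)
  show "sqint (cubeM R) (V (mi_inc i \<alpha>))" using V m by (auto simp: wchain_def)
  show "sqint (cubeM R) (pd i f)" by (intro nice_sqint f)
  fix \<phi> :: "real^'a \<Rightarrow> real" assume p: "stest (cube R) \<phi>"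
  have s: "smooth (pd i \<phi>)" using p stest_smooth smooth_D(2) by blast
  have "integral\<^sup>L (cubeM R) (\<lambda>x. V \<alpha> x * pd i \<phi> x) = integral\<^sup>L (cubeM R) (\<lambda>x. f x * pd i \<phi> x)"
  proof (rule integral_cong_AE)
    show "AE x in cubeM R. V \<alpha> x * pd i \<phi> x = f x * pd i \<phi> x" using ae by eventually_elim simp
    have "V \<alpha> \<in> borel_measurable (cubeM R)" using V m sqint_measurable by (auto simp: wchain_def)
    thus "(\<lambda>x. V \<alpha> x * pd i \<phi> x) \<in> borel_measurable (cubeM R)"
      using nice_measurable[OF smooth_nice[OF s]] by (intro borel_measurable_times)
    show "(\<lambda>x. f x * pd i \<phi> x) \<in> borel_measurable (cubeM R)"
      by (intro nice_measurable nice_mult f smooth_nice s)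
  qed
  thus "integral\<^sup>L (cubeM R) (\<lambda>x. V (mi_inc i \<alpha>) x * \<phi> x) = integral\<^sup>L (cubeM R) (\<lambda>x. pd i f x * \<phi> x)"
    using V al p integration_by_parts_stest[OF f p] unfolding wchain_def by simp
qed

lemma wd_0_AE:
  assumes "u \<in> sobolev (cube R) p"
  shows "AE x in cubeM R. wd (cube R) (\<lambda>_. 0) u x = u x"
proof (rule is_wderiv_unique[OF wd_is_wderiv[OF assms]])
  show "(\<lambda>_. 0) \<in> multi_idx p" by (simp add: multi_idx_def)
  have "length (mi_list (\<lambda>_::'a. 0)) = 0" by (simp add: mi_list_length)
  thus "is_wderiv (cube R) (\<lambda>_. 0) u u"
    using sobolev_sqint[OF assms] by (simp add: is_wderiv_iff)
qed

lemma wd_1_AE: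
  assumes "u \<in> sobolev (cube R) p" "C2_cl R u" "p \<ge> 1"
  shows "AE x in cubeM R. wd (cube R) (mi_inc i (\<lambda>_. 0)) u x = pd i u x"
  by (rule wchain_pd_AE[OF wchain_wd[OF assms(1)] _ _ _ _ wd_0_AE[OF assms(1)]])
     (use assms C2_cl_nice C2_cl_ldiff in auto)

lemma wd_2_AE:
  assumes "u \<in> sobolev (cube R) p" "C2_cl R u" "p \<ge> 2"
  shows "AE x in cubeM R. wd (cube R) (mi_inc j (mi_inc i (\<lambda>_. 0))) u x = pd j (pd i u) x"
  by (rule wchain_pd_AE[OF wchain_wd[OF assms(1)] _ _ _ _ wd_1_AE[OF assms(1,2)]])
     (use assms C2_cl_nice C2_cl_ldiff in \<open>auto simp: sum_mi_inc\<close>)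

section \<open>Sobolev embedding\<close>

text \<open>The difference quotients of \<open>f\<close> are bounded by \<open>B\<close> through the
  mean value theorem, so \<open>\<bar>w z\<bar> * B\<close> dominates the integrands; this suits a
  \<open>w\<close> that is merely integrable.\<close>

lemma deriv_under_integral:
  fixes f f' :: "real \<Rightarrow> 'a \<Rightarrow> real"
  assumes w: "integrable M w" and t: "t \<in> {a<..<b}"
    and fm: "\<And>s. s \<in> {a<..<b} \<Longrightarrow> f s \<in> borel_measurable M" and f'm: "f' t \<in> borel_measurable M"
    and D: "\<And>s z. s \<in> {a<..<b} \<Longrightarrow> ((\<lambda>s. f s z) has_real_derivative f' s z) (at s)"
    and B: "\<And>s z. s \<in> {a<..<b} \<Longrightarrow> \<bar>f' s z\<bar> \<le> B" "\<And>s z. s \<in> {a<..<b} \<Longrightarrow> \<bar>f s z\<bar> \<le> B'"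
  shows "((\<lambda>s. integral\<^sup>L M (\<lambda>z. w z * f s z)) has_real_derivative integral\<^sup>L M (\<lambda>z. w z * f' t z)) (at t)"
  unfolding DERIV_def tendsto_at_iff_sequentially
proof (intro allI impI)
  fix X :: "nat \<Rightarrow> real" assume X: "\<forall>i. X i \<in> UNIV - {0}" "X \<longlonglongrightarrow> 0"
  let ?Q = "\<lambda>n. (integral\<^sup>L M (\<lambda>z. w z * f (t + X n) z) - integral\<^sup>L M (\<lambda>z. w z * f t z)) / X n"
  have "(\<lambda>n. t + X n) \<longlonglongrightarrow> t + 0" by (intro tendsto_intros X)
  hence "eventually (\<lambda>n. t + X n \<in> {a<..<b}) sequentially"
    using t by (intro topological_tendstoD) auto
  then obtain N where N: "\<And>n. n \<ge> N \<Longrightarrow> t + X n \<in> {a<..<b}" by (auto simp: eventually_sequentially)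
  have wm: "w \<in> borel_measurable M" using w by simp
  have wf: "integrable M (\<lambda>z. w z * f s z)" if "s \<in> {a<..<b}" for s
  proof (rule Bochner_Integration.integrable_bound[of M "\<lambda>z. B' * w z"])
    show "AE z in M. norm (w z * f s z) \<le> norm (B' * w z)"
    proof (rule AE_I2)
      fix z
      have "\<bar>w z\<bar> * \<bar>f s z\<bar> \<le> \<bar>w z\<bar> * \<bar>B'\<bar>" using B(2)[OF that, of z] by (intro mult_left_mono) auto
      thus "norm (w z * f s z) \<le> norm (B' * w z)" by (simp add: abs_mult mult.commute)
    qed
  qed (use w fm[OF that] wm in auto)
  have quot: "\<bar>(f (t + h) z - f t z) / h\<bar> \<le> B" if "t + h \<in> {a<..<b}" "h \<noteq> 0" for h z
  proof -
    have "norm (f (t + h) z - f t z) \<le> B * norm (t + h - t)"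
      by (rule field_differentiable_bound[of "{a<..<b}" "\<lambda>s. f s z" "\<lambda>s. f' s z"])
         (use that t B(1) D in \<open>auto intro: has_field_derivative_at_within\<close>)
    thus ?thesis using that(2) by (simp add: field_simps)
  qed
  have "(\<lambda>n. ?Q (n + N)) \<longlonglongrightarrow> integral\<^sup>L M (\<lambda>z. w z * f' t z)"
  proof -
    have "?Q (n + N) = integral\<^sup>L M (\<lambda>z. w z * ((f (t + X (n + N)) z - f t z) / X (n + N)))" for n
    proof -
      have "?Q (n + N) = integral\<^sup>L M (\<lambda>z. w z * f (t + X (n + N)) z - w z * f t z) / X (n + N)"
        using wf[OF N] wf[OF t] by simp
      also have "\<dots> = integral\<^sup>L M (\<lambda>z. (w z * f (t + X (n + N)) z - w z * f t z) / X (n + N))" by simp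
      finally show ?thesis by (simp add: right_diff_distrib)
    qed
    moreover have "(\<lambda>n. integral\<^sup>L M (\<lambda>z. w z * ((f (t + X (n + N)) z - f t z) / X (n + N)))) \<longlonglongrightarrow> integral\<^sup>L M (\<lambda>z. w z * f' t z)"
    proof (rule integral_dominated_convergence[where w="\<lambda>z. \<bar>w z\<bar> * B"])
      show "(\<lambda>z. w z * f' t z) \<in> borel_measurable M" using wm f'm by simp
      show "integrable M (\<lambda>z. \<bar>w z\<bar> * B)" using w by simp
      show "(\<lambda>z. w z * ((f (t + X (n + N)) z - f t z) / X (n + N))) \<in> borel_measurable M" for n
        using wm fm[OF t] fm[OF N[of "n + N"]] by simp
      show "AE z in M. (\<lambda>n. w z * ((f (t + X (n + N)) z - f t z) / X (n + N))) \<longlonglongrightarrow> w z * f' t z"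
      proof (intro AE_I2 tendsto_mult tendsto_const)
        fix z
        have "((\<lambda>h. (f (t + h) z - f t z) / h) \<longlongrightarrow> f' t z) (at 0)"
          using D[OF t] by (simp add: DERIV_def)
        thus "(\<lambda>n. (f (t + X (n + N)) z - f t z) / X (n + N)) \<longlonglongrightarrow> f' t z"
          by (rule tendsto_within_seq) (use X in \<open>auto intro: LIMSEQ_ignore_initial_segment\<close>)
      qed
      show "AE z in M. norm (w z * ((f (t + X (n + N)) z - f t z) / X (n + N))) \<le> \<bar>w z\<bar> * B" for n
        unfolding real_norm_def abs_mult
        by (intro AE_I2 mult_left_mono quot N) (use X in auto)
    qed
    ultimately show ?thesis by presburger
  qed
  hence "?Q \<longlonglongrightarrow> integral\<^sup>L M (\<lambda>z. w z * f' t z)" by (rule LIMSEQ_offset)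
  thus "((\<lambda>h. (integral\<^sup>L M (\<lambda>z. w z * f (t + h) z) - integral\<^sup>L M (\<lambda>z. w z * f t z)) / h) \<circ> X) \<longlonglongrightarrow> integral\<^sup>L M (\<lambda>z. w z * f' t z)"
    by (simp add: o_def)
qed

lemma stest_bounded:
  assumes "stest U \<phi>" obtains S where "S \<ge> 0" "\<And>x. \<bar>\<phi> x\<bar> \<le> S"
proof -
  obtain K where K: "compact K" "\<And>x. x \<notin> K \<Longrightarrow> \<phi> x = 0" using assms by (auto simp: stest_def)
  have "bounded (\<phi> ` K)"
    by (intro compact_imp_bounded compact_continuous_image K continuous_on_subset[OF smooth_D(3)])
       (use assms stest_smooth in auto)
  then obtain S where "\<And>x. x \<in> K \<Longrightarrow> \<bar>\<phi> x\<bar> \<le> S" by (auto simp: bounded_iff)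
  hence "\<bar>\<phi> x\<bar> \<le> max S 0" for x using K(2)[of x] by (cases "x \<in> K") (auto simp: le_max_iff_disj)
  thus ?thesis using that[of "max S 0"] by auto
qed

text \<open>The test function \<open>\<psi>\<close> contracted towards \<open>x\<close> by the factor \<open>1 / \<sigma>\<close> with its mass preserved,
  and its moment in direction \<open>i\<close>, which appears in the derivative with respect to \<open>\<sigma>\<close>. Convexity of
  the cube keeps the support inside it for \<open>\<sigma> \<ge> 1\<close>.\<close>

definition kern :: "(real^'n::finite \<Rightarrow> real) \<Rightarrow> real^'n \<Rightarrow> real \<Rightarrow> real^'n \<Rightarrow> real" where
  "kern \<psi> x \<sigma> z = \<sigma> ^ CARD('n) * \<psi> (x + \<sigma> *\<^sub>R (z - x))"

definition mom :: "(real^'n::finite \<Rightarrow> real) \<Rightarrow> real^'n \<Rightarrow> 'n \<Rightarrow> real^'n \<Rightarrow> real" where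
  "mom \<psi> x i y = \<psi> y * (y $ i - x $ i)"

lemma stest_mom: "stest U \<psi> \<Longrightarrow> stest U (mom \<psi> x i)"
proof -
  assume s: "stest U \<psi>"
  have "smooth (\<lambda>y. y $ i + (- x $ i))" by (intro smooth_add smooth_coord smooth_const)
  from stest_mult[OF s this] show ?thesis unfolding mom_def[abs_def] by simp
qed

lemma kern_eq: "kern \<psi> x \<sigma> = (\<lambda>z. \<sigma> ^ CARD('n) * \<psi> ((x - \<sigma> *\<^sub>R x) + \<sigma> *\<^sub>R z))" for x :: "real^'n::finite"
  by (simp add: kern_def[abs_def] algebra_simps)

lemma smooth_kern: "smooth \<psi> \<Longrightarrow> smooth (kern \<psi> x \<sigma>)"
  unfolding kern_eq by (intro smooth_mult smooth_const smooth_affine_comp)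

text \<open>Both \<open>x\<close> and the dilated point lie in the cube, so their coordinates differ
  by at most \<open>2 * R\<close>; division by \<open>\<sigma>\<close> gives the bound.\<close>

lemma kern_support:
  assumes "stest (cube R) \<psi>" "x \<in> cube R" "\<sigma> \<ge> 1" "kern \<psi> x \<sigma> z \<noteq> 0"
  shows "\<bar>z $ i - x $ i\<bar> \<le> 2 * R / \<sigma>"
proof -
  have "\<psi> (x + \<sigma> *\<^sub>R (z - x)) \<noteq> 0" using assms(4) by (auto simp: kern_def)
  hence "x + \<sigma> *\<^sub>R (z - x) \<in> cube R" using assms(1) by (auto simp: stest_def)
  hence "- R < x $ i + \<sigma> * (z $ i - x $ i)" "x $ i + \<sigma> * (z $ i - x $ i) < R" "- R < x $ i" "x $ i < R"
    using assms(2) by (auto simp: mem_cube)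
  hence "\<bar>\<sigma> * (z $ i - x $ i)\<bar> \<le> 2 * R" by linarith
  hence "\<sigma> * \<bar>z $ i - x $ i\<bar> \<le> 2 * R" using assms(3) by (simp add: abs_mult)
  thus ?thesis using assms(3) by (simp add: pos_le_divide_eq mult.commute)
qed

lemma stest_kern:
  assumes "stest (cube R) \<psi>" "x \<in> cube R" "\<sigma> \<ge> 1"
  shows "stest (cube R) (kern \<psi> x \<sigma>)"
proof -
  obtain K where K: "compact K" "K \<subseteq> cube R" "\<And>x. x \<notin> K \<Longrightarrow> \<psi> x = 0" using assms by (auto simp: stest_def)
  let ?h = "\<lambda>y. x + (1 / \<sigma>) *\<^sub>R (y - x)"
  have "compact (?h ` K)" by (intro compact_continuous_image K continuous_intros)
  moreover have "?h ` K \<subseteq> cube R"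
  proof safe
    fix y assume "y \<in> K"
    hence "y \<in> cube R" using K by blast
    have "convex (cube R :: (real^'a) set)" unfolding cube_def by (rule convex_box)
    from convexD[OF this assms(2) \<open>y \<in> cube R\<close>, of "1 - 1 / \<sigma>" "1 / \<sigma>"] assms(3)
    show "?h y \<in> cube R" by (simp add: algebra_simps)
  qed
  moreover have "kern \<psi> x \<sigma> z = 0" if "z \<notin> ?h ` K" for z
  proof -
    have "?h (x + \<sigma> *\<^sub>R (z - x)) = z" using assms(3) by simp
    have "x + \<sigma> *\<^sub>R (z - x) \<notin> K"
    proof
      assume "x + \<sigma> *\<^sub>R (z - x) \<in> K"
      hence "?h (x + \<sigma> *\<^sub>R (z - x)) \<in> ?h ` K" by (rule imageI)
      thus False using that \<open>?h (x + \<sigma> *\<^sub>R (z - x)) = z\<close> by simp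
    qed
    thus ?thesis using K(3) by (simp add: kern_def)
  qed
  ultimately show ?thesis unfolding stest_def
    using smooth_kern[OF stest_smooth[OF assms(1)]] by blast
qed

lemma pd_kern:
  fixes x :: "real^'n::finite"
  assumes "smooth \<psi>"
  shows "pd i (kern \<psi> x \<sigma>) z = \<sigma> ^ (CARD('n) + 1) * pd i \<psi> (x + \<sigma> *\<^sub>R (z - x))"
proof -
  let ?a = "x - \<sigma> *\<^sub>R x" and ?d = "CARD('n)"
  have ya: "?a + \<sigma> *\<^sub>R z = x + \<sigma> *\<^sub>R (z - x)" by (simp add: algebra_simps)
  have "pd i (kern \<psi> x \<sigma>) z = \<sigma> ^ ?d * pd i (\<lambda>z. \<psi> (?a + \<sigma> *\<^sub>R z)) z"
    unfolding kern_eq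
    by (subst pd_mult[OF smooth_D(1)[OF smooth_const] smooth_D(1)[OF smooth_affine_comp[OF assms]]]) simp
  also have "pd i (\<lambda>z. \<psi> (?a + \<sigma> *\<^sub>R z)) z = \<sigma> * pd i \<psi> (?a + \<sigma> *\<^sub>R z)"
    by (rule pd_affine_comp[OF smooth_D(1)[OF assms]])
  finally show ?thesis unfolding ya by simp
qed

lemma pd_kern_mom:
  fixes x :: "real^'n::finite"
  assumes "smooth \<psi>"
  shows "pd i (kern (mom \<psi> x i) x \<sigma>) z
     = \<sigma> ^ (CARD('n) + 1) * (pd i \<psi> (x + \<sigma> *\<^sub>R (z - x)) * (\<sigma> * (z $ i - x $ i)) + \<psi> (x + \<sigma> *\<^sub>R (z - x)))"
proof -
  have sc: "smooth (\<lambda>y. y $ i + (- x $ i))" by (intro smooth_add smooth_coord smooth_const)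
  have m: "mom \<psi> x i = (\<lambda>y. \<psi> y * (y $ i + (- x $ i)))" by (simp add: mom_def[abs_def])
  have sm: "smooth (mom \<psi> x i)" unfolding m by (intro smooth_mult assms sc)
  have pdm: "pd i (mom \<psi> x i) y = pd i \<psi> y * (y $ i - x $ i) + \<psi> y" for y
  proof -
    have "pd i (\<lambda>y. y $ i + (- x $ i)) y = 1"
      by (subst pd_add) (auto simp: smooth_D(1) smooth_coord smooth_const pd_coord)
    thus ?thesis unfolding m by (subst pd_mult[OF smooth_D(1)[OF assms] smooth_D(1)[OF sc]]) simp
  qed
  have "pd i (kern (mom \<psi> x i) x \<sigma>) z = \<sigma> ^ (CARD('n) + 1) * pd i (mom \<psi> x i) (x + \<sigma> *\<^sub>R (z - x))"
    by (rule pd_kern[OF sm])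
  thus ?thesis unfolding pdm by simp
qed

text \<open>The product rule yields the dimension times a power of \<open>\<sigma>\<close> times
  \<open>\<psi>\<close>, plus the radial derivative of \<open>\<psi>\<close>. This is exactly a
  divergence, up to the factor \<open>\<sigma>\<^sup>2\<close>: the moments supply the components of
  the vector field. The divergence form is what allows the derivatives to be moved onto the other
  factor of an integral.\<close>

lemma kern_deriv:
  fixes x :: "real^'n::finite"
  assumes "smooth \<psi>" "\<sigma> > 0"
  shows "((\<lambda>\<sigma>. kern \<psi> x \<sigma> z) has_real_derivative (\<Sum>i\<in>UNIV. pd i (kern (mom \<psi> x i) x \<sigma>) z) / \<sigma>\<^sup>2) (at \<sigma>)"
proof -
  let ?d = "CARD('n)" and ?y = "x + \<sigma> *\<^sub>R (z - x)"
  have "((\<lambda>\<sigma>. x + \<sigma> *\<^sub>R (z - x)) has_derivative (\<lambda>t. t *\<^sub>R (z - x))) (at \<sigma>)"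
    by (auto intro!: derivative_eq_intros)
  from has_derivative_compose[OF this has_derivative_pd[OF smooth_D(1)[OF assms(1)]]]
  have "((\<lambda>\<sigma>. \<psi> (x + \<sigma> *\<^sub>R (z - x))) has_real_derivative (\<Sum>i\<in>UNIV. (z $ i - x $ i) * pd i \<psi> ?y)) (at \<sigma>)"
    unfolding has_field_derivative_def
    by (rule has_derivative_eq_rhs) (simp add: fun_eq_iff sum_distrib_left mult_ac)
  from DERIV_mult[OF DERIV_pow[of ?d \<sigma>] this]
  have "((\<lambda>\<sigma>. kern \<psi> x \<sigma> z) has_real_derivative
      (real ?d * \<sigma> ^ (?d - Suc 0) * \<psi> ?y + (\<Sum>i\<in>UNIV. (z $ i - x $ i) * pd i \<psi> ?y) * \<sigma> ^ ?d)) (at \<sigma>)"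
    unfolding kern_def[abs_def] .
  moreover have "(\<Sum>i\<in>UNIV. pd i (kern (mom \<psi> x i) x \<sigma>) z) / \<sigma>\<^sup>2
      = real ?d * \<sigma> ^ (?d - Suc 0) * \<psi> ?y + (\<Sum>i\<in>UNIV. (z $ i - x $ i) * pd i \<psi> ?y) * \<sigma> ^ ?d"
  proof -
    \<comment> \<open>The dimension is positive, so the exponent \<open>?d - Suc 0\<close> is a true
      predecessor.\<close>
    obtain m where m: "?d = Suc m" using zero_less_card_finite[where 'a='n] by (metis gr0_implies_Suc)
    have "(\<Sum>i\<in>UNIV. pd i (kern (mom \<psi> x i) x \<sigma>) z)
      = \<sigma> ^ (?d + 1) * (\<sigma> * (\<Sum>i\<in>UNIV. (z $ i - x $ i) * pd i \<psi> ?y) + real ?d * \<psi> ?y)"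
      unfolding pd_kern_mom[OF assms(1)]
      by (simp only: sum_distrib_left[symmetric] sum.distrib mult.left_commute[of _ \<sigma>] mult.commute[of "pd _ _ _"] mult.assoc)
         (simp add: sum_distrib_left mult_ac)
    thus ?thesis using assms(2) by (simp add: m power2_eq_square field_simps)
  qed
  ultimately show ?thesis by simp
qed

text \<open>The integrand lives on a box around \<open>x\<close> of side
  \<open>4 * R / \<sigma>\<close>.\<close>

lemma integral_kern_bound:
  fixes x :: "real^'n::finite"
  assumes f: "nice R f" and x: "x \<in> cube R" and s: "\<sigma> \<ge> 1" and C: "C \<ge> 0" and R: "R > 0"
    and b: "\<And>z. z \<in> cube R \<Longrightarrow> f z \<le> C" "\<And>z. z \<in> cube R \<Longrightarrow> f z \<noteq> 0 \<Longrightarrow> (\<forall>i. \<bar>z $ i - x $ i\<bar> \<le> 2 * R / \<sigma>)"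
  shows "integral\<^sup>L (cubeM R) f \<le> C * (4 * R / \<sigma>) ^ CARD('n)"
proof -
  define q where "q = (vec (2 * R / \<sigma>) :: real^'n)"
  let ?Q = "cbox (x - q) (x + q)"
  have Q: "z \<in> ?Q" if "\<forall>i. \<bar>z $ i - x $ i\<bar> \<le> 2 * R / \<sigma>" for z
    unfolding mem_box_cart
  proof
    fix i
    have "\<bar>z $ i - x $ i\<bar> \<le> q $ i" using that by (simp add: q_def)
    thus "(x - q) $ i \<le> z $ i \<and> z $ i \<le> (x + q) $ i" by auto
  qed
  have Qs: "?Q \<in> sets lebesgue" by simp
  have Qm: "?Q \<inter> cube R \<in> sets (cubeM R)" "cube R \<inter> ?Q \<in> sets lebesgue"
    using Qs by (auto simp: sets_restrict_space_iff intro!: sets.Int)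
  have i1: "integrable (cubeM R) (indicator (?Q \<inter> cube R) :: _ \<Rightarrow> real)"
    using finite_measure.emeasure_finite[OF finite_measure_cube] Qm
    by (intro integrable_real_indicator) (auto simp: less_top)
  have "integral\<^sup>L (cubeM R) f \<le> integral\<^sup>L (cubeM R) (\<lambda>z. C * indicator (?Q \<inter> cube R) z)"
  proof (rule integral_mono[OF nice_integrable[OF f] integrable_mult_right[OF i1]])
    fix z :: "real^'n" assume "z \<in> space (cubeM R)"
    hence z: "z \<in> cube R" by simp
    show "f z \<le> C * indicator (?Q \<inter> cube R) z"
    proof (cases "f z = 0")
      case False
      thus ?thesis using b(1)[OF z] Q[OF b(2)[OF z False]] z by simp
    qed (use C in simp)
  qed
  also have "\<dots> = C * measure (cubeM R) (?Q \<inter> cube R)"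
    using Qm by (simp add: Int_absorb2)
  also have "\<dots> \<le> C * measure lebesgue ?Q"
  proof (rule mult_left_mono[OF _ C])
    have "measure (cubeM R) (?Q \<inter> cube R) = measure lebesgue (?Q \<inter> cube R)"
      by (rule measure_restrict_space) auto
    also have "\<dots> \<le> measure lebesgue ?Q"
      by (rule measure_mono_fmeasurable) (use Qm in \<open>auto simp: Int_commute\<close>)
    finally show "measure (cubeM R) (?Q \<inter> cube R) \<le> measure lebesgue ?Q" .
  qed
  also have "measure lebesgue ?Q = (4 * R / \<sigma>) ^ CARD('n)"
  proof -
    have "x \<in> ?Q" using Q[of x] R s by simp
    hence "measure lborel ?Q = (\<Prod>i\<in>UNIV. (x + q) $ i - (x - q) $ i)" by (intro content_cbox_cart) auto
    thus ?thesis by (simp add: q_def)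
  qed
  finally show ?thesis .
qed

text \<open>With \<open>d\<close> the dimension, the kernel has height of order
  \<open>\<sigma> ^ d\<close> on a set of measure of order \<open>1 / \<sigma> ^ d\<close>, hence
  L^2 norm of order \<open>\<sigma> powr (d / 2)\<close>, and Cauchy-Schwarz applies. The exponent
  is raised to \<open>real c + 1 / 2\<close> so that all later exponents are half-integers.\<close>

lemma kern_integral_bound:
  fixes x :: "real^'n::finite"
  assumes w: "sqint (cubeM R) w" and p: "stest (cube R) \<psi>" "\<And>y. \<bar>\<psi> y\<bar> \<le> S" and x: "x \<in> cube R"
    and s: "\<sigma> \<ge> 1" and R: "R > 0" and c: "CARD('n) \<le> 2 * c"
    and N: "integral\<^sup>L (cubeM R) (\<lambda>z. (w z)\<^sup>2) \<le> N\<^sup>2" "N \<ge> 0"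
  shows "\<bar>integral\<^sup>L (cubeM R) (\<lambda>z. w z * kern \<psi> x \<sigma> z)\<bar> \<le> S * sqrt ((4 * R) ^ CARD('n)) * N * \<sigma> powr (real c + 1 / 2)"
proof -
  let ?d = "CARD('n)"
  have S: "S \<ge> 0" using p(2)[of 0] by linarith
  have kn: "nice R (kern \<psi> x \<sigma>)" by (intro smooth_nice smooth_kern stest_smooth[OF p(1)])
  have "integral\<^sup>L (cubeM R) (\<lambda>z. (kern \<psi> x \<sigma> z)\<^sup>2) \<le> (\<sigma> ^ ?d * S)\<^sup>2 * (4 * R / \<sigma>) ^ ?d"
  proof (rule integral_kern_bound[OF _ x s _ R])
    show "nice R (\<lambda>z. (kern \<psi> x \<sigma> z)\<^sup>2)" by (intro nice_power kn)
    fix z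
    have "\<bar>kern \<psi> x \<sigma> z\<bar> \<le> \<sigma> ^ ?d * S" unfolding kern_def abs_mult using p(2) s by (intro mult_mono) auto
    thus "(kern \<psi> x \<sigma> z)\<^sup>2 \<le> (\<sigma> ^ ?d * S)\<^sup>2" using power_mono[of "\<bar>kern \<psi> x \<sigma> z\<bar>" _ 2] by simp
    assume "(kern \<psi> x \<sigma> z)\<^sup>2 \<noteq> 0"
    thus "\<forall>i. \<bar>z $ i - x $ i\<bar> \<le> 2 * R / \<sigma>" using kern_support[OF p(1) x s] by simp
  qed simp
  also have "\<dots> = S\<^sup>2 * ((4 * R) ^ ?d * \<sigma> ^ ?d)"
    using s by (simp add: power2_eq_square power_divide field_simps)
  finally have k2: "integral\<^sup>L (cubeM R) (\<lambda>z. (kern \<psi> x \<sigma> z)\<^sup>2) \<le> S\<^sup>2 * ((4 * R) ^ ?d * \<sigma> ^ ?d)" .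
  have "(integral\<^sup>L (cubeM R) (\<lambda>z. w z * kern \<psi> x \<sigma> z))\<^sup>2 \<le>
     integral\<^sup>L (cubeM R) (\<lambda>z. (w z)\<^sup>2) * integral\<^sup>L (cubeM R) (\<lambda>z. (kern \<psi> x \<sigma> z)\<^sup>2)"
    by (rule sqint_Cauchy_Schwarz[OF w nice_sqint[OF kn]])
  also have "\<dots> \<le> N\<^sup>2 * (S\<^sup>2 * ((4 * R) ^ ?d * \<sigma> ^ ?d))"
    by (rule mult_mono[OF N(1) k2]) (auto intro: integral_nonneg_AE)
  finally have "sqrt ((integral\<^sup>L (cubeM R) (\<lambda>z. w z * kern \<psi> x \<sigma> z))\<^sup>2) \<le> sqrt (N\<^sup>2 * (S\<^sup>2 * ((4 * R) ^ ?d * \<sigma> ^ ?d)))"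
    by (rule real_sqrt_le_mono)
  hence 1: "\<bar>integral\<^sup>L (cubeM R) (\<lambda>z. w z * kern \<psi> x \<sigma> z)\<bar> \<le> N * (S * (sqrt ((4 * R) ^ ?d) * sqrt (\<sigma> ^ ?d)))"
    using N(2) S by (simp add: real_sqrt_mult)
  have "\<sigma> ^ ?d \<le> \<sigma> ^ (2 * c)" using s c by (intro power_increasing)
  hence "sqrt (\<sigma> ^ ?d) \<le> sqrt ((\<sigma> ^ c)\<^sup>2)" by (simp add: power_mult[symmetric] mult.commute)
  also have "\<dots> = \<sigma> powr real c" using s by (simp add: powr_realpow)
  also have "\<dots> \<le> \<sigma> powr (real c + 1 / 2)" using s by (intro powr_mono) auto
  finally have 2: "sqrt (\<sigma> ^ ?d) \<le> \<sigma> powr (real c + 1 / 2)" .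
  have "N * (S * (sqrt ((4 * R) ^ ?d) * sqrt (\<sigma> ^ ?d))) \<le> N * (S * (sqrt ((4 * R) ^ ?d) * \<sigma> powr (real c + 1 / 2)))"
    using N S R by (intro mult_left_mono 2) auto
  with 1 show ?thesis by (simp add: mult_ac)
qed

text \<open>Half-integer exponents never equal -1, so integration yields a power and no logarithm.
  For \<open>m = 0\<close> the bound on the derivative is integrable up to infinity and
  \<open>f\<close> stays bounded. The factor 2 bounds \<open>1 / (real m - 1 / 2)\<close> for
  positive \<open>m\<close>, and the whole increment of the antiderivative for
  \<open>m = 0\<close>.\<close>

lemma growth_bound:
  fixes f f' :: "real \<Rightarrow> real"
  assumes "\<sigma> \<ge> 1" "C \<ge> 0" and D: "\<And>t. 1 \<le> t \<Longrightarrow> (f has_real_derivative f' t) (at t)"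
    and b: "\<And>t. 1 \<le> t \<Longrightarrow> \<bar>f' t\<bar> \<le> C * t powr (real m - 3 / 2)"
  shows "\<bar>f \<sigma>\<bar> \<le> \<bar>f 1\<bar> + 2 * C * (if m = 0 then 1 else \<sigma> powr (real m - 1 / 2))"
proof -
  define B where "B t = t powr (real m - 1 / 2) / (real m - 1 / 2)" for t :: real
  have m0: "real m - 1 / 2 \<noteq> 0"
  proof
    assume "real m - 1 / 2 = 0"
    hence "real (2 * m) = real 1" by simp
    hence "2 * m = 1" unfolding of_nat_eq_iff .
    thus False by presburger
  qed
  have DB: "(B has_real_derivative t powr (real m - 3 / 2)) (at t)" if "1 \<le> t" for t
    unfolding B_def[abs_def] using that m0
    by (auto intro!: derivative_eq_intros simp: diff_diff_eq)
  have "f \<sigma> - C * B \<sigma> \<le> f 1 - C * B 1"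
  proof (rule DERIV_nonpos_imp_nonincreasing[OF assms(1)])
    fix t assume "1 \<le> t" "t \<le> \<sigma>"
    hence "((\<lambda>t. f t - C * B t) has_real_derivative f' t - C * t powr (real m - 3 / 2)) (at t)"
      by (intro DERIV_diff DERIV_cmult D DB)
    thus "\<exists>y. ((\<lambda>t. f t - C * B t) has_real_derivative y) (at t) \<and> y \<le> 0"
      using b[OF \<open>1 \<le> t\<close>] by (intro exI conjI) auto
  qed
  moreover have "f \<sigma> + C * B \<sigma> \<ge> f 1 + C * B 1"
  proof (rule DERIV_nonneg_imp_nondecreasing[OF assms(1)])
    fix t assume "1 \<le> t" "t \<le> \<sigma>"
    hence "((\<lambda>t. f t + C * B t) has_real_derivative f' t + C * t powr (real m - 3 / 2)) (at t)"
      by (intro DERIV_add DERIV_cmult D DB)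
    thus "\<exists>y. ((\<lambda>t. f t + C * B t) has_real_derivative y) (at t) \<and> 0 \<le> y"
      using b[OF \<open>1 \<le> t\<close>] by (intro exI conjI) auto
  qed
  ultimately have "\<bar>f \<sigma>\<bar> \<le> \<bar>f 1\<bar> + C * (B \<sigma> - B 1)" by (simp add: algebra_simps)
  also have "\<dots> \<le> \<bar>f 1\<bar> + C * (2 * (if m = 0 then 1 else \<sigma> powr (real m - 1 / 2)))"
  proof (intro add_left_mono mult_left_mono assms(2))
    show "B \<sigma> - B 1 \<le> 2 * (if m = 0 then 1 else \<sigma> powr (real m - 1 / 2))"
  proof (cases "m = 0")
    case True thus ?thesis using assms(1) by (simp add: B_def)
  next
    case False
    have "1 / (real m - 1 / 2) \<le> 2" using False by (cases m) (auto simp: field_simps)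
    hence "\<sigma> powr (real m - 1 / 2) * (1 / (real m - 1 / 2)) \<le> \<sigma> powr (real m - 1 / 2) * 2"
      by (intro mult_left_mono) auto
    moreover have "B 1 \<ge> 0" using False by (cases m) (auto simp: B_def)
    moreover have "B \<sigma> = \<sigma> powr (real m - 1 / 2) * (1 / (real m - 1 / 2))" by (simp add: B_def)
    ultimately show ?thesis using False by simp
  qed
  qed
  finally show ?thesis by (simp only: mult_ac)
qed

lemma kern_integral_deriv:
  fixes x :: "real^'n::finite"
  assumes w: "integrable (cubeM R) w" and p: "stest (cube R) \<psi>" and x: "x \<in> cube R" and s: "\<sigma> \<ge> 1" and R: "R > 0"
  shows "((\<lambda>\<sigma>. integral\<^sup>L (cubeM R) (\<lambda>z. w z * kern \<psi> x \<sigma> z)) has_real_derivative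
     (\<Sum>i\<in>UNIV. integral\<^sup>L (cubeM R) (\<lambda>z. w z * pd i (kern (mom \<psi> x i) x \<sigma>) z)) / \<sigma>\<^sup>2) (at \<sigma>)"
proof -
  let ?d = "CARD('n)"
  define f' where "f' \<sigma> z = (\<Sum>i\<in>UNIV. pd i (kern (mom \<psi> x i) x \<sigma>) z) / \<sigma>\<^sup>2" for \<sigma> z
  have sp: "smooth \<psi>" by (rule stest_smooth[OF p])
  have sm: "smooth (mom \<psi> x i)" for i by (rule stest_smooth[OF stest_mom[OF p]])
  obtain S0 where S0: "S0 \<ge> 0" "\<And>y. \<bar>\<psi> y\<bar> \<le> S0" using stest_bounded[OF p] by metis
  have "\<exists>S. \<forall>y. \<bar>pd i (mom \<psi> x i) y\<bar> \<le> S" for i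
    using stest_bounded[OF stest_pd[OF stest_mom[OF p]], of i x i] by metis
  then obtain S where S: "\<And>i y. \<bar>pd i (mom \<psi> x i) y\<bar> \<le> S i" by metis
  have pk: "pd i (kern (mom \<psi> x i) x \<sigma>) z = \<sigma> ^ (?d + 1) * pd i (mom \<psi> x i) (x + \<sigma> *\<^sub>R (z - x))" for i \<sigma> z
    by (rule pd_kern[OF sm])
  have kn: "nice R (pd i (kern (mom \<psi> x i) x \<sigma>))" for i \<sigma> by (intro smooth_nice smooth_D(2) smooth_kern sm)
  have f'n: "nice R (f' \<sigma>)" for \<sigma> unfolding f'_def[abs_def] divide_inverse by (intro nice_intros kn)
  have "((\<lambda>\<sigma>. integral\<^sup>L (cubeM R) (\<lambda>z. w z * kern \<psi> x \<sigma> z)) has_real_derivative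
     integral\<^sup>L (cubeM R) (\<lambda>z. w z * f' \<sigma> z)) (at \<sigma>)"
  \<comment> \<open>The interval stays away from 0, where the factor
    \<open>1 / \<sigma>\<^sup>2\<close> is unbounded.\<close>
  proof (rule deriv_under_integral[OF w, where a="1/2" and b="\<sigma> + 1" and f'=f'])
    show "\<sigma> \<in> {1/2<..<\<sigma> + 1}" using s by auto
    show "kern \<psi> x s \<in> borel_measurable (cubeM R)" for s by (intro nice_measurable smooth_nice smooth_kern sp)
    show "f' \<sigma> \<in> borel_measurable (cubeM R)" by (intro nice_measurable f'n)
    fix s :: real and z :: "real^'n" assume s': "s \<in> {1/2<..<\<sigma> + 1}"
    show "((\<lambda>s. kern \<psi> x s z) has_real_derivative f' s z) (at s)"
      unfolding f'_def using s' by (intro kern_deriv sp) auto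
    show "\<bar>kern \<psi> x s z\<bar> \<le> (\<sigma> + 1) ^ ?d * S0"
      unfolding kern_def abs_mult using s' S0 by (intro mult_mono) (auto simp: power_abs intro!: power_mono)
    have "\<bar>f' s z\<bar> = \<bar>\<Sum>i\<in>UNIV. pd i (kern (mom \<psi> x i) x s) z\<bar> / s\<^sup>2" by (simp add: f'_def)
    also have "\<dots> \<le> (\<Sum>i\<in>UNIV. (\<sigma> + 1) ^ (?d + 1) * S i) / (1/2)\<^sup>2"
    proof (intro frac_le sum_nonneg)
      show "\<bar>\<Sum>i\<in>UNIV. pd i (kern (mom \<psi> x i) x s) z\<bar> \<le> (\<Sum>i\<in>UNIV. (\<sigma> + 1) ^ (?d + 1) * S i)"
      proof (intro order_trans[OF sum_abs] sum_mono)
        fix i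
        show "\<bar>pd i (kern (mom \<psi> x i) x s) z\<bar> \<le> (\<sigma> + 1) ^ (?d + 1) * S i"
          unfolding pk abs_mult using s' S[of i] by (intro mult_mono) (auto simp: power_abs intro!: power_mono mult_mono)
      qed
      show "(1/2)\<^sup>2 \<le> s\<^sup>2" using s' by (intro power_mono) auto
      show "0 \<le> (\<sigma> + 1) ^ (?d + 1) * S i" for i using S[of i 0] s by (intro mult_nonneg_nonneg) auto
    qed simp
    finally show "\<bar>f' s z\<bar> \<le> (\<Sum>i\<in>UNIV. (\<sigma> + 1) ^ (?d + 1) * S i) / (1/2)\<^sup>2" .
  qed
  moreover have "integral\<^sup>L (cubeM R) (\<lambda>z. w z * f' \<sigma> z)
     = (\<Sum>i\<in>UNIV. integral\<^sup>L (cubeM R) (\<lambda>z. w z * pd i (kern (mom \<psi> x i) x \<sigma>) z)) / \<sigma>\<^sup>2"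
  proof -
    have wi: "integrable (cubeM R) (\<lambda>z. w z * pd i (kern (mom \<psi> x i) x \<sigma>) z)" for i
    proof -
      obtain B where B: "\<And>z. z \<in> cube R \<Longrightarrow> \<bar>pd i (kern (mom \<psi> x i) x \<sigma>) z\<bar> \<le> B" using kn[of i \<sigma>] by (auto simp: nice_def)
      show ?thesis
      proof (rule Bochner_Integration.integrable_bound[of _ "\<lambda>z. B * w z"])
        show "(\<lambda>z. w z * pd i (kern (mom \<psi> x i) x \<sigma>) z) \<in> borel_measurable (cubeM R)"
          using w nice_measurable[OF kn[of i \<sigma>]] by (intro borel_measurable_times) auto
        show "AE z in cubeM R. norm (w z * pd i (kern (mom \<psi> x i) x \<sigma>) z) \<le> norm (B * w z)"
        proof (rule AE_I2)
          fix z :: "real^'n" assume "z \<in> space (cubeM R)"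
          hence "\<bar>pd i (kern (mom \<psi> x i) x \<sigma>) z\<bar> \<le> \<bar>B\<bar>" using B[of z] by simp
          from mult_left_mono[OF this, of "\<bar>w z\<bar>"]
          show "norm (w z * pd i (kern (mom \<psi> x i) x \<sigma>) z) \<le> norm (B * w z)" by (simp add: abs_mult mult.commute)
        qed
      qed (use w in simp)
    qed
    have "(\<lambda>z. w z * f' \<sigma> z) = (\<lambda>z. (\<Sum>i\<in>UNIV. w z * pd i (kern (mom \<psi> x i) x \<sigma>) z) / \<sigma>\<^sup>2)"
      by (simp add: f'_def sum_distrib_left)
    thus ?thesis using wi by simp
  qed
  ultimately show ?thesis by simp
qed

text \<open>Induction on the number \<open>k\<close> of derivatives of \<open>V \<alpha>\<close>
  that are spent. One more derivative lowers the growth exponent in \<open>\<sigma>\<close> by one,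
  and after \<open>c + 1\<close> of them the bound is free of \<open>\<sigma>\<close>. Each step
  replaces the test function by its moments, which depend on \<open>x\<close>; this is why
  \<open>C\<close> depends on the test function through the sup bound \<open>S\<close> alone and is
  chosen before \<open>\<psi>\<close>, \<open>x\<close> and \<open>V\<close>.\<close>

lemma wchain_kern_bound:
  fixes R :: real and c p :: nat
  assumes R: "R > 0" and c: "CARD('n::finite) \<le> 2 * c" and k: "k \<le> c + 1"
  shows "\<forall>S\<ge>0. \<exists>C\<ge>0. \<forall>V N (x::real^'n) \<psi> \<alpha> \<sigma>. wchain R p V \<longrightarrow> N \<ge> 0 \<longrightarrow>
     (\<forall>\<alpha>\<in>multi_idx p. integral\<^sup>L (cubeM R) (\<lambda>z. (V \<alpha> z)\<^sup>2) \<le> N\<^sup>2) \<longrightarrow> x \<in> cube R \<longrightarrow>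
     stest (cube R) \<psi> \<longrightarrow> (\<forall>y. \<bar>\<psi> y\<bar> \<le> S) \<longrightarrow> sum \<alpha> UNIV + k \<le> p \<longrightarrow> \<sigma> \<ge> 1 \<longrightarrow>
     \<bar>integral\<^sup>L (cubeM R) (\<lambda>z. V \<alpha> z * kern \<psi> x \<sigma> z)\<bar>
       \<le> C * N * (if k = c + 1 then 1 else \<sigma> powr (real (c + 1 - k) - 1 / 2))"
  using k
proof (induction k)
  case 0
  show ?case
  proof (intro allI impI)
    fix S :: real assume S: "S \<ge> 0"
    show "\<exists>C\<ge>0. \<forall>V N (x::real^'n) \<psi> \<alpha> \<sigma>. wchain R p V \<longrightarrow> N \<ge> 0 \<longrightarrow>
     (\<forall>\<alpha>\<in>multi_idx p. integral\<^sup>L (cubeM R) (\<lambda>z. (V \<alpha> z)\<^sup>2) \<le> N\<^sup>2) \<longrightarrow> x \<in> cube R \<longrightarrow>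
     stest (cube R) \<psi> \<longrightarrow> (\<forall>y. \<bar>\<psi> y\<bar> \<le> S) \<longrightarrow> sum \<alpha> UNIV + 0 \<le> p \<longrightarrow> \<sigma> \<ge> 1 \<longrightarrow>
     \<bar>integral\<^sup>L (cubeM R) (\<lambda>z. V \<alpha> z * kern \<psi> x \<sigma> z)\<bar>
       \<le> C * N * (if 0 = c + 1 then 1 else \<sigma> powr (real (c + 1 - 0) - 1 / 2))"
    proof (rule exI[of _ "S * sqrt ((4 * R) ^ CARD('n))"], intro conjI allI impI)
      show "0 \<le> S * sqrt ((4 * R) ^ CARD('n))" using S R by simp
      fix V :: "('n \<Rightarrow> nat) \<Rightarrow> real^'n \<Rightarrow> real" and N and x :: "real^'n" and \<psi> :: "real^'n \<Rightarrow> real" and \<alpha> :: "'n \<Rightarrow> nat" and \<sigma> :: real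
      assume a: "wchain R p V" "N \<ge> 0" "\<forall>\<alpha>\<in>multi_idx p. integral\<^sup>L (cubeM R) (\<lambda>z. (V \<alpha> z)\<^sup>2) \<le> N\<^sup>2"
        "x \<in> cube R" "stest (cube R) \<psi>" "\<forall>y. \<bar>\<psi> y\<bar> \<le> S" "sum \<alpha> UNIV + 0 \<le> p" "1 \<le> \<sigma>"
      have m: "\<alpha> \<in> multi_idx p" using a(7) by (simp add: multi_idx_def)
      have "\<bar>integral\<^sup>L (cubeM R) (\<lambda>z. V \<alpha> z * kern \<psi> x \<sigma> z)\<bar> \<le> S * sqrt ((4 * R) ^ CARD('n)) * N * \<sigma> powr (real c + 1 / 2)"
        by (rule kern_integral_bound) (use a m R c in \<open>auto simp: wchain_def\<close>)
      thus "\<bar>integral\<^sup>L (cubeM R) (\<lambda>z. V \<alpha> z * kern \<psi> x \<sigma> z)\<bar>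
       \<le> S * sqrt ((4 * R) ^ CARD('n)) * N * (if 0 = c + 1 then 1 else \<sigma> powr (real (c + 1 - 0) - 1 / 2))"
        by (simp add: add.commute)
    qed
  qed
next
  case (Suc k)
  show ?case
  proof (intro allI impI)
    fix S :: real assume S: "S \<ge> 0"
    have kc: "k \<le> c + 1" "k \<le> c" using Suc.prems by auto
    \<comment> \<open>The exponent reached in this step is \<open>real m - 1 / 2\<close>; the last
      step has \<open>m = 0\<close>, where the growth stops.\<close>
    define m where "m = c - k"
    \<comment> \<open>Coordinates of two points of the cube differ by at most \<open>2 * R\<close>,
      so this is a sup bound for the moments of \<open>\<psi>\<close>.\<close>
    have "2 * R * S \<ge> 0" using S R by simp
    from Suc.IH[OF kc(1), rule_format, OF this] obtain C where C: "C \<ge> 0" and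
      IH: "\<And>V N (x::real^'n) \<psi> \<alpha> \<sigma>. wchain R p V \<Longrightarrow> N \<ge> 0 \<Longrightarrow>
     (\<forall>\<alpha>\<in>multi_idx p. integral\<^sup>L (cubeM R) (\<lambda>z. (V \<alpha> z)\<^sup>2) \<le> N\<^sup>2) \<Longrightarrow> x \<in> cube R \<Longrightarrow>
     stest (cube R) \<psi> \<Longrightarrow> (\<forall>y. \<bar>\<psi> y\<bar> \<le> 2 * R * S) \<Longrightarrow> sum \<alpha> UNIV + k \<le> p \<Longrightarrow> \<sigma> \<ge> 1 \<Longrightarrow>
     \<bar>integral\<^sup>L (cubeM R) (\<lambda>z. V \<alpha> z * kern \<psi> x \<sigma> z)\<bar>
       \<le> C * N * (if k = c + 1 then 1 else \<sigma> powr (real (c + 1 - k) - 1 / 2))" by blast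
    define C0 where "C0 = S * sqrt ((4 * R) ^ CARD('n))"
    have C0: "C0 \<ge> 0" using S R by (simp add: C0_def)
    let ?C = "C0 + 2 * (real CARD('n) * C)"
    show "\<exists>C\<ge>0. \<forall>V N (x::real^'n) \<psi> \<alpha> \<sigma>. wchain R p V \<longrightarrow> N \<ge> 0 \<longrightarrow>
     (\<forall>\<alpha>\<in>multi_idx p. integral\<^sup>L (cubeM R) (\<lambda>z. (V \<alpha> z)\<^sup>2) \<le> N\<^sup>2) \<longrightarrow> x \<in> cube R \<longrightarrow>
     stest (cube R) \<psi> \<longrightarrow> (\<forall>y. \<bar>\<psi> y\<bar> \<le> S) \<longrightarrow> sum \<alpha> UNIV + Suc k \<le> p \<longrightarrow> \<sigma> \<ge> 1 \<longrightarrow>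
     \<bar>integral\<^sup>L (cubeM R) (\<lambda>z. V \<alpha> z * kern \<psi> x \<sigma> z)\<bar>
       \<le> C * N * (if Suc k = c + 1 then 1 else \<sigma> powr (real (c + 1 - Suc k) - 1 / 2))"
    proof (rule exI[of _ ?C], intro conjI allI impI)
      show "0 \<le> ?C" using C C0 by simp
      fix V :: "('n \<Rightarrow> nat) \<Rightarrow> real^'n \<Rightarrow> real" and N and x :: "real^'n" and \<psi> :: "real^'n \<Rightarrow> real" and \<alpha> :: "'n \<Rightarrow> nat" and \<sigma> :: real
      assume a: "wchain R p V" "N \<ge> 0" "\<forall>\<alpha>\<in>multi_idx p. integral\<^sup>L (cubeM R) (\<lambda>z. (V \<alpha> z)\<^sup>2) \<le> N\<^sup>2"
        "x \<in> cube R" "stest (cube R) \<psi>" "\<forall>y. \<bar>\<psi> y\<bar> \<le> S" "sum \<alpha> UNIV + Suc k \<le> p" "1 \<le> \<sigma>"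
      have ma: "\<alpha> \<in> multi_idx p" using a(7) by (simp add: multi_idx_def)
      have sq: "sqint (cubeM R) (V \<alpha>)" using a(1) ma by (simp add: wchain_def)
      define T where "T t = integral\<^sup>L (cubeM R) (\<lambda>z. V \<alpha> z * kern \<psi> x t z)" for t
      define T' where "T' t = (\<Sum>i\<in>UNIV. integral\<^sup>L (cubeM R) (\<lambda>z. V \<alpha> z * pd i (kern (mom \<psi> x i) x t) z)) / t\<^sup>2" for t
      have "\<bar>T \<sigma>\<bar> \<le> \<bar>T 1\<bar> + 2 * (real CARD('n) * C * N) * (if m = 0 then 1 else \<sigma> powr (real m - 1 / 2))"
      proof (rule growth_bound[OF a(8)])
        show "0 \<le> real CARD('n) * C * N" using C a(2) by simp
        fix t :: real assume t: "1 \<le> t"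
        show "(T has_real_derivative T' t) (at t)"
          unfolding T_def[abs_def] T'_def
          by (rule kern_integral_deriv[OF finite_measure.sqint_integrable[OF finite_measure_cube sq] a(5,4) t R])
        have mb: "\<forall>y. \<bar>mom \<psi> x i y\<bar> \<le> 2 * R * S" for i
        proof
          fix y
          show "\<bar>mom \<psi> x i y\<bar> \<le> 2 * R * S"
          proof (cases "y \<in> cube R")
            case True
            hence "\<bar>y $ i - x $ i\<bar> \<le> 2 * R" using a(4) unfolding mem_cube by (smt (verit))
            thus ?thesis unfolding mom_def abs_mult using a(6) S by (subst mult.commute) (intro mult_mono, auto)
          next
            case False
            hence "\<psi> y = 0" using a(5) by (auto simp: stest_def)
            thus ?thesis using S R by (simp add: mom_def)
          qed
        qed
        have "\<bar>integral\<^sup>L (cubeM R) (\<lambda>z. V \<alpha> z * pd i (kern (mom \<psi> x i) x t) z)\<bar> \<le> C * N * t powr (real m + 1 / 2)" for i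
        proof -
          have st: "stest (cube R) (kern (mom \<psi> x i) x t)" by (intro stest_kern stest_mom a t)
          have "integral\<^sup>L (cubeM R) (\<lambda>z. V \<alpha> z * pd i (kern (mom \<psi> x i) x t) z)
              = - integral\<^sup>L (cubeM R) (\<lambda>z. V (mi_inc i \<alpha>) z * kern (mom \<psi> x i) x t z)"
            using a(1,7) st unfolding wchain_def by simp
          moreover have "\<bar>integral\<^sup>L (cubeM R) (\<lambda>z. V (mi_inc i \<alpha>) z * kern (mom \<psi> x i) x t z)\<bar>
             \<le> C * N * (if k = c + 1 then 1 else t powr (real (c + 1 - k) - 1 / 2))"
            by (rule IH[OF a(1-4) stest_mom[OF a(5)] mb _ t]) (use a(7) in \<open>simp add: sum_mi_inc\<close>)
          ultimately show ?thesis using kc by (simp add: m_def of_nat_diff algebra_simps)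
        qed
        hence "\<bar>\<Sum>i\<in>UNIV. integral\<^sup>L (cubeM R) (\<lambda>z. V \<alpha> z * pd i (kern (mom \<psi> x i) x t) z)\<bar>
            \<le> (\<Sum>i\<in>(UNIV::'n set). C * N * t powr (real m + 1 / 2))"
          by (intro order_trans[OF sum_abs] sum_mono) auto
        hence "\<bar>T' t\<bar> \<le> (real CARD('n) * (C * N * t powr (real m + 1 / 2))) / t\<^sup>2"
          unfolding T'_def abs_divide by (simp add: divide_right_mono)
        also have "\<dots> = real CARD('n) * C * N * t powr (real m - 3 / 2)"
        proof -
          have "t powr (real m + 1 / 2) = t powr (real m - 3 / 2) * t powr 2" by (subst powr_add[symmetric]) (simp add: add.commute)
          thus ?thesis using t by simp
        qed
        finally show "\<bar>T' t\<bar> \<le> real CARD('n) * C * N * t powr (real m - 3 / 2)" .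
      qed
      \<comment> \<open>The initial value at \<open>\<sigma> = 1\<close> is estimated directly and
        accounts for the summand \<open>C0\<close> of the constant.\<close>
      moreover have "\<bar>T 1\<bar> \<le> S * sqrt ((4 * R) ^ CARD('n)) * N * 1 powr (real c + 1 / 2)"
        unfolding T_def by (rule kern_integral_bound) (use a ma R c sq in auto)
      moreover have "(if m = 0 then 1 else \<sigma> powr (real m - 1 / 2)) \<ge> 1"
        using a(8) by (cases m) (auto intro!: ge_one_powr_ge_zero)
      hence "C0 * N * 1 \<le> C0 * N * (if m = 0 then 1 else \<sigma> powr (real m - 1 / 2))"
        using C0 a(2) by (intro mult_left_mono) auto
      moreover have "(if Suc k = c + 1 then 1 else \<sigma> powr (real (c + 1 - Suc k) - 1 / 2)) = (if m = 0 then 1 else \<sigma> powr (real m - 1 / 2))"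
        using kc by (auto simp: m_def)
      ultimately show "\<bar>integral\<^sup>L (cubeM R) (\<lambda>z. V \<alpha> z * kern \<psi> x \<sigma> z)\<bar>
       \<le> ?C * N * (if Suc k = c + 1 then 1 else \<sigma> powr (real (c + 1 - Suc k) - 1 / 2))"
        unfolding T_def[symmetric] C0_def[symmetric] by (simp only: distrib_right) (simp add: mult_ac)
    qed
  qed
qed

text \<open>Conservation of mass by constancy in \<open>\<sigma>\<close>: the derivative in
  \<open>\<sigma>\<close> is a sum of integrals of derivatives of compactly supported functions, and
  at \<open>\<sigma> = 1\<close> the kernel is \<open>\<psi>\<close>.\<close>

lemma kern_mass:
  fixes x :: "real^'n::finite"
  assumes p: "stest (cube R) \<psi>" and x: "x \<in> cube R" and s: "\<sigma> \<ge> 1" and R: "R > 0"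
  shows "integral\<^sup>L (cubeM R) (kern \<psi> x \<sigma>) = integral\<^sup>L (cubeM R) \<psi>"
proof -
  let ?T = "\<lambda>\<sigma>. integral\<^sup>L (cubeM R) (\<lambda>z. 1 * kern \<psi> x \<sigma> z)"
  have z: "integral\<^sup>L (cubeM R) (\<lambda>z. 1 * pd i (kern (mom \<psi> x i) x t) z) = 0" if "t \<ge> 1" for i t
    using integration_by_parts_stest[of R "\<lambda>_. 1" i "kern (mom \<psi> x i) x t"] stest_kern[OF stest_mom[OF p] x that]
    by (simp add: nice_const ldiff_def)
  have "(?T has_real_derivative 0) (at t within {1..})" if t: "t \<in> {1..}" for t
  proof -
    have t1: "1 \<le> t" using t by simp
    have "(?T has_real_derivative (\<Sum>i\<in>UNIV. integral\<^sup>L (cubeM R) (\<lambda>z. 1 * pd i (kern (mom \<psi> x i) x t) z)) / t\<^sup>2) (at t)"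
      by (rule kern_integral_deriv[OF _ p x t1 R]) (intro nice_integrable nice_const)
    thus ?thesis using z[OF t1] by (simp add: has_field_derivative_at_within)
  qed
  then obtain c where c: "\<And>t. t \<in> {1..} \<Longrightarrow> ?T t = c"
    using has_field_derivative_zero_constant[of "{1..}" ?T] by (auto simp: convex_real_interval)
  have "kern \<psi> x 1 = \<psi>" by (simp add: kern_def[abs_def])
  thus ?thesis using c[of \<sigma>] c[of 1] s by simp
qed

lemma kern_tendsto:
  fixes x :: "real^'n::finite"
  assumes p: "stest (cube R) \<psi>" and x: "x \<in> cube R" and R: "R > 0" and w: "nice R w"
  shows "((\<lambda>\<sigma>. integral\<^sup>L (cubeM R) (\<lambda>z. w z * kern \<psi> x \<sigma> z)) \<longlongrightarrow> w x * integral\<^sup>L (cubeM R) \<psi>) at_top"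
proof (rule tendstoI)
  fix e :: real assume e: "e > 0"
  let ?d = "CARD('n)"
  obtain S where S: "S \<ge> 0" "\<And>y. \<bar>\<psi> y\<bar> \<le> S" using stest_bounded[OF p] by metis
  \<comment> \<open>A bound for the L^1 norm of the kernels, uniform in \<open>\<sigma>\<close>; the
    summand 1 makes it positive.\<close>
  define A where "A = S * (4 * R) ^ ?d + 1"
  have A: "A > 0" using S R by (simp add: A_def add_nonneg_pos)
  have "isCont w x" using w x by (auto simp: nice_def continuous_on_eq_continuous_at)
  then obtain d where d: "d > 0" "\<And>z. dist z x < d \<Longrightarrow> dist (w z) (w x) < e / (2 * A)"
    using e A unfolding continuous_at_eps_delta by (metis divide_pos_pos mult_pos_pos zero_less_numeral)
  \<comment> \<open>Beyond this value every point of the support has l^1 distance less than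
    \<open>d\<close> from \<open>x\<close>.\<close>
  define \<sigma>0 where "\<sigma>0 = max 1 (2 * R * real ?d / d + 1)"
  have "dist (integral\<^sup>L (cubeM R) (\<lambda>z. w z * kern \<psi> x \<sigma> z)) (w x * integral\<^sup>L (cubeM R) \<psi>) < e" if s0: "\<sigma> \<ge> \<sigma>0" for \<sigma>
  proof -
    have s: "\<sigma> \<ge> 1" "\<sigma> > 2 * R * real ?d / d" using s0 by (auto simp: \<sigma>0_def)
    have kn: "nice R (kern \<psi> x \<sigma>)" by (intro smooth_nice smooth_kern stest_smooth[OF p])
    have "integral\<^sup>L (cubeM R) (\<lambda>z. w z * kern \<psi> x \<sigma> z) - w x * integral\<^sup>L (cubeM R) \<psi>
        = integral\<^sup>L (cubeM R) (\<lambda>z. w z * kern \<psi> x \<sigma> z) - integral\<^sup>L (cubeM R) (\<lambda>z. w x * kern \<psi> x \<sigma> z)"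
      using kern_mass[OF p x s(1) R] by simp
    also have "\<dots> = integral\<^sup>L (cubeM R) (\<lambda>z. w z * kern \<psi> x \<sigma> z - w x * kern \<psi> x \<sigma> z)"
      by (intro Bochner_Integration.integral_diff[symmetric] nice_integrable nice_mult nice_const w kn)
    finally have eq: "integral\<^sup>L (cubeM R) (\<lambda>z. w z * kern \<psi> x \<sigma> z) - w x * integral\<^sup>L (cubeM R) \<psi>
        = integral\<^sup>L (cubeM R) (\<lambda>z. (w z - w x) * kern \<psi> x \<sigma> z)" by (simp add: left_diff_distrib)
    have n: "nice R (\<lambda>z. (w z - w x) * kern \<psi> x \<sigma> z)" by (intro nice_intros w kn)
    have "\<bar>integral\<^sup>L (cubeM R) (\<lambda>z. (w z - w x) * kern \<psi> x \<sigma> z)\<bar> \<le> integral\<^sup>L (cubeM R) (\<lambda>z. \<bar>(w z - w x) * kern \<psi> x \<sigma> z\<bar>)"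
      by (rule integral_abs_bound)
    also have "\<dots> \<le> (e / (2 * A) * (\<sigma> ^ ?d * S)) * (4 * R / \<sigma>) ^ ?d"
    proof (rule integral_kern_bound[OF _ x s(1) _ R])
      show "nice R (\<lambda>z. \<bar>(w z - w x) * kern \<psi> x \<sigma> z\<bar>)" using n by (auto simp: nice_def intro!: continuous_intros)
      show "0 \<le> e / (2 * A) * (\<sigma> ^ ?d * S)" using e A S s by simp
      fix z :: "real^'n" assume z: "z \<in> cube R"
      have supp: "\<forall>i. \<bar>z $ i - x $ i\<bar> \<le> 2 * R / \<sigma>" if "\<bar>(w z - w x) * kern \<psi> x \<sigma> z\<bar> \<noteq> 0"
        using kern_support[OF p x s(1), of z] that by auto
      thus "\<bar>(w z - w x) * kern \<psi> x \<sigma> z\<bar> \<noteq> 0 \<Longrightarrow> \<forall>i. \<bar>z $ i - x $ i\<bar> \<le> 2 * R / \<sigma>" .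
      show "\<bar>(w z - w x) * kern \<psi> x \<sigma> z\<bar> \<le> e / (2 * A) * (\<sigma> ^ ?d * S)"
      proof (cases "(w z - w x) * kern \<psi> x \<sigma> z = 0")
        case True
        have "0 \<le> e / (2 * A) * (\<sigma> ^ ?d * S)" using e A S s by simp
        thus ?thesis unfolding True by simp
      next
        case False
        have "norm (z - x) \<le> (\<Sum>i\<in>UNIV. \<bar>(z - x) $ i\<bar>)" by (rule norm_le_l1_cart)
        also have "\<dots> \<le> (\<Sum>i\<in>(UNIV :: 'n set). 2 * R / \<sigma>)" using supp False by (intro sum_mono) auto
        also have "\<dots> < d" using s d(1) by (simp add: field_simps)
        finally have "dist (w z) (w x) < e / (2 * A)" by (intro d(2)) (simp add: dist_norm)
        hence 1: "\<bar>w z - w x\<bar> \<le> e / (2 * A)" by (simp add: dist_real_def)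
        have 2: "\<bar>kern \<psi> x \<sigma> z\<bar> \<le> \<sigma> ^ ?d * S" unfolding kern_def abs_mult using S(2) s by (intro mult_mono) auto
        show ?thesis unfolding abs_mult using e A by (intro mult_mono 1 2) auto
      qed
    qed
    also have "\<dots> = e / (2 * A) * (S * (4 * R) ^ ?d)" using s by (simp add: power_divide)
    also have "\<dots> \<le> e / (2 * A) * A" using e A by (intro mult_left_mono) (auto simp: A_def)
    also have "\<dots> < e" using e A by simp
    finally show ?thesis unfolding dist_real_def eq .
  qed
  thus "\<forall>\<^sub>F \<sigma> in at_top. dist (integral\<^sup>L (cubeM R) (\<lambda>z. w z * kern \<psi> x \<sigma> z)) (w x * integral\<^sup>L (cubeM R) \<psi>) < e"
    by (auto simp: eventually_at_top_linorder)
qed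

text \<open>Bumps on the whole cube converge to 1, so their integrals converge to its
  volume.\<close>

lemma exists_stest_pos:
  assumes "R > 0"
  obtains \<psi> where "stest (cube R :: (real^'n::finite) set) \<psi>" "integral\<^sup>L (cubeM R) \<psi> > 0"
proof -
  let ?c = "R *\<^sub>R One :: real^'n"
  have "(\<lambda>n. integral\<^sup>L (cubeM R) (boxbump n (- ?c) ?c)) \<longlonglongrightarrow> integral\<^sup>L (cubeM R) (\<lambda>x::real^'n. 1)"
  proof (rule integral_dominated_convergence[where w="\<lambda>_. 1"])
    show "integrable (cubeM R) (\<lambda>_::real^'n. 1::real)" by (intro nice_integrable nice_const)
    show "boxbump n (- ?c) ?c \<in> borel_measurable (cubeM R)" for n
      by (intro nice_measurable smooth_nice smooth_boxbump)
    show "AE x in cubeM R. (\<lambda>n. boxbump n (- ?c) ?c x) \<longlonglongrightarrow> 1"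
    proof (rule AE_I2)
      fix x :: "real^'n" assume "x \<in> space (cubeM R)"
      hence "x \<in> box (- ?c) ?c" by (simp add: cube_def)
      thus "(\<lambda>n. boxbump n (- ?c) ?c x) \<longlonglongrightarrow> 1" using boxbump_tendsto[of "- ?c" ?c x] by simp
    qed
    show "AE x in cubeM R. norm (boxbump n (- ?c) ?c x) \<le> 1" for n
      by (intro AE_I2) (simp add: abs_of_nonneg boxbump_bounds)
  qed simp
  moreover have "integral\<^sup>L (cubeM R) (\<lambda>x::real^'n. 1::real) > 0"
  proof -
    have "integral\<^sup>L (cubeM R) (\<lambda>x::real^'n. 1::real) = measure (cubeM R) (cube R :: (real^'n) set)" by simp
    also have "\<dots> = measure lebesgue (cube R :: (real^'n) set)" by (rule measure_restrict_space) auto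
    also have "\<dots> = measure lborel (cbox (- ?c) ?c)" unfolding cube_def by (simp add: measure_lborel_box_eq measure_lborel_cbox_eq)
    also have "\<dots> = (\<Prod>i\<in>UNIV. ?c $ i - (- ?c) $ i)"
    proof (rule content_cbox_cart)
      have "(0::real^'n) \<in> cbox (- ?c) ?c" using assms by (simp add: mem_box_cart)
      thus "cbox (- ?c) ?c \<noteq> {}" by blast
    qed
    also have "\<dots> > 0" using assms by (intro prod_pos) simp
    finally show ?thesis .
  qed
  ultimately have "eventually (\<lambda>n. integral\<^sup>L (cubeM R) (boxbump n (- ?c) ?c) > 0) sequentially"
    by (rule order_tendstoD)
  then obtain n where "n > 0" "integral\<^sup>L (cubeM R) (boxbump n (- ?c) ?c) > 0"
    unfolding eventually_sequentially by (metis le_SucI nat_le_linear zero_less_Suc)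
  moreover have "stest (cube R) (boxbump n (- ?c) ?c)" by (rule stest_boxbump[OF \<open>n > 0\<close>]) (simp add: cube_def)
  ultimately show ?thesis using that by blast
qed

text \<open>After \<open>c + 1\<close> derivatives the means against
  \<open>kern \<psi> x \<sigma>\<close> are bounded independently of \<open>\<sigma>\<close>; as
  \<open>\<sigma>\<close> tends to infinity they tend to \<open>w x\<close> times the positive mass
  of \<open>\<psi>\<close>.\<close>

lemma wchain_sup_bound:
  assumes R: "R > 0" and c: "CARD('n::finite) \<le> 2 * c"
  shows "\<exists>K\<ge>0. \<forall>V N (w :: real^'n \<Rightarrow> real) x \<alpha>. wchain R p V \<longrightarrow> N \<ge> 0 \<longrightarrow>
     (\<forall>\<alpha>\<in>multi_idx p. integral\<^sup>L (cubeM R) (\<lambda>z. (V \<alpha> z)\<^sup>2) \<le> N\<^sup>2) \<longrightarrow> x \<in> cube R \<longrightarrow>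
     sum \<alpha> UNIV + (c + 1) \<le> p \<longrightarrow> nice R w \<longrightarrow> (AE z in cubeM R. V \<alpha> z = w z) \<longrightarrow> \<bar>w x\<bar> \<le> K * N"
proof -
  obtain \<psi> where p: "stest (cube R :: (real^'n) set) \<psi>" "integral\<^sup>L (cubeM R) \<psi> > 0" using exists_stest_pos[OF R] .
  obtain S where S: "S \<ge> 0" "\<And>y. \<bar>\<psi> y\<bar> \<le> S" using stest_bounded[OF p(1)] by metis
  from wchain_kern_bound[OF R c order_refl, rule_format, OF S(1), of p]
  obtain C where C: "C \<ge> 0" and b: "\<And>V N (x::real^'n) \<psi> \<alpha> \<sigma>. wchain R p V \<Longrightarrow> N \<ge> 0 \<Longrightarrow>
     (\<forall>\<alpha>\<in>multi_idx p. integral\<^sup>L (cubeM R) (\<lambda>z. (V \<alpha> z)\<^sup>2) \<le> N\<^sup>2) \<Longrightarrow> x \<in> cube R \<Longrightarrow>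
     stest (cube R) \<psi> \<Longrightarrow> (\<forall>y. \<bar>\<psi> y\<bar> \<le> S) \<Longrightarrow> sum \<alpha> UNIV + (c + 1) \<le> p \<Longrightarrow> \<sigma> \<ge> 1 \<Longrightarrow>
     \<bar>integral\<^sup>L (cubeM R) (\<lambda>z. V \<alpha> z * kern \<psi> x \<sigma> z)\<bar>
       \<le> C * N * (if c + 1 = c + 1 then 1 else \<sigma> powr (real (c + 1 - (c + 1)) - 1 / 2))" by blast
  let ?I = "integral\<^sup>L (cubeM R) \<psi>"
  show ?thesis
  proof (intro exI[of _ "C / ?I"] conjI allI impI)
    show "0 \<le> C / ?I" using C p(2) by simp
    fix V :: "('n \<Rightarrow> nat) \<Rightarrow> real^'n \<Rightarrow> real" and N and w :: "real^'n \<Rightarrow> real" and x :: "real^'n" and \<alpha> :: "'n \<Rightarrow> nat"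
    assume a: "wchain R p V" "N \<ge> 0" "\<forall>\<alpha>\<in>multi_idx p. integral\<^sup>L (cubeM R) (\<lambda>z. (V \<alpha> z)\<^sup>2) \<le> N\<^sup>2"
      "x \<in> cube R" "sum \<alpha> UNIV + (c + 1) \<le> p" "nice R w" "AE z in cubeM R. V \<alpha> z = w z"
    have m: "\<alpha> \<in> multi_idx p" using a(5) by (simp add: multi_idx_def)
    have bd: "\<bar>integral\<^sup>L (cubeM R) (\<lambda>z. w z * kern \<psi> x \<sigma> z)\<bar> \<le> C * N" if "\<sigma> \<ge> 1" for \<sigma>
    proof -
      have kn: "nice R (kern \<psi> x \<sigma>)" by (intro smooth_nice smooth_kern stest_smooth[OF p(1)])
      have "integral\<^sup>L (cubeM R) (\<lambda>z. w z * kern \<psi> x \<sigma> z) = integral\<^sup>L (cubeM R) (\<lambda>z. V \<alpha> z * kern \<psi> x \<sigma> z)"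
      proof (rule integral_cong_AE)
        show "(\<lambda>z. w z * kern \<psi> x \<sigma> z) \<in> borel_measurable (cubeM R)" by (intro nice_measurable nice_mult a kn)
        show "(\<lambda>z. V \<alpha> z * kern \<psi> x \<sigma> z) \<in> borel_measurable (cubeM R)"
          using a(1) m by (intro borel_measurable_times nice_measurable kn sqint_measurable) (auto simp: wchain_def)
        show "AE z in cubeM R. w z * kern \<psi> x \<sigma> z = V \<alpha> z * kern \<psi> x \<sigma> z" using a(7) by eventually_elim simp
      qed
      thus ?thesis using b[OF a(1-4) p(1) _ a(5) that] S(2) by simp
    qed
    have "((\<lambda>\<sigma>. \<bar>integral\<^sup>L (cubeM R) (\<lambda>z. w z * kern \<psi> x \<sigma> z)\<bar>) \<longlongrightarrow> \<bar>w x * ?I\<bar>) at_top"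
      by (intro tendsto_rabs kern_tendsto p a R)
    moreover have "\<forall>\<^sub>F \<sigma> in at_top. \<bar>integral\<^sup>L (cubeM R) (\<lambda>z. w z * kern \<psi> x \<sigma> z)\<bar> \<le> C * N"
      using eventually_ge_at_top[of 1] by eventually_elim (rule bd)
    ultimately have "\<bar>w x * ?I\<bar> \<le> C * N" by (rule tendsto_upperbound) simp
    thus "\<bar>w x\<bar> \<le> C / ?I * N" using p(2) by (simp add: abs_mult field_simps)
  qed
qed

lemma sobolev_embedding:
  assumes R: "R > 0" and p: "real p > real_of_int \<lceil>real CARD('n::finite) / 2\<rceil> + 2"
  obtains K where "K \<ge> 0" "\<And>(u :: real^'n \<Rightarrow> real) x. u \<in> sobolev (cube R) p \<Longrightarrow> C2_cl R u \<Longrightarrow> x \<in> cube R \<Longrightarrow>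
      \<bar>u x\<bar> \<le> K * sob_norm (cube R) p u \<and> (\<forall>i. \<bar>pd i u x\<bar> \<le> K * sob_norm (cube R) p u) \<and>
      (\<forall>i j. \<bar>pd j (pd i u) x\<bar> \<le> K * sob_norm (cube R) p u)"
proof -
  define c where "c = nat \<lceil>real CARD('n) / 2\<rceil>"
  have c0: "real c = real_of_int \<lceil>real CARD('n) / 2\<rceil>" unfolding c_def by (simp add: of_nat_nat)
  have "real CARD('n) / 2 \<le> real c" unfolding c0 by simp
  hence c: "CARD('n) \<le> 2 * c" by linarith
  \<comment> \<open>\<open>c + 1\<close> derivatives pay for the sup bound and two more are kept for
    the second derivatives of \<open>u\<close>; this is where the hypothesis on \<open>p\<close>
    enters.\<close>
  have cp: "c + 3 \<le> p" using p unfolding c0[symmetric] by linarith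
  from wchain_sup_bound[OF R c, of p] obtain K where K: "K \<ge> 0" and
    b: "\<And>V N (w :: real^'n \<Rightarrow> real) x \<alpha>. wchain R p V \<Longrightarrow> N \<ge> 0 \<Longrightarrow>
     (\<forall>\<alpha>\<in>multi_idx p. integral\<^sup>L (cubeM R) (\<lambda>z. (V \<alpha> z)\<^sup>2) \<le> N\<^sup>2) \<Longrightarrow> x \<in> cube R \<Longrightarrow>
     sum \<alpha> UNIV + (c + 1) \<le> p \<Longrightarrow> nice R w \<Longrightarrow> (AE z in cubeM R. V \<alpha> z = w z) \<Longrightarrow> \<bar>w x\<bar> \<le> K * N" by blast
  show ?thesis
  proof (rule that[OF K])
    fix u :: "real^'n \<Rightarrow> real" and x :: "real^'n"
    assume u: "u \<in> sobolev (cube R) p" "C2_cl R u" and x: "x \<in> cube R"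
    have N: "\<forall>\<alpha>\<in>multi_idx p. integral\<^sup>L (cubeM R) (\<lambda>z. (wd (cube R) \<alpha> u z)\<^sup>2) \<le> (sob_norm (cube R) p u)\<^sup>2"
    proof
      fix \<alpha> :: "'n \<Rightarrow> nat" assume "\<alpha> \<in> multi_idx p"
      hence "integral\<^sup>L (cubeM R) (\<lambda>z. wd (cube R) \<alpha> u z * wd (cube R) \<alpha> u z)
         \<le> (\<Sum>\<alpha>\<in>multi_idx p. integral\<^sup>L (cubeM R) (\<lambda>z. wd (cube R) \<alpha> u z * wd (cube R) \<alpha> u z))"
        by (intro member_le_sum integral_nonneg_AE AE_I2) auto
      thus "integral\<^sup>L (cubeM R) (\<lambda>z. (wd (cube R) \<alpha> u z)\<^sup>2) \<le> (sob_norm (cube R) p u)\<^sup>2"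
        unfolding sob_norm_sq sob_inner_eq by (simp add: power2_eq_square)
    qed
    note B = b[OF wchain_wd[OF u(1)] sob_norm_nonneg N x]
    have p1: "1 \<le> p" "2 \<le> p" using cp by auto
    show "\<bar>u x\<bar> \<le> K * sob_norm (cube R) p u \<and> (\<forall>i. \<bar>pd i u x\<bar> \<le> K * sob_norm (cube R) p u) \<and>
      (\<forall>i j. \<bar>pd j (pd i u) x\<bar> \<le> K * sob_norm (cube R) p u)"
      by (intro conjI allI;
          rule B[OF _ _ wd_0_AE[OF u(1)]] B[OF _ _ wd_1_AE[OF u p1(1)]] B[OF _ _ wd_2_AE[OF u p1(2)]])
         (use cp C2_cl_nice[OF u(2)] in \<open>auto simp: sum_mi_inc\<close>)
  qed
qed

section \<open>Weighted integration by parts\<close>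

lemma ldiff_cong: "(\<And>x. x \<in> cube R \<Longrightarrow> f x = g x) \<Longrightarrow> ldiff R i f \<longleftrightarrow> ldiff R i g"
  unfolding ldiff_def
  using differentiable_cong_open[OF open_cube[of R], where f=f and g=g] differentiable_cong_open[OF open_cube[of R], where f=g and g=f]
  by (intro ball_cong refl iffI) (auto simp: fun_eq_iff)

lemma pd_cong_cube: "(\<And>x. x \<in> cube R \<Longrightarrow> f x = g x) \<Longrightarrow> x \<in> cube R \<Longrightarrow> pd i f x = pd i g x"
  by (rule pd_cong[OF open_cube])

lemma pd_mult_cube: "x \<in> cube R \<Longrightarrow> ldiff R i f \<Longrightarrow> ldiff R i g \<Longrightarrow> pd i (\<lambda>x. f x * g x) x = pd i f x * g x + f x * pd i g x"
  unfolding ldiff_def by (intro pd_mult_line) auto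

lemma pd_add_cube: "x \<in> cube R \<Longrightarrow> ldiff R i f \<Longrightarrow> ldiff R i g \<Longrightarrow> pd i (\<lambda>x. f x + g x) x = pd i f x + pd i g x"
  unfolding ldiff_def pd_def[of i "\<lambda>x. f x + g x"]
  by (intro DERIV_imp_deriv DERIV_add pd_line_deriv) auto

lemma ldiff_add: "ldiff R i f \<Longrightarrow> ldiff R i g \<Longrightarrow> ldiff R i (\<lambda>x. f x + g x)"
  by (simp add: ldiff_def)

text \<open>The interior content of \<open>C2_cl\<close>. Boundary limits are recorded apart from
  it, in \<open>zero_bdry\<close>, so that products with the exponential weight are treated without
  limits of second derivatives.\<close>

definition c2 :: "real \<Rightarrow> (real^'n::finite \<Rightarrow> real) \<Rightarrow> bool" where
  "c2 R u \<longleftrightarrow> nice R u \<and> (\<forall>i. ldiff R i u \<and> nice R (pd i u) \<and> (\<forall>j. ldiff R j (pd i u) \<and> nice R (pd j (pd i u))))"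

lemma c2_D:
  assumes "c2 R u"
  shows "nice R u" "ldiff R i u" "nice R (pd i u)" "ldiff R j (pd i u)" "nice R (pd j (pd i u))"
  using assms by (auto simp: c2_def)

lemma C2_cl_c2: "C2_cl R u \<Longrightarrow> c2 R u"
  unfolding c2_def by (intro conjI allI C2_cl_nice C2_cl_ldiff)

lemma c2_pd_commute:
  assumes "c2 R u" "x \<in> cube R" shows "pd i (pd j u) x = pd j (pd i u) x"
  by (rule pd_commute_open[OF open_cube assms(2)])
     (use assms(1) in \<open>auto simp: c2_def ldiff_def nice_def\<close>)

lemma c2_mult_pd:
  assumes f: "c2 R f" and g: "c2 R g" and x: "x \<in> cube R"
  shows "pd i (\<lambda>x. f x * g x) x = pd i f x * g x + f x * pd i g x"
    "pd j (pd i (\<lambda>x. f x * g x)) x = pd j (pd i f) x * g x + pd i f x * pd j g x + pd j f x * pd i g x + f x * pd j (pd i g) x"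
proof -
  have 1: "pd i (\<lambda>x. f x * g x) x = pd i f x * g x + f x * pd i g x" if "x \<in> cube R" for x
    by (intro pd_mult_cube[OF that] c2_D f g)
  show "pd i (\<lambda>x. f x * g x) x = pd i f x * g x + f x * pd i g x" by (rule 1[OF x])
  have "pd j (pd i (\<lambda>x. f x * g x)) x = pd j (\<lambda>x. pd i f x * g x + f x * pd i g x) x"
    by (rule pd_cong_cube[OF 1 x])
  also have "\<dots> = pd j (\<lambda>x. pd i f x * g x) x + pd j (\<lambda>x. f x * pd i g x) x"
    by (intro pd_add_cube[OF x] ldiff_mult c2_D f g)
  also have "pd j (\<lambda>x. pd i f x * g x) x = pd j (pd i f) x * g x + pd i f x * pd j g x"
    by (intro pd_mult_cube[OF x] c2_D f g)
  also have "pd j (\<lambda>x. f x * pd i g x) x = pd j f x * pd i g x + f x * pd j (pd i g) x"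
    by (intro pd_mult_cube[OF x] c2_D f g)
  finally show "pd j (pd i (\<lambda>x. f x * g x)) x = pd j (pd i f) x * g x + pd i f x * pd j g x + pd j f x * pd i g x + f x * pd j (pd i g) x"
    by simp
qed

lemma c2_mult:
  assumes f: "c2 R f" and g: "c2 R g" shows "c2 R (\<lambda>x. f x * g x)"
  unfolding c2_def
proof (intro conjI allI)
  show "nice R (\<lambda>x. f x * g x)" by (intro nice_mult c2_D f g)
  fix i show "ldiff R i (\<lambda>x. f x * g x)" by (intro ldiff_mult c2_D f g)
  show "nice R (pd i (\<lambda>x. f x * g x))"
    by (subst nice_cong[OF c2_mult_pd(1)[OF f g]], assumption) (intro nice_add nice_mult c2_D f g)
  fix j show "ldiff R j (pd i (\<lambda>x. f x * g x))"
    by (subst ldiff_cong[OF c2_mult_pd(1)[OF f g]], assumption) (intro ldiff_add ldiff_mult c2_D f g)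
  show "nice R (pd j (pd i (\<lambda>x. f x * g x)))"
    by (subst nice_cong[OF c2_mult_pd(2)[OF f g]], assumption) (intro nice_add nice_mult c2_D f g)
qed

section \<open>Functions of the distinguished coordinate\<close>

lemma coord_interval: "x \<in> cube R \<Longrightarrow> - R \<le> x $ k \<and> x $ k \<le> R"
  by (auto simp: mem_cube less_imp_le)

lemma continuous_coord:
  assumes "continuous_on {- R..R} m"
  shows "continuous_on (ccube R) (\<lambda>x. m (x $ k))"
proof (rule continuous_on_compose2[OF assms])
  show "continuous_on (ccube R) (\<lambda>x. x $ k)" by (intro continuous_intros)
  show "(\<lambda>x. x $ k) ` ccube R \<subseteq> {- R..R}" by (auto simp: mem_ccube)
qed

lemma nice_coord: "continuous_on {- R..R} m \<Longrightarrow> nice R (\<lambda>x. m (x $ k))"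
  by (rule nice_continuous_ccube[OF continuous_coord])

lemma coord_line:
  assumes D: "\<And>z. - R \<le> z \<Longrightarrow> z \<le> R \<Longrightarrow> (m has_real_derivative m' z) (at z)" and x: "x \<in> cube R"
  shows "((\<lambda>t. m ((x + t *\<^sub>R axis i 1) $ k)) has_real_derivative (if i = k then m' (x $ k) else 0)) (at 0)"
proof (cases "i = k")
  case True
  have "(m has_real_derivative m' (x $ k)) (at (x $ k + 0))" using D coord_interval[OF x] by simp
  hence "((\<lambda>t. m (x $ k + t)) has_real_derivative m' (x $ k) * 1) (at 0)"
    by (rule DERIV_chain2[where f=m and g="\<lambda>t. x $ k + t"]) (auto intro!: derivative_eq_intros)
  thus ?thesis using True by simp
next
  case False
  thus ?thesis by (simp add: axis_def)
qed

lemma coord_pd: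
  assumes D: "\<And>z. - R \<le> z \<Longrightarrow> z \<le> R \<Longrightarrow> (m has_real_derivative m' z) (at z)"
  shows "x \<in> cube R \<Longrightarrow> pd i (\<lambda>x. m (x $ k)) x = (if i = k then m' (x $ k) else 0)"
    "ldiff R i (\<lambda>x. m (x $ k))"
proof -
  show "x \<in> cube R \<Longrightarrow> pd i (\<lambda>x. m (x $ k)) x = (if i = k then m' (x $ k) else 0)"
    unfolding pd_def by (rule DERIV_imp_deriv[OF coord_line]) (use D in auto)
  show "ldiff R i (\<lambda>x. m (x $ k))"
    unfolding ldiff_def using coord_line[of R m m'] D real_differentiable_def by blast
qed

lemma DERIV_continuous_on_interval:
  assumes "\<And>z. - R \<le> z \<Longrightarrow> z \<le> R \<Longrightarrow> (m has_real_derivative m' z) (at z)"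
  shows "continuous_on {- R..R} (m :: real \<Rightarrow> real)"
  using assms by (auto intro!: continuous_at_imp_continuous_on DERIV_isCont)

lemma coord_c2:
  assumes D: "\<And>z. - R \<le> z \<Longrightarrow> z \<le> R \<Longrightarrow> (m has_real_derivative m' z) (at z)"
    and D': "\<And>z. - R \<le> z \<Longrightarrow> z \<le> R \<Longrightarrow> (m' has_real_derivative m'' z) (at z)"
    and c: "continuous_on {- R..R} m''"
  shows "c2 R (\<lambda>x. m (x $ k))"
    "x \<in> cube R \<Longrightarrow> pd j (pd i (\<lambda>x. m (x $ k))) x = (if i = k \<and> j = k then m'' (x $ k) else 0)"
proof -
  have z: "ldiff R j (\<lambda>x. 0)" "pd j (\<lambda>x. 0) x = 0" for j x by (auto simp: ldiff_def)
  have eq: "pd i (\<lambda>x. m (x $ k)) x = (if i = k then m' (x $ k) else 0)" if "x \<in> cube R" for i x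
    using coord_pd(1)[of R m m', OF D that] by simp
  have eq2: "pd j (pd i (\<lambda>x. m (x $ k))) x = (if i = k \<and> j = k then m'' (x $ k) else 0)" if "x \<in> cube R" for i j x
    by (subst pd_cong_cube[OF eq that], assumption) (use coord_pd(1)[of R m' m'', OF D' that] z in \<open>cases "i = k"; simp\<close>)
  show "x \<in> cube R \<Longrightarrow> pd j (pd i (\<lambda>x. m (x $ k))) x = (if i = k \<and> j = k then m'' (x $ k) else 0)" by (rule eq2)
  show "c2 R (\<lambda>x. m (x $ k))"
    unfolding c2_def
  proof (intro conjI allI)
    show "nice R (\<lambda>x. m (x $ k))" by (intro nice_coord DERIV_continuous_on_interval[OF D])
    fix i show "ldiff R i (\<lambda>x. m (x $ k))" by (rule coord_pd[OF D])
    show "nice R (pd i (\<lambda>x. m (x $ k)))"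
      by (subst nice_cong[OF eq], assumption) (use nice_coord[OF DERIV_continuous_on_interval[OF D']] nice_const in \<open>cases "i = k"; simp\<close>)
    fix j show "ldiff R j (pd i (\<lambda>x. m (x $ k)))"
      by (subst ldiff_cong[OF eq], assumption) (use coord_pd(2)[of R m' m'', OF D'] z in \<open>cases "i = k"; simp\<close>)
    show "nice R (pd j (pd i (\<lambda>x. m (x $ k))))"
      by (subst nice_cong[OF eq2], assumption) (use nice_coord[OF c] nice_const in \<open>cases "i = k"; cases "j = k"; simp\<close>)
  qed
qed

text \<open>The second clause records that Dirichlet data zero make the tangential derivatives vanish on
  every face, the third is the Neumann condition on the top face.\<close>

definition zero_bdry :: "real \<Rightarrow> 'n \<Rightarrow> (real^'n::finite \<Rightarrow> real) \<Rightarrow> bool" where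
  "zero_bdry R k u \<longleftrightarrow> (\<forall>x\<in>bdry R. (u \<longlongrightarrow> 0) (at x within cube R)) \<and>
     (\<forall>i j c x. (c = R \<or> c = - R) \<longrightarrow> x \<in> face R j c \<longrightarrow> i \<noteq> j \<longrightarrow> (pd i u \<longlongrightarrow> 0) (at x within cube R)) \<and>
     (\<forall>x\<in>face R k R. (pd k u \<longlongrightarrow> 0) (at x within cube R)) \<and>
     (\<forall>i. \<forall>x\<in>bdry R. \<exists>l. (pd i u \<longlongrightarrow> l) (at x within cube R))"

lemma zero_bdry_D:
  assumes "zero_bdry R k u"
  shows "x \<in> bdry R \<Longrightarrow> (u \<longlongrightarrow> 0) (at x within cube R)"
    "c = R \<or> c = - R \<Longrightarrow> x \<in> face R j c \<Longrightarrow> i \<noteq> j \<Longrightarrow> (pd i u \<longlongrightarrow> 0) (at x within cube R)"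
    "x \<in> face R k R \<Longrightarrow> (pd k u \<longlongrightarrow> 0) (at x within cube R)"
    "x \<in> bdry R \<Longrightarrow> \<exists>l. (pd i u \<longlongrightarrow> l) (at x within cube R)"
proof -
  note z = assms[unfolded zero_bdry_def]
  show "x \<in> bdry R \<Longrightarrow> (u \<longlongrightarrow> 0) (at x within cube R)" using conjunct1[OF z] by (rule bspec)
  show "c = R \<or> c = - R \<Longrightarrow> x \<in> face R j c \<Longrightarrow> i \<noteq> j \<Longrightarrow> (pd i u \<longlongrightarrow> 0) (at x within cube R)"
    by (rule conjunct1[OF conjunct2[OF z], rule_format])
  show "x \<in> face R k R \<Longrightarrow> (pd k u \<longlongrightarrow> 0) (at x within cube R)"
    using conjunct1[OF conjunct2[OF conjunct2[OF z]]] by (rule bspec)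
  show "x \<in> bdry R \<Longrightarrow> \<exists>l. (pd i u \<longlongrightarrow> l) (at x within cube R)"
    using conjunct2[OF conjunct2[OF conjunct2[OF z]]] by simp
qed

text \<open>Membership in \<open>H0set\<close> speaks of values and of the normal derivative on top;
  the vanishing of the tangential derivatives is a consequence, supplied by
  \<open>C2_cl_tangential\<close>.\<close>

lemma H0set_zero_bdry:
  assumes "h \<in> H0set R p k" "R > 0" shows "C2_cl R h" "zero_bdry R k h"
proof -
  have h: "C2_cl R h" "\<And>x. x \<in> bdry R \<Longrightarrow> h x = 0" "\<And>x. x \<in> gamma_plus k R \<Longrightarrow> (pd k h \<longlongrightarrow> 0) (at x within cube R)"
    using assms(1) by (auto simp: H0set_def Hset_def Hp_def)
  show "C2_cl R h" by (rule h)
  show "zero_bdry R k h"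
    unfolding zero_bdry_def
  proof (intro conjI ballI allI impI)
    show "(h \<longlongrightarrow> 0) (at x within cube R)" if "x \<in> bdry R" for x
      by (rule C2_cl_tendsto_bdry[OF h(1,2) that])
    show "(pd i h \<longlongrightarrow> 0) (at x within cube R)" if "c = R \<or> c = - R" "x \<in> face R j c" "i \<noteq> j" for i j c x
      by (rule C2_cl_tangential[OF h(1,2) assms(2) that])
    show "(pd k h \<longlongrightarrow> 0) (at x within cube R)" if "x \<in> face R k R" for x
      using h(3)[of x] face_bdry[OF assms(2) _ that] that by (auto simp: gamma_plus_def face_def)
    show "\<exists>l. (pd i h \<longlongrightarrow> l) (at x within cube R)" if "x \<in> bdry R" for i x
      using h(1) that by (auto simp: C2_cl_def bdry_def)
  qed
qed

lemma tendsto_cong_cube: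
  assumes "\<And>x. x \<in> cube R \<Longrightarrow> f x = g x" "(g \<longlongrightarrow> l) (at x within cube R)"
  shows "(f \<longlongrightarrow> l) (at x within cube R)"
proof -
  have "\<forall>\<^sub>F x in at x within cube R. f x = g x"
    unfolding eventually_at_filter using assms(1) by (auto intro: always_eventually)
  thus ?thesis using tendsto_cong assms(2) by blast
qed

lemma coord_tendsto:
  assumes "continuous_on {- R..R} m" "x \<in> bdry R"
  shows "((\<lambda>x. m (x $ k)) \<longlongrightarrow> m (x $ k)) (at x within cube R)"
proof -
  have "continuous_on (ccube R) (\<lambda>x. m (x $ k))"
    by (rule continuous_coord[OF assms(1)])
  hence "((\<lambda>x. m (x $ k)) \<longlongrightarrow> m (x $ k)) (at x within ccube R)"
    using assms(2) by (auto simp: continuous_on_def bdry_def)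
  thus ?thesis by (rule tendsto_within_subset[OF _ cube_subset_ccube])
qed

text \<open>The term with \<open>m'\<close> carries the factor \<open>h\<close>, which tends to 0 at
  the boundary, so the limits of the first derivatives are only rescaled by
  \<open>m\<close>.\<close>

lemma zero_bdry_mult_coord:
  assumes R: "R > 0" and D: "\<And>z. - R \<le> z \<Longrightarrow> z \<le> R \<Longrightarrow> (m has_real_derivative m' z) (at z)"
    and c: "continuous_on {- R..R} m'" and h: "c2 R h" "zero_bdry R k h"
  shows "zero_bdry R k (\<lambda>x. m (x $ k) * h x)"
proof -
  have eq: "pd i (\<lambda>x. m (x $ k) * h x) x = (if i = k then m' (x $ k) else 0) * h x + m (x $ k) * pd i h x" if "x \<in> cube R" for i x
    using pd_mult_cube[OF that coord_pd(2)[of R m m', OF D] c2_D(2)[OF h(1)]] coord_pd(1)[of R m m', OF D that] by simp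
  note cm = coord_tendsto[OF DERIV_continuous_on_interval[OF D]]
  have cm': "\<exists>l. ((\<lambda>x. if i = k then m' (x $ k) else 0) \<longlongrightarrow> l) (at x within cube R)" if "x \<in> bdry R" for i x
    using coord_tendsto[OF c that] by (cases "i = k") auto
  have h0: "(h \<longlongrightarrow> 0) (at x within cube R)" if "x \<in> bdry R" for x by (rule zero_bdry_D(1)[OF h(2) that])
  have pdl: "(pd i (\<lambda>x. m (x $ k) * h x) \<longlongrightarrow> m (x $ k) * l) (at x within cube R)"
    if x: "x \<in> bdry R" and l: "(pd i h \<longlongrightarrow> l) (at x within cube R)" for i x l
  proof (rule tendsto_cong_cube[OF eq])
    obtain l' where l': "((\<lambda>x. if i = k then m' (x $ k) else 0) \<longlongrightarrow> l') (at x within cube R)" using cm'[OF x] by blast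
    show "((\<lambda>x. (if i = k then m' (x $ k) else 0) * h x + m (x $ k) * pd i h x) \<longlongrightarrow> m (x $ k) * l) (at x within cube R)"
      using tendsto_add[OF tendsto_mult[OF l' h0[OF x]] tendsto_mult[OF cm[OF _ _ x] l]] by simp
  qed
  show ?thesis
    unfolding zero_bdry_def
  proof (intro conjI ballI allI impI)
    show "((\<lambda>x. m (x $ k) * h x) \<longlongrightarrow> 0) (at x within cube R)" if "x \<in> bdry R" for x
      using tendsto_mult[OF cm[OF _ _ that] h0[OF that]] by simp
    show "(pd i (\<lambda>x. m (x $ k) * h x) \<longlongrightarrow> 0) (at x within cube R)" if "c = R \<or> c = - R" "x \<in> face R j c" "i \<noteq> j" for i j c x
      using pdl[OF face_bdry[OF R that(1,2)] zero_bdry_D(2)[OF h(2) that]] by simp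
    show "(pd k (\<lambda>x. m (x $ k) * h x) \<longlongrightarrow> 0) (at x within cube R)" if "x \<in> face R k R" for x
      using pdl[OF face_bdry[OF R _ that] zero_bdry_D(3)[OF h(2) that]] by simp
    show "\<exists>l. (pd i (\<lambda>x. m (x $ k) * h x) \<longlongrightarrow> l) (at x within cube R)" if "x \<in> bdry R" for i x
    proof -
      from zero_bdry_D(4)[OF h(2) that] obtain l where l: "(pd i h \<longlongrightarrow> l) (at x within cube R)" by blast
      from pdl[OF that l] show ?thesis by blast
    qed
  qed
qed

section \<open>Integral identities with a weight in the distinguished coordinate\<close>

lemma div_zero:
  fixes G :: "real^'n::finite \<Rightarrow> real"
  assumes "nice R G" "ldiff R i G" "nice R D" "\<And>x. x \<in> cube R \<Longrightarrow> pd i G x = D x"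
    "\<And>x c. c = R \<or> c = - R \<Longrightarrow> x \<in> face R i c \<Longrightarrow> (G \<longlongrightarrow> 0) (at x within cube R)"
  shows "integral\<^sup>L (cubeM R) D = 0"
proof -
  have n: "nice R (pd i G)" using assms(3,4) nice_cong[of R "pd i G" D] by blast
  have "integral\<^sup>L (cubeM R) (pd i G) = 0"
    by (rule integral_pd_zero[OF assms(1,2) n]) (use assms(5) in blast)+
  moreover have "integral\<^sup>L (cubeM R) (pd i G) = integral\<^sup>L (cubeM R) D"
    by (intro Bochner_Integration.integral_cong) (use assms(4) in auto)
  ultimately show ?thesis by simp
qed

lemma div_nonpos:
  fixes G :: "real^'n::finite \<Rightarrow> real"
  assumes "nice R G" "ldiff R i G" "nice R D" "\<And>x. x \<in> cube R \<Longrightarrow> pd i G x = D x"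
    "\<And>x. x \<in> face R i R \<Longrightarrow> (G \<longlongrightarrow> 0) (at x within cube R)"
    "\<And>x. x \<in> face R i (- R) \<Longrightarrow> \<exists>l\<ge>0. (G \<longlongrightarrow> l) (at x within cube R)"
  shows "integral\<^sup>L (cubeM R) D \<le> 0"
proof -
  have n: "nice R (pd i G)" using assms(3,4) nice_cong[of R "pd i G" D] by blast
  have "integral\<^sup>L (cubeM R) (pd i G) \<le> 0"
    by (rule integral_pd_nonpos[OF assms(1,2) n assms(5,6)])
  moreover have "integral\<^sup>L (cubeM R) (pd i G) = integral\<^sup>L (cubeM R) D"
    by (intro Bochner_Integration.integral_cong) (use assms(4) in auto)
  ultimately show ?thesis by simp
qed

context
  fixes R :: real and k :: "'n::finite" and w :: "real^'n \<Rightarrow> real" and m m' :: "real \<Rightarrow> real"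
  assumes R: "R > 0" and w: "c2 R w" "zero_bdry R k w"
    and D: "\<And>z. - R \<le> z \<Longrightarrow> z \<le> R \<Longrightarrow> (m has_real_derivative m' z) (at z)"
    and c: "continuous_on {- R..R} m'"
begin

private lemma mn: "nice R (\<lambda>x. m (x $ k))" "nice R (\<lambda>x. m' (x $ k))"
  by (rule nice_coord[OF DERIV_continuous_on_interval[OF D]], assumption+) (rule nice_coord[OF c])

private lemma ml: "ldiff R i (\<lambda>x. m (x $ k))"
  by (rule coord_pd[OF D])

private lemma mpd: "x \<in> cube R \<Longrightarrow> pd i (\<lambda>x. m (x $ k)) x = (if i = k then m' (x $ k) else 0)"
  using coord_pd(1)[of R m m', OF D] .

private lemma mt: "x \<in> bdry R \<Longrightarrow> ((\<lambda>x. m (x $ k)) \<longlongrightarrow> m (x $ k)) (at x within cube R)"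
  by (rule coord_tendsto[OF DERIV_continuous_on_interval[OF D]])

private lemmas wn = c2_D[OF w(1)]

private lemma w0: "c = R \<or> c = - R \<Longrightarrow> x \<in> face R i c \<Longrightarrow> (w \<longlongrightarrow> 0) (at x within cube R)"
  by (rule zero_bdry_D(1)[OF w(2) face_bdry[OF R]])

private lemma wt: "c = R \<or> c = - R \<Longrightarrow> x \<in> face R j c \<Longrightarrow> i \<noteq> j \<Longrightarrow> (pd i w \<longlongrightarrow> 0) (at x within cube R)"
  by (rule zero_bdry_D(2)[OF w(2)])

private lemma wl: "c = R \<or> c = - R \<Longrightarrow> x \<in> face R j c \<Longrightarrow> \<exists>l. (pd i w \<longlongrightarrow> l) (at x within cube R)"
  by (rule zero_bdry_D(4)[OF w(2) face_bdry[OF R]])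

text \<open>Integrates the derivative of \<open>m w\<^sup>2\<close> in direction
  \<open>k\<close>.\<close>

lemma ibp_square:
  "integral\<^sup>L (cubeM R) (\<lambda>x. m' (x $ k) * (w x)\<^sup>2) + 2 * integral\<^sup>L (cubeM R) (\<lambda>x. m (x $ k) * w x * pd k w x) = 0"
proof -
  let ?D = "\<lambda>x. m' (x $ k) * (w x)\<^sup>2 + 2 * (m (x $ k) * w x * pd k w x)"
  have n: "nice R (\<lambda>x. m' (x $ k) * (w x)\<^sup>2)" "nice R (\<lambda>x. m (x $ k) * w x * pd k w x)"
    by (intro nice_mult nice_power mn wn)+
  have "integral\<^sup>L (cubeM R) ?D = 0"
  proof (rule div_zero[where i=k and G="\<lambda>x. m (x $ k) * (w x * w x)"])
    show "nice R (\<lambda>x. m (x $ k) * (w x * w x))" by (intro nice_mult mn wn)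
    show "ldiff R k (\<lambda>x. m (x $ k) * (w x * w x))" by (intro ldiff_mult ml wn)
    show "nice R ?D" by (intro nice_add nice_mult nice_const n)
    show "pd k (\<lambda>x. m (x $ k) * (w x * w x)) x = ?D x" if "x \<in> cube R" for x
      using mpd[OF that, of k]
      by (subst pd_mult_cube[OF that ml ldiff_mult[OF wn(2) wn(2)]], subst pd_mult_cube[OF that wn(2) wn(2)])
         (simp add: power2_eq_square algebra_simps)
    show "((\<lambda>x. m (x $ k) * (w x * w x)) \<longlongrightarrow> 0) (at x within cube R)" if "c = R \<or> c = - R" "x \<in> face R k c" for x c
      using tendsto_mult[OF mt[OF face_bdry[OF R that]] tendsto_mult[OF w0[OF that] w0[OF that]]] by simp
  qed
  thus ?thesis using nice_integrable[OF n(1)] nice_integrable[OF n(2)] by simp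
qed

text \<open>Integrates the derivative of \<open>m w (pd j w)\<close> in direction \<open>j\<close>;
  the weight itself is differentiated only for \<open>j = k\<close>.\<close>

lemma ibp_lap:
  "integral\<^sup>L (cubeM R) (\<lambda>x. m (x $ k) * (pd j w x)\<^sup>2) + integral\<^sup>L (cubeM R) (\<lambda>x. m (x $ k) * w x * pd j (pd j w) x)
    + (if j = k then integral\<^sup>L (cubeM R) (\<lambda>x. m' (x $ k) * w x * pd k w x) else 0) = 0"
proof -
  let ?c = "if j = k then 1 else 0 :: real"
  let ?D = "\<lambda>x. m (x $ k) * (pd j w x)\<^sup>2 + m (x $ k) * w x * pd j (pd j w) x + ?c * (m' (x $ k) * w x * pd k w x)"
  have n: "nice R (\<lambda>x. m (x $ k) * (pd j w x)\<^sup>2)" "nice R (\<lambda>x. m (x $ k) * w x * pd j (pd j w) x)"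
     "nice R (\<lambda>x. m' (x $ k) * w x * pd k w x)"
    by (intro nice_mult nice_power mn wn)+
  have "integral\<^sup>L (cubeM R) ?D = 0"
  proof (rule div_zero[where i=j and G="\<lambda>x. m (x $ k) * (w x * pd j w x)"])
    show "nice R (\<lambda>x. m (x $ k) * (w x * pd j w x))" by (intro nice_mult mn wn)
    show "ldiff R j (\<lambda>x. m (x $ k) * (w x * pd j w x))" by (intro ldiff_mult ml wn)
    show "nice R ?D" by (intro nice_add nice_mult nice_const n)
    show "pd j (\<lambda>x. m (x $ k) * (w x * pd j w x)) x = ?D x" if "x \<in> cube R" for x
      using mpd[OF that, of j]
      by (subst pd_mult_cube[OF that ml ldiff_mult[OF wn(2) wn(4)]], subst pd_mult_cube[OF that wn(2) wn(4)])
         (simp add: power2_eq_square algebra_simps)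
    show "((\<lambda>x. m (x $ k) * (w x * pd j w x)) \<longlongrightarrow> 0) (at x within cube R)" if "c = R \<or> c = - R" "x \<in> face R j c" for x c
    proof -
      from wl[OF that] obtain l where "(pd j w \<longlongrightarrow> l) (at x within cube R)" by blast
      from tendsto_mult[OF mt[OF face_bdry[OF R that]] tendsto_mult[OF w0[OF that] this]] show ?thesis by simp
    qed
  qed
  thus ?thesis using nice_integrable[OF n(1)] nice_integrable[OF n(2)] nice_integrable[OF n(3)] by (cases "j = k") auto
qed

text \<open>Integrates the derivative of \<open>m (pd k w)\<^sup>2\<close> in direction
  \<open>k\<close>. The top face contributes nothing by the Neumann condition. At the bottom face
  the limit of \<open>pd k w\<close> is unknown, but it enters squared and with the nonnegative
  factor \<open>m\<close>, so that it costs equality and nothing more.\<close>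

lemma ibp_normal:
  assumes pos: "\<And>z. - R \<le> z \<Longrightarrow> z \<le> R \<Longrightarrow> m z \<ge> 0"
  shows "integral\<^sup>L (cubeM R) (\<lambda>x. m' (x $ k) * (pd k w x)\<^sup>2) + 2 * integral\<^sup>L (cubeM R) (\<lambda>x. m (x $ k) * pd k w x * pd k (pd k w) x) \<le> 0"
proof -
  let ?D = "\<lambda>x. m' (x $ k) * (pd k w x)\<^sup>2 + 2 * (m (x $ k) * pd k w x * pd k (pd k w) x)"
  have n: "nice R (\<lambda>x. m' (x $ k) * (pd k w x)\<^sup>2)" "nice R (\<lambda>x. m (x $ k) * pd k w x * pd k (pd k w) x)"
    by (intro nice_mult nice_power mn wn)+
  have "integral\<^sup>L (cubeM R) ?D \<le> 0"
  proof (rule div_nonpos[where i=k and G="\<lambda>x. m (x $ k) * (pd k w x * pd k w x)"])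
    show "nice R (\<lambda>x. m (x $ k) * (pd k w x * pd k w x))" by (intro nice_mult mn wn)
    show "ldiff R k (\<lambda>x. m (x $ k) * (pd k w x * pd k w x))" by (intro ldiff_mult ml wn)
    show "nice R ?D" by (intro nice_add nice_mult nice_const n)
    show "pd k (\<lambda>x. m (x $ k) * (pd k w x * pd k w x)) x = ?D x" if "x \<in> cube R" for x
      using mpd[OF that, of k]
      by (subst pd_mult_cube[OF that ml ldiff_mult[OF wn(4) wn(4)]], subst pd_mult_cube[OF that wn(4) wn(4)])
         (simp add: power2_eq_square algebra_simps)
    show "((\<lambda>x. m (x $ k) * (pd k w x * pd k w x)) \<longlongrightarrow> 0) (at x within cube R)" if "x \<in> face R k R" for x
    proof -
      have "(pd k w \<longlongrightarrow> 0) (at x within cube R)" by (rule zero_bdry_D(3)[OF w(2) that])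
      from tendsto_mult[OF mt[OF face_bdry[OF R _ that]] tendsto_mult[OF this this]] show ?thesis by simp
    qed
    show "\<exists>l\<ge>0. ((\<lambda>x. m (x $ k) * (pd k w x * pd k w x)) \<longlongrightarrow> l) (at x within cube R)" if "x \<in> face R k (- R)" for x
    proof -
      from wl[OF _ that, of k] obtain l where l: "(pd k w \<longlongrightarrow> l) (at x within cube R)" by auto
      from tendsto_mult[OF mt[OF face_bdry[OF R _ that]] tendsto_mult[OF l l]]
      have "((\<lambda>x. m (x $ k) * (pd k w x * pd k w x)) \<longlongrightarrow> m (x $ k) * (l * l)) (at x within cube R)" by simp
      moreover have "m (x $ k) * (l * l) \<ge> 0" using pos[of "x $ k"] that R by (auto simp: face_def)
      ultimately show ?thesis by blast
    qed
  qed
  thus ?thesis using nice_integrable[OF n(1)] nice_integrable[OF n(2)] by simp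
qed

text \<open>Two divergences are combined, that of \<open>m (pd k w) (pd j w)\<close> in direction
  \<open>j\<close> and that of \<open>m (pd j w)\<^sup>2\<close> in direction \<open>k\<close>;
  commuting the mixed derivatives eliminates their common term. On each face concerned a tangential
  derivative occurs as a factor, so no boundary terms remain.\<close>

lemma ibp_tangential:
  assumes jk: "j \<noteq> k"
  shows "2 * integral\<^sup>L (cubeM R) (\<lambda>x. m (x $ k) * pd k w x * pd j (pd j w) x) = integral\<^sup>L (cubeM R) (\<lambda>x. m' (x $ k) * (pd j w x)\<^sup>2)"
proof -
  let ?A = "\<lambda>x. m (x $ k) * pd j w x * pd k (pd j w) x"
  let ?D = "\<lambda>x. ?A x + m (x $ k) * pd k w x * pd j (pd j w) x"
  let ?D' = "\<lambda>x. m' (x $ k) * (pd j w x)\<^sup>2 + 2 * ?A x"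
  have n: "nice R ?A" "nice R (\<lambda>x. m (x $ k) * pd k w x * pd j (pd j w) x)" "nice R (\<lambda>x. m' (x $ k) * (pd j w x)\<^sup>2)"
    by (intro nice_mult nice_power mn wn)+
  have "integral\<^sup>L (cubeM R) ?D = 0"
  proof (rule div_zero[where i=j and G="\<lambda>x. m (x $ k) * (pd k w x * pd j w x)"])
    show "nice R (\<lambda>x. m (x $ k) * (pd k w x * pd j w x))" by (intro nice_mult mn wn)
    show "ldiff R j (\<lambda>x. m (x $ k) * (pd k w x * pd j w x))" by (intro ldiff_mult ml wn)
    show "nice R ?D" by (intro nice_add nice_mult nice_const n)
    show "pd j (\<lambda>x. m (x $ k) * (pd k w x * pd j w x)) x = ?D x" if "x \<in> cube R" for x
      using mpd[OF that, of j] jk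
      by (subst pd_mult_cube[OF that ml ldiff_mult[OF wn(4) wn(4)]], subst pd_mult_cube[OF that wn(4) wn(4)])
         (simp add: c2_pd_commute[OF w(1) that, of j k] algebra_simps)
    show "((\<lambda>x. m (x $ k) * (pd k w x * pd j w x)) \<longlongrightarrow> 0) (at x within cube R)" if "c = R \<or> c = - R" "x \<in> face R j c" for x c
    proof -
      from wl[OF that] obtain l where "(pd j w \<longlongrightarrow> l) (at x within cube R)" by blast
      from tendsto_mult[OF mt[OF face_bdry[OF R that]] tendsto_mult[OF wt[OF that jk[symmetric]] this]] show ?thesis by simp
    qed
  qed
  moreover have "integral\<^sup>L (cubeM R) ?D' = 0"
  proof (rule div_zero[where i=k and G="\<lambda>x. m (x $ k) * (pd j w x * pd j w x)"])
    show "nice R (\<lambda>x. m (x $ k) * (pd j w x * pd j w x))" by (intro nice_mult mn wn)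
    show "ldiff R k (\<lambda>x. m (x $ k) * (pd j w x * pd j w x))" by (intro ldiff_mult ml wn)
    show "nice R ?D'" by (intro nice_add nice_mult nice_const n)
    show "pd k (\<lambda>x. m (x $ k) * (pd j w x * pd j w x)) x = ?D' x" if "x \<in> cube R" for x
      using mpd[OF that, of k]
      by (subst pd_mult_cube[OF that ml ldiff_mult[OF wn(4) wn(4)]], subst pd_mult_cube[OF that wn(4) wn(4)])
         (simp add: power2_eq_square algebra_simps)
    show "((\<lambda>x. m (x $ k) * (pd j w x * pd j w x)) \<longlongrightarrow> 0) (at x within cube R)" if "c = R \<or> c = - R" "x \<in> face R k c" for x c
      using tendsto_mult[OF mt[OF face_bdry[OF R that]] tendsto_mult[OF wt[OF that jk] wt[OF that jk]]] by simp
  qed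
  ultimately show ?thesis
    using nice_integrable[OF n(1)] nice_integrable[OF n(2)] nice_integrable[OF n(3)] by simp
qed

end

section \<open>Carleman estimate\<close>

text \<open>The letters stand for the integrals occurring in \<open>carleman_conjugated\<close>; \<open>e1\<close> to \<open>e6\<close> are the
  outcome of integrating by parts.\<close>

lemma carleman_algebra:
  fixes X1 X2 X3 P G :: "'n::finite \<Rightarrow> real" and T V B N Z U lam a1 a2 A :: real
  assumes e1: "P k + 2 * X1 k \<le> 0" and e2: "\<And>j. j \<noteq> k \<Longrightarrow> 2 * X1 j = P j"
    and e3: "\<And>j. P j + X2 j + (if j = k then Z else 0) = 0" and e4: "U + 2 * Z = 0" and e5: "3 * V + 2 * T = 0"
    and e6: "\<And>j. G j + X3 j = 0"
    and i1: "0 \<le> P k" and i2: "a2 * B \<le> V" and i3: "a1\<^sup>2 * N \<le> B" and i4: "U \<le> A * N" and i5: "0 \<le> N"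
    and a2: "a2 > 0" and A: "A \<ge> 0" and lam: "lam \<ge> 1" "a2\<^sup>2 / 4 + A \<le> a2 * a1\<^sup>2 * lam"
  shows "lam * a2 * (\<Sum>j\<in>UNIV. G j) + 2 * lam ^ 3 * a2 * a1\<^sup>2 * N
    \<le> (\<Sum>j\<in>UNIV. - (4 * lam) * X1 j - 2 * lam * X2 j - lam * a2 * X3 j)
      - 4 * lam ^ 3 * T - 2 * lam ^ 3 * V - lam ^ 3 * a2 * B - lam\<^sup>2 * (a2\<^sup>2 / 4) * N"
proof -
  have "(\<Sum>j\<in>UNIV. - (4 * lam) * X1 j - 2 * lam * X2 j - lam * a2 * X3 j)
     = (\<Sum>j\<in>UNIV. (if j = k then - (4 * lam) * X1 k + 2 * lam * P k + 2 * lam * Z else 0) + lam * a2 * G j)"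
  proof (intro sum.cong refl)
    fix j
    have f3: "X3 j = - G j" using e6[of j] by linarith
    show "- (4 * lam) * X1 j - 2 * lam * X2 j - lam * a2 * X3 j
      = (if j = k then - (4 * lam) * X1 k + 2 * lam * P k + 2 * lam * Z else 0) + lam * a2 * G j"
    proof (cases "j = k")
      case True
      have "X2 j = - P j - Z" using e3[of j] True by simp
      thus ?thesis unfolding f3 using True by (simp only: if_True) (simp add: algebra_simps)
    next
      case False
      \<comment> \<open>In directions other than \<open>k\<close> the two weighted terms cancel, so
        the gradient survives there only through \<open>X3\<close>.\<close>
      have "X2 j = - P j" "P j = 2 * X1 j" using e3[of j] e2[OF False] False by simp_all
      thus ?thesis unfolding f3 using False by (simp only: if_False)
    qed
  qed
  hence sumF: "(\<Sum>j\<in>UNIV. - (4 * lam) * X1 j - 2 * lam * X2 j - lam * a2 * X3 j)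
     = - (4 * lam) * X1 k + 2 * lam * P k + 2 * lam * Z + lam * a2 * (\<Sum>j\<in>UNIV. G j)"
    by (simp add: sum.distrib sum_distrib_left)
  have l0: "lam > 0" using lam(1) by linarith
  have "2 * lam * (P k + 2 * X1 k) \<le> 0" using e1 l0 by (intro mult_nonneg_nonpos) auto
  hence l1: "- (4 * lam) * X1 k \<ge> 2 * lam * P k" by (simp add: algebra_simps)
  have "lam * (- (2 * Z)) \<le> lam * (A * N)" using i4 e4 l0 by (intro mult_left_mono) auto
  hence l2: "2 * lam * Z \<ge> - (lam * A * N)" by (simp add: algebra_simps)
  \<comment> \<open>Balance of the cubic terms: \<open>T\<close> supplies six copies of
    \<open>lam ^ 3 * V\<close>. Two pay for the term \<open>- 2 * lam ^ 3 * V\<close>, one for the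
    term with \<open>B\<close>, one in \<open>l6\<close> for the terms of lower order in
    \<open>lam\<close>, and two remain in the conclusion.\<close>
  have "T = - (3 / 2) * V" using e5 by simp
  hence l3: "- 4 * lam ^ 3 * T = 6 * (lam ^ 3 * V)" by (simp add: algebra_simps)
  have "lam ^ 3 * (a2 * B) \<le> lam ^ 3 * V" using i2 l0 by (intro mult_left_mono) auto
  hence l4: "lam ^ 3 * a2 * B \<le> lam ^ 3 * V" by (simp add: mult.assoc)
  have "lam ^ 3 * a2 * (a1\<^sup>2 * N) \<le> lam ^ 3 * a2 * B" using i3 l0 a2 by (intro mult_left_mono) auto
  hence l5: "lam ^ 3 * a2 * a1\<^sup>2 * N \<le> lam ^ 3 * a2 * B" by (simp add: mult.assoc)
  have l6: "lam\<^sup>2 * (a2\<^sup>2 / 4) * N + lam * A * N \<le> lam ^ 3 * a2 * a1\<^sup>2 * N"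
  proof -
    have "lam * A \<le> lam\<^sup>2 * A" using lam(1) A by (intro mult_right_mono) (auto simp: power2_eq_square)
    moreover have "lam\<^sup>2 * (a2\<^sup>2 / 4 + A) \<le> lam\<^sup>2 * (a2 * a1\<^sup>2 * lam)" using lam(2) by (intro mult_left_mono) auto
    ultimately have "lam\<^sup>2 * (a2\<^sup>2 / 4) + lam * A \<le> lam ^ 3 * a2 * a1\<^sup>2"
      by (simp add: power2_eq_square power3_eq_cube algebra_simps)
    from mult_right_mono[OF this i5] show ?thesis by (simp only: distrib_right)
  qed
  have l7: "0 \<le> 2 * lam * P k" using l0 i1 by simp
  have l8: "2 * lam ^ 3 * V = 2 * (lam ^ 3 * V)" "2 * lam ^ 3 * a2 * a1\<^sup>2 * N = 2 * (lam ^ 3 * a2 * a1\<^sup>2 * N)"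
    "- 4 * lam ^ 3 * T = - (4 * lam ^ 3 * T)" by simp_all
  show ?thesis unfolding sumF using l1 l2 l3 l4 l5 l6 l7 l8 by linarith
qed

text \<open>The square on the right is that of the conjugated operator
  \<open>e^(lam \<mu>) \<Delta> e^(- lam \<mu>)\<close> applied to \<open>w\<close>, where
  \<open>m1\<close> to \<open>m4\<close> are the derivatives of \<open>\<mu>\<close>. The operator
  splits into a symmetric part \<open>S\<close> and an antisymmetric part \<open>B\<close>.
  Integrating the cross term \<open>2 * S * B\<close> by parts produces the cubic power of
  \<open>lam\<close>, and the product of \<open>S\<close> with a multiple of \<open>w\<close>
  produces the full gradient.\<close>

lemma carleman_conjugated:
  fixes w :: "real^'n::finite \<Rightarrow> real"
  assumes R: "R > 0" and w: "c2 R w" "zero_bdry R k w"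
    and D1: "\<And>z. - R \<le> z \<Longrightarrow> z \<le> R \<Longrightarrow> (m1 has_real_derivative m2 z) (at z)"
    and D2: "\<And>z. - R \<le> z \<Longrightarrow> z \<le> R \<Longrightarrow> (m2 has_real_derivative m3 z) (at z)"
    and D3: "\<And>z. - R \<le> z \<Longrightarrow> z \<le> R \<Longrightarrow> (m3 has_real_derivative m4 z) (at z)"
    and c4: "continuous_on {- R..R} m4"
    and a1: "a1 > 0" "\<And>z. - R \<le> z \<Longrightarrow> z \<le> R \<Longrightarrow> a1 \<le> m1 z"
    and a2: "a2 > 0" "\<And>z. - R \<le> z \<Longrightarrow> z \<le> R \<Longrightarrow> a2 \<le> m2 z"
    and A: "A \<ge> 0" "\<And>z. - R \<le> z \<Longrightarrow> z \<le> R \<Longrightarrow> m4 z \<le> A"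
    and lam: "lam \<ge> 1" "a2\<^sup>2 / 4 + A \<le> a2 * a1\<^sup>2 * lam"
  shows "lam * a2 * (\<Sum>j\<in>UNIV. integral\<^sup>L (cubeM R) (\<lambda>x. (pd j w x)\<^sup>2))
      + 2 * lam ^ 3 * a2 * a1\<^sup>2 * integral\<^sup>L (cubeM R) (\<lambda>x. (w x)\<^sup>2)
    \<le> integral\<^sup>L (cubeM R) (\<lambda>x. (lap w x - 2 * lam * m1 (x $ k) * pd k w x - lam * m2 (x $ k) * w x
         + lam\<^sup>2 * (m1 (x $ k))\<^sup>2 * w x)\<^sup>2)"
proof -
  let ?I = "integral\<^sup>L (cubeM R)"
  note wn = c2_D[OF w(1)]
  have mc: "continuous_on {- R..R} m1" "continuous_on {- R..R} m2" "continuous_on {- R..R} m3"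
    using DERIV_continuous_on_interval[OF D1] DERIV_continuous_on_interval[OF D2] DERIV_continuous_on_interval[OF D3] by blast+
  note mn = nice_coord[OF mc(1), where k=k] nice_coord[OF mc(2), where k=k] nice_coord[OF mc(3), where k=k] nice_coord[OF c4, where k=k]
  define f1 where "f1 j x = m1 (x $ k) * pd k w x * pd j (pd j w) x" for j x
  define f2 where "f2 j x = m2 (x $ k) * w x * pd j (pd j w) x" for j x
  define f3 where "f3 j x = w x * pd j (pd j w) x" for j x
  define t where "t x = (m1 (x $ k)) ^ 3 * w x * pd k w x" for x
  define v where "v x = (m1 (x $ k))\<^sup>2 * m2 (x $ k) * (w x)\<^sup>2" for x
  define bb where "bb x = (m1 (x $ k))\<^sup>2 * (w x)\<^sup>2" for x
  define P where "P j x = m2 (x $ k) * (pd j w x)\<^sup>2" for j x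
  define G where "G j x = (pd j w x)\<^sup>2" for j x
  define Z where "Z x = m3 (x $ k) * w x * pd k w x" for x
  define U where "U x = m4 (x $ k) * (w x)\<^sup>2" for x
  define nn where "nn x = (w x)\<^sup>2" for x
  have n: "nice R (f1 j)" "nice R (f2 j)" "nice R (f3 j)" "nice R t" "nice R v" "nice R bb" "nice R (P j)" "nice R (G j)"
      "nice R Z" "nice R U" "nice R nn" for j
    unfolding f1_def[abs_def] f2_def[abs_def] f3_def[abs_def] t_def[abs_def] v_def[abs_def] bb_def[abs_def] P_def[abs_def]
      G_def[abs_def] Z_def[abs_def] U_def[abs_def] nn_def[abs_def]
    by (intro nice_mult nice_power mn wn)+
  have int: "integrable (cubeM R) (f1 j)" "integrable (cubeM R) (f2 j)" "integrable (cubeM R) (f3 j)" "integrable (cubeM R) t"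
      "integrable (cubeM R) v" "integrable (cubeM R) bb" "integrable (cubeM R) nn" for j
    by (intro nice_integrable n)+
  define Q where "Q x = (\<Sum>j\<in>UNIV. - (4 * lam) * f1 j x - 2 * lam * f2 j x - lam * a2 * f3 j x)
      - 4 * lam ^ 3 * t x - 2 * lam ^ 3 * v x - lam ^ 3 * a2 * bb x - lam\<^sup>2 * (a2\<^sup>2 / 4) * nn x" for x
  have Qn: "nice R Q" unfolding Q_def[abs_def] by (intro nice_diff nice_mult nice_sum nice_const n)
  define Pw where "Pw x = lap w x - 2 * lam * m1 (x $ k) * pd k w x - lam * m2 (x $ k) * w x
         + lam\<^sup>2 * (m1 (x $ k))\<^sup>2 * w x" for x
  have Pn: "nice R (\<lambda>x. (Pw x)\<^sup>2)" unfolding Pw_def[abs_def] lap_def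
    by (intro nice_power nice_add nice_diff nice_mult nice_sum nice_const mn wn)
  \<comment> \<open>\<open>Q\<close> is \<open>(S + B)\<^sup>2\<close> without two squares; the one involving \<open>a2 * w\<close> is chosen so that the gradient
     term gets a positive coefficient in every direction.\<close>
  have QP: "Q x \<le> (Pw x)\<^sup>2" for x
  proof -
    define S where "S = lap w x + lam\<^sup>2 * (m1 (x $ k))\<^sup>2 * w x"
    define B where "B = - 2 * lam * m1 (x $ k) * pd k w x - lam * m2 (x $ k) * w x"
    have "(\<Sum>j\<in>UNIV. - (4 * lam) * f1 j x - 2 * lam * f2 j x - lam * a2 * f3 j x)
       = (\<Sum>j\<in>UNIV. pd j (pd j w) x) * (- 4 * lam * m1 (x $ k) * pd k w x - 2 * lam * m2 (x $ k) * w x - lam * a2 * w x)"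
      unfolding sum_distrib_right by (intro sum.cong) (auto simp: f1_def f2_def f3_def algebra_simps)
    hence "Q x = 2 * S * B - lam * a2 * S * w x - lam\<^sup>2 * (a2\<^sup>2 / 4) * (w x)\<^sup>2"
      unfolding Q_def S_def B_def lap_def
      by (simp add: t_def v_def bb_def nn_def algebra_simps power2_eq_square power3_eq_cube)
    moreover have "(Pw x)\<^sup>2 = (S + B)\<^sup>2" unfolding Pw_def S_def B_def by (simp add: algebra_simps)
    moreover have "(S + B)\<^sup>2 - (2 * S * B - lam * a2 * S * w x - lam\<^sup>2 * (a2\<^sup>2 / 4) * (w x)\<^sup>2) = B\<^sup>2 + (S + lam * a2 * w x / 2)\<^sup>2"
      by (simp add: power2_eq_square algebra_simps)
    moreover have "0 \<le> B\<^sup>2 + (S + lam * a2 * w x / 2)\<^sup>2" by simp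
    ultimately show ?thesis by linarith
  qed
  have IQ: "?I Q = (\<Sum>j\<in>UNIV. - (4 * lam) * ?I (f1 j) - 2 * lam * ?I (f2 j) - lam * a2 * ?I (f3 j))
      - 4 * lam ^ 3 * ?I t - 2 * lam ^ 3 * ?I v - lam ^ 3 * a2 * ?I bb - lam\<^sup>2 * (a2\<^sup>2 / 4) * ?I nn"
    unfolding Q_def[abs_def] using int by simp
  \<comment> \<open>The identities \<open>e1\<close> to \<open>e4\<close> take \<open>m1\<close>,
    \<open>m2\<close> and \<open>m3\<close> as weights, and differentiating the last of them brings
    in \<open>m4\<close>.\<close>
  have e1: "?I (P k) + 2 * ?I (f1 k) \<le> 0"
    using ibp_normal[OF R w D1 mc(2)] a1 unfolding P_def[abs_def] f1_def[abs_def] by (metis less_imp_le order_trans)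
  have e2: "2 * ?I (f1 j) = ?I (P j)" if "j \<noteq> k" for j
    using ibp_tangential[OF R w D1 mc(2) that] unfolding P_def[abs_def] f1_def[abs_def] by blast
  have e3: "?I (P j) + ?I (f2 j) + (if j = k then ?I Z else 0) = 0" for j
    using ibp_lap[OF R w D2 mc(3)] unfolding P_def[abs_def] f2_def[abs_def] Z_def[abs_def] by blast
  have e4: "?I U + 2 * ?I Z = 0"
    using ibp_square[OF R w D3 c4] unfolding U_def[abs_def] Z_def[abs_def] by blast
  have e5: "3 * ?I v + 2 * ?I t = 0"
  proof -
    \<comment> \<open>The term \<open>t\<close> carries the weight \<open>m1 ^ 3\<close>, whose
      derivative is three times the coefficient in \<open>v\<close>.\<close>
    have D5: "((\<lambda>z. (m1 z) ^ 3) has_real_derivative (3 * ((m1 z)\<^sup>2 * m2 z))) (at z)" if "- R \<le> z" "z \<le> R" for z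
      using D1[OF that] by (auto intro!: derivative_eq_intros simp: power2_eq_square)
    have c5: "continuous_on {- R..R} (\<lambda>z. 3 * ((m1 z)\<^sup>2 * m2 z))" by (intro continuous_intros mc)
    have "?I (\<lambda>x. 3 * ((m1 (x $ k))\<^sup>2 * m2 (x $ k)) * (w x)\<^sup>2) + 2 * ?I t = 0"
      using ibp_square[OF R w D5 c5] unfolding t_def[abs_def] by blast
    moreover have "(\<lambda>x. 3 * ((m1 (x $ k))\<^sup>2 * m2 (x $ k)) * (w x)\<^sup>2) = (\<lambda>x. 3 * v x)" by (simp add: v_def mult.assoc)
    ultimately show ?thesis by simp
  qed
  have e6: "?I (G j) + ?I (f3 j) = 0" for j
    using ibp_lap[OF R w, of "\<lambda>_. 1" "\<lambda>_. 0" j] unfolding G_def[abs_def] f3_def[abs_def] by (simp split: if_splits)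
  have i1: "0 \<le> ?I (P k)"
    using integral_mono_cube[OF nice_const[of R 0] n(7)[of k]] a2 coord_interval[of _ R k] unfolding P_def by (simp add: less_le_trans less_imp_le)
  have i2: "a2 * ?I bb \<le> ?I v"
  proof -
    have "?I (\<lambda>x. a2 * bb x) \<le> ?I v"
    proof (rule integral_mono_cube[OF nice_mult[OF nice_const n(6)] n(5)])
      fix x :: "real^'n" assume "x \<in> cube R"
      hence "a2 \<le> m2 (x $ k)" using a2(2) coord_interval by blast
      hence "a2 * ((m1 (x $ k))\<^sup>2 * (w x)\<^sup>2) \<le> m2 (x $ k) * ((m1 (x $ k))\<^sup>2 * (w x)\<^sup>2)" by (intro mult_right_mono) auto
      thus "a2 * bb x \<le> v x" by (simp add: bb_def v_def mult_ac)
    qed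
    thus ?thesis by simp
  qed
  have i3: "a1\<^sup>2 * ?I nn \<le> ?I bb"
  proof -
    have "?I (\<lambda>x. a1\<^sup>2 * nn x) \<le> ?I bb"
    proof (rule integral_mono_cube[OF nice_mult[OF nice_const n(11)] n(6)])
      fix x :: "real^'n" assume "x \<in> cube R"
      hence "a1 \<le> m1 (x $ k)" using a1(2) coord_interval by blast
      hence "a1\<^sup>2 \<le> (m1 (x $ k))\<^sup>2" using a1(1) by (intro power_mono) auto
      thus "a1\<^sup>2 * nn x \<le> bb x" unfolding bb_def nn_def by (intro mult_right_mono) auto
    qed
    thus ?thesis by simp
  qed
  have i4: "?I U \<le> A * ?I nn"
  proof -
    have "?I U \<le> ?I (\<lambda>x. A * nn x)"
    proof (rule integral_mono_cube[OF n(10) nice_mult[OF nice_const n(11)]])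
      fix x :: "real^'n" assume "x \<in> cube R"
      hence "m4 (x $ k) \<le> A" using A(2) coord_interval by blast
      thus "U x \<le> A * nn x" unfolding U_def nn_def by (intro mult_right_mono) auto
    qed
    thus ?thesis by simp
  qed
  have i5: "0 \<le> ?I nn" unfolding nn_def[abs_def] by (intro integral_nonneg_AE AE_I2) simp
  have "lam * a2 * (\<Sum>j\<in>UNIV. ?I (G j)) + 2 * lam ^ 3 * a2 * a1\<^sup>2 * ?I nn \<le> ?I Q"
    unfolding IQ by (rule carleman_algebra[OF e1 e2 e3 e4 e5 e6 i1 i2 i3 i4 i5 a2(1) A(1) lam])
  also have "?I Q \<le> ?I (\<lambda>x. (Pw x)\<^sup>2)" by (rule integral_mono_cube[OF Qn Pn QP])
  finally show ?thesis unfolding Pw_def nn_def[abs_def] G_def[abs_def] .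
qed

lemma powr_ratio_deriv:
  assumes "b > 0" "z + r > (0::real)"
  shows "((\<lambda>z. c * ((z + r) / b) powr q) has_real_derivative (c * q / b) * ((z + r) / b) powr (q - 1)) (at z)"
  using assms by (auto intro!: derivative_eq_intros simp: field_simps powr_diff)

text \<open>The conjugated estimate is used for \<open>w = e^(lam \<mu>) h\<close>. Going back from
  \<open>w\<close> to \<open>h\<close> costs a term of order \<open>lam\<^sup>2 w\<^sup>2\<close>,
  because the exponential is differentiated as well; even with the additional factor
  \<open>lam\<close> on the left, the cubic coefficient of \<open>w\<^sup>2\<close> pays for
  it.\<close>

lemma carleman_estimate:
  fixes k :: "'n::finite"
  assumes R: "R > 0" and r: "r > R + 1" and b: "b > R + r" and beta: "\<beta> > 1"
  obtains c L where "c > 0" "L \<ge> 1" "\<And>lam h. lam \<ge> L \<Longrightarrow> C2_cl R h \<Longrightarrow> zero_bdry R k h \<Longrightarrow>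
     c * lam * integral\<^sup>L (cubeM R) (\<lambda>x. weight k r b lam \<beta> x * ((h x)\<^sup>2 + (\<Sum>j\<in>UNIV. (pd j h x)\<^sup>2)))
     \<le> integral\<^sup>L (cubeM R) (\<lambda>x. weight k r b lam \<beta> x * (lap h x)\<^sup>2)"
proof -
  have b0: "b > 0" using R r b by linarith
  \<comment> \<open>This family is closed under differentiation and contains \<open>\<mu>\<close>;
    on the interval in question \<open>z + r\<close> is positive because
    \<open>r > R + 1\<close>.\<close>
  define mm where "mm c q z = c * ((z + r) / b) powr q" for c q z
  have Dm: "(mm c q has_real_derivative mm (c * q / b) (q - 1) z) (at z)" if "- R \<le> z" "z \<le> R" for c q z
    unfolding mm_def[abs_def] by (rule powr_ratio_deriv) (use b0 that r in auto)
  define m where "m = mm 1 \<beta>"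
  define m1 where "m1 = mm (\<beta> / b) (\<beta> - 1)"
  define m2 where "m2 = mm (\<beta> / b * (\<beta> - 1) / b) (\<beta> - 1 - 1)"
  define m3 where "m3 = mm (\<beta> / b * (\<beta> - 1) / b * (\<beta> - 1 - 1) / b) (\<beta> - 1 - 1 - 1)"
  define m4 where "m4 = mm (\<beta> / b * (\<beta> - 1) / b * (\<beta> - 1 - 1) / b * (\<beta> - 1 - 1 - 1) / b) (\<beta> - 1 - 1 - 1 - 1)"
  have D0: "(m has_real_derivative m1 z) (at z)" and D1: "(m1 has_real_derivative m2 z) (at z)"
    and D2: "(m2 has_real_derivative m3 z) (at z)" and D3: "(m3 has_real_derivative m4 z) (at z)"
    if "- R \<le> z" "z \<le> R" for z
    using Dm[OF that, of 1 \<beta>] Dm[OF that, of "\<beta> / b"] Dm[OF that, of "\<beta> / b * (\<beta> - 1) / b"]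
      Dm[OF that, of "\<beta> / b * (\<beta> - 1) / b * (\<beta> - 1 - 1) / b"]
    by (simp_all only: m_def m1_def m2_def m3_def m4_def mult_1)
  have cm: "continuous_on {- R..R} (mm c q)" for c q by (rule DERIV_continuous_on_interval[OF Dm])
  note c1 = cm[of "\<beta> / b" "\<beta> - 1", folded m1_def] and c2 = cm[of "\<beta> / b * (\<beta> - 1) / b" "\<beta> - 1 - 1", folded m2_def]
    and c4 = cm[of "\<beta> / b * (\<beta> - 1) / b * (\<beta> - 1 - 1) / b * (\<beta> - 1 - 1 - 1) / b" "\<beta> - 1 - 1 - 1 - 1", folded m4_def]
  have ne: "{- R..R} \<noteq> {}" using R by simp
  have pos: "\<exists>a>0. \<forall>z. - R \<le> z \<longrightarrow> z \<le> R \<longrightarrow> a \<le> mm c q z" if "c > 0" for c q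
  proof -
    obtain z0 where z0: "z0 \<in> {- R..R}" "\<forall>z\<in>{- R..R}. mm c q z0 \<le> mm c q z"
      using continuous_attains_inf[OF compact_Icc ne cm] by blast
    have "mm c q z0 > 0" using z0(1) r b0 that by (auto simp: mm_def)
    thus ?thesis using z0(2) by (intro exI[of _ "mm c q z0"]) auto
  qed
  have bnd: "\<exists>A\<ge>0. \<forall>z. - R \<le> z \<longrightarrow> z \<le> R \<longrightarrow> mm c q z \<le> A" for c q
  proof -
    obtain z0 where "\<forall>z\<in>{- R..R}. mm c q z \<le> mm c q z0"
      using continuous_attains_sup[OF compact_Icc ne cm] by blast
    thus ?thesis by (intro exI[of _ "max 0 (mm c q z0)"]) (auto simp: le_max_iff_disj)
  qed
  obtain a1 where a1: "a1 > 0" "\<And>z. - R \<le> z \<Longrightarrow> z \<le> R \<Longrightarrow> a1 \<le> m1 z"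
    using pos[of "\<beta> / b" "\<beta> - 1"] beta b0 unfolding m1_def by auto
  \<comment> \<open>Strict convexity of \<open>\<mu>\<close>: the coefficient is positive because
    \<open>\<beta> > 1\<close>.\<close>
  obtain a2 where a2: "a2 > 0" "\<And>z. - R \<le> z \<Longrightarrow> z \<le> R \<Longrightarrow> a2 \<le> m2 z"
    using pos[of "\<beta> / b * (\<beta> - 1) / b" "\<beta> - 1 - 1"] beta b0 unfolding m2_def by auto
  obtain A1 where A1: "A1 \<ge> 0" "\<And>z. - R \<le> z \<Longrightarrow> z \<le> R \<Longrightarrow> m1 z \<le> A1"
    using bnd[of "\<beta> / b" "\<beta> - 1"] unfolding m1_def by auto
  obtain A where A: "A \<ge> 0" "\<And>z. - R \<le> z \<Longrightarrow> z \<le> R \<Longrightarrow> m4 z \<le> A"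
    using bnd unfolding m4_def by metis
  define L where "L = max 1 ((a2\<^sup>2 / 4 + A) / (a2 * a1\<^sup>2))"
  \<comment> \<open>The first bound pays for the gradient of \<open>w\<close>, the second for the
    square of \<open>w\<close> including the cost of returning to \<open>h\<close>.\<close>
  define c where "c = min (a2 / 2) (2 * a2 * a1\<^sup>2 / (2 * A1\<^sup>2 + 1))"
  have A1p: "2 * A1\<^sup>2 + 1 > 0" by (simp add: add_nonneg_pos)
  have c: "c > 0" "2 * c \<le> a2" "c * (2 * A1\<^sup>2 + 1) \<le> 2 * a2 * a1\<^sup>2"
  proof -
    show "c > 0" "2 * c \<le> a2" using a1(1) a2(1) A1p by (auto simp: c_def)
    have "c \<le> 2 * a2 * a1\<^sup>2 / (2 * A1\<^sup>2 + 1)" by (simp add: c_def)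
    thus "c * (2 * A1\<^sup>2 + 1) \<le> 2 * a2 * a1\<^sup>2" using A1p by (simp add: pos_le_divide_eq)
  qed
  show ?thesis
  proof (rule that[of c L])
    show "c > 0" by (rule c) show "L \<ge> 1" by (simp add: L_def)
    fix lam :: real and h :: "real^'n \<Rightarrow> real"
    assume lam: "lam \<ge> L" and h: "C2_cl R h" "zero_bdry R k h"
    have l1: "lam \<ge> 1" using lam by (simp add: L_def)
    have l2: "a2\<^sup>2 / 4 + A \<le> a2 * a1\<^sup>2 * lam"
    proof -
      have "(a2\<^sup>2 / 4 + A) / (a2 * a1\<^sup>2) \<le> lam" using lam by (simp add: L_def)
      thus ?thesis using a1(1) a2(1) by (simp add: pos_divide_le_eq mult.commute)
    qed
    let ?I = "integral\<^sup>L (cubeM R)"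
    define E where "E z = exp (lam * m z)" for z
    define E1 where "E1 z = lam * m1 z * E z" for z
    define E2 where "E2 z = (lam * m2 z + lam\<^sup>2 * (m1 z)\<^sup>2) * E z" for z
    have DE: "(E has_real_derivative E1 z) (at z)" if "- R \<le> z" "z \<le> R" for z
      unfolding E_def[abs_def] E1_def using D0[OF that] by (auto intro!: derivative_eq_intros)
    have DE1: "(E1 has_real_derivative E2 z) (at z)" if "- R \<le> z" "z \<le> R" for z
      unfolding E1_def[abs_def] E2_def using D1[OF that] DE[OF that]
      by (auto intro!: derivative_eq_intros simp: E1_def power2_eq_square algebra_simps)
    have cE: "continuous_on {- R..R} E" "continuous_on {- R..R} E1"
      using DERIV_continuous_on_interval[OF DE] DERIV_continuous_on_interval[OF DE1] by blast+
    have cE2: "continuous_on {- R..R} E2" unfolding E2_def[abs_def] by (intro continuous_intros c1 c2 cE)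
    have Ec2: "c2 R (\<lambda>x. E (x $ k))" by (rule coord_c2[OF DE DE1 cE2])
    have hc2: "c2 R h" by (rule C2_cl_c2[OF h(1)])
    define w where "w x = E (x $ k) * h x" for x
    have wc2: "c2 R w" unfolding w_def[abs_def] by (rule c2_mult[OF Ec2 hc2])
    have wzb: "zero_bdry R k w" unfolding w_def[abs_def] by (rule zero_bdry_mult_coord[OF R DE cE(2) hc2 h(2)])
    note wn = c2_D[OF wc2] and hn = c2_D[OF hc2]
    have nE: "nice R (\<lambda>x. (E (x $ k))\<^sup>2)" by (intro nice_power nice_coord cE)
    have pw: "pd i w x = (if i = k then lam * m1 (x $ k) * w x else 0) + E (x $ k) * pd i h x" if "x \<in> cube R" for i x
      using c2_mult_pd(1)[OF Ec2 hc2 that, of i] coord_pd(1)[of R E E1, OF DE that, of i k]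
      unfolding w_def[abs_def] by (simp add: E1_def)
    have pw2: "pd i (pd i w) x = (if i = k then E2 (x $ k) * h x + 2 * E1 (x $ k) * pd k h x else 0) + E (x $ k) * pd i (pd i h) x"
      if "x \<in> cube R" for i x
      using c2_mult_pd(2)[OF Ec2 hc2 that, of i i] coord_pd(1)[of R E E1, OF DE that, of i k]
        coord_c2(2)[OF DE DE1 cE2 that, of i i k]
      unfolding w_def[abs_def] by simp
    \<comment> \<open>The terms from differentiating the exponential cancel: the conjugated operator
      on \<open>w\<close> is the exponential times the Laplacian of \<open>h\<close>.\<close>
    have lw: "lap w x - 2 * lam * m1 (x $ k) * pd k w x - lam * m2 (x $ k) * w x + lam\<^sup>2 * (m1 (x $ k))\<^sup>2 * w x
        = E (x $ k) * lap h x" if x: "x \<in> cube R" for x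
    proof -
      have "lap w x = E2 (x $ k) * h x + 2 * E1 (x $ k) * pd k h x + E (x $ k) * lap h x"
        unfolding lap_def pw2[OF x] by (simp add: sum.distrib sum_distrib_left)
      thus ?thesis unfolding pw[OF x] by (simp add: E2_def E1_def w_def algebra_simps power2_eq_square)
    qed
    have W: "weight k r b lam \<beta> x = (E (x $ k))\<^sup>2" for x
      unfolding weight_def E_def m_def mm_def by (simp add: exp_double[symmetric] mult.assoc)
    have main: "lam * a2 * (\<Sum>j\<in>UNIV. ?I (\<lambda>x. (pd j w x)\<^sup>2)) + 2 * lam ^ 3 * a2 * a1\<^sup>2 * ?I (\<lambda>x. (w x)\<^sup>2)
      \<le> ?I (\<lambda>x. weight k r b lam \<beta> x * (lap h x)\<^sup>2)"
    proof -
      have "?I (\<lambda>x. (lap w x - 2 * lam * m1 (x $ k) * pd k w x - lam * m2 (x $ k) * w x + lam\<^sup>2 * (m1 (x $ k))\<^sup>2 * w x)\<^sup>2)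
         = ?I (\<lambda>x. weight k r b lam \<beta> x * (lap h x)\<^sup>2)"
        by (intro Bochner_Integration.integral_cong) (auto simp: lw W power_mult_distrib)
      thus ?thesis using carleman_conjugated[OF R wc2 wzb D1 D2 D3 c4 a1 a2 A l1 l2] by simp
    qed
    have nG: "nice R (\<lambda>x. \<Sum>j\<in>UNIV. (pd j w x)\<^sup>2)" "nice R (\<lambda>x. (w x)\<^sup>2)" "\<And>j. nice R (\<lambda>x. (pd j w x)\<^sup>2)"
      by (intro nice_power nice_sum wn)+
    have "?I (\<lambda>x. weight k r b lam \<beta> x * ((h x)\<^sup>2 + (\<Sum>j\<in>UNIV. (pd j h x)\<^sup>2)))
       \<le> ?I (\<lambda>x. 2 * (\<Sum>j\<in>UNIV. (pd j w x)\<^sup>2) + (2 * lam\<^sup>2 * A1\<^sup>2 + 1) * (w x)\<^sup>2)"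
    proof (rule integral_mono_cube)
      show "nice R (\<lambda>x. weight k r b lam \<beta> x * ((h x)\<^sup>2 + (\<Sum>j\<in>UNIV. (pd j h x)\<^sup>2)))"
        unfolding W by (intro nice_mult nice_add nice_power nice_sum nE hn)
      show "nice R (\<lambda>x. 2 * (\<Sum>j\<in>UNIV. (pd j w x)\<^sup>2) + (2 * lam\<^sup>2 * A1\<^sup>2 + 1) * (w x)\<^sup>2)"
        by (intro nice_mult nice_add nice_const nG)
      fix x :: "real^'n" assume x: "x \<in> cube R"
      have m1x: "0 \<le> m1 (x $ k)" "m1 (x $ k) \<le> A1" using a1 A1(2) coord_interval[OF x, of k] by (auto intro: order_trans[OF less_imp_le])
      have gj: "(E (x $ k))\<^sup>2 * (pd j h x)\<^sup>2 \<le> 2 * (pd j w x)\<^sup>2 + (if j = k then 2 * lam\<^sup>2 * A1\<^sup>2 * (w x)\<^sup>2 else 0)" for j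
      proof (cases "j = k")
        case True
        have "E (x $ k) * pd k h x = pd k w x - lam * m1 (x $ k) * w x" using pw[OF x, of k] by simp
        hence "(E (x $ k))\<^sup>2 * (pd k h x)\<^sup>2 = (pd k w x - lam * m1 (x $ k) * w x)\<^sup>2" by (simp add: power_mult_distrib[symmetric])
        also have "\<dots> \<le> 2 * (pd k w x)\<^sup>2 + 2 * (lam * m1 (x $ k) * w x)\<^sup>2"
          using zero_le_power2[of "pd k w x + lam * m1 (x $ k) * w x"] by (simp add: power2_eq_square algebra_simps)
        also have "(lam * m1 (x $ k) * w x)\<^sup>2 \<le> lam\<^sup>2 * A1\<^sup>2 * (w x)\<^sup>2"
          unfolding power_mult_distrib using m1x by (intro mult_right_mono mult_left_mono power_mono) auto
        finally show ?thesis using True by simp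
      next
        case False
        thus ?thesis using pw[OF x, of j] by (simp add: power_mult_distrib)
      qed
      have "weight k r b lam \<beta> x * ((h x)\<^sup>2 + (\<Sum>j\<in>UNIV. (pd j h x)\<^sup>2))
         = (w x)\<^sup>2 + (\<Sum>j\<in>UNIV. (E (x $ k))\<^sup>2 * (pd j h x)\<^sup>2)"
        unfolding W w_def by (simp add: distrib_left sum_distrib_left power_mult_distrib)
      also have "\<dots> \<le> (w x)\<^sup>2 + (\<Sum>j\<in>UNIV. 2 * (pd j w x)\<^sup>2 + (if j = k then 2 * lam\<^sup>2 * A1\<^sup>2 * (w x)\<^sup>2 else 0))"
        by (intro add_left_mono sum_mono gj)
      also have "\<dots> = 2 * (\<Sum>j\<in>UNIV. (pd j w x)\<^sup>2) + (2 * lam\<^sup>2 * A1\<^sup>2 + 1) * (w x)\<^sup>2"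
        by (simp add: sum.distrib sum_distrib_left algebra_simps)
      finally show "weight k r b lam \<beta> x * ((h x)\<^sup>2 + (\<Sum>j\<in>UNIV. (pd j h x)\<^sup>2))
         \<le> 2 * (\<Sum>j\<in>UNIV. (pd j w x)\<^sup>2) + (2 * lam\<^sup>2 * A1\<^sup>2 + 1) * (w x)\<^sup>2" .
    qed
    also have "\<dots> = 2 * (\<Sum>j\<in>UNIV. ?I (\<lambda>x. (pd j w x)\<^sup>2)) + (2 * lam\<^sup>2 * A1\<^sup>2 + 1) * ?I (\<lambda>x. (w x)\<^sup>2)"
      using nice_integrable[OF nG(1)] nice_integrable[OF nG(2)] nice_integrable[OF nG(3)] by simp
    finally have up: "?I (\<lambda>x. weight k r b lam \<beta> x * ((h x)\<^sup>2 + (\<Sum>j\<in>UNIV. (pd j h x)\<^sup>2)))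
      \<le> 2 * (\<Sum>j\<in>UNIV. ?I (\<lambda>x. (pd j w x)\<^sup>2)) + (2 * lam\<^sup>2 * A1\<^sup>2 + 1) * ?I (\<lambda>x. (w x)\<^sup>2)" .
    let ?G = "\<Sum>j\<in>UNIV. ?I (\<lambda>x. (pd j w x)\<^sup>2)" and ?N = "?I (\<lambda>x. (w x)\<^sup>2)"
    have G0: "?G \<ge> 0" "?N \<ge> 0" by (intro sum_nonneg integral_nonneg_AE AE_I2; simp)+
    have "c * lam * ?I (\<lambda>x. weight k r b lam \<beta> x * ((h x)\<^sup>2 + (\<Sum>j\<in>UNIV. (pd j h x)\<^sup>2)))
        \<le> c * lam * (2 * ?G + (2 * lam\<^sup>2 * A1\<^sup>2 + 1) * ?N)"
      using c(1) l1 by (intro mult_left_mono up) auto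
    also have "\<dots> \<le> lam * a2 * ?G + 2 * lam ^ 3 * a2 * a1\<^sup>2 * ?N"
    proof -
      have "lam * (2 * c) * ?G \<le> lam * a2 * ?G" using c(2) l1 G0 by (intro mult_right_mono mult_left_mono) auto
      moreover have "c * lam * (2 * lam\<^sup>2 * A1\<^sup>2 + 1) \<le> 2 * lam ^ 3 * a2 * a1\<^sup>2"
      proof -
        have "1 \<le> lam\<^sup>2" using l1 by simp
        hence "2 * lam\<^sup>2 * A1\<^sup>2 + 1 \<le> lam\<^sup>2 * (2 * A1\<^sup>2 + 1)" by (simp add: algebra_simps)
        hence "c * lam * (2 * lam\<^sup>2 * A1\<^sup>2 + 1) \<le> c * lam * (lam\<^sup>2 * (2 * A1\<^sup>2 + 1))" using c(1) l1 by (intro mult_left_mono) auto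
        also have "\<dots> = lam ^ 3 * (c * (2 * A1\<^sup>2 + 1))" by (simp add: power2_eq_square power3_eq_cube mult_ac)
        also have "\<dots> \<le> lam ^ 3 * (2 * a2 * a1\<^sup>2)" using c(3) l1 by (intro mult_left_mono) auto
        finally show ?thesis by (simp add: mult_ac)
      qed
      hence "c * lam * (2 * lam\<^sup>2 * A1\<^sup>2 + 1) * ?N \<le> 2 * lam ^ 3 * a2 * a1\<^sup>2 * ?N" using G0(2) by (rule mult_right_mono)
      ultimately show ?thesis by (simp add: algebra_simps)
    qed
    also note main
    finally show "c * lam * ?I (\<lambda>x. weight k r b lam \<beta> x * ((h x)\<^sup>2 + (\<Sum>j\<in>UNIV. (pd j h x)\<^sup>2)))
     \<le> ?I (\<lambda>x. weight k r b lam \<beta> x * (lap h x)\<^sup>2)" .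
  qed
qed

section \<open>Linear combinations and bounds for the nonlinearity\<close>

lemma pd_lincomb_cube:
  assumes "x \<in> cube R" "ldiff R i u" "ldiff R i v"
  shows "pd i (\<lambda>x. a * u x + b * v x) x = a * pd i u x + b * pd i v x"
  using assms unfolding ldiff_def pd_def[of i "\<lambda>x. a * u x + b * v x"]
  by (intro DERIV_imp_deriv DERIV_add DERIV_cmult pd_line_deriv) auto

lemma ldiff_lincomb: "ldiff R i u \<Longrightarrow> ldiff R i v \<Longrightarrow> ldiff R i (\<lambda>x. a * u x + b * v x)"
  by (simp add: ldiff_def)

lemma pd2_lincomb_cube:
  assumes "x \<in> cube R" "c2 R u" "c2 R v"
  shows "pd j (pd i (\<lambda>x. a * u x + b * v x)) x = a * pd j (pd i u) x + b * pd j (pd i v) x"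
proof -
  have "pd j (pd i (\<lambda>x. a * u x + b * v x)) x = pd j (\<lambda>x. a * pd i u x + b * pd i v x) x"
    by (rule pd_cong_cube[OF _ assms(1)]) (rule pd_lincomb_cube[OF _ c2_D(2)[OF assms(2)] c2_D(2)[OF assms(3)]])
  also have "\<dots> = a * pd j (pd i u) x + b * pd j (pd i v) x"
    by (rule pd_lincomb_cube[OF assms(1) c2_D(4)[OF assms(2)] c2_D(4)[OF assms(3)]])
  finally show ?thesis .
qed

lemma C2_cl_lincomb:
  assumes u: "C2_cl R u" and v: "C2_cl R v"
  shows "C2_cl R (\<lambda>x. a * u x + b * v x)"
proof -
  let ?w = "\<lambda>x. a * u x + b * v x"
  note cu = C2_cl_c2[OF u] and cv = C2_cl_c2[OF v]
  have eq: "pd i ?w x = a * pd i u x + b * pd i v x" if "x \<in> cube R" for i x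
    by (rule pd_lincomb_cube[OF that c2_D(2)[OF cu] c2_D(2)[OF cv]])
  have eq2: "pd j (pd i ?w) x = a * pd j (pd i u) x + b * pd j (pd i v) x" if "x \<in> cube R" for i j x
    by (rule pd2_lincomb_cube[OF that cu cv])
  have l1: "ldiff R i ?w" for i by (intro ldiff_lincomb c2_D cu cv)
  have l2: "ldiff R j (pd i ?w)" for i j
    using ldiff_lincomb[OF c2_D(4)[OF cu] c2_D(4)[OF cv]] ldiff_cong[of R "pd i ?w" "\<lambda>x. a * pd i u x + b * pd i v x", OF eq] by simp
  have c: "continuous_on (ccube R) ?w" using u v by (auto simp: C2_cl_def intro!: continuous_intros)
  have c1: "continuous_on (cube R) (pd i ?w)" for i
  proof -
    have "continuous_on (cube R) (\<lambda>x. a * pd i u x + b * pd i v x)" using u v by (auto simp: C2_cl_def intro!: continuous_intros)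
    thus ?thesis by (subst continuous_on_cong[OF refl eq])
  qed
  have c2: "continuous_on (cube R) (pd j (pd i ?w))" for i j
  proof -
    have "continuous_on (cube R) (\<lambda>x. a * pd j (pd i u) x + b * pd j (pd i v) x)" using u v by (auto simp: C2_cl_def intro!: continuous_intros)
    thus ?thesis by (subst continuous_on_cong[OF refl eq2])
  qed
  have t1: "\<exists>l. (pd i ?w \<longlongrightarrow> l) (at x within cube R)" if x: "x \<in> ccube R" for i x
  proof -
    have "\<exists>l. (pd i u \<longlongrightarrow> l) (at x within cube R)" "\<exists>l. (pd i v \<longlongrightarrow> l) (at x within cube R)"
      using u v x by (auto simp: C2_cl_def)
    then obtain l l' where l: "(pd i u \<longlongrightarrow> l) (at x within cube R)" "(pd i v \<longlongrightarrow> l') (at x within cube R)" by blast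
    have "((\<lambda>x. a * pd i u x + b * pd i v x) \<longlongrightarrow> a * l + b * l') (at x within cube R)" by (intro tendsto_intros l)
    from tendsto_cong_cube[OF eq this] show ?thesis by blast
  qed
  have t2: "\<exists>l. (pd j (pd i ?w) \<longlongrightarrow> l) (at x within cube R)" if x: "x \<in> ccube R" for i j x
  proof -
    have "\<exists>l. (pd j (pd i u) \<longlongrightarrow> l) (at x within cube R)" "\<exists>l. (pd j (pd i v) \<longlongrightarrow> l) (at x within cube R)"
      using u v x by (auto simp: C2_cl_def)
    then obtain l l' where l: "(pd j (pd i u) \<longlongrightarrow> l) (at x within cube R)" "(pd j (pd i v) \<longlongrightarrow> l') (at x within cube R)" by blast
    have "((\<lambda>x. a * pd j (pd i u) x + b * pd j (pd i v) x) \<longlongrightarrow> a * l + b * l') (at x within cube R)" by (intro tendsto_intros l)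
    from tendsto_cong_cube[OF eq2 this] show ?thesis by blast
  qed
  show ?thesis unfolding C2_cl_def
    using c c1 c2 t1 t2 l1[unfolded ldiff_def] l2[unfolded ldiff_def] by blast
qed

lemma Hp_D:
  assumes "u \<in> Hp R p" shows "u \<in> sobolev (cube R) p" "C2_cl R u" "c2 R u"
  using assms by (auto simp: Hp_def C2_cl_c2)

lemma Hp_lincomb:
  assumes "u \<in> Hp R p" "v \<in> Hp R p" shows "(\<lambda>x. a * u x + b * v x) \<in> Hp R p"
  using assms sobolev_lincomb[of u R p v a b] C2_cl_lincomb[of R u v a b] by (auto simp: Hp_def)

lemma Hset_lincomb:
  assumes R: "R > 0" and u: "u \<in> Hset R p k f g" and v: "v \<in> Hset R p k f' g'"
  shows "(\<lambda>x. a * u x + b * v x) \<in> Hset R p k (\<lambda>x. a * f x + b * f' x) (\<lambda>x. a * g x + b * g' x)"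
proof -
  have h: "u \<in> Hp R p" "v \<in> Hp R p" using u v by (auto simp: Hset_def)
  have "(pd k (\<lambda>x. a * u x + b * v x) \<longlongrightarrow> a * g x + b * g' x) (at x within cube R)" if "x \<in> gamma_plus k R" for x
  proof (rule tendsto_cong_cube)
    show "pd k (\<lambda>x. a * u x + b * v x) x = a * pd k u x + b * pd k v x" if "x \<in> cube R" for x
      by (rule pd_lincomb_cube[OF that c2_D(2)[OF Hp_D(3)[OF h(1)]] c2_D(2)[OF Hp_D(3)[OF h(2)]]])
    show "((\<lambda>x. a * pd k u x + b * pd k v x) \<longlongrightarrow> a * g x + b * g' x) (at x within cube R)"
      using u v that by (intro tendsto_intros) (auto simp: Hset_def)
  qed
  thus ?thesis using Hp_lincomb[OF h] u v by (auto simp: Hset_def)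
qed

lemma Hset_diff:
  assumes "R > 0" "u \<in> Hset R p k f g" "v \<in> Hset R p k f g"
  shows "(\<lambda>x. v x - u x) \<in> H0set R p k"
  using Hset_lincomb[OF assms(1,3,2), of 1 "-1"] by (simp add: H0set_def)

section \<open>Bounds for the nonlinearity on compact sets\<close>

lemma grad_nth [simp]: "grad u x $ i = pd i u x"
  by (simp add: grad_def)

lemma norm_sq_vec: "(norm (q :: real^'n::finite))\<^sup>2 = (\<Sum>i\<in>UNIV. (q $ i)\<^sup>2)"
  by (simp add: norm_vec_def L2_set_def sum_nonneg)

text \<open>The derivative in \<open>C2_F\<close> is taken within a set that is the full space in
  \<open>s\<close> and \<open>q\<close>. A line with \<open>x\<close> fixed never leaves it, so
  derivatives in these variables are two-sided even for \<open>x\<close> on the boundary of the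
  cube, and they agree with \<open>dsF\<close> and \<open>dpF\<close>.\<close>

lemma C2_F_partials:
  fixes F :: "real^'n::finite \<Rightarrow> real \<Rightarrow> real^'n \<Rightarrow> real" and G1 :: "(real^'n) \<times> real \<times> (real^'n) \<Rightarrow> ((real^'n) \<times> real \<times> (real^'n)) \<Rightarrow>\<^sub>L real"
  assumes G1: "\<And>y. y \<in> ccube R \<times> UNIV \<times> UNIV \<Longrightarrow>
        ((\<lambda>(x,s,q). F x s q) has_derivative blinfun_apply (G1 y)) (at y within ccube R \<times> UNIV \<times> UNIV)"
    and x: "x \<in> ccube R"
  shows "((\<lambda>t. F x (s + t * a) (q + t *\<^sub>R \<xi>)) has_real_derivative G1 (x, s + t * a, q + t *\<^sub>R \<xi>) (0, a, \<xi>)) (at t)"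
    "dsF F x s q = G1 (x, s, q) (0, 1, 0)" "dpF F x s q $ i = G1 (x, s, q) (0, 0, axis i 1)"
    "dpF F x s q \<bullet> \<xi> = G1 (x, s, q) (0, 0, \<xi>)"
proof -
  show D: "((\<lambda>t. F x (s + t * a) (q + t *\<^sub>R \<xi>)) has_real_derivative G1 (x, s + t * a, q + t *\<^sub>R \<xi>) (0, a, \<xi>)) (at t)" for s a q \<xi> t
  proof -
    let ?p = "\<lambda>t. (x, s + t * a, q + t *\<^sub>R \<xi>)"
    have p: "(?p has_derivative (\<lambda>h. (0, h * a, h *\<^sub>R \<xi>))) (at t)"
      by (auto intro!: derivative_eq_intros)
    have "((\<lambda>(x,s,q). F x s q) has_derivative blinfun_apply (G1 (?p t))) (at (?p t) within range ?p)"
      by (rule has_derivative_subset[OF G1]) (use x in auto)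
    from has_derivative_in_compose[OF p this]
    have "((\<lambda>t. F x (s + t * a) (q + t *\<^sub>R \<xi>)) has_derivative (\<lambda>h. G1 (?p t) (0, h * a, h *\<^sub>R \<xi>))) (at t)" by simp
    moreover have "G1 (?p t) (0, h * a, h *\<^sub>R \<xi>) = h * G1 (?p t) (0, a, \<xi>)" for h
      using blinfun.scaleR_right[of "G1 (?p t)" h "(0, a, \<xi>)"] by simp
    ultimately show ?thesis by (simp add: has_field_derivative_def mult.commute[of _ "G1 _ _"] mult_commute_abs)
  qed
  have "((\<lambda>t. F x (0 + t * 1) (q + t *\<^sub>R 0)) has_real_derivative G1 (x, 0 + s * 1, q + s *\<^sub>R 0) (0, 1, 0)) (at s)" by (rule D)
  thus "dsF F x s q = G1 (x, s, q) (0, 1, 0)" unfolding dsF_def by (intro DERIV_imp_deriv) simp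
  show dp: "dpF F x s q $ i = G1 (x, s, q) (0, 0, axis i 1)" for i
  proof -
    have "((\<lambda>t. F x (s + t * 0) (q + t *\<^sub>R axis i 1)) has_real_derivative G1 (x, s + 0 * 0, q + 0 *\<^sub>R axis i 1) (0, 0, axis i 1)) (at 0)" by (rule D)
    thus ?thesis unfolding dpF_def vec_lambda_beta by (intro DERIV_imp_deriv) simp
  qed
  have "(0, 0, \<xi>) = (\<Sum>i\<in>UNIV. \<xi> $ i *\<^sub>R (0::real^'n, 0::real, axis i 1 :: real^'n))"
    by (simp add: sum_prod scalar_mult_eq_scaleR[symmetric] basis_expansion)
  hence "G1 (x, s, q) (0, 0, \<xi>) = (\<Sum>i\<in>UNIV. \<xi> $ i * G1 (x, s, q) (0, 0, axis i 1))"
    by (simp only: blinfun.sum_right blinfun.scaleR_right real_scaleR_def)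
  thus "dpF F x s q \<bullet> \<xi> = G1 (x, s, q) (0, 0, \<xi>)"
    by (simp add: inner_vec_def dp mult.commute)
qed

text \<open>The mean value theorem along the segment from \<open>(s, q)\<close> to
  \<open>(s', q')\<close> with \<open>x\<close> fixed, for \<open>F\<close> and then for its
  derivative. By convexity of balls the segment remains in the compact set \<open>?Q\<close>, where
  \<open>F\<close> and its first two derivatives are bounded.\<close>

lemma C2_F_bounds:
  fixes F :: "real^'n::finite \<Rightarrow> real \<Rightarrow> real^'n \<Rightarrow> real"
  assumes "C2_F R F"
  obtains K where "K \<ge> 0"
    "\<And>x s q s' q'. x \<in> ccube R \<Longrightarrow> \<bar>s\<bar> \<le> B \<Longrightarrow> \<bar>s'\<bar> \<le> B \<Longrightarrow> norm q \<le> B \<Longrightarrow> norm q' \<le> B \<Longrightarrow>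
      \<bar>F x s' q' - F x s q - dsF F x s q * (s' - s) - dpF F x s q \<bullet> (q' - q)\<bar> \<le> K * ((s' - s)\<^sup>2 + (norm (q' - q))\<^sup>2)"
    "\<And>x s q s' q'. x \<in> ccube R \<Longrightarrow> \<bar>s\<bar> \<le> B \<Longrightarrow> \<bar>s'\<bar> \<le> B \<Longrightarrow> norm q \<le> B \<Longrightarrow> norm q' \<le> B \<Longrightarrow>
      (F x s' q' - F x s q)\<^sup>2 \<le> K * ((s' - s)\<^sup>2 + (norm (q' - q))\<^sup>2)"
    "\<And>x s q. x \<in> ccube R \<Longrightarrow> \<bar>s\<bar> \<le> B \<Longrightarrow> norm q \<le> B \<Longrightarrow> \<bar>F x s q\<bar> \<le> K"
proof -
  let ?X = "ccube R \<times> UNIV \<times> UNIV :: ((real^'n) \<times> real \<times> (real^'n)) set"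
  let ?F = "\<lambda>(x,s,q). F x s q"
  obtain G1 G2 where G1: "\<And>y. y \<in> ?X \<Longrightarrow> (?F has_derivative blinfun_apply (G1 y)) (at y within ?X)"
    and G2: "\<And>y. y \<in> ?X \<Longrightarrow> (G1 has_derivative blinfun_apply (G2 y)) (at y within ?X)" and c2: "continuous_on ?X G2"
    using assms unfolding C2_F_def by blast
  have c1: "continuous_on ?X G1" by (rule has_derivative_continuous_on[OF G2])
  have c0: "continuous_on ?X ?F" by (rule has_derivative_continuous_on[OF G1])
  let ?Q = "ccube R \<times> {- B..B} \<times> cball 0 B :: ((real^'n) \<times> real \<times> (real^'n)) set"
  have Qc: "compact ?Q" by (intro compact_Times compact_ccube compact_Icc compact_cball)
  have QX: "?Q \<subseteq> ?X" by auto
  have bd: "\<exists>K\<ge>0. \<forall>y\<in>?Q. norm (g y) \<le> K" if "continuous_on ?X g" for g :: "_ \<Rightarrow> 'z::real_normed_vector"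
  proof -
    have "bounded (g ` ?Q)" by (intro compact_imp_bounded compact_continuous_image Qc continuous_on_subset[OF that QX])
    then obtain K where "\<forall>y\<in>?Q. norm (g y) \<le> K" unfolding bounded_iff by auto
    thus ?thesis by (intro exI[of _ "max K 0"]) (auto simp: le_max_iff_disj)
  qed
  obtain K0 where K0: "K0 \<ge> 0" "\<And>y. y \<in> ?Q \<Longrightarrow> norm (?F y) \<le> K0" using bd[OF c0] by blast
  obtain K1 where K1: "K1 \<ge> 0" "\<And>y. y \<in> ?Q \<Longrightarrow> norm (G1 y) \<le> K1" using bd[OF c1] by blast
  obtain K2 where K2: "K2 \<ge> 0" "\<And>y. y \<in> ?Q \<Longrightarrow> norm (G2 y) \<le> K2" using bd[OF c2] by blast
  define K where "K = K0 + K1\<^sup>2 + K2"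
  have K: "K0 \<le> K" "K1\<^sup>2 \<le> K" "K2 \<le> K" "K \<ge> 0" using K0 K1 K2 by (auto simp: K_def)
  have seg: "\<exists>y. y \<in> ?Q \<and> F x s' q' - F x s q = G1 y (0, a, \<xi>) \<and>
      \<bar>F x s' q' - F x s q - dsF F x s q * (s' - s) - dpF F x s q \<bullet> (q' - q)\<bar> \<le> K2 * (norm (0::real^'n, a, \<xi>))\<^sup>2"
    if x: "x \<in> ccube R" and b: "\<bar>s\<bar> \<le> B" "\<bar>s'\<bar> \<le> B" "norm q \<le> B" "norm q' \<le> B" and a: "a = s' - s" "\<xi> = q' - q" for x s q s' q' a \<xi>
  proof -
    let ?y = "\<lambda>t. (x, s + t * a, q + t *\<^sub>R \<xi>)" and ?v = "(0::real^'n, a, \<xi>)"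
    have yQ: "?y t \<in> ?Q" if "0 \<le> t" "t \<le> 1" for t
    proof -
      have e1: "s + t * a = (1 - t) * s + t * s'" "q + t *\<^sub>R \<xi> = (1 - t) *\<^sub>R q + t *\<^sub>R q'"
        by (simp_all add: a algebra_simps)
      have "\<bar>(1 - t) * s + t * s'\<bar> \<le> (1 - t) * \<bar>s\<bar> + t * \<bar>s'\<bar>"
        using that abs_triangle_ineq[of "(1 - t) * s" "t * s'"] by (simp add: abs_mult)
      also have "\<dots> \<le> (1 - t) * B + t * B" using that b by (intro add_mono mult_left_mono) auto
      finally have 1: "\<bar>(1 - t) * s + t * s'\<bar> \<le> B" by (simp add: algebra_simps)
      have "norm ((1 - t) *\<^sub>R q + t *\<^sub>R q') \<le> (1 - t) * norm q + t * norm q'"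
        using that norm_triangle_ineq[of "(1 - t) *\<^sub>R q" "t *\<^sub>R q'"] by simp
      also have "\<dots> \<le> (1 - t) * B + t * B" using that b by (intro add_mono mult_left_mono) auto
      finally have 2: "norm ((1 - t) *\<^sub>R q + t *\<^sub>R q') \<le> B" by (simp add: algebra_simps)
      show ?thesis unfolding e1 using 1 2 x by (auto simp: abs_le_iff)
    qed
    have "\<exists>\<tau>>0. \<tau> < 1 \<and> F x (s + 1 * a) (q + 1 *\<^sub>R \<xi>) - F x (s + 0 * a) (q + 0 *\<^sub>R \<xi>) = (1 - 0) * G1 (?y \<tau>) ?v"
      by (rule MVT2) (auto intro!: C2_F_partials(1)[OF G1 x])
    then obtain \<tau> where t: "0 < \<tau>" "\<tau> < 1" "F x s' q' - F x s q = G1 (?y \<tau>) ?v" by (auto simp: a)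
    have DG: "((\<lambda>t. G1 (?y t) ?v) has_real_derivative G2 (?y t) ?v ?v) (at t)" for t
    proof -
      have p: "(?y has_derivative (\<lambda>h. (0, h * a, h *\<^sub>R \<xi>))) (at t)" by (auto intro!: derivative_eq_intros)
      have "(G1 has_derivative blinfun_apply (G2 (?y t))) (at (?y t) within range ?y)"
        by (rule has_derivative_subset[OF G2]) (use x in auto)
      from has_derivative_in_compose[OF p this]
      have "((\<lambda>t. G1 (?y t)) has_derivative (\<lambda>h. G2 (?y t) (0, h * a, h *\<^sub>R \<xi>))) (at t)" by simp
      hence "((\<lambda>t. G1 (?y t) ?v) has_derivative (\<lambda>h. G2 (?y t) (0, h * a, h *\<^sub>R \<xi>) ?v)) (at t)"
        by (rule bounded_linear.has_derivative[OF blinfun.bounded_linear_left])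
      moreover have "G2 (?y t) (0, h * a, h *\<^sub>R \<xi>) ?v = h * G2 (?y t) ?v ?v" for h
        using blinfun.scaleR_right[of "G2 (?y t)" h ?v] by (simp add: blinfun.scaleR_left)
      ultimately show ?thesis by (simp add: has_field_derivative_def mult_commute_abs)
    qed
    \<comment> \<open>A second application, between the start and the intermediate point
      \<open>\<tau>\<close>, shows that the first-order remainder is quadratic; the factor
      \<open>\<tau>\<close> is at most 1.\<close>
    have "\<exists>\<tau>'>0. \<tau>' < \<tau> \<and> G1 (?y \<tau>) ?v - G1 (?y 0) ?v = (\<tau> - 0) * G2 (?y \<tau>') ?v ?v"
      by (rule MVT2[OF t(1)]) (rule DG)
    then obtain \<tau>' where t': "0 < \<tau>'" "\<tau>' < \<tau>" "G1 (?y \<tau>) ?v - G1 (x, s, q) ?v = \<tau> * G2 (?y \<tau>') ?v ?v" by auto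
    have "G1 (x, s, q) ?v = dsF F x s q * (s' - s) + dpF F x s q \<bullet> (q' - q)"
    proof -
      have "?v = a *\<^sub>R (0, 1, 0) + (0, 0, \<xi>)" by simp
      hence "G1 (x, s, q) ?v = a * G1 (x, s, q) (0, 1, 0) + G1 (x, s, q) (0, 0, \<xi>)"
        by (simp only: blinfun.add_right blinfun.scaleR_right real_scaleR_def)
      thus ?thesis using C2_F_partials(2)[OF G1 x, of s q] C2_F_partials(4)[OF G1 x, of s q \<xi>] by (simp add: a mult.commute)
    qed
    hence "\<bar>F x s' q' - F x s q - dsF F x s q * (s' - s) - dpF F x s q \<bullet> (q' - q)\<bar> = \<bar>\<tau> * G2 (?y \<tau>') ?v ?v\<bar>"
      using t(3) t'(3) by simp
    also have "\<dots> \<le> 1 * norm (G2 (?y \<tau>') ?v ?v)" unfolding abs_mult using t by (intro mult_mono) auto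
    also have "\<dots> \<le> norm (G2 (?y \<tau>')) * norm ?v * norm ?v"
      unfolding mult_1 by (rule order_trans[OF norm_blinfun mult_right_mono[OF norm_blinfun]]) simp
    also have "\<dots> \<le> K2 * norm ?v * norm ?v" using K2(2)[OF yQ] t t' by (intro mult_right_mono) auto
    finally have "\<bar>F x s' q' - F x s q - dsF F x s q * (s' - s) - dpF F x s q \<bullet> (q' - q)\<bar> \<le> K2 * (norm ?v)\<^sup>2"
      by (simp add: power2_eq_square mult.assoc)
    thus ?thesis using yQ[of \<tau>] t by (intro exI[of _ "?y \<tau>"] conjI) simp_all
  qed
  have nv: "(norm (0::real^'n, a, \<xi>))\<^sup>2 = a\<^sup>2 + (norm \<xi>)\<^sup>2" for a :: real and \<xi> :: "real^'n"
    by (simp add: norm_Pair)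
  show ?thesis
  proof (rule that[OF K(4)])
    fix x q q' :: "real^'n" and s s' :: real
    assume b: "x \<in> ccube R" "\<bar>s\<bar> \<le> B" "\<bar>s'\<bar> \<le> B" "norm q \<le> B" "norm q' \<le> B"
    let ?n = "(s' - s)\<^sup>2 + (norm (q' - q))\<^sup>2"
    obtain y where s: "y \<in> ?Q" "F x s' q' - F x s q = G1 y (0, s' - s, q' - q)"
      "\<bar>F x s' q' - F x s q - dsF F x s q * (s' - s) - dpF F x s q \<bullet> (q' - q)\<bar> \<le> K2 * ?n"
      using seg[OF b refl refl] unfolding nv by (elim exE conjE)
    show "\<bar>F x s' q' - F x s q - dsF F x s q * (s' - s) - dpF F x s q \<bullet> (q' - q)\<bar> \<le> K * ?n"
      by (rule order_trans[OF s(3)]) (use K in \<open>intro mult_right_mono; simp\<close>)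
    have "\<bar>F x s' q' - F x s q\<bar> \<le> norm (G1 y) * norm (0::real^'n, s' - s, q' - q)"
      unfolding s(2) using norm_blinfun[of "G1 y" "(0, s' - s, q' - q)"] by (simp only: real_norm_def)
    also have "\<dots> \<le> K1 * norm (0::real^'n, s' - s, q' - q)" by (intro mult_right_mono K1(2) s(1)) simp
    finally have "\<bar>F x s' q' - F x s q\<bar>\<^sup>2 \<le> (K1 * norm (0::real^'n, s' - s, q' - q))\<^sup>2" by (intro power_mono) auto
    hence "(F x s' q' - F x s q)\<^sup>2 \<le> K1\<^sup>2 * ?n" unfolding power_mult_distrib nv by simp
    also have "\<dots> \<le> K * ?n" using K by (intro mult_right_mono) auto
    finally show "(F x s' q' - F x s q)\<^sup>2 \<le> K * ?n" .
  next
    fix x q :: "real^'n" and s :: real assume b: "x \<in> ccube R" "\<bar>s\<bar> \<le> B" "norm q \<le> B"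
    hence "(x, s, q) \<in> ?Q" by (auto simp: abs_le_iff)
    from K0(2)[OF this] show "\<bar>F x s q\<bar> \<le> K" using K(1) by simp
  qed
qed

text \<open>For \<open>x\<close> in the cube the triples \<open>(x, u x, grad u x)\<close> stay in a
  compact set, so continuous functions of them are bounded.\<close>

lemma C2_F_nice:
  fixes F :: "real^'n::finite \<Rightarrow> real \<Rightarrow> real^'n \<Rightarrow> real"
  assumes F: "C2_F R F" and u: "c2 R u"
  shows "nice R (\<lambda>x. F x (u x) (grad u x))" "nice R (\<lambda>x. dsF F x (u x) (grad u x))"
    "nice R (\<lambda>x. dpF F x (u x) (grad u x) $ i)"
proof -
  let ?X = "ccube R \<times> UNIV \<times> UNIV :: ((real^'n) \<times> real \<times> (real^'n)) set"
  let ?F = "\<lambda>(x,s,q). F x s q"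
  obtain G1 G2 where G1: "\<And>y. y \<in> ?X \<Longrightarrow> (?F has_derivative blinfun_apply (G1 y)) (at y within ?X)"
    and G2: "\<And>y. y \<in> ?X \<Longrightarrow> (G1 has_derivative blinfun_apply (G2 y)) (at y within ?X)"
    using F unfolding C2_F_def by blast
  have c1: "continuous_on ?X G1" by (rule has_derivative_continuous_on[OF G2])
  have c0: "continuous_on ?X ?F" by (rule has_derivative_continuous_on[OF G1])
  note un = c2_D[OF u]
  have cg: "continuous_on (cube R) (grad u)"
    unfolding grad_def[abs_def] using un(3) by (intro continuous_on_vec_lambda) (auto simp: nice_def)
  have cy: "continuous_on (cube R) (\<lambda>x. (x, u x, grad u x))"
    using un(1) cg by (intro continuous_on_Pair continuous_on_id) (auto simp: nice_def)
  obtain B0 where B0: "\<And>x. x \<in> cube R \<Longrightarrow> \<bar>u x\<bar> \<le> B0" using un(1) by (auto simp: nice_def)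
  have "nice R (\<lambda>x. \<Sum>i\<in>UNIV. (pd i u x)\<^sup>2)" by (intro nice_sum nice_power un)
  then obtain B1 where B1: "\<And>x. x \<in> cube R \<Longrightarrow> \<bar>\<Sum>i\<in>UNIV. (pd i u x)\<^sup>2\<bar> \<le> B1" by (auto simp: nice_def)
  define B where "B = max B0 (sqrt B1)"
  let ?Q = "ccube R \<times> {- B..B} \<times> cball 0 B :: ((real^'n) \<times> real \<times> (real^'n)) set"
  have Qc: "compact ?Q" by (intro compact_Times compact_ccube compact_Icc compact_cball)
  have yQ: "(x, u x, grad u x) \<in> ?Q" if "x \<in> cube R" for x
  proof -
    have "(norm (grad u x))\<^sup>2 \<le> B1" using B1[OF that] by (simp add: norm_sq_vec)
    hence "norm (grad u x) \<le> sqrt B1" by (rule real_le_rsqrt)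
    thus ?thesis using B0[OF that] that cube_subset_ccube by (auto simp: B_def abs_le_iff)
  qed
  have comp: "nice R (\<lambda>x. g (x, u x, grad u x))" if g: "continuous_on ?X g" for g :: "_ \<Rightarrow> real"
  proof -
    have "bounded (g ` ?Q)" by (intro compact_imp_bounded compact_continuous_image Qc continuous_on_subset[OF g]) auto
    then obtain K where K: "\<And>y. y \<in> ?Q \<Longrightarrow> \<bar>g y\<bar> \<le> K" unfolding bounded_iff by auto
    have "continuous_on (cube R) (\<lambda>x. g (x, u x, grad u x))"
      by (rule continuous_on_compose2[OF g cy]) (use cube_subset_ccube in auto)
    thus ?thesis using K[OF yQ] by (auto simp: nice_def)
  qed
  show "nice R (\<lambda>x. F x (u x) (grad u x))" using comp[OF c0] by simp
  have b: "continuous_on ?X (\<lambda>y. G1 y v)" for v by (intro continuous_intros c1)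
  have xc: "x \<in> ccube R" if "x \<in> cube R" for x using that cube_subset_ccube by blast
  show "nice R (\<lambda>x. dsF F x (u x) (grad u x))"
    using comp[OF b[of "(0,1,0)"]] nice_cong[of R "\<lambda>x. dsF F x (u x) (grad u x)" "\<lambda>x. G1 (x, u x, grad u x) (0, 1, 0)"]
      C2_F_partials(2)[OF G1 xc] by simp
  show "nice R (\<lambda>x. dpF F x (u x) (grad u x) $ i)"
    using comp[OF b[of "(0,0,axis i 1)"]] nice_cong[of R "\<lambda>x. dpF F x (u x) (grad u x) $ i" "\<lambda>x. G1 (x, u x, grad u x) (0, 0, axis i 1)"]
      C2_F_partials(3)[OF G1 xc] by simp
qed

section \<open>Quadratic remainder and strong convexity\<close>

definition Aop :: "real \<Rightarrow> (real^'n::finite \<Rightarrow> real \<Rightarrow> real^'n \<Rightarrow> real) \<Rightarrow> (real^'n \<Rightarrow> real) \<Rightarrow> real^'n \<Rightarrow> real" where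
  "Aop \<epsilon> F u x = - \<epsilon> * lap u x + F x (u x) (grad u x)"

definition Lop :: "real \<Rightarrow> (real^'n::finite \<Rightarrow> real \<Rightarrow> real^'n \<Rightarrow> real) \<Rightarrow> (real^'n \<Rightarrow> real) \<Rightarrow> (real^'n \<Rightarrow> real) \<Rightarrow> real^'n \<Rightarrow> real" where
  "Lop \<epsilon> F u h x = - \<epsilon> * lap h x + dsF F x (u x) (grad u x) * h x + dpF F x (u x) (grad u x) \<bullet> grad h x"

lemma Jfun_eq: "Jfun R p k \<epsilon> r b F lam \<beta> \<eta> u =
   integral\<^sup>L (cubeM R) (\<lambda>x. weight k r b lam \<beta> x * (Aop \<epsilon> F u x)\<^sup>2) + \<eta> * (sob_norm (cube R) p u)\<^sup>2"
  unfolding Jfun_def Aop_def by (simp add: set_integral_eq)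

lemma DJfun_eq: "DJfun R p k \<epsilon> r b F lam \<beta> \<eta> u h =
   2 * integral\<^sup>L (cubeM R) (\<lambda>x. weight k r b lam \<beta> x * Aop \<epsilon> F u x * Lop \<epsilon> F u h x) + 2 * \<eta> * sob_inner (cube R) p u h"
  unfolding DJfun_def Aop_def Lop_def by (simp add: set_integral_eq)

lemma nice_weight:
  assumes "R > 0" "r > R + 1" "b > R + r"
  shows "nice R (weight k r b lam \<beta>)"
  unfolding weight_def[abs_def]
  by (rule nice_coord) (use assms in \<open>auto intro!: continuous_intros\<close>)

lemma weight_ge_1: "lam \<ge> 0 \<Longrightarrow> weight k r b lam \<beta> x \<ge> 1"
  unfolding weight_def by simp

lemma nice_lap: "c2 R u \<Longrightarrow> nice R (lap u)"
  unfolding lap_def[abs_def] by (intro nice_sum c2_D)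

lemma nice_Aop: "C2_F R F \<Longrightarrow> c2 R u \<Longrightarrow> nice R (Aop \<epsilon> F u)"
  unfolding Aop_def[abs_def] by (intro nice_add nice_mult nice_const nice_lap C2_F_nice)

lemma nice_Lop: "C2_F R F \<Longrightarrow> c2 R u \<Longrightarrow> c2 R h \<Longrightarrow> nice R (Lop \<epsilon> F u h)"
  unfolding Lop_def[abs_def] inner_vec_def inner_real_def grad_nth
  by (intro nice_add nice_mult nice_const nice_lap nice_sum C2_F_nice c2_D)

lemma lap_lincomb:
  assumes "c2 R u" "c2 R v" "x \<in> cube R"
  shows "lap (\<lambda>x. a * u x + b * v x) x = a * lap u x + b * lap v x"
    "grad (\<lambda>x. a * u x + b * v x) x = a *\<^sub>R grad u x + b *\<^sub>R grad v x"
proof -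
  show "lap (\<lambda>x. a * u x + b * v x) x = a * lap u x + b * lap v x"
    unfolding lap_def pd2_lincomb_cube[OF assms(3,1,2)] by (simp add: sum.distrib sum_distrib_left)
  show "grad (\<lambda>x. a * u x + b * v x) x = a *\<^sub>R grad u x + b *\<^sub>R grad v x"
    unfolding vec_eq_iff using pd_lincomb_cube[OF assms(3) c2_D(2)[OF assms(1)] c2_D(2)[OF assms(2)]] by simp
qed

lemma lap_add:
  assumes "c2 R u" "c2 R v" "x \<in> cube R"
  shows "lap (\<lambda>x. u x + v x) x = lap u x + lap v x" "grad (\<lambda>x. u x + v x) x = grad u x + grad v x"
  using lap_lincomb[OF assms, of 1 1] by simp_all

lemma Hp_add: "u \<in> Hp R p \<Longrightarrow> h \<in> Hp R p \<Longrightarrow> (\<lambda>x. u x + h x) \<in> Hp R p"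
  using Hp_lincomb[of u R p h 1 1] by simp

text \<open>The integrand, apart from the weight, of \<open>J (u + h) - J u - DJ u h\<close>.\<close>

definition quad_rem :: "real \<Rightarrow> (real^'n::finite \<Rightarrow> real \<Rightarrow> real^'n \<Rightarrow> real) \<Rightarrow> (real^'n \<Rightarrow> real) \<Rightarrow> (real^'n \<Rightarrow> real) \<Rightarrow> real^'n \<Rightarrow> real" where
  "quad_rem \<epsilon> F u h x = (Aop \<epsilon> F (\<lambda>x. u x + h x) x - Aop \<epsilon> F u x)\<^sup>2
     + 2 * Aop \<epsilon> F u x * (Aop \<epsilon> F (\<lambda>x. u x + h x) x - Aop \<epsilon> F u x - Lop \<epsilon> F u h x)"

lemma nice_quad_rem:
  assumes "C2_F R F" "u \<in> Hp R p" "h \<in> Hp R p" shows "nice R (quad_rem \<epsilon> F u h)"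
  unfolding quad_rem_def[abs_def]
  by (intro nice_add nice_power nice_diff nice_mult nice_const nice_Aop nice_Lop assms Hp_D(3)[of _ R p] Hp_add)

lemma J_expand:
  assumes W: "R > 0" "r > R + 1" "b > R + r" and F: "C2_F R F" and u: "u \<in> Hp R p" and h: "h \<in> Hp R p"
  shows "Jfun R p k \<epsilon> r b F lam \<beta> \<eta> (\<lambda>x. u x + h x) - Jfun R p k \<epsilon> r b F lam \<beta> \<eta> u - DJfun R p k \<epsilon> r b F lam \<beta> \<eta> u h
    = integral\<^sup>L (cubeM R) (\<lambda>x. weight k r b lam \<beta> x * quad_rem \<epsilon> F u h x) + \<eta> * (sob_norm (cube R) p h)\<^sup>2"
proof -
  let ?I = "integral\<^sup>L (cubeM R)" and ?W = "weight k r b lam \<beta>" and ?v = "\<lambda>x. u x + h x"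
  note cu = Hp_D(3)[OF u] and ch = Hp_D(3)[OF h] and cv = Hp_D(3)[OF Hp_add[OF u h]]
  have n: "nice R (\<lambda>x. ?W x * (Aop \<epsilon> F ?v x)\<^sup>2)" "nice R (\<lambda>x. ?W x * (Aop \<epsilon> F u x)\<^sup>2)"
    "nice R (\<lambda>x. ?W x * Aop \<epsilon> F u x * Lop \<epsilon> F u h x)"
    by (intro nice_mult nice_power nice_weight W nice_Aop nice_Lop F cu ch cv)+
  note i = nice_integrable[OF n(1)] nice_integrable[OF n(2)] nice_integrable[OF n(3)]
  have "?I (\<lambda>x. ?W x * quad_rem \<epsilon> F u h x) = ?I (\<lambda>x. ?W x * (Aop \<epsilon> F ?v x)\<^sup>2 - ?W x * (Aop \<epsilon> F u x)\<^sup>2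
     - 2 * (?W x * Aop \<epsilon> F u x * Lop \<epsilon> F u h x))"
    by (intro Bochner_Integration.integral_cong refl) (simp add: quad_rem_def power2_eq_square algebra_simps)
  also have "\<dots> = ?I (\<lambda>x. ?W x * (Aop \<epsilon> F ?v x)\<^sup>2) - ?I (\<lambda>x. ?W x * (Aop \<epsilon> F u x)\<^sup>2)
     - 2 * ?I (\<lambda>x. ?W x * Aop \<epsilon> F u x * Lop \<epsilon> F u h x)"
    using i by simp
  finally have 1: "?I (\<lambda>x. ?W x * quad_rem \<epsilon> F u h x) = \<dots>" .
  have 2: "(sob_norm (cube R) p ?v)\<^sup>2 = (sob_norm (cube R) p u)\<^sup>2 + 2 * sob_inner (cube R) p u h + (sob_norm (cube R) p h)\<^sup>2"
    using sob_norm_lincomb_sq[OF Hp_D(1)[OF u] Hp_D(1)[OF h], of 1 1] by simp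
  show ?thesis unfolding Jfun_eq DJfun_eq 1 2 by (simp add: algebra_simps)
qed

text \<open>Serves to cancel or combine the linear terms when the convexity inequality is used in
  two opposite directions.\<close>

lemma DJ_uminus:
  assumes "C2_F R F" "u \<in> Hp R p" "h \<in> Hp R p"
  shows "DJfun R p k \<epsilon> r b F lam \<beta> \<eta> u (\<lambda>x. - h x) = - DJfun R p k \<epsilon> r b F lam \<beta> \<eta> u h"
proof -
  note ch = Hp_D(3)[OF assms(3)]
  have L: "Lop \<epsilon> F u (\<lambda>x. - h x) x = - Lop \<epsilon> F u h x" if "x \<in> cube R" for x
    using lap_lincomb[OF ch ch that, of "-1" 0] by (simp add: Lop_def)
  have "integral\<^sup>L (cubeM R) (\<lambda>x. weight k r b lam \<beta> x * Aop \<epsilon> F u x * Lop \<epsilon> F u (\<lambda>x. - h x) x)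
     = integral\<^sup>L (cubeM R) (\<lambda>x. - (weight k r b lam \<beta> x * Aop \<epsilon> F u x * Lop \<epsilon> F u h x))"
    by (intro Bochner_Integration.integral_cong refl) (simp add: L)
  moreover have "sob_inner (cube R) p u (\<lambda>x. - h x) = - sob_inner (cube R) p u h"
    using sob_inner_lincomb[OF Hp_D(1)[OF assms(3)] Hp_D(1)[OF assms(3)] Hp_D(1)[OF assms(2)], of "-1" 0]
    by (simp add: sob_inner_commute[of _ p u])
  ultimately show ?thesis unfolding DJfun_eq by simp
qed

text \<open>The square of the function is included: this is the integrand of the squared H^1
  norm.\<close>

definition gradsq :: "(real^'n::finite \<Rightarrow> real) \<Rightarrow> real^'n \<Rightarrow> real" where
  "gradsq h x = (h x)\<^sup>2 + (\<Sum>j\<in>UNIV. (pd j h x)\<^sup>2)"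

lemma nice_gradsq: "c2 R h \<Longrightarrow> nice R (gradsq h)"
  unfolding gradsq_def[abs_def] by (intro nice_add nice_power nice_sum c2_D)

text \<open>The operator is linear in the Laplacian, so its first-order remainder \<open>Q\<close>
  comes from \<open>F\<close> alone and is bounded by a multiple of \<open>gradsq h x\<close>; it is
  multiplied by \<open>Aop \<epsilon> F u x\<close>, which is bounded. In the increment
  \<open>D\<close> the Laplacian of \<open>h\<close> is separated from the increment
  \<open>f\<close> of the nonlinearity by completing squares.\<close>

lemma quad_rem_bounds:
  fixes F :: "real^'n::finite \<Rightarrow> real \<Rightarrow> real^'n \<Rightarrow> real"
  assumes F: "C2_F R F" and eps: "\<epsilon> > 0"
  obtains K where "K \<ge> 0" "\<And>u h x. c2 R u \<Longrightarrow> c2 R h \<Longrightarrow> x \<in> cube R \<Longrightarrow> \<bar>u x\<bar> \<le> B \<Longrightarrow> \<bar>lap u x\<bar> \<le> B \<Longrightarrow> norm (grad u x) \<le> B \<Longrightarrow>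
      \<bar>u x + h x\<bar> \<le> B \<Longrightarrow> norm (grad u x + grad h x) \<le> B \<Longrightarrow>
      \<epsilon>\<^sup>2 / 2 * (lap h x)\<^sup>2 - K * gradsq h x \<le> quad_rem \<epsilon> F u h x \<and> \<bar>quad_rem \<epsilon> F u h x\<bar> \<le> 2 * \<epsilon>\<^sup>2 * (lap h x)\<^sup>2 + K * gradsq h x"
proof -
  obtain K0 where K0: "K0 \<ge> 0"
    "\<And>x s q s' q'. x \<in> ccube R \<Longrightarrow> \<bar>s\<bar> \<le> B \<Longrightarrow> \<bar>s'\<bar> \<le> B \<Longrightarrow> norm q \<le> B \<Longrightarrow> norm q' \<le> B \<Longrightarrow>
      \<bar>F x s' q' - F x s q - dsF F x s q * (s' - s) - dpF F x s q \<bullet> (q' - q)\<bar> \<le> K0 * ((s' - s)\<^sup>2 + (norm (q' - q))\<^sup>2)"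
    "\<And>x s q s' q'. x \<in> ccube R \<Longrightarrow> \<bar>s\<bar> \<le> B \<Longrightarrow> \<bar>s'\<bar> \<le> B \<Longrightarrow> norm q \<le> B \<Longrightarrow> norm q' \<le> B \<Longrightarrow>
      (F x s' q' - F x s q)\<^sup>2 \<le> K0 * ((s' - s)\<^sup>2 + (norm (q' - q))\<^sup>2)"
    "\<And>x s q. x \<in> ccube R \<Longrightarrow> \<bar>s\<bar> \<le> B \<Longrightarrow> norm q \<le> B \<Longrightarrow> \<bar>F x s q\<bar> \<le> K0"
    by (rule C2_F_bounds[OF F, where B=B]) (rule that)
  \<comment> \<open>Twice \<open>K0\<close> covers the squared increment of \<open>F\<close> in the
    upper estimate, the rest covers the product of \<open>Aop\<close> with the first-order
    remainder.\<close>
  define K where "K = 2 * K0 + 2 * (\<epsilon> * \<bar>B\<bar> + K0) * K0"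
  have K: "K \<ge> 0" using K0(1) eps by (simp add: K_def)
  show ?thesis
  proof (rule that[OF K])
    fix u h :: "real^'n \<Rightarrow> real" and x :: "real^'n"
    assume a: "c2 R u" "c2 R h" "x \<in> cube R" "\<bar>u x\<bar> \<le> B" "\<bar>lap u x\<bar> \<le> B" "norm (grad u x) \<le> B"
      "\<bar>u x + h x\<bar> \<le> B" "norm (grad u x + grad h x) \<le> B"
    have xc: "x \<in> ccube R" using a(3) cube_subset_ccube by blast
    let ?N = "gradsq h x"
    have N: "(h x)\<^sup>2 + (norm (grad h x))\<^sup>2 = ?N" by (simp add: gradsq_def norm_sq_vec)
    have N0: "?N \<ge> 0" unfolding gradsq_def by (intro add_nonneg_nonneg sum_nonneg) auto
    define f where "f = F x (u x + h x) (grad u x + grad h x) - F x (u x) (grad u x)"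
    define Au where "Au = Aop \<epsilon> F u x"
    define D where "D = Aop \<epsilon> F (\<lambda>x. u x + h x) x - Aop \<epsilon> F u x"
    define Q where "Q = D - Lop \<epsilon> F u h x"
    have D: "D = - \<epsilon> * lap h x + f"
      unfolding D_def Aop_def f_def lap_add[OF a(1-3)] by (simp add: algebra_simps)
    have Q: "Q = f - dsF F x (u x) (grad u x) * h x - dpF F x (u x) (grad u x) \<bullet> grad h x"
      unfolding Q_def D Lop_def by simp
    have f2: "f\<^sup>2 \<le> K0 * ?N" using K0(3)[OF xc a(4,7,6,8)] by (simp add: f_def N)
    have Qb: "\<bar>Q\<bar> \<le> K0 * ?N" using K0(2)[OF xc a(4,7,6,8)] by (simp add: f_def N Q)
    have Ab: "\<bar>Au\<bar> \<le> \<epsilon> * \<bar>B\<bar> + K0"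
    proof -
      have "\<bar>Au\<bar> \<le> \<epsilon> * \<bar>lap u x\<bar> + \<bar>F x (u x) (grad u x)\<bar>"
        unfolding Au_def Aop_def using eps abs_triangle_ineq[of "- \<epsilon> * lap u x"] by (simp add: abs_mult)
      also have "\<dots> \<le> \<epsilon> * \<bar>B\<bar> + K0" using a(5) eps K0(4)[OF xc a(4,6)] by (intro add_mono mult_left_mono) auto
      finally show ?thesis .
    qed
    have AQ: "\<bar>2 * Au * Q\<bar> \<le> 2 * ((\<epsilon> * \<bar>B\<bar> + K0) * (K0 * ?N))"
    proof -
      have "\<bar>Au\<bar> * \<bar>Q\<bar> \<le> (\<epsilon> * \<bar>B\<bar> + K0) * (K0 * ?N)" using Ab Qb by (intro mult_mono) auto
      thus ?thesis by (simp add: abs_mult)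
    qed
    have KN: "K * ?N = 2 * (K0 * ?N) + 2 * ((\<epsilon> * \<bar>B\<bar> + K0) * (K0 * ?N))" by (simp add: K_def algebra_simps)
    have rem: "quad_rem \<epsilon> F u h x = D\<^sup>2 + 2 * Au * Q" unfolding quad_rem_def D_def Q_def Au_def by simp
    \<comment> \<open>The difference of the two sides is half the square of
      \<open>\<epsilon> * lap h x - 2 * f\<close>.\<close>
    have lo: "\<epsilon>\<^sup>2 / 2 * (lap h x)\<^sup>2 - f\<^sup>2 \<le> D\<^sup>2"
      using zero_le_power2[of "\<epsilon> * lap h x - 2 * f"] unfolding D by (simp add: power2_eq_square algebra_simps)
    have up: "D\<^sup>2 \<le> 2 * \<epsilon>\<^sup>2 * (lap h x)\<^sup>2 + 2 * f\<^sup>2"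
      using zero_le_power2[of "\<epsilon> * lap h x + f"] unfolding D by (simp add: power2_eq_square algebra_simps)
    have K0N: "0 \<le> K0 * ?N" using K0(1) N0 by simp
    have "\<epsilon>\<^sup>2 / 2 * (lap h x)\<^sup>2 - K * ?N \<le> quad_rem \<epsilon> F u h x"
      unfolding rem KN using lo f2 AQ K0N by linarith
    moreover have "\<bar>quad_rem \<epsilon> F u h x\<bar> \<le> \<bar>D\<^sup>2\<bar> + \<bar>2 * Au * Q\<bar>" unfolding rem by (rule abs_triangle_ineq)
    hence "\<bar>quad_rem \<epsilon> F u h x\<bar> \<le> 2 * \<epsilon>\<^sup>2 * (lap h x)\<^sup>2 + K * ?N"
      unfolding KN using up f2 AQ by (simp add: abs_of_nonneg)
    ultimately show "\<epsilon>\<^sup>2 / 2 * (lap h x)\<^sup>2 - K * ?N \<le> quad_rem \<epsilon> F u h x \<and> \<bar>quad_rem \<epsilon> F u h x\<bar> \<le> 2 * \<epsilon>\<^sup>2 * (lap h x)\<^sup>2 + K * ?N" by blast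
  qed
qed

section \<open>Sup bounds and the H^1 norm for elements of H^p\<close>

lemma sup_bounds:
  assumes R: "R > 0" and p: "real p > real_of_int \<lceil>real CARD('n::finite) / 2\<rceil> + 2"
  obtains K where "K \<ge> 0" "\<And>(u :: real^'n \<Rightarrow> real) x. u \<in> Hp R p \<Longrightarrow> x \<in> cube R \<Longrightarrow>
      \<bar>u x\<bar> \<le> K * sob_norm (cube R) p u \<and> \<bar>lap u x\<bar> \<le> K * sob_norm (cube R) p u \<and> norm (grad u x) \<le> K * sob_norm (cube R) p u"
proof -
  obtain K where K: "K \<ge> 0" and b: "\<And>(u :: real^'n \<Rightarrow> real) x. u \<in> sobolev (cube R) p \<Longrightarrow> C2_cl R u \<Longrightarrow> x \<in> cube R \<Longrightarrow>
      \<bar>u x\<bar> \<le> K * sob_norm (cube R) p u \<and> (\<forall>i. \<bar>pd i u x\<bar> \<le> K * sob_norm (cube R) p u) \<and>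
      (\<forall>i j. \<bar>pd j (pd i u) x\<bar> \<le> K * sob_norm (cube R) p u)"
    using sobolev_embedding[OF R p] by metis
  let ?d = "real CARD('n)"
  have d1: "?d \<ge> 1" using zero_less_card_finite[where 'a='n] by linarith
  show ?thesis
  proof (rule that[of "?d * K"], goal_cases)
    case 1 show ?case using K by simp
  next
    case (2 u x)
    let ?N = "sob_norm (cube R) p u"
    note B = b[OF Hp_D(1,2)[OF 2(1)] 2(2)]
    have KN: "K * ?N \<ge> 0" by (intro mult_nonneg_nonneg K sob_norm_nonneg)
    have "1 * (K * ?N) \<le> ?d * (K * ?N)" using d1 KN by (intro mult_right_mono)
    hence "\<bar>u x\<bar> \<le> ?d * K * ?N" using B by (simp add: mult.assoc)
    moreover have "\<bar>lap u x\<bar> \<le> ?d * K * ?N"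
    proof -
      have "\<bar>lap u x\<bar> \<le> (\<Sum>i\<in>UNIV. \<bar>pd i (pd i u) x\<bar>)" unfolding lap_def by (rule sum_abs)
      also have "\<dots> \<le> (\<Sum>i\<in>(UNIV::'n set). K * ?N)" using B by (intro sum_mono) auto
      finally show ?thesis by simp
    qed
    moreover have "norm (grad u x) \<le> ?d * K * ?N"
    proof -
      have "norm (grad u x) \<le> (\<Sum>i\<in>UNIV. \<bar>grad u x $ i\<bar>)" by (rule norm_le_l1_cart)
      also have "\<dots> \<le> (\<Sum>i\<in>(UNIV::'n set). K * ?N)" using B by (intro sum_mono) auto
      finally show ?thesis by simp
    qed
    ultimately show ?case by blast
  qed
qed

lemma multi_idx_1: "(multi_idx 1 :: ('n::finite \<Rightarrow> nat) set) = insert (\<lambda>_. 0) (range (\<lambda>i. mi_inc i (\<lambda>_. 0)))"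
proof
  show "insert (\<lambda>_. 0) (range (\<lambda>i. mi_inc i (\<lambda>_. 0))) \<subseteq> (multi_idx 1 :: ('n \<Rightarrow> nat) set)"
    by (auto simp: multi_idx_def sum_mi_inc)
  show "(multi_idx 1 :: ('n \<Rightarrow> nat) set) \<subseteq> insert (\<lambda>_. 0) (range (\<lambda>i. mi_inc i (\<lambda>_. 0)))"
  proof
    fix \<alpha> :: "'n \<Rightarrow> nat" assume "\<alpha> \<in> multi_idx 1"
    hence s: "sum \<alpha> UNIV \<le> 1" by (simp add: multi_idx_def)
    show "\<alpha> \<in> insert (\<lambda>_. 0) (range (\<lambda>i. mi_inc i (\<lambda>_. 0)))"
    proof (cases "\<forall>i. \<alpha> i = 0")
      case False
      then obtain i where i: "\<alpha> i \<noteq> 0" by blast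
      have "sum \<alpha> UNIV = \<alpha> i + sum \<alpha> (UNIV - {i})" by (rule sum.remove) auto
      hence "\<alpha> i = 1" "sum \<alpha> (UNIV - {i}) = 0" using s i by linarith+
      hence "\<alpha> = mi_inc i (\<lambda>_. 0)" by (auto simp: mi_inc_def fun_eq_iff)
      thus ?thesis by blast
    qed auto
  qed
qed

text \<open>The multi-indices of order at most one are zero and the unit indices, all of them
  different, and the chosen weak derivatives agree almost everywhere with the classical
  ones.\<close>

lemma sob_norm_1_sq:
  fixes u :: "real^'n::finite \<Rightarrow> real"
  assumes u: "u \<in> Hp R p" and p: "p \<ge> 1"
  shows "(sob_norm (cube R) 1 u)\<^sup>2 = integral\<^sup>L (cubeM R) (gradsq u)"
proof -
  note c = c2_D[OF Hp_D(3)[OF u]]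
  have s: "multi_idx 1 \<subseteq> (multi_idx p :: ('n \<Rightarrow> nat) set)" using p by (auto simp: multi_idx_def)
  have sq: "sqint (cubeM R) (wd (cube R) \<alpha> u)" if "\<alpha> \<in> multi_idx 1" for \<alpha>
    by (rule wd_sqint[OF Hp_D(1)[OF u]]) (use s that in blast)
  have e: "integral\<^sup>L (cubeM R) (\<lambda>x. wd (cube R) \<alpha> u x * wd (cube R) \<alpha> u x) = integral\<^sup>L (cubeM R) (\<lambda>x. (f x)\<^sup>2)"
    if "\<alpha> \<in> multi_idx 1" "AE x in cubeM R. wd (cube R) \<alpha> u x = f x" "nice R f" for \<alpha> f
  proof (rule integral_cong_AE)
    show "(\<lambda>x. wd (cube R) \<alpha> u x * wd (cube R) \<alpha> u x) \<in> borel_measurable (cubeM R)"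
      by (intro borel_measurable_times sqint_measurable sq that)
    show "(\<lambda>x. (f x)\<^sup>2) \<in> borel_measurable (cubeM R)" by (intro nice_measurable nice_power that)
    show "AE x in cubeM R. wd (cube R) \<alpha> u x * wd (cube R) \<alpha> u x = (f x)\<^sup>2"
      using that(2) by eventually_elim (simp add: power2_eq_square)
  qed
  have ne: "(\<lambda>_. 0) \<notin> range (\<lambda>i::'n. mi_inc i (\<lambda>_. 0))"
  proof
    assume "(\<lambda>_. 0) \<in> range (\<lambda>i::'n. mi_inc i (\<lambda>_. 0))"
    then obtain i :: 'n where "(\<lambda>_. 0) = mi_inc i (\<lambda>_. 0)" by blast
    hence "(\<lambda>_. 0::nat) i = mi_inc i (\<lambda>_. 0) i" by (rule fun_cong)
    thus False by (simp add: mi_inc_def)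
  qed
  have inj: "inj (\<lambda>i::'n. mi_inc i (\<lambda>_. 0))"
  proof (rule injI)
    fix i j :: 'n assume "mi_inc i (\<lambda>_. 0) = mi_inc j (\<lambda>_. 0)"
    hence "mi_inc i (\<lambda>_. 0) i = mi_inc j (\<lambda>_. 0) i" by simp
    thus "i = j" by (auto simp: mi_inc_def split: if_splits)
  qed
  have mi: "(\<lambda>_. 0) \<in> multi_idx 1" "mi_inc i (\<lambda>_. 0) \<in> multi_idx 1" for i :: 'n
    by (simp_all add: multi_idx_def sum_mi_inc)
  have "(sob_norm (cube R) 1 u)\<^sup>2 = integral\<^sup>L (cubeM R) (\<lambda>x. (u x)\<^sup>2) + (\<Sum>i\<in>UNIV. integral\<^sup>L (cubeM R) (\<lambda>x. (pd i u x)\<^sup>2))"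
    unfolding sob_norm_sq sob_inner_eq multi_idx_1
    using ne inj e[OF mi(1) wd_0_AE[OF Hp_D(1)[OF u]] c(1)] e[OF mi(2) wd_1_AE[OF Hp_D(1,2)[OF u] p] c(3)]
    by (simp add: sum.reindex)
  also have "\<dots> = integral\<^sup>L (cubeM R) (gradsq u)"
  proof -
    have i: "integrable (cubeM R) (\<lambda>x. (u x)\<^sup>2)" "integrable (cubeM R) (\<lambda>x. (pd i u x)\<^sup>2)" for i
      by (intro nice_integrable nice_power c)+
    show ?thesis unfolding gradsq_def[abs_def] using i by simp
  qed
  finally show ?thesis .
qed

text \<open>By the embedding \<open>quad_rem\<close> is at every point at most a multiple of the
  squared norm of \<open>h\<close>, and the weight is integrable. A remainder of quadratic order is
  more than differentiability at \<open>u\<close> asks for.\<close>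

lemma J_quadratic_remainder:
  fixes F :: "real^'n::finite \<Rightarrow> real \<Rightarrow> real^'n \<Rightarrow> real"
  assumes R: "R > 0" and eps: "\<epsilon> > 0" and rb: "r > R + 1" "b > R + r"
    and p: "real p > real_of_int \<lceil>real CARD('n) / 2\<rceil> + 2" and F: "C2_F R F" and eta: "\<eta> > 0" and u: "u \<in> Hp R p"
  obtains C where "C \<ge> 0" "\<And>h. h \<in> Hp R p \<Longrightarrow> sob_norm (cube R) p h \<le> 1 \<Longrightarrow>
    \<bar>Jfun R p k \<epsilon> r b F lam \<beta> \<eta> (\<lambda>x. u x + h x) - Jfun R p k \<epsilon> r b F lam \<beta> \<eta> u - DJfun R p k \<epsilon> r b F lam \<beta> \<eta> u h\<bar>
      \<le> C * (sob_norm (cube R) p h)\<^sup>2"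
proof -
  let ?n = "sob_norm (cube R) p :: (real^'n \<Rightarrow> real) \<Rightarrow> real" and ?I = "integral\<^sup>L (cubeM R)" and ?W = "weight k r b lam \<beta>"
  obtain K where K: "K \<ge> 0" and S: "\<And>(u :: real^'n \<Rightarrow> real) x. u \<in> Hp R p \<Longrightarrow> x \<in> cube R \<Longrightarrow>
      \<bar>u x\<bar> \<le> K * ?n u \<and> \<bar>lap u x\<bar> \<le> K * ?n u \<and> norm (grad u x) \<le> K * ?n u"
    using sup_bounds[OF R p] by metis
  \<comment> \<open>For \<open>h\<close> of norm at most 1 both \<open>u\<close> and
    \<open>u + h\<close> obey this bound, so one constant serves all such \<open>h\<close>.\<close>
  define B where "B = K * ?n u + K"
  obtain K1 where K1: "K1 \<ge> 0" and Q: "\<And>u h x. c2 R u \<Longrightarrow> c2 R h \<Longrightarrow> x \<in> cube R \<Longrightarrow> \<bar>u x\<bar> \<le> B \<Longrightarrow> \<bar>lap u x\<bar> \<le> B \<Longrightarrow> norm (grad u x) \<le> B \<Longrightarrow>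
      \<bar>u x + h x\<bar> \<le> B \<Longrightarrow> norm (grad u x + grad h x) \<le> B \<Longrightarrow>
      \<epsilon>\<^sup>2 / 2 * (lap h x)\<^sup>2 - K1 * gradsq h x \<le> quad_rem \<epsilon> F u h x \<and> \<bar>quad_rem \<epsilon> F u h x\<bar> \<le> 2 * \<epsilon>\<^sup>2 * (lap h x)\<^sup>2 + K1 * gradsq h x"
    using quad_rem_bounds[OF F eps, of B] by metis
  define C0 where "C0 = (2 * \<epsilon>\<^sup>2 + 2 * K1) * K\<^sup>2"
  have Wn: "nice R ?W" by (rule nice_weight[OF R rb])
  have W0: "?W x \<ge> 0" for x by (simp add: weight_def)
  have IW: "?I ?W \<ge> 0" using W0 by (intro integral_nonneg_AE AE_I2)
  show ?thesis
  proof (rule that[of "C0 * ?I ?W + \<eta>"])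
    have C0: "C0 \<ge> 0" using K1 by (simp add: C0_def)
    show "0 \<le> C0 * ?I ?W + \<eta>" using C0 IW eta by simp
    fix h :: "real^'n \<Rightarrow> real" assume h: "h \<in> Hp R p" "?n h \<le> 1"
    have bd: "\<bar>quad_rem \<epsilon> F u h x\<bar> \<le> C0 * (?n h)\<^sup>2" if x: "x \<in> cube R" for x
    proof -
      note Su = S[OF u x] and Sh = S[OF h(1) x]
      have Kh: "K * ?n h \<le> K" using K h(2) by (simp add: mult_left_le)
      have uB: "\<bar>u x\<bar> \<le> B" "\<bar>lap u x\<bar> \<le> B" "norm (grad u x) \<le> B" using Su K by (auto simp: B_def)
      have "\<bar>u x + h x\<bar> \<le> B" using Su Sh Kh unfolding B_def by linarith
      moreover have "norm (grad u x + grad h x) \<le> B"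
        using Su Sh Kh norm_triangle_ineq[of "grad u x" "grad h x"] unfolding B_def by linarith
      ultimately have 1: "\<bar>quad_rem \<epsilon> F u h x\<bar> \<le> 2 * \<epsilon>\<^sup>2 * (lap h x)\<^sup>2 + K1 * gradsq h x"
        using Q[OF Hp_D(3)[OF u] Hp_D(3)[OF h(1)] x uB] by blast
      have l2: "(lap h x)\<^sup>2 \<le> K\<^sup>2 * (?n h)\<^sup>2"
        using Sh power_mono[of "\<bar>lap h x\<bar>" "K * ?n h" 2] by (simp add: power_mult_distrib)
      have h2: "(h x)\<^sup>2 \<le> K\<^sup>2 * (?n h)\<^sup>2"
        using Sh power_mono[of "\<bar>h x\<bar>" "K * ?n h" 2] by (simp add: power_mult_distrib)
      have g2: "(norm (grad h x))\<^sup>2 \<le> K\<^sup>2 * (?n h)\<^sup>2"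
        using Sh power_mono[of "norm (grad h x)" "K * ?n h" 2] by (simp add: power_mult_distrib)
      have gs: "gradsq h x \<le> 2 * (K\<^sup>2 * (?n h)\<^sup>2)" using h2 g2 by (simp add: gradsq_def norm_sq_vec)
      have "2 * \<epsilon>\<^sup>2 * (lap h x)\<^sup>2 + K1 * gradsq h x \<le> 2 * \<epsilon>\<^sup>2 * (K\<^sup>2 * (?n h)\<^sup>2) + K1 * (2 * (K\<^sup>2 * (?n h)\<^sup>2))"
        using K1 by (intro add_mono mult_left_mono l2 gs) auto
      also have "\<dots> = C0 * (?n h)\<^sup>2" by (simp add: C0_def algebra_simps)
      finally show ?thesis using 1 by simp
    qed
    have nr: "nice R (quad_rem \<epsilon> F u h)" by (rule nice_quad_rem[OF F u h(1)])
    have "\<bar>?I (\<lambda>x. ?W x * quad_rem \<epsilon> F u h x)\<bar> \<le> ?I (\<lambda>x. \<bar>?W x * quad_rem \<epsilon> F u h x\<bar>)" by (rule integral_abs_bound)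
    also have "\<dots> \<le> ?I (\<lambda>x. C0 * (?n h)\<^sup>2 * ?W x)"
    proof (rule integral_mono_cube)
      show "nice R (\<lambda>x. \<bar>?W x * quad_rem \<epsilon> F u h x\<bar>)"
        using nice_mult[OF Wn nr] by (auto simp: nice_def intro!: continuous_intros)
      show "nice R (\<lambda>x. C0 * (?n h)\<^sup>2 * ?W x)" by (intro nice_mult nice_const Wn)
      show "\<bar>?W x * quad_rem \<epsilon> F u h x\<bar> \<le> C0 * (?n h)\<^sup>2 * ?W x" if "x \<in> cube R" for x
        using mult_left_mono[OF bd[OF that] W0[of x]] W0[of x] by (simp add: abs_mult mult_ac)
    qed
    also have "\<dots> = C0 * (?n h)\<^sup>2 * ?I ?W" by simp
    finally have "\<bar>?I (\<lambda>x. ?W x * quad_rem \<epsilon> F u h x) + \<eta> * (?n h)\<^sup>2\<bar> \<le> C0 * (?n h)\<^sup>2 * ?I ?W + \<eta> * (?n h)\<^sup>2"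
      using eta by (intro order_trans[OF abs_triangle_ineq] add_mono) (auto simp: abs_mult)
    thus "\<bar>Jfun R p k \<epsilon> r b F lam \<beta> \<eta> (\<lambda>x. u x + h x) - Jfun R p k \<epsilon> r b F lam \<beta> \<eta> u - DJfun R p k \<epsilon> r b F lam \<beta> \<eta> u h\<bar>
      \<le> (C0 * ?I ?W + \<eta>) * (?n h)\<^sup>2"
      unfolding J_expand[OF R rb F u h(1)] by (simp add: algebra_simps)
  qed
qed

text \<open>The Carleman estimate turns the weighted Laplacian term into
  \<open>\<epsilon>\<^sup>2 / 2 * (c * lam)\<close> times the weighted integral of
  \<open>gradsq h\<close>, against a loss of \<open>K1\<close> times the same integral with
  \<open>K1\<close> independent of \<open>lam\<close>. As the weight is at least 1, the weighted
  integral dominates the squared H^1 norm.\<close>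

lemma J_strongly_convex:
  fixes F :: "real^'n::finite \<Rightarrow> real \<Rightarrow> real^'n \<Rightarrow> real"
  assumes R: "R > 0" and eps: "\<epsilon> > 0" and rb: "r > R + 1" "b > R + r"
    and p: "real p > real_of_int \<lceil>real CARD('n) / 2\<rceil> + 2" and F: "C2_F R F" and M: "M > 0" and beta: "\<beta> > 1"
  obtains lam0 where "lam0 > 1" "\<And>lam f g \<eta> u v. lam > lam0 \<Longrightarrow> \<eta> > 0 \<Longrightarrow>
     u \<in> Hset R p k f g \<inter> Bbar R p M \<Longrightarrow> v \<in> Hset R p k f g \<inter> Bbar R p M \<Longrightarrow>
     Jfun R p k \<epsilon> r b F lam \<beta> \<eta> v - Jfun R p k \<epsilon> r b F lam \<beta> \<eta> u - DJfun R p k \<epsilon> r b F lam \<beta> \<eta> u (\<lambda>x. v x - u x)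
       \<ge> (sob_norm (cube R) 1 (\<lambda>x. v x - u x))\<^sup>2 + \<eta> * (sob_norm (cube R) p (\<lambda>x. v x - u x))\<^sup>2"
proof -
  let ?n = "sob_norm (cube R) p :: (real^'n \<Rightarrow> real) \<Rightarrow> real" and ?I = "integral\<^sup>L (cubeM R)"
  obtain K where K: "K \<ge> 0" and S: "\<And>(u :: real^'n \<Rightarrow> real) x. u \<in> Hp R p \<Longrightarrow> x \<in> cube R \<Longrightarrow>
      \<bar>u x\<bar> \<le> K * ?n u \<and> \<bar>lap u x\<bar> \<le> K * ?n u \<and> norm (grad u x) \<le> K * ?n u"
    using sup_bounds[OF R p] by metis
  \<comment> \<open>A sup bound for all members of the closed ball; \<open>u + h\<close> is the
    admissible \<open>v\<close>, hence covered as well.\<close>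
  define B where "B = K * M"
  obtain K1 where K1: "K1 \<ge> 0" and Q: "\<And>u h x. c2 R u \<Longrightarrow> c2 R h \<Longrightarrow> x \<in> cube R \<Longrightarrow> \<bar>u x\<bar> \<le> B \<Longrightarrow> \<bar>lap u x\<bar> \<le> B \<Longrightarrow> norm (grad u x) \<le> B \<Longrightarrow>
      \<bar>u x + h x\<bar> \<le> B \<Longrightarrow> norm (grad u x + grad h x) \<le> B \<Longrightarrow>
      \<epsilon>\<^sup>2 / 2 * (lap h x)\<^sup>2 - K1 * gradsq h x \<le> quad_rem \<epsilon> F u h x \<and> \<bar>quad_rem \<epsilon> F u h x\<bar> \<le> 2 * \<epsilon>\<^sup>2 * (lap h x)\<^sup>2 + K1 * gradsq h x"
    using quad_rem_bounds[OF F eps, of B] by metis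
  obtain c L where c: "c > 0" and L: "L \<ge> 1" and car: "\<And>lam h. lam \<ge> L \<Longrightarrow> C2_cl R h \<Longrightarrow> zero_bdry R k h \<Longrightarrow>
     c * lam * ?I (\<lambda>x. weight k r b lam \<beta> x * ((h x)\<^sup>2 + (\<Sum>j\<in>UNIV. (pd j h x)\<^sup>2)))
     \<le> ?I (\<lambda>x. weight k r b lam \<beta> x * (lap h x)\<^sup>2)"
    by (rule carleman_estimate[OF R rb beta, where k=k]) (rule that)
  \<comment> \<open>Chosen so that the surplus over \<open>K1\<close> is at least 1. This makes 1
    the constant in front of the H^1 norm, uniformly in \<open>\<eta>\<close> and in the boundary
    data.\<close>
  define lam0 where "lam0 = max L (2 * (K1 + 1) / (\<epsilon>\<^sup>2 * c)) + 1"
  have p1: "p \<ge> 1"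
  proof -
    have "real_of_int \<lceil>real CARD('n) / 2\<rceil> \<ge> 0" by simp
    thus ?thesis using p by linarith
  qed
  show ?thesis
  proof (rule that[of lam0])
    show "lam0 > 1" using L by (simp add: lam0_def)
    fix lam \<eta> :: real and f g u v :: "real^'n \<Rightarrow> real"
    assume lam: "lam > lam0" and eta: "\<eta> > 0" and u: "u \<in> Hset R p k f g \<inter> Bbar R p M" and v: "v \<in> Hset R p k f g \<inter> Bbar R p M"
    let ?W = "weight k r b lam \<beta>"
    define h where "h x = v x - u x" for x
    have hH: "h \<in> H0set R p k" unfolding h_def[abs_def] using Hset_diff[OF R] u v by blast
    have up: "u \<in> Hp R p" "v \<in> Hp R p" "h \<in> Hp R p" "?n u \<le> M" "?n v \<le> M"
      using u v hH by (auto simp: Hset_def Bbar_def H0set_def)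
    have v_eq: "(\<lambda>x. u x + h x) = v" by (simp add: h_def fun_eq_iff)
    note ch = Hp_D(3)[OF up(3)]
    have l1: "lam \<ge> L" "lam \<ge> 0" using lam L by (auto simp: lam0_def)
    have l2: "\<epsilon>\<^sup>2 / 2 * (c * lam) \<ge> K1 + 1"
    proof -
      have "2 * (K1 + 1) / (\<epsilon>\<^sup>2 * c) \<le> lam" using lam by (simp add: lam0_def)
      thus ?thesis using eps c by (simp add: pos_divide_le_eq mult_ac)
    qed
    have Wn: "nice R ?W" by (rule nice_weight[OF R rb])
    have W1: "?W x \<ge> 1" for x by (rule weight_ge_1[OF l1(2)])
    have pt: "\<epsilon>\<^sup>2 / 2 * (lap h x)\<^sup>2 - K1 * gradsq h x \<le> quad_rem \<epsilon> F u h x" if x: "x \<in> cube R" for x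
    proof -
      have KM: "K * ?n u \<le> B" "K * ?n v \<le> B" unfolding B_def using K up by (auto intro: mult_left_mono)
      note Su = S[OF up(1) x] and Sv = S[OF up(2) x]
      have gv: "grad u x + grad h x = grad v x"
        using lap_add(2)[OF Hp_D(3)[OF up(1)] ch x] unfolding v_eq by simp
      have hv: "u x + h x = v x" by (simp add: h_def)
      show ?thesis
        using Q[OF Hp_D(3)[OF up(1)] ch x, unfolded gv hv] Su Sv KM by (meson order_trans)
    qed
    have nN: "nice R (\<lambda>x. ?W x * gradsq h x)" and nL: "nice R (\<lambda>x. ?W x * (lap h x)\<^sup>2)"
      by (intro nice_mult nice_power Wn nice_gradsq nice_lap ch)+
    note iN = nice_integrable[OF nN] and iL = nice_integrable[OF nL]
    have g0: "gradsq h x \<ge> 0" for x unfolding gradsq_def by (intro add_nonneg_nonneg sum_nonneg) auto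
    have N0: "?I (\<lambda>x. ?W x * gradsq h x) \<ge> ?I (gradsq h)"
    proof (rule integral_mono_cube[OF nice_gradsq[OF ch] nN])
      show "gradsq h x \<le> ?W x * gradsq h x" for x using mult_right_mono[OF W1 g0, of x x] by simp
    qed
    have N1: "?I (gradsq h) \<ge> 0" using g0 by (intro integral_nonneg_AE AE_I2)
    have "(sob_norm (cube R) 1 h)\<^sup>2 = ?I (gradsq h)" by (rule sob_norm_1_sq[OF up(3) p1])
    also have "\<dots> \<le> ?I (\<lambda>x. ?W x * gradsq h x)" by (rule N0)
    also have "\<dots> \<le> (\<epsilon>\<^sup>2 / 2 * (c * lam) - K1) * ?I (\<lambda>x. ?W x * gradsq h x)"
      using mult_right_mono[of 1 "\<epsilon>\<^sup>2 / 2 * (c * lam) - K1" "?I (\<lambda>x. ?W x * gradsq h x)"] l2 N0 N1 by simp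
    also have "\<dots> = \<epsilon>\<^sup>2 / 2 * (c * lam * ?I (\<lambda>x. ?W x * gradsq h x)) - K1 * ?I (\<lambda>x. ?W x * gradsq h x)"
      by (simp add: algebra_simps)
    also have "\<dots> \<le> \<epsilon>\<^sup>2 / 2 * ?I (\<lambda>x. ?W x * (lap h x)\<^sup>2) - K1 * ?I (\<lambda>x. ?W x * gradsq h x)"
      using car[OF l1(1) H0set_zero_bdry[OF hH R]] unfolding gradsq_def[abs_def]
      by (intro diff_right_mono mult_left_mono) auto
    also have "\<dots> = ?I (\<lambda>x. \<epsilon>\<^sup>2 / 2 * (?W x * (lap h x)\<^sup>2) - K1 * (?W x * gradsq h x))"
      using iN iL by simp
    also have "\<dots> \<le> ?I (\<lambda>x. ?W x * quad_rem \<epsilon> F u h x)"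
    proof (rule integral_mono_cube)
      show "nice R (\<lambda>x. \<epsilon>\<^sup>2 / 2 * (?W x * (lap h x)\<^sup>2) - K1 * (?W x * gradsq h x))"
        by (intro nice_diff nice_mult[OF nice_const] nN nL)
      show "nice R (\<lambda>x. ?W x * quad_rem \<epsilon> F u h x)" by (intro nice_mult Wn nice_quad_rem[OF F up(1,3)])
      fix x :: "real^'n" assume x: "x \<in> cube R"
      have "?W x * (\<epsilon>\<^sup>2 / 2 * (lap h x)\<^sup>2 - K1 * gradsq h x) \<le> ?W x * quad_rem \<epsilon> F u h x"
        using W1[of x] by (intro mult_left_mono pt x) auto
      thus "\<epsilon>\<^sup>2 / 2 * (?W x * (lap h x)\<^sup>2) - K1 * (?W x * gradsq h x) \<le> ?W x * quad_rem \<epsilon> F u h x"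
        by (simp add: algebra_simps)
    qed
    finally have "(sob_norm (cube R) 1 h)\<^sup>2 \<le> ?I (\<lambda>x. ?W x * quad_rem \<epsilon> F u h x)" .
    thus "Jfun R p k \<epsilon> r b F lam \<beta> \<eta> v - Jfun R p k \<epsilon> r b F lam \<beta> \<eta> u - DJfun R p k \<epsilon> r b F lam \<beta> \<eta> u (\<lambda>x. v x - u x)
       \<ge> (sob_norm (cube R) 1 (\<lambda>x. v x - u x))\<^sup>2 + \<eta> * (sob_norm (cube R) p (\<lambda>x. v x - u x))\<^sup>2"
      using J_expand[OF R rb F up(1,3), of k \<epsilon> lam \<beta> \<eta>] unfolding v_eq h_def[abs_def] by simp
  qed
qed

section \<open>Existence and uniqueness of the minimizer\<close>

text \<open>The parallelogram law, in the form that measures the loss of norm at a midpoint.\<close>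

lemma sob_midpoint_sq:
  assumes "u \<in> Hp R p" "v \<in> Hp R p"
  shows "(sob_norm (cube R) p (\<lambda>x. (u x + v x) / 2))\<^sup>2 + (sob_norm (cube R) p (\<lambda>x. v x - u x))\<^sup>2 / 4
     = ((sob_norm (cube R) p u)\<^sup>2 + (sob_norm (cube R) p v)\<^sup>2) / 2"
proof -
  note s = Hp_D(1)[OF assms(1)] Hp_D(1)[OF assms(2)]
  have "(\<lambda>x. (u x + v x) / 2) = (\<lambda>x. 1/2 * u x + 1/2 * v x)" "(\<lambda>x. v x - u x) = (\<lambda>x. (-1) * u x + 1 * v x)"
    by (auto simp: fun_eq_iff)
  thus ?thesis by (simp only: sob_norm_lincomb_sq[OF s]) (simp add: power2_eq_square field_simps)
qed

lemma midpoint_admissible: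
  assumes R: "R > 0" and M: "M > 0" and u: "u \<in> Hset R p k f g \<inter> Bbar R p M" and v: "v \<in> Hset R p k f g \<inter> Bbar R p M"
  shows "(\<lambda>x. (u x + v x) / 2) \<in> Hset R p k f g \<inter> Bbar R p M"
proof -
  have h: "u \<in> Hp R p" "v \<in> Hp R p" "sob_norm (cube R) p u \<le> M" "sob_norm (cube R) p v \<le> M"
    using u v by (auto simp: Hset_def Bbar_def)
  have eq: "(\<lambda>x. (u x + v x) / 2) = (\<lambda>x. 1/2 * u x + 1/2 * v x)" by (auto simp: fun_eq_iff)
  have fe: "(\<lambda>x. 1/2 * f x + 1/2 * f x) = f" for f :: "real^'a \<Rightarrow> real" by (auto simp: fun_eq_iff)
  have 1: "(\<lambda>x. (u x + v x) / 2) \<in> Hset R p k f g"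
    using Hset_lincomb[OF R, of u p k f g v f g "1/2" "1/2"] u v unfolding eq fe by blast
  have "(sob_norm (cube R) p u)\<^sup>2 \<le> M\<^sup>2" "(sob_norm (cube R) p v)\<^sup>2 \<le> M\<^sup>2"
    using h sob_norm_nonneg[of R p] by (auto intro!: power_mono)
  hence "((sob_norm (cube R) p u)\<^sup>2 + (sob_norm (cube R) p v)\<^sup>2) / 2 \<le> M\<^sup>2" by simp
  moreover have "0 \<le> (sob_norm (cube R) p (\<lambda>x. v x - u x))\<^sup>2 / 4" by simp
  ultimately have "(sob_norm (cube R) p (\<lambda>x. (u x + v x) / 2))\<^sup>2 \<le> M\<^sup>2"
    using sob_midpoint_sq[OF h(1,2)] by linarith
  hence "sob_norm (cube R) p (\<lambda>x. (u x + v x) / 2) \<le> M" by (rule power2_le_imp_le) (use M in simp)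
  thus ?thesis using 1 by (auto simp: Bbar_def Hset_def)
qed

section \<open>Uniform limits and completeness of the admissible class\<close>

lemma pd_uniform_limit:
  fixes u :: "nat \<Rightarrow> real^'n::finite \<Rightarrow> real"
  assumes l: "\<And>n. ldiff R i (u n)"
    and lim: "\<And>x. x \<in> cube R \<Longrightarrow> (\<lambda>n. u n x) \<longlonglongrightarrow> U x"
    and unif: "uniform_limit (cube R) (\<lambda>n. pd i (u n)) q sequentially"
    and x: "x \<in> cube R"
  shows "((\<lambda>t. U (x + t *\<^sub>R axis i 1)) has_real_derivative q x) (at 0)"
proof -
  \<comment> \<open>The parameters for which the line through \<open>x\<close> stays in the cube; on
    this interval a sequence with uniformly convergent derivatives may be differentiated in the
    limit.\<close>
  define S where "S = {- R - x $ i <..< R - x $ i}"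
  have S0: "0 \<in> S" "open S" "convex S" using x by (auto simp: S_def mem_cube)
  have mem: "x + t *\<^sub>R axis i 1 \<in> cube R" if "t \<in> S" for t
    by (rule axis_line_cube[OF x]) (use that in \<open>auto simp: S_def\<close>)
  have "\<exists>g. \<forall>t\<in>S. (\<lambda>n. u n (x + t *\<^sub>R axis i 1)) \<longlonglongrightarrow> g t \<and> (g has_derivative (\<lambda>h. h * q (x + t *\<^sub>R axis i 1))) (at t within S)"
  proof (rule has_derivative_sequence[OF S0(3)])
    show "((\<lambda>t. u n (x + t *\<^sub>R axis i 1)) has_derivative (\<lambda>h. h * pd i (u n) (x + t *\<^sub>R axis i 1))) (at t within S)" if "t \<in> S" for n t
    proof -
      have "((\<lambda>t. u n (x + t *\<^sub>R axis i 1)) has_real_derivative pd i (u n) (x + t *\<^sub>R axis i 1)) (at t)"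
        by (rule pd_line_deriv_at) (use l mem[OF that] in \<open>auto simp: ldiff_def\<close>)
      thus ?thesis by (simp add: has_field_derivative_def has_derivative_at_withinI mult_commute_abs)
    qed
    show "\<forall>\<^sub>F n in sequentially. \<forall>t\<in>S. \<forall>h. norm (h * pd i (u n) (x + t *\<^sub>R axis i 1) - h * q (x + t *\<^sub>R axis i 1)) \<le> e * norm h"
      if "e > 0" for e
      using uniform_limitD[OF unif that]
    proof eventually_elim
      case (elim n)
      show ?case
      proof (intro ballI allI)
        fix t h assume "t \<in> S"
        have "\<bar>h\<bar> * \<bar>pd i (u n) (x + t *\<^sub>R axis i 1) - q (x + t *\<^sub>R axis i 1)\<bar> \<le> \<bar>h\<bar> * e"
          using elim mem[OF \<open>t \<in> S\<close>] by (intro mult_left_mono) (auto simp: dist_real_def less_imp_le)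
        thus "norm (h * pd i (u n) (x + t *\<^sub>R axis i 1) - h * q (x + t *\<^sub>R axis i 1)) \<le> e * norm h"
          by (simp add: abs_mult[symmetric] right_diff_distrib mult.commute)
      qed
    qed
    show "0 \<in> S" by (rule S0)
    show "(\<lambda>n. u n (x + 0 *\<^sub>R axis i 1)) \<longlonglongrightarrow> U x" using lim[OF x] by simp
  qed
  then obtain g where g: "\<And>t. t \<in> S \<Longrightarrow> (\<lambda>n. u n (x + t *\<^sub>R axis i 1)) \<longlonglongrightarrow> g t"
    "\<And>t. t \<in> S \<Longrightarrow> (g has_derivative (\<lambda>h. h * q (x + t *\<^sub>R axis i 1))) (at t within S)" by blast
  have "g t = U (x + t *\<^sub>R axis i 1)" if "t \<in> S" for t
    using LIMSEQ_unique[OF g(1)[OF that] lim[OF mem[OF that]]] .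
  moreover have "(g has_derivative (\<lambda>h. h * q x)) (at 0)"
    using g(2)[OF S0(1)] at_within_open[OF S0(1,2)] by simp
  ultimately have "((\<lambda>t. U (x + t *\<^sub>R axis i 1)) has_derivative (\<lambda>h. h * q x)) (at 0)"
    using has_derivative_transform_within_open[OF _ S0(2,1), of g "\<lambda>h. h * q x" UNIV "\<lambda>t. U (x + t *\<^sub>R axis i 1)"] by simp
  thus ?thesis by (simp add: has_field_derivative_def mult_commute_abs)
qed

lemma uniform_limit_tendsto_const:
  fixes q :: "nat \<Rightarrow> real^'n::finite \<Rightarrow> real"
  assumes u: "uniform_limit (cube R) q Q sequentially" and l: "\<And>n. (q n \<longlongrightarrow> L n) (at x within cube R)"
    and lim: "L \<longlonglongrightarrow> l"
  shows "(Q \<longlongrightarrow> l) (at x within cube R)"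
proof (rule swap_uniform_limit'[OF _ lim u])
  show "\<forall>\<^sub>F n in sequentially. (q n \<longlongrightarrow> L n) (at x within cube R)" by (intro always_eventually allI l)
  show "\<forall>\<^sub>F y in at x within cube R. y \<in> cube R" by (simp add: eventually_at_filter)
qed simp

text \<open>Uniform closeness on the cube passes to the limits at \<open>x\<close>, so these form a
  Cauchy sequence, and the two limits can be interchanged.\<close>

lemma uniform_limit_tendsto_within:
  fixes q :: "nat \<Rightarrow> real^'n::finite \<Rightarrow> real"
  assumes u: "uniform_limit (cube R) q Q sequentially" and l: "\<And>n. \<exists>l. (q n \<longlongrightarrow> l) (at x within cube R)"
  shows "\<exists>l. (Q \<longlongrightarrow> l) (at x within cube R)"
\<comment> \<open>Under the trivial filter every value is a limit.\<close>
proof (cases "at x within cube R = bot")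
  case False
  obtain L where L: "\<And>n. (q n \<longlongrightarrow> L n) (at x within cube R)" using l by metis
  have "Cauchy L"
  proof (rule CauchyI)
    fix e :: real assume e: "e > 0"
    from uniform_limitD[OF u, of "e/4"] e obtain N where N: "\<And>n y. n \<ge> N \<Longrightarrow> y \<in> cube R \<Longrightarrow> dist (q n y) (Q y) < e/4"
      unfolding eventually_sequentially by auto
    have "norm (L m - L n) < e" if mn: "m \<ge> N" "n \<ge> N" for m n
    proof -
      have "((\<lambda>y. \<bar>q m y - q n y\<bar>) \<longlongrightarrow> \<bar>L m - L n\<bar>) (at x within cube R)" by (intro tendsto_intros L)
      moreover have "\<forall>\<^sub>F y in at x within cube R. \<bar>q m y - q n y\<bar> \<le> e/2"
        unfolding eventually_at_filter
      proof (rule always_eventually, intro allI impI)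
        fix y :: "real^'n" assume "y \<in> cube R"
        from N[OF mn(1) this] N[OF mn(2) this] show "\<bar>q m y - q n y\<bar> \<le> e/2" unfolding dist_real_def by linarith
      qed
      ultimately have "\<bar>L m - L n\<bar> \<le> e/2" by (rule tendsto_upperbound[OF _ _ False])
      thus ?thesis using e by simp
    qed
    thus "\<exists>N. \<forall>m\<ge>N. \<forall>n\<ge>N. norm (L m - L n) < e" by blast
  qed
  then obtain l where "L \<longlonglongrightarrow> l" using Cauchy_convergent_iff convergent_def by blast
  from uniform_limit_tendsto_const[OF u L this] show ?thesis by blast
qed simp

text \<open>\<open>wd\<close> is a choice, so the norm of a difference or of a limit is computed
  from whatever weak derivatives are at hand; all choices agree almost everywhere.\<close>

lemma sob_norm_sq_eq:
  fixes u :: "real^'n::finite \<Rightarrow> real"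
  assumes "u \<in> sobolev (cube R) p" "\<And>\<alpha>. \<alpha> \<in> multi_idx p \<Longrightarrow> is_wderiv (cube R) \<alpha> u (w \<alpha>)"
  shows "(sob_norm (cube R) p u)\<^sup>2 = (\<Sum>\<alpha>\<in>multi_idx p. integral\<^sup>L (cubeM R) (\<lambda>x. (w \<alpha> x)\<^sup>2))"
  unfolding sob_norm_sq sob_inner_eq
proof (intro sum.cong refl integral_cong_AE)
  fix \<alpha> :: "'n \<Rightarrow> nat" assume al: "\<alpha> \<in> multi_idx p"
  have "sqint (cubeM R) (w \<alpha>)" "sqint (cubeM R) (wd (cube R) \<alpha> u)"
    using assms(2)[OF al] wd_sqint[OF assms(1) al] by (auto simp: is_wderiv_iff)
  thus "(\<lambda>x. wd (cube R) \<alpha> u x * wd (cube R) \<alpha> u x) \<in> borel_measurable (cubeM R)" "(\<lambda>x. (w \<alpha> x)\<^sup>2) \<in> borel_measurable (cubeM R)"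
    by (auto dest!: sqint_measurable)
  show "AE x in cubeM R. wd (cube R) \<alpha> u x * wd (cube R) \<alpha> u x = (w \<alpha> x)\<^sup>2"
    using is_wderiv_unique[OF wd_is_wderiv[OF assms(1) al] assms(2)[OF al]]
    by eventually_elim (simp add: power2_eq_square)
qed

lemma is_wderiv_diff:
  assumes "is_wderiv (cube R) \<alpha> u v" "is_wderiv (cube R) \<alpha> u' v'" "sqint (cubeM R) u" "sqint (cubeM R) u'"
  shows "is_wderiv (cube R) \<alpha> (\<lambda>x. u x - u' x) (\<lambda>x. v x - v' x)"
  using is_wderiv_lincomb[OF assms, of 1 "-1"] by simp

lemma sobolev_diff:
  "u \<in> sobolev (cube R) p \<Longrightarrow> v \<in> sobolev (cube R) p \<Longrightarrow> (\<lambda>x. u x - v x) \<in> sobolev (cube R) p"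
  using sobolev_lincomb[of u R p v 1 "-1"] by simp

text \<open>Two kinds of limits are matched. The embedding makes the sequence converge uniformly
  with its derivatives up to order two, which preserves \<open>C2_cl\<close> and the boundary data.
  Completeness of L^2 gives limits of all weak derivatives up to order \<open>p\<close>, and passing
  to the limit in the weak formulation shows that they are the weak derivatives of the uniform
  limit.\<close>

lemma Hset_complete:
  fixes u :: "nat \<Rightarrow> real^'n::finite \<Rightarrow> real"
  assumes R: "R > 0" and p: "real p > real_of_int \<lceil>real CARD('n) / 2\<rceil> + 2"
    and u: "\<And>n. u n \<in> Hset R p k f g"
    and cau: "\<And>e. e > 0 \<Longrightarrow> \<exists>N. \<forall>m\<ge>N. \<forall>n\<ge>N. sob_norm (cube R) p (\<lambda>x. u m x - u n x) < e"
  obtains U where "U \<in> Hset R p k f g" "(\<lambda>n. sob_norm (cube R) p (\<lambda>x. u n x - U x)) \<longlonglongrightarrow> 0"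
proof -
  let ?n = "sob_norm (cube R) p :: (real^'n \<Rightarrow> real) \<Rightarrow> real" and ?I = "integral\<^sup>L (cubeM R)"
  obtain K where K: "K \<ge> 0" and emb: "\<And>(u :: real^'n \<Rightarrow> real) x. u \<in> sobolev (cube R) p \<Longrightarrow> C2_cl R u \<Longrightarrow> x \<in> cube R \<Longrightarrow>
      \<bar>u x\<bar> \<le> K * ?n u \<and> (\<forall>i. \<bar>pd i u x\<bar> \<le> K * ?n u) \<and> (\<forall>i j. \<bar>pd j (pd i u) x\<bar> \<le> K * ?n u)"
    by (rule sobolev_embedding[OF R p]) (rule that)
  have uH: "u n \<in> Hp R p" for n using u by (auto simp: Hset_def)
  note us = Hp_D(1)[OF uH] and uC = Hp_D(2)[OF uH] and uc = Hp_D(3)[OF uH]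
  let ?d = "\<lambda>m n x. u m x - u n x"
  have dH: "?d m n \<in> Hp R p" for m n using Hp_lincomb[OF uH uH, of 1 m "-1" n] by simp
  have dpd: "pd i (?d m n) x = pd i (u m) x - pd i (u n) x" "pd j (pd i (?d m n)) x = pd j (pd i (u m)) x - pd j (pd i (u n)) x"
    if "x \<in> cube R" for i j m n x
    using pd_lincomb_cube[OF that c2_D(2)[OF uc[of m]] c2_D(2)[OF uc[of n]], of i 1 "-1"]
      pd2_lincomb_cube[OF that uc[of m] uc[of n], of j i 1 "-1"] by simp_all
  have B: "\<bar>u m x - u n x\<bar> \<le> K * ?n (?d m n)" "\<bar>pd i (u m) x - pd i (u n) x\<bar> \<le> K * ?n (?d m n)"
    "\<bar>pd j (pd i (u m)) x - pd j (pd i (u n)) x\<bar> \<le> K * ?n (?d m n)" if "x \<in> cube R" for i j m n x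
    using emb[OF Hp_D(1,2)[OF dH[of m n]] that] dpd[OF that] by auto
  have ul: "\<exists>Q. uniform_limit S w Q sequentially" if "\<And>m n x. x \<in> S \<Longrightarrow> \<bar>w m x - w n x\<bar> \<le> K * ?n (?d m n)"
    for S and w :: "nat \<Rightarrow> real^'n \<Rightarrow> real"
  proof -
    have "uniformly_Cauchy_on S w"
      unfolding uniformly_Cauchy_on_def
    proof (intro allI impI)
      fix e :: real assume e: "e > 0"
      \<comment> \<open>The denominator is \<open>K + 1\<close> because \<open>K\<close> may be
        0.\<close>
      then obtain N where N: "\<forall>m\<ge>N. \<forall>n\<ge>N. ?n (?d m n) < e / (K + 1)" using cau[of "e / (K + 1)"] K by auto
      have "dist (w m x) (w n x) < e" if "x \<in> S" "m \<ge> N" "n \<ge> N" for x m n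
      proof -
        have "dist (w m x) (w n x) \<le> K * ?n (?d m n)"
          using \<open>\<And>m n x. x \<in> S \<Longrightarrow> \<bar>w m x - w n x\<bar> \<le> K * ?n (?d m n)\<close>[OF that(1)] by (simp add: dist_real_def)
        also have "\<dots> \<le> K * (e / (K + 1))" using N that K by (intro mult_left_mono) (auto simp: less_imp_le)
        also have "\<dots> < e" using e K by (simp add: field_simps)
        finally show ?thesis .
      qed
      thus "\<exists>M. \<forall>x\<in>S. \<forall>m\<ge>M. \<forall>n\<ge>M. dist (w m x) (w n x) < e" by blast
    qed
    thus ?thesis using Cauchy_uniformly_convergent uniformly_convergent_on_def by blast
  qed
  \<comment> \<open>Outside the open cube all members coincide, with \<open>f\<close> on the
    boundary and with 0 beyond, so the convergence is uniform on the whole space.\<close>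
  have "\<bar>u m x - u n x\<bar> \<le> K * ?n (?d m n)" for m n x
  proof (cases "x \<in> cube R")
    case False
    have "u m x = u n x"
    proof (cases "x \<in> ccube R")
      case True
      hence "x \<in> bdry R" using False by (simp add: bdry_def)
      thus ?thesis using u[of m] u[of n] by (simp add: Hset_def)
    next
      case False
      thus ?thesis using uH[of m] uH[of n] by (simp add: Hp_def)
    qed
    thus ?thesis using K sob_norm_nonneg[of R p "?d m n"] by simp
  qed (rule B)
  then obtain U where U: "uniform_limit UNIV u U sequentially" using ul[of UNIV u] by blast
  have Ucc: "uniform_limit (ccube R) u U sequentially" "uniform_limit (cube R) u U sequentially"
    using uniform_limit_on_subset[OF U] by auto
  have Upt: "(\<lambda>n. u n x) \<longlonglongrightarrow> U x" for x using tendsto_uniform_limitI[OF U] by simp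
  have "\<exists>Q. uniform_limit (cube R) (\<lambda>n. pd i (u n)) Q sequentially" for i by (rule ul) (rule B)
  then obtain q where q: "\<And>i. uniform_limit (cube R) (\<lambda>n. pd i (u n)) (q i) sequentially" by metis
  have "\<exists>Q. uniform_limit (cube R) (\<lambda>n. pd j (pd i (u n))) Q sequentially" for i j by (rule ul) (rule B)
  note ex = this
  define qq where "qq i j = (SOME Q. uniform_limit (cube R) (\<lambda>n. pd j (pd i (u n))) Q sequentially)" for i j
  have qq: "uniform_limit (cube R) (\<lambda>n. pd j (pd i (u n))) (qq i j) sequentially" for i j
    unfolding qq_def by (rule someI_ex[OF ex])
  have DU: "((\<lambda>t. U (x + t *\<^sub>R axis i 1)) has_real_derivative q i x) (at 0)" if "x \<in> cube R" for i x
    by (rule pd_uniform_limit[OF c2_D(2)[OF uc] Upt q that])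
  have Dq: "((\<lambda>t. q i (x + t *\<^sub>R axis j 1)) has_real_derivative qq i j x) (at 0)" if "x \<in> cube R" for i j x
    by (rule pd_uniform_limit[OF c2_D(4)[OF uc] tendsto_uniform_limitI[OF q] qq that])
  have pU: "pd i U x = q i x" if "x \<in> cube R" for i x
    unfolding pd_def by (rule DERIV_imp_deriv[OF DU[OF that]])
  have ppU: "pd j (pd i U) x = qq i j x" if "x \<in> cube R" for i j x
  proof -
    have "pd j (pd i U) x = pd j (q i) x" by (rule pd_cong_cube[OF pU that])
    also have "\<dots> = qq i j x" unfolding pd_def by (rule DERIV_imp_deriv[OF Dq[OF that]])
    finally show ?thesis .
  qed
  have lU: "ldiff R i U" for i unfolding ldiff_def using DU real_differentiable_def by blast
  have lq: "ldiff R j (q i)" for i j unfolding ldiff_def using Dq real_differentiable_def by blast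
  have lpU: "ldiff R j (pd i U)" for i j
    using lq[of j i] ldiff_cong[of R "pd i U" "q i" j, OF pU] by simp
  have cU: "continuous_on (ccube R) U"
    by (rule uniform_limit_theorem[OF always_eventually Ucc(1)]) (use uC in \<open>auto simp: C2_cl_def\<close>)
  have cq: "continuous_on (cube R) (q i)" for i
    by (rule uniform_limit_theorem[OF always_eventually q]) (use uC in \<open>auto simp: C2_cl_def\<close>)
  have cqq: "continuous_on (cube R) (qq i j)" for i j
    by (rule uniform_limit_theorem[OF always_eventually qq]) (use uC in \<open>auto simp: C2_cl_def\<close>)
  have tq: "\<exists>l. (pd i U \<longlongrightarrow> l) (at x within cube R)" if "x \<in> ccube R" for i x
  proof -
    have "\<exists>l. (q i \<longlongrightarrow> l) (at x within cube R)"
      by (rule uniform_limit_tendsto_within[OF q]) (use uC that in \<open>auto simp: C2_cl_def\<close>)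
    then obtain l where "(q i \<longlongrightarrow> l) (at x within cube R)" by blast
    thus ?thesis using tendsto_cong_cube[where f="pd i U" and g="q i" and R=R] pU by blast
  qed
  have tqq: "\<exists>l. (pd j (pd i U) \<longlongrightarrow> l) (at x within cube R)" if "x \<in> ccube R" for i j x
  proof -
    have "\<exists>l. (qq i j \<longlongrightarrow> l) (at x within cube R)"
      by (rule uniform_limit_tendsto_within[OF qq]) (use uC that in \<open>auto simp: C2_cl_def\<close>)
    then obtain l where "(qq i j \<longlongrightarrow> l) (at x within cube R)" by blast
    thus ?thesis using tendsto_cong_cube[where f="pd j (pd i U)" and g="qq i j" and R=R] ppU by blast
  qed
  have C2U: "C2_cl R U"
    unfolding C2_cl_def
  proof (intro conjI ballI allI)
    show "continuous_on (ccube R) U" by (rule cU)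
    show "(\<lambda>t. U (x + t *\<^sub>R axis i 1)) differentiable at 0" if "x \<in> cube R" for x i using lU that by (simp add: ldiff_def)
    show "(\<lambda>t. pd i U (x + t *\<^sub>R axis j 1)) differentiable at 0" if "x \<in> cube R" for x i j using lpU that by (simp add: ldiff_def)
    show "continuous_on (cube R) (pd i U)" for i by (subst continuous_on_cong[OF refl pU]) (simp_all add: cq)
    show "continuous_on (cube R) (pd j (pd i U))" for i j by (subst continuous_on_cong[OF refl ppU]) (simp_all add: cqq)
    show "\<exists>l. (pd i U \<longlongrightarrow> l) (at x within cube R)" if "x \<in> ccube R" for i x by (rule tq[OF that])
    show "\<exists>l. (pd j (pd i U) \<longlongrightarrow> l) (at x within cube R)" if "x \<in> ccube R" for i j x by (rule tqq[OF that])
  qed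
  have Uout: "U x = 0" if "x \<notin> ccube R" for x
  proof -
    have "u n x = 0" for n using uH that by (simp add: Hp_def)
    thus ?thesis using Upt[of x] by (simp add: LIMSEQ_const_iff)
  qed
  have Ub: "U x = f x" if "x \<in> bdry R" for x
  proof -
    have "u n x = f x" for n using u that by (simp add: Hset_def)
    thus ?thesis using Upt[of x] by (simp add: LIMSEQ_const_iff)
  qed
  have Ug: "(pd k U \<longlongrightarrow> g x) (at x within cube R)" if "x \<in> gamma_plus k R" for x
  proof (rule tendsto_cong_cube[OF pU])
    show "(q k \<longlongrightarrow> g x) (at x within cube R)"
      by (rule uniform_limit_tendsto_const[OF q _ tendsto_const]) (use u that in \<open>auto simp: Hset_def\<close>)
  qed
  have nU: "nice R U" by (rule C2_cl_nice[OF C2U])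
  have L2U: "(\<lambda>n. ?I (\<lambda>x. (u n x - U x)\<^sup>2)) \<longlonglongrightarrow> 0"
  proof (rule LIMSEQ_I)
    fix e :: real assume e: "e > 0"
    define V where "V = ?I (\<lambda>x::real^'n. 1::real)"
    have V: "V \<ge> 0" unfolding V_def by (intro integral_nonneg_AE AE_I2) simp
    \<comment> \<open>The cap 1 gives \<open>d\<^sup>2 \<le> d\<close>.\<close>
    define d where "d = min 1 (e / (V + 1))"
    have d: "d > 0" "d \<le> 1" "d * V < e"
    proof -
      show "d > 0" "d \<le> 1" using e V by (auto simp: d_def)
      have "d * V \<le> e / (V + 1) * V" using V by (intro mult_right_mono) (auto simp: d_def)
      also have "\<dots> < e" using e V by (simp add: field_simps)
      finally show "d * V < e" .
    qed
    from uniform_limitD[OF Ucc(2) d(1)] obtain N where N: "\<And>n x. n \<ge> N \<Longrightarrow> x \<in> cube R \<Longrightarrow> dist (u n x) (U x) < d"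
      unfolding eventually_sequentially by auto
    have "norm (?I (\<lambda>x. (u n x - U x)\<^sup>2) - 0) < e" if n: "n \<ge> N" for n
    proof -
      have "?I (\<lambda>x. (u n x - U x)\<^sup>2) \<le> ?I (\<lambda>x::real^'n. d * 1)"
      proof (rule integral_mono_cube)
        show "nice R (\<lambda>x. (u n x - U x)\<^sup>2)" by (intro nice_power nice_diff nU c2_D(1)[OF uc])
        show "nice R (\<lambda>x. d * 1)" by (rule nice_const)
        fix x :: "real^'n" assume "x \<in> cube R"
        hence a: "\<bar>u n x - U x\<bar> \<le> d" using N[OF n] by (auto simp: dist_real_def less_imp_le)
        have "\<bar>u n x - U x\<bar>\<^sup>2 \<le> d\<^sup>2" using a by (intro power_mono) auto
        also have "d\<^sup>2 \<le> d * 1" using d unfolding power2_eq_square by (intro mult_left_mono) auto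
        finally show "(u n x - U x)\<^sup>2 \<le> d * 1" by simp
      qed
      also have "\<dots> = d * V" unfolding V_def by (rule integral_mult_right_zero)
      finally have "?I (\<lambda>x. (u n x - U x)\<^sup>2) < e" using d(3) by simp
      moreover have "0 \<le> ?I (\<lambda>x. (u n x - U x)\<^sup>2)" by (intro integral_nonneg_AE AE_I2) simp
      ultimately show ?thesis by simp
    qed
    thus "\<exists>N. \<forall>n\<ge>N. norm (?I (\<lambda>x. (u n x - U x)\<^sup>2) - 0) < e" by blast
  qed
  note su = sobolev_sqint[OF us] and sU = nice_sqint[OF nU]
  have "\<exists>w. is_wderiv (cube R) \<alpha> U w \<and> (\<lambda>n. ?I (\<lambda>x. (wd (cube R) \<alpha> (u n) x - w x)\<^sup>2)) \<longlonglongrightarrow> 0"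
    if al: "\<alpha> \<in> multi_idx p" for \<alpha>
  proof -
    let ?V = "\<lambda>n. wd (cube R) \<alpha> (u n)"
    \<comment> \<open>The squared norm of the difference is a sum of nonnegative terms over
      multi-indices, of which this is one.\<close>
    have VV: "?I (\<lambda>x. (?V m x - ?V n x)\<^sup>2) \<le> (?n (?d m n))\<^sup>2" for m n
    proof -
      have "(?n (?d m n))\<^sup>2 = (\<Sum>\<alpha>\<in>multi_idx p. ?I (\<lambda>x. (wd (cube R) \<alpha> (u m) x - wd (cube R) \<alpha> (u n) x)\<^sup>2))"
        by (intro sob_norm_sq_eq sobolev_diff us is_wderiv_diff wd_is_wderiv[OF us] su)
      also have "\<dots> \<ge> ?I (\<lambda>x. (?V m x - ?V n x)\<^sup>2)"
        by (rule member_le_sum[OF al, of "\<lambda>\<alpha>. ?I (\<lambda>x. (wd (cube R) \<alpha> (u m) x - wd (cube R) \<alpha> (u n) x)\<^sup>2)"])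
           (auto intro!: integral_nonneg_AE AE_I2)
      finally show ?thesis .
    qed
    have Vs: "sqint (cubeM R) (?V n)" for n by (rule wd_sqint[OF us al])
    have "\<exists>N. \<forall>m\<ge>N. \<forall>n\<ge>N. ?I (\<lambda>x. (?V m x - ?V n x)\<^sup>2) < e" if e: "e > 0" for e
    proof -
      obtain N where N: "\<forall>m\<ge>N. \<forall>n\<ge>N. ?n (?d m n) < sqrt e" using cau[of "sqrt e"] e by auto
      have "(?n (?d m n))\<^sup>2 < e" if "m \<ge> N" "n \<ge> N" for m n
      proof -
        have "(?n (?d m n))\<^sup>2 < (sqrt e)\<^sup>2" using N that sob_norm_nonneg by (intro power_strict_mono) auto
        thus ?thesis using e by simp
      qed
      thus ?thesis using VV by (meson order_le_less_trans)
    qed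
    then obtain w where w: "sqint (cubeM R) w" "(\<lambda>n. ?I (\<lambda>x. (?V n x - w x)\<^sup>2)) \<longlonglongrightarrow> 0"
      using finite_measure.sqint_complete[where f="?V", OF finite_measure_cube Vs] by blast
    have "is_wderiv (cube R) \<alpha> U w"
      unfolding is_wderiv_iff
    proof (intro conjI w(1) allI impI)
      fix \<phi> :: "real^'n \<Rightarrow> real" assume t: "test_fun (cube R) \<phi>"
      have p1: "sqint (cubeM R) (pdl (mi_list \<alpha>) \<phi>)" by (rule nice_sqint[OF test_fun_nice[OF t]])
      have p2: "sqint (cubeM R) \<phi>" using nice_sqint[OF test_fun_nice[OF t, of R "[]"]] by simp
      have "(\<lambda>n. ?I (\<lambda>x. u n x * pdl (mi_list \<alpha>) \<phi> x)) \<longlonglongrightarrow> ?I (\<lambda>x. U x * pdl (mi_list \<alpha>) \<phi> x)"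
        by (rule finite_measure.sqint_tendsto_integral[OF finite_measure_cube su sU L2U p1])
      moreover have "?I (\<lambda>x. u n x * pdl (mi_list \<alpha>) \<phi> x) = (-1) ^ sum \<alpha> UNIV * ?I (\<lambda>x. ?V n x * \<phi> x)" for n
        using wd_is_wderiv[OF us al] t by (simp add: is_wderiv_iff)
      moreover have "(\<lambda>n. (-1) ^ sum \<alpha> UNIV * ?I (\<lambda>x. ?V n x * \<phi> x)) \<longlonglongrightarrow> (-1) ^ sum \<alpha> UNIV * ?I (\<lambda>x. w x * \<phi> x)"
        by (intro tendsto_mult tendsto_const finite_measure.sqint_tendsto_integral[OF finite_measure_cube Vs w p2])
      ultimately show "?I (\<lambda>x. U x * pdl (mi_list \<alpha>) \<phi> x) = (-1) ^ sum \<alpha> UNIV * ?I (\<lambda>x. w x * \<phi> x)"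
        by (simp only:) (rule LIMSEQ_unique)
    qed
    thus ?thesis using w(2) by blast
  qed
  then have "\<exists>w. \<forall>\<alpha>\<in>multi_idx p. is_wderiv (cube R) \<alpha> U (w \<alpha>) \<and>
      (\<lambda>n. ?I (\<lambda>x. (wd (cube R) \<alpha> (u n) x - w \<alpha> x)\<^sup>2)) \<longlonglongrightarrow> 0" by (intro bchoice ballI)
  then obtain w where w: "\<And>\<alpha>. \<alpha> \<in> multi_idx p \<Longrightarrow> is_wderiv (cube R) \<alpha> U (w \<alpha>)"
    "\<And>\<alpha>. \<alpha> \<in> multi_idx p \<Longrightarrow> (\<lambda>n. ?I (\<lambda>x. (wd (cube R) \<alpha> (u n) x - w \<alpha> x)\<^sup>2)) \<longlonglongrightarrow> 0" by blast
  have Us: "U \<in> sobolev (cube R) p" using sU w(1) by (auto simp: sobolev_def L2_iff)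
  have UH: "U \<in> Hset R p k f g" using Us C2U Uout Ub Ug by (auto simp: Hset_def Hp_def)
  have "(?n (\<lambda>x. u n x - U x))\<^sup>2 = (\<Sum>\<alpha>\<in>multi_idx p. ?I (\<lambda>x. (wd (cube R) \<alpha> (u n) x - w \<alpha> x)\<^sup>2))" for n
    by (intro sob_norm_sq_eq sobolev_diff us Us is_wderiv_diff wd_is_wderiv[OF us] su sU w)
  moreover have "(\<lambda>n. \<Sum>\<alpha>\<in>multi_idx p. ?I (\<lambda>x. (wd (cube R) \<alpha> (u n) x - w \<alpha> x)\<^sup>2)) \<longlonglongrightarrow> (\<Sum>\<alpha>\<in>(multi_idx p :: ('n \<Rightarrow> nat) set). 0)"
    by (intro tendsto_sum w)
  ultimately have "(\<lambda>n. (?n (\<lambda>x. u n x - U x))\<^sup>2) \<longlonglongrightarrow> 0" by simp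
  hence "(\<lambda>n. sqrt ((?n (\<lambda>x. u n x - U x))\<^sup>2)) \<longlonglongrightarrow> sqrt 0" by (rule tendsto_real_sqrt)
  hence "(\<lambda>n. ?n (\<lambda>x. u n x - U x)) \<longlonglongrightarrow> 0" by (simp only: real_sqrt_abs abs_of_nonneg[OF sob_norm_nonneg] real_sqrt_zero)
  thus ?thesis using that UH by blast
qed

section \<open>The minimizer as the limit of a minimizing sequence\<close>

lemma sob_norm_triangle:
  assumes "u \<in> sobolev (cube R) p" "v \<in> sobolev (cube R) p"
  shows "sob_norm (cube R) p (\<lambda>x. u x - v x) \<le> sob_norm (cube R) p u + sob_norm (cube R) p v"
proof (rule power2_le_imp_le)
  have "(sob_norm (cube R) p (\<lambda>x. u x - v x))\<^sup>2 = (sob_norm (cube R) p u)\<^sup>2 - 2 * sob_inner (cube R) p u v + (sob_norm (cube R) p v)\<^sup>2"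
    using sob_norm_lincomb_sq[OF assms, of 1 "-1"] by simp
  thus "(sob_norm (cube R) p (\<lambda>x. u x - v x))\<^sup>2 \<le> (sob_norm (cube R) p u + sob_norm (cube R) p v)\<^sup>2"
    using sob_Cauchy_Schwarz[OF assms] by (simp add: power2_sum)
  show "0 \<le> sob_norm (cube R) p u + sob_norm (cube R) p v" by (intro add_nonneg_nonneg sob_norm_nonneg)
qed

text \<open>Continuity of the derivative as a linear functional. Combined with the convexity
  inequality based at the limit, it takes the place of lower semicontinuity of \<open>J\<close>
  along the minimizing sequence.\<close>

lemma DJ_bounded:
  fixes F :: "real^'n::finite \<Rightarrow> real \<Rightarrow> real^'n \<Rightarrow> real"
  assumes R: "R > 0" and eps: "\<epsilon> > 0" and rb: "r > R + 1" "b > R + r"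
    and p: "real p > real_of_int \<lceil>real CARD('n) / 2\<rceil> + 2" and F: "C2_F R F" and eta: "\<eta> > 0" and u: "u \<in> Hp R p"
  obtains C where "\<And>h. h \<in> Hp R p \<Longrightarrow> \<bar>DJfun R p k \<epsilon> r b F lam \<beta> \<eta> u h\<bar> \<le> C * sob_norm (cube R) p h"
proof -
  let ?n = "sob_norm (cube R) p :: (real^'n \<Rightarrow> real) \<Rightarrow> real" and ?I = "integral\<^sup>L (cubeM R)" and ?W = "weight k r b lam \<beta>"
  obtain K where K: "K \<ge> 0" and S: "\<And>(u :: real^'n \<Rightarrow> real) x. u \<in> Hp R p \<Longrightarrow> x \<in> cube R \<Longrightarrow>
      \<bar>u x\<bar> \<le> K * ?n u \<and> \<bar>lap u x\<bar> \<le> K * ?n u \<and> norm (grad u x) \<le> K * ?n u"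
    by (rule sup_bounds[OF R p]) (rule that)
  note cu = Hp_D(3)[OF u]
  define Z where "Z x = \<epsilon> + \<bar>dsF F x (u x) (grad u x)\<bar> + (\<Sum>i\<in>UNIV. \<bar>dpF F x (u x) (grad u x) $ i\<bar>)" for x
  have na: "nice R (\<lambda>x. \<bar>w x\<bar>)" if "nice R w" for w :: "real^'n \<Rightarrow> real"
    using that by (auto simp: nice_def intro!: continuous_intros)
  have Wn: "nice R ?W" by (rule nice_weight[OF R rb])
  have nZ: "nice R Z" unfolding Z_def[abs_def] by (intro nice_add nice_const nice_sum na C2_F_nice[OF F cu])
  define G where "G x = \<bar>?W x * Aop \<epsilon> F u x\<bar> * Z x" for x
  have nG: "nice R G" unfolding G_def[abs_def] by (intro nice_mult na Wn nice_Aop[OF F cu] nZ)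
  show ?thesis
  proof (rule that[of "2 * (K * ?I G) + 2 * \<eta> * ?n u"])
    fix h :: "real^'n \<Rightarrow> real" assume h: "h \<in> Hp R p"
    have Lb: "\<bar>Lop \<epsilon> F u h x\<bar> \<le> Z x * (K * ?n h)" if x: "x \<in> cube R" for x
    proof -
      let ?k = "K * ?n h" and ?s = "dsF F x (u x) (grad u x)" and ?p = "dpF F x (u x) (grad u x)"
      note B = S[OF h x]
      have "\<bar>?p \<bullet> grad h x\<bar> \<le> (\<Sum>i\<in>UNIV. \<bar>?p $ i\<bar> * \<bar>grad h x $ i\<bar>)"
        unfolding inner_vec_def inner_real_def abs_mult[symmetric] by (rule sum_abs)
      also have "\<dots> \<le> (\<Sum>i\<in>UNIV. \<bar>?p $ i\<bar> * ?k)"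
        using B component_le_norm_cart[of "grad h x"] by (intro sum_mono mult_left_mono) (auto intro: order_trans)
      finally have 1: "\<bar>?p \<bullet> grad h x\<bar> \<le> (\<Sum>i\<in>UNIV. \<bar>?p $ i\<bar>) * ?k" by (simp add: sum_distrib_right)
      have 2: "\<bar>- \<epsilon> * lap h x\<bar> \<le> \<epsilon> * ?k" using B eps by (simp add: abs_mult)
      have 3: "\<bar>?s * h x\<bar> \<le> \<bar>?s\<bar> * ?k" unfolding abs_mult using B by (intro mult_left_mono) auto
      have "\<bar>Lop \<epsilon> F u h x\<bar> \<le> \<bar>- \<epsilon> * lap h x\<bar> + \<bar>?s * h x\<bar> + \<bar>?p \<bullet> grad h x\<bar>"
        unfolding Lop_def by linarith
      also have "\<dots> \<le> Z x * ?k" using 1 2 3 unfolding Z_def distrib_right by linarith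
      finally show ?thesis .
    qed
    let ?g = "\<lambda>x. ?W x * Aop \<epsilon> F u x * Lop \<epsilon> F u h x"
    have ng: "nice R ?g" by (intro nice_mult Wn nice_Aop[OF F cu] nice_Lop[OF F cu Hp_D(3)[OF h]])
    have "\<bar>?I ?g\<bar> \<le> ?I (\<lambda>x. \<bar>?g x\<bar>)" by (rule integral_abs_bound)
    also have "\<dots> \<le> ?I (\<lambda>x. (K * ?n h) * G x)"
    proof (rule integral_mono_cube[OF na[OF ng] nice_mult[OF nice_const nG]])
      fix x :: "real^'n" assume "x \<in> cube R"
      from mult_left_mono[OF Lb[OF this], of "\<bar>?W x * Aop \<epsilon> F u x\<bar>"]
      show "\<bar>?g x\<bar> \<le> (K * ?n h) * G x" by (simp add: G_def abs_mult mult_ac)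
    qed
    also have "\<dots> = K * ?I G * ?n h" by simp
    finally have 1: "\<bar>?I ?g\<bar> \<le> K * ?I G * ?n h" .
    have 2: "\<bar>sob_inner (cube R) p u h\<bar> \<le> ?n u * ?n h" by (rule sob_Cauchy_Schwarz[OF Hp_D(1)[OF u] Hp_D(1)[OF h]])
    have "\<bar>DJfun R p k \<epsilon> r b F lam \<beta> \<eta> u h\<bar> \<le> 2 * \<bar>?I ?g\<bar> + 2 * \<eta> * \<bar>sob_inner (cube R) p u h\<bar>"
      unfolding DJfun_eq using eta by (intro order_trans[OF abs_triangle_ineq]) (simp add: abs_mult)
    also have "\<dots> \<le> 2 * (K * ?I G * ?n h) + 2 * \<eta> * (?n u * ?n h)"
      using 1 2 eta by (intro add_mono mult_left_mono) auto
    finally show "\<bar>DJfun R p k \<epsilon> r b F lam \<beta> \<eta> u h\<bar> \<le> (2 * (K * ?I G) + 2 * \<eta> * ?n u) * ?n h"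
      by (simp add: algebra_simps)
  qed
qed

text \<open>The convexity hypothesis is the part of strong convexity governed by
  \<open>\<eta>\<close>: it controls the norm in which the admissible set is complete.\<close>

lemma unique_minimizer:
  fixes F :: "real^'n::finite \<Rightarrow> real \<Rightarrow> real^'n \<Rightarrow> real" and k :: 'n
  assumes R: "R > 0" and eps: "\<epsilon> > 0" and rb: "r > R + 1" "b > R + r"
    and p: "real p > real_of_int \<lceil>real CARD('n) / 2\<rceil> + 2" and F: "C2_F R F" and M: "M > 0" and eta: "\<eta> > 0"
    and ne: "Hset R p k f g \<inter> Bbar R p M \<noteq> {}"
    and sc: "\<And>u v. u \<in> Hset R p k f g \<inter> Bbar R p M \<Longrightarrow> v \<in> Hset R p k f g \<inter> Bbar R p M \<Longrightarrow>
     Jfun R p k \<epsilon> r b F lam \<beta> \<eta> v - Jfun R p k \<epsilon> r b F lam \<beta> \<eta> u - DJfun R p k \<epsilon> r b F lam \<beta> \<eta> u (\<lambda>x. v x - u x)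
       \<ge> \<eta> * (sob_norm (cube R) p (\<lambda>x. v x - u x))\<^sup>2"
  shows "\<exists>!u. u \<in> Hset R p k f g \<inter> Bbar R p M \<and> (\<forall>v\<in>Hset R p k f g \<inter> Bbar R p M.
               Jfun R p k \<epsilon> r b F lam \<beta> \<eta> u \<le> Jfun R p k \<epsilon> r b F lam \<beta> \<eta> v)"
proof -
  let ?S = "Hset R p k f g \<inter> Bbar R p M" and ?n = "sob_norm (cube R) p :: (real^'n \<Rightarrow> real) \<Rightarrow> real"
  define J where "J = Jfun R p k \<epsilon> r b F lam \<beta> \<eta>"
  define DJ where "DJ = DJfun R p k \<epsilon> r b F lam \<beta> \<eta>"
  note sc = sc[folded J_def DJ_def]
  have SH: "u \<in> Hp R p" if "u \<in> ?S" for u using that by (auto simp: Hset_def)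
  have J0: "J u \<ge> 0" for u
  proof -
    have "0 \<le> integral\<^sup>L (cubeM R) (\<lambda>x. weight k r b lam \<beta> x * (Aop \<epsilon> F u x)\<^sup>2)"
      by (intro integral_nonneg_AE AE_I2) (simp add: weight_def)
    thus ?thesis unfolding J_def Jfun_eq using eta by simp
  qed
  define m where "m = Inf (J ` ?S)"
  have bb: "bdd_below (J ` ?S)" using J0 by (intro bdd_belowI[of _ 0]) auto
  have mle: "m \<le> J u" if "u \<in> ?S" for u unfolding m_def using bb that by (intro cInf_lower) auto
  \<comment> \<open>Strong convexity based at the midpoint \<open>w\<close> and evaluated at both
    ends; the directions are opposite, so the linear terms cancel. Each end is at half the distance,
    and twice a quarter gives the factor \<open>\<eta> / 2\<close>.\<close>
  have mid: "J u + J v \<ge> 2 * m + \<eta> / 2 * (?n (\<lambda>x. v x - u x))\<^sup>2" if u: "u \<in> ?S" and v: "v \<in> ?S" for u v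
  proof -
    define w where "w x = (u x + v x) / 2" for x
    have w: "w \<in> ?S" unfolding w_def[abs_def] by (rule midpoint_admissible[OF R M u v])
    have hH: "(\<lambda>x. v x - w x) \<in> Hp R p" using Hp_lincomb[OF SH[OF v] SH[OF w], of 1 "-1"] by simp
    have e: "(\<lambda>x. u x - w x) = (\<lambda>x. - (v x - w x))" by (auto simp: w_def fun_eq_iff field_simps)
    have "(\<lambda>x. v x - w x) = (\<lambda>x. (1/2) * (v x - u x) + 0 * (v x - u x))" by (auto simp: w_def fun_eq_iff field_simps)
    hence n1: "(?n (\<lambda>x. v x - w x))\<^sup>2 = (?n (\<lambda>x. v x - u x))\<^sup>2 / 4"
      using sob_norm_lincomb_sq[of "\<lambda>x. v x - u x" R p "\<lambda>x. v x - u x" "1/2" 0]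
        sobolev_diff[OF Hp_D(1)[OF SH[OF v]] Hp_D(1)[OF SH[OF u]]] by (simp add: power2_eq_square)
    have "DJ w (\<lambda>x. u x - w x) = - DJ w (\<lambda>x. v x - w x)"
      unfolding e DJ_def by (rule DJ_uminus[OF F SH[OF w] hH])
    moreover have "?n (\<lambda>x. u x - w x) \<ge> 0" by (rule sob_norm_nonneg)
    moreover have "(?n (\<lambda>x. u x - w x))\<^sup>2 = (?n (\<lambda>x. v x - w x))\<^sup>2"
      unfolding e using sob_norm_lincomb_sq[OF Hp_D(1)[OF hH] Hp_D(1)[OF hH], of "-1" 0] by simp
    ultimately have "J u + J v \<ge> 2 * J w + 2 * (\<eta> * (?n (\<lambda>x. v x - w x))\<^sup>2)"
      using sc[OF w u] sc[OF w v] by simp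
    thus ?thesis using mle[OF w] unfolding n1 by simp
  qed
  have "\<exists>u\<in>?S. J u < m + 1 / real (Suc n)" for n
  proof -
    have "Inf (J ` ?S) < m + 1 / real (Suc n)" by (simp add: m_def)
    thus ?thesis using cInf_lessD[of "J ` ?S"] ne by fastforce
  qed
  then obtain u where u: "\<And>n. u n \<in> ?S" "\<And>n. J (u n) < m + 1 / real (Suc n)" by metis
  have uH: "u n \<in> Hset R p k f g" for n using u(1) by blast
  have cauchy: "\<exists>N. \<forall>i\<ge>N. \<forall>j\<ge>N. ?n (\<lambda>x. u i x - u j x) < e" if e: "e > 0" for e
  proof -
    \<comment> \<open>\<open>mid\<close> bounds \<open>\<eta> / 2\<close> times the squared distance
      by \<open>J (u i) + J (u j) - 2 * m\<close>, which is below
      \<open>2 / real (Suc N)\<close>.\<close>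
    obtain N where N: "1 / real (Suc N) < \<eta> * e\<^sup>2 / 4"
      using reals_Archimedean[of "\<eta> * e\<^sup>2 / 4"] e eta by (auto simp: inverse_eq_divide)
    have "?n (\<lambda>x. u i x - u j x) < e" if ij: "i \<ge> N" "j \<ge> N" for i j
    proof -
      have s: "1 / real (Suc i) \<le> 1 / real (Suc N)" "1 / real (Suc j) \<le> 1 / real (Suc N)"
        using ij by (auto intro!: divide_left_mono)
      have "\<eta> / 2 * (?n (\<lambda>x. u i x - u j x))\<^sup>2 < \<eta> * e\<^sup>2 / 2"
        using mid[OF u(1)[of j] u(1)[of i]] u(2)[of i] u(2)[of j] s N by linarith
      hence "(?n (\<lambda>x. u i x - u j x))\<^sup>2 < e\<^sup>2" using eta by simp
      thus ?thesis using e by (rule_tac power_less_imp_less_base[where n=2]) auto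
    qed
    thus ?thesis by blast
  qed
  have "\<exists>U. U \<in> Hset R p k f g \<and> (\<lambda>n. ?n (\<lambda>x. u n x - U x)) \<longlonglongrightarrow> 0"
    by (rule Hset_complete[OF R p uH], erule cauchy, blast)
  then obtain U where U: "U \<in> Hset R p k f g" "(\<lambda>n. ?n (\<lambda>x. u n x - U x)) \<longlonglongrightarrow> 0" by blast
  have UHp: "U \<in> Hp R p" using U(1) by (simp add: Hset_def)
  have dH: "(\<lambda>x. u n x - U x) \<in> Hp R p" for n using Hp_lincomb[OF SH[OF u(1)] UHp, of 1 n "-1"] by simp
  have "?n U \<le> M"
  proof -
    have "?n U \<le> M + ?n (\<lambda>x. u n x - U x)" for n
    proof -
      have "?n (\<lambda>x. u n x - (u n x - U x)) \<le> ?n (u n) + ?n (\<lambda>x. u n x - U x)"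
        by (rule sob_norm_triangle[OF Hp_D(1)[OF SH[OF u(1)]] Hp_D(1)[OF dH]])
      moreover have "?n (u n) \<le> M" using u(1)[of n] by (simp add: Bbar_def)
      ultimately show ?thesis by simp
    qed
    moreover have "(\<lambda>n. M + ?n (\<lambda>x. u n x - U x)) \<longlonglongrightarrow> M + 0" by (intro tendsto_intros U)
    ultimately show ?thesis using LIMSEQ_le_const by fastforce
  qed
  hence US: "U \<in> ?S" using U(1) UHp by (simp add: Bbar_def)
  have "\<exists>C. \<forall>h. h \<in> Hp R p \<longrightarrow> \<bar>DJ U h\<bar> \<le> C * ?n h"
    unfolding DJ_def by (rule DJ_bounded[OF R eps rb p F eta UHp, where k=k and lam=lam and \<beta>=\<beta>]) blast
  then obtain C where C: "\<And>h. h \<in> Hp R p \<Longrightarrow> \<bar>DJ U h\<bar> \<le> C * ?n h" by blast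
  have JU: "J U = m"
  proof (rule antisym[OF _ mle[OF US]])
    \<comment> \<open>Convexity based at \<open>U\<close> bounds \<open>J U\<close> by
      \<open>J (u n)\<close> minus the derivative in the direction from \<open>U\<close> to
      \<open>u n\<close>, and that derivative tends to 0.\<close>
    have "J U \<le> m + 1 / real (Suc n) + C * ?n (\<lambda>x. u n x - U x)" for n
    proof -
      have "0 \<le> \<eta> * (?n (\<lambda>x. u n x - U x))\<^sup>2" using eta by simp
      thus ?thesis using sc[OF US u(1)[of n]] C[OF dH[of n]] u(2)[of n] by linarith
    qed
    moreover have "(\<lambda>n. m + 1 / real (Suc n) + C * ?n (\<lambda>x. u n x - U x)) \<longlonglongrightarrow> m + 0 + C * 0"
      by (intro tendsto_intros U) real_asymp
    ultimately show "J U \<le> m" using LIMSEQ_le_const by fastforce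
  qed
  show ?thesis
    unfolding J_def[symmetric]
  proof (rule ex1I[of _ U])
    show "U \<in> ?S \<and> (\<forall>v\<in>?S. J U \<le> J v)" using US mle JU by auto
    fix V assume V: "V \<in> ?S \<and> (\<forall>v\<in>?S. J V \<le> J v)"
    hence VS: "V \<in> ?S" and JV: "J V \<le> m" using US JU by auto
    have "\<eta> / 2 * (?n (\<lambda>x. V x - U x))\<^sup>2 \<le> 0" using mid[OF US VS] JU JV by simp
    hence n0: "?n (\<lambda>x. V x - U x) = 0" using eta by (simp add: mult_le_0_iff)
    obtain K where S: "\<And>(u :: real^'n \<Rightarrow> real) x. u \<in> Hp R p \<Longrightarrow> x \<in> cube R \<Longrightarrow>
      \<bar>u x\<bar> \<le> K * ?n u \<and> \<bar>lap u x\<bar> \<le> K * ?n u \<and> norm (grad u x) \<le> K * ?n u"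
      by (rule sup_bounds[OF R p]) (rule that)
    have VU: "(\<lambda>x. V x - U x) \<in> Hp R p" using Hp_lincomb[OF SH[OF VS] UHp, of 1 "-1"] by simp
    show "V = U"
    proof
      fix x :: "real^'n"
      \<comment> \<open>The embedding settles the open cube; on the boundary and outside the closed
        cube all admissible functions agree by definition.\<close>
      consider "x \<in> cube R" | "x \<in> bdry R" | "x \<notin> ccube R" by (auto simp: bdry_def)
      thus "V x = U x"
      proof cases
        case 1 thus ?thesis using S[OF VU 1] n0 by simp
      next
        case 2 thus ?thesis using US VS by (simp add: Hset_def)
      next
        case 3 thus ?thesis using SH[OF VS] UHp by (simp add: Hp_def)
      qed
    qed
  qed
qed

theorem theorem4p1:
  fixes R r b \<epsilon>0 M :: real and p :: nat and k :: "'n::finite"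
    and F :: "real^'n \<Rightarrow> real \<Rightarrow> real^'n \<Rightarrow> real"
    and f g :: "real^'n \<Rightarrow> real"
  assumes "R > 0" and "\<epsilon>0 > 0" and "r > R + 1" and "b > R + r"
    and "real p > real_of_int \<lceil>real CARD('n) / 2\<rceil> + 2"
    and "C2_F R F"
    and "M > 0"
    and "Hset R p k f g \<inter> Bbar R p M \<noteq> {}"
  shows
    "(\<forall>lam \<beta> \<eta> u. lam > 1 \<longrightarrow> \<beta> > 1 \<longrightarrow> \<eta> > 0 \<longrightarrow> u \<in> Hp R p \<longrightarrow>
       (\<forall>e>0. \<exists>\<delta>>0. \<forall>h\<in>H0set R p k. h \<noteq> (\<lambda>_. 0) \<and> sob_norm (cube R) p h < \<delta> \<longrightarrow>
          \<bar>Jfun R p k \<epsilon>0 r b F lam \<beta> \<eta> (\<lambda>x. u x + h x) - Jfun R p k \<epsilon>0 r b F lam \<beta> \<eta> u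
            - DJfun R p k \<epsilon>0 r b F lam \<beta> \<eta> u h\<bar> / sob_norm (cube R) p h < e))
     \<and>
     (\<forall>\<beta>>1. \<exists>lam0>1. \<forall>lam>lam0.
        (\<exists>C>0. \<forall>f' g' \<eta> u v. \<eta> > 0 \<longrightarrow>
           u \<in> Hset R p k f' g' \<inter> Bbar R p M \<longrightarrow> v \<in> Hset R p k f' g' \<inter> Bbar R p M \<longrightarrow>
           Jfun R p k \<epsilon>0 r b F lam \<beta> \<eta> v - Jfun R p k \<epsilon>0 r b F lam \<beta> \<eta> u
             - DJfun R p k \<epsilon>0 r b F lam \<beta> \<eta> u (\<lambda>x. v x - u x)
           \<ge> C * (sob_norm (cube R) 1 (\<lambda>x. v x - u x))^2
             + \<eta> * (sob_norm (cube R) p (\<lambda>x. v x - u x))^2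
           \<and>
           DJfun R p k \<epsilon>0 r b F lam \<beta> \<eta> v (\<lambda>x. v x - u x)
             - DJfun R p k \<epsilon>0 r b F lam \<beta> \<eta> u (\<lambda>x. v x - u x)
           \<ge> C * (sob_norm (cube R) 1 (\<lambda>x. v x - u x))^2
             + \<eta> * (sob_norm (cube R) p (\<lambda>x. v x - u x))^2)
        \<and>
        (\<forall>\<eta>>0. \<exists>!u. u \<in> Hset R p k f g \<inter> Bbar R p M \<and>
            (\<forall>v\<in>Hset R p k f g \<inter> Bbar R p M.
               Jfun R p k \<epsilon>0 r b F lam \<beta> \<eta> u \<le> Jfun R p k \<epsilon>0 r b F lam \<beta> \<eta> v)))"
proof (intro conjI allI impI)
  fix lam \<beta> \<eta> e :: real and u :: "real^'n \<Rightarrow> real"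
  assume a: "lam > 1" "\<beta> > 1" "\<eta> > 0" "u \<in> Hp R p" "e > 0"
  obtain C where C: "C \<ge> 0" "\<And>h. h \<in> Hp R p \<Longrightarrow> sob_norm (cube R) p h \<le> 1 \<Longrightarrow>
    \<bar>Jfun R p k \<epsilon>0 r b F lam \<beta> \<eta> (\<lambda>x. u x + h x) - Jfun R p k \<epsilon>0 r b F lam \<beta> \<eta> u - DJfun R p k \<epsilon>0 r b F lam \<beta> \<eta> u h\<bar>
      \<le> C * (sob_norm (cube R) p h)\<^sup>2"
    by (rule J_quadratic_remainder[OF assms(1-6) a(3,4)]) (rule that)
  show "\<exists>\<delta>>0. \<forall>h\<in>H0set R p k. h \<noteq> (\<lambda>_. 0) \<and> sob_norm (cube R) p h < \<delta> \<longrightarrow>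
          \<bar>Jfun R p k \<epsilon>0 r b F lam \<beta> \<eta> (\<lambda>x. u x + h x) - Jfun R p k \<epsilon>0 r b F lam \<beta> \<eta> u
            - DJfun R p k \<epsilon>0 r b F lam \<beta> \<eta> u h\<bar> / sob_norm (cube R) p h < e"
  \<comment> \<open>The bound 1 makes the quadratic remainder estimate available;
    \<open>C + 1\<close> guards against \<open>C = 0\<close>.\<close>
  proof (intro exI[of _ "min 1 (e / (C + 1))"] conjI ballI impI)
    show "0 < min 1 (e / (C + 1))" using a(5) C(1) by simp
    fix h assume h: "h \<in> H0set R p k" "h \<noteq> (\<lambda>_. 0) \<and> sob_norm (cube R) p h < min 1 (e / (C + 1))"
    let ?n = "sob_norm (cube R) p h"
    let ?D = "\<bar>Jfun R p k \<epsilon>0 r b F lam \<beta> \<eta> (\<lambda>x. u x + h x) - Jfun R p k \<epsilon>0 r b F lam \<beta> \<eta> u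
            - DJfun R p k \<epsilon>0 r b F lam \<beta> \<eta> u h\<bar>"
    have hH: "h \<in> Hp R p" using h(1) by (simp add: H0set_def Hset_def)
    have D: "?D \<le> C * ?n\<^sup>2" using C(2)[OF hH] h(2) by simp
    show "?D / ?n < e"
    proof (cases "?n = 0")
      \<comment> \<open>Division by 0 has the value 0, so the quotient is below \<open>e\<close>
        here.\<close>
      case True thus ?thesis using a(5) by simp
    next
      case False
      hence n: "?n > 0" using sob_norm_nonneg[of R p h] by simp
      have "?D / ?n \<le> C * ?n\<^sup>2 / ?n" using D n by (intro divide_right_mono) auto
      also have "\<dots> = C * ?n" using n by (simp add: power2_eq_square)
      also have "\<dots> \<le> C * (e / (C + 1))" using h(2) C(1) by (intro mult_left_mono) auto
      also have "\<dots> < e" using a(5) C(1) by (simp add: field_simps)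
      finally show ?thesis .
    qed
  qed
next
  fix \<beta> :: real assume beta: "\<beta> > 1"
  obtain lam0 where l0: "lam0 > 1" and sc: "\<And>lam f g \<eta> u v. lam > lam0 \<Longrightarrow> \<eta> > 0 \<Longrightarrow>
     u \<in> Hset R p k f g \<inter> Bbar R p M \<Longrightarrow> v \<in> Hset R p k f g \<inter> Bbar R p M \<Longrightarrow>
     Jfun R p k \<epsilon>0 r b F lam \<beta> \<eta> v - Jfun R p k \<epsilon>0 r b F lam \<beta> \<eta> u - DJfun R p k \<epsilon>0 r b F lam \<beta> \<eta> u (\<lambda>x. v x - u x)
       \<ge> (sob_norm (cube R) 1 (\<lambda>x. v x - u x))\<^sup>2 + \<eta> * (sob_norm (cube R) p (\<lambda>x. v x - u x))\<^sup>2"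
    by (rule J_strongly_convex[OF assms(1-7) beta, where k=k]) (rule that)
  have mono: "DJfun R p k \<epsilon>0 r b F lam \<beta> \<eta> v (\<lambda>x. v x - u x) - DJfun R p k \<epsilon>0 r b F lam \<beta> \<eta> u (\<lambda>x. v x - u x)
      \<ge> (sob_norm (cube R) 1 (\<lambda>x. v x - u x))\<^sup>2 + \<eta> * (sob_norm (cube R) p (\<lambda>x. v x - u x))\<^sup>2"
    if a: "lam > lam0" "\<eta> > 0" "u \<in> Hset R p k f' g' \<inter> Bbar R p M" "v \<in> Hset R p k f' g' \<inter> Bbar R p M" for lam \<eta> u v f' g'
  proof -
    have H: "u \<in> Hp R p" "v \<in> Hp R p" using a by (auto simp: Hset_def)
    have d: "(\<lambda>x. v x - u x) \<in> Hp R p" using Hp_lincomb[OF H(2,1), of 1 "-1"] by simp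
    have "DJfun R p k \<epsilon>0 r b F lam \<beta> \<eta> v (\<lambda>x. u x - v x) = - DJfun R p k \<epsilon>0 r b F lam \<beta> \<eta> v (\<lambda>x. v x - u x)"
      using DJ_uminus[OF assms(6) H(2) d, of k \<epsilon>0 r b lam \<beta> \<eta>] by simp
    moreover have "0 \<le> (sob_norm (cube R) 1 (\<lambda>x. u x - v x))\<^sup>2 + \<eta> * (sob_norm (cube R) p (\<lambda>x. u x - v x))\<^sup>2"
      using a(2) by simp
    \<comment> \<open>Adding the inequality with \<open>u\<close> and \<open>v\<close> exchanged
      cancels the values of \<open>J\<close>; the right-hand side of the exchanged inequality is
      nonnegative and is dropped.\<close>
    ultimately show ?thesis using sc[OF a] sc[OF a(1,2,4,3)] by linarith
  qed
  show "\<exists>lam0>1. \<forall>lam>lam0.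
        (\<exists>C>0. \<forall>f' g' \<eta> u v. \<eta> > 0 \<longrightarrow>
           u \<in> Hset R p k f' g' \<inter> Bbar R p M \<longrightarrow> v \<in> Hset R p k f' g' \<inter> Bbar R p M \<longrightarrow>
           Jfun R p k \<epsilon>0 r b F lam \<beta> \<eta> v - Jfun R p k \<epsilon>0 r b F lam \<beta> \<eta> u
             - DJfun R p k \<epsilon>0 r b F lam \<beta> \<eta> u (\<lambda>x. v x - u x)
           \<ge> C * (sob_norm (cube R) 1 (\<lambda>x. v x - u x))^2
             + \<eta> * (sob_norm (cube R) p (\<lambda>x. v x - u x))^2
           \<and>
           DJfun R p k \<epsilon>0 r b F lam \<beta> \<eta> v (\<lambda>x. v x - u x)
             - DJfun R p k \<epsilon>0 r b F lam \<beta> \<eta> u (\<lambda>x. v x - u x)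
           \<ge> C * (sob_norm (cube R) 1 (\<lambda>x. v x - u x))^2
             + \<eta> * (sob_norm (cube R) p (\<lambda>x. v x - u x))^2)
        \<and>
        (\<forall>\<eta>>0. \<exists>!u. u \<in> Hset R p k f g \<inter> Bbar R p M \<and>
            (\<forall>v\<in>Hset R p k f g \<inter> Bbar R p M.
               Jfun R p k \<epsilon>0 r b F lam \<beta> \<eta> u \<le> Jfun R p k \<epsilon>0 r b F lam \<beta> \<eta> v))"
  proof (rule exI[of _ lam0], intro conjI allI impI)
    show "lam0 > 1" by (rule l0)
    fix lam assume lam: "lam > lam0"
    show "\<exists>C>0. \<forall>f' g' \<eta> u v. \<eta> > 0 \<longrightarrow>
           u \<in> Hset R p k f' g' \<inter> Bbar R p M \<longrightarrow> v \<in> Hset R p k f' g' \<inter> Bbar R p M \<longrightarrow>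
           Jfun R p k \<epsilon>0 r b F lam \<beta> \<eta> v - Jfun R p k \<epsilon>0 r b F lam \<beta> \<eta> u
             - DJfun R p k \<epsilon>0 r b F lam \<beta> \<eta> u (\<lambda>x. v x - u x)
           \<ge> C * (sob_norm (cube R) 1 (\<lambda>x. v x - u x))^2
             + \<eta> * (sob_norm (cube R) p (\<lambda>x. v x - u x))^2
           \<and>
           DJfun R p k \<epsilon>0 r b F lam \<beta> \<eta> v (\<lambda>x. v x - u x)
             - DJfun R p k \<epsilon>0 r b F lam \<beta> \<eta> u (\<lambda>x. v x - u x)
           \<ge> C * (sob_norm (cube R) 1 (\<lambda>x. v x - u x))^2
             + \<eta> * (sob_norm (cube R) p (\<lambda>x. v x - u x))^2"
      \<comment> \<open>The threshold \<open>lam0\<close> was chosen to leave the constant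
        1.\<close>
      by (intro exI[of _ 1] conjI allI impI) (use sc[OF lam] mono[OF lam] in \<open>simp_all only: mult_1 zero_less_one\<close>)
    fix \<eta> :: real assume eta: "\<eta> > 0"
    show "\<exists>!u. u \<in> Hset R p k f g \<inter> Bbar R p M \<and>
            (\<forall>v\<in>Hset R p k f g \<inter> Bbar R p M.
               Jfun R p k \<epsilon>0 r b F lam \<beta> \<eta> u \<le> Jfun R p k \<epsilon>0 r b F lam \<beta> \<eta> v)"
    proof (rule unique_minimizer[OF assms(1-7) eta assms(8)])
      fix u v assume "u \<in> Hset R p k f g \<inter> Bbar R p M" "v \<in> Hset R p k f g \<inter> Bbar R p M"
      from sc[OF lam eta this]
      show "Jfun R p k \<epsilon>0 r b F lam \<beta> \<eta> v - Jfun R p k \<epsilon>0 r b F lam \<beta> \<eta> u - DJfun R p k \<epsilon>0 r b F lam \<beta> \<eta> u (\<lambda>x. v x - u x)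
        \<ge> \<eta> * (sob_norm (cube R) p (\<lambda>x. v x - u x))\<^sup>2"
        using zero_le_power2[of "sob_norm (cube R) 1 (\<lambda>x. v x - u x)"] by linarith
    qed
  qed
qed

end
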